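(* Let $(x_*(\cdot),u_*(\cdot))$ be an admissible process of problem (P) (see context) with $x_*(\cdot)\in\mathscr{B}_{\rm Lip}$. Assume that $$\int_0^\infty \|\varphi(t,x_*(t),u_*(t))\|\,dt<\infty,\qquad \int_0^\infty \|\varphi_x(t,x_*(t),u_*(t))\|\,dt<\infty,$$ and that there is $\gamma>0$ such that for every $\delta>0$ there exists $T>0$ with $$\int_T^\infty \big\|\varphi(t,x(t),u_*(t))-\varphi(t,x'(t),u_*(t))-\varphi_x(t,x_*(t),u_*(t))(x(t)-x'(t))\big\|\,dt\le \delta\|x(\cdot)-x'(\cdot)\|_\infty$$ for all $x(\cdot),x'(\cdot)\in W^1_\infty(\mathbb{R}_+,\mathbb{R}^n)$ with $\|x(\cdot)-x_*(\cdot)\|_\infty<\gamma$ and $\|x'(\cdot)-x_*(\cdot)\|_\infty<\gamma$. If $(x_*(\cdot),u_*(\cdot))$ is a strong local minimum of problem (P), then there exist $\lambda_0\ge 0$, $p(\cdot)\in W^1_\infty(\mathbb{R}_+,\mathbb{R}^n)$, and vectors $l_0\in\mathbb{R}^{s_0}$, $l_1\in\mathbb{R}^{s_1}$, where $\lambda_0,p(\cdot),l_0,l_1$ are not all zero, such that: (a) for almost every $t\in\mathbb{R}_+$ $$\dot p(t)=-\varphi_x^T(t,x_*(t),u_*(t))\,p(t)+\lambda_0\,\omega(t)f_x(t,x_*(t),u_*(t)),$$ and $$p(0)={h_0'}^T(x_*(0))\,l_0,\qquad \lim_{t\to\infty}p(t)=-\lim_{t\to\infty}h_{1x}^T(t,x_*(t))\,l_1;$$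 (b) for almost every $t\in\mathbb{R}_+$ $$H(t,x_*(t),u_*(t),p(t),\lambda_0)=\max_{u\in U}H(t,x_*(t),u,p(t),\lambda_0).$$
   Context: $\mathbb{R}_+=[0,\infty)$, $\overline{\mathbb{R}}_+=[0,\infty]$ (compactified half-line). $W^1_\infty(\mathbb{R}_+,\mathbb{R}^n)$ is the space of bounded functions, absolutely continuous on compact intervals, with essentially bounded derivative. $L_\infty(\mathbb{R}_+,U)$ is the set of essentially bounded measurable functions with values in $U$. Problem (P): $$J(x(\cdot),u(\cdot))=\int_0^\infty\omega(t)f(t,x(t),u(t))\,dt\to\inf,\quad \dot x(t)=\varphi(t,x(t),u(t)),$$ $$h_0(x(0))=0,\quad \lim_{t\to\infty}h_1(t,x(t))=0,\quad u(t)\in U,$$ with $\emptyset\ne U\subseteq\mathbb{R}^m$, $\omega(\cdot)\in L_1(\mathbb{R}_+,\mathbb{R}_+)$, $f:\mathbb{R}\times\mathbb{R}^n\times\mathbb{R}^m\to\mathbb{R}$, $\varphi:\mathbb{R}\times\mathbb{R}^n\times\mathbb{R}^m\to\mathbb{R}^n$, $h_0:\mathbb{R}^n\to\mathbb{R}^{s_0}$, $h_1:\mathbb{R}\times\mathbb{R}^n\to\mathbb{R}^{s_1}$. A process $(x(\cdot),u(\cdot))\in W^1_\infty(\mathbb{R}_+,\mathbb{R}^n)\times L_\infty(\mathbb{R}_+,U)$ is admissible if $x(\cdot)$ solves the differential equation on every finite interval in the sense of Carathéodory, the boundary conditions hold, and the Lebesgue integral $J(x(\cdot),u(\cdot))$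 is finite. An admissible process $(x_*(\cdot),u_*(\cdot))$ is a strong local minimum if there is $\varepsilon>0$ such that $J(x(\cdot),u(\cdot))\ge J(x_*(\cdot),u_*(\cdot))$ for all admissible $(x(\cdot),u(\cdot))$ with $\|x(\cdot)-x_*(\cdot)\|_\infty\le\varepsilon$. Regularity class: $x_*(\cdot)\in\mathscr{B}_{\rm Lip}$ means that $x_*(\cdot)\in W^1_\infty(\mathbb{R}_+,\mathbb{R}^n)$ and for every compact $U_1\subseteq\mathbb{R}^m$ there is $\gamma>0$ such that on $V_\gamma\times U_1$, $V_\gamma=\{(t,x)\in\overline{\mathbb{R}}_+\times\mathbb{R}^n: \|x-x_*(t)\|\le\gamma\}$, the maps $f(t,x,u)$, $\varphi(t,x,u)$, $h_0(x)$, $h_1(t,x)$ are uniformly continuous and uniformly continuously differentiable with respect to $x$ (differentiable in $x$ with uniformly continuous $x$-derivatives). Here $t$ ranges over $\overline{\mathbb{R}}_+$; concretely, uniform continuity on the points of $V_\gamma$ with $t<\infty$ is meant with respect to a metric of the compact space $[0,\infty]$ in $t$ (e.g. $|\arctan t-\arctan s|$) and the Euclidean metric in $x,u$. Pontryagin function: $H(t,x,u,p,\lambda_0)=\langle p,\varphi(t,x,u)\rangle-\lambda_0\,\omega(t)f(t,x,u)$.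
   Formalization: The adjoint function p is claimed to be bounded and absolutely continuous on compact intervals, and to lie in W^1_∞ only when ω is essentially bounded; for unbounded ω in L_1 the claim p in W^1_∞ fails, e.g. φ=0, U={0}, f=h_0=x_1, h_1=x_2. *)

theory Defs
  imports "HOL-Analysis.Analysis"
begin

text \<open>Trajectories and controls are total functions on \<^typ>\<open>real\<close>; only their values on \<open>[0,\<infinity>)\<close>
  are ever used. Almost everywhere statements and integrals refer to Lebesgue measure on
  \<open>[0,\<infinity>)\<close>.\<close>

abbreviation leb_half :: "real measure" where
  "leb_half \<equiv> lebesgue_on {0..}"

definition abs_cont_on :: "real \<Rightarrow> real \<Rightarrow> (real \<Rightarrow> 'a::real_normed_vector) \<Rightarrow> bool" where
  "abs_cont_on s t x \<longleftrightarrow>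
     (\<forall>\<epsilon>>0. \<exists>\<delta>>0. \<forall>(N::nat) a b.
        (\<forall>i<N. s \<le> a i \<and> a i \<le> b i \<and> b i \<le> t) \<and>
        (\<forall>i<N. \<forall>j<N. i \<noteq> j \<longrightarrow> {a i<..<b i} \<inter> {a j<..<b j} = {}) \<and>
        (\<Sum>i<N. b i - a i) < \<delta> \<longrightarrow>
        (\<Sum>i<N. norm (x (b i) - x (a i))) < \<epsilon>)"

definition locally_abs_cont :: "(real \<Rightarrow> 'a::real_normed_vector) \<Rightarrow> bool" where
  "locally_abs_cont x \<longleftrightarrow> (\<forall>T>0. abs_cont_on 0 T x)"

definition ess_bounded :: "(real \<Rightarrow> 'a::real_normed_vector) \<Rightarrow> bool" where
  "ess_bounded u \<longleftrightarrow> (\<exists>C. AE t in leb_half. norm (u t) \<le> C)"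

definition W1_inf :: "(real \<Rightarrow> 'a::real_normed_vector) set" where
  "W1_inf = {x. bounded (x ` {0..}) \<and> locally_abs_cont x \<and>
     (\<exists>x'. (AE t in leb_half. (x has_vector_derivative x' t) (at t within {0..})) \<and>
           ess_bounded x')}"

definition L_inf :: "'a::euclidean_space set \<Rightarrow> (real \<Rightarrow> 'a) set" where
  "L_inf U = {u \<in> borel_measurable leb_half. (\<forall>t\<ge>0. u t \<in> U) \<and> ess_bounded u}"

text \<open>Meaningful for functions that are bounded on \<open>[0,\<infinity>)\<close>; below it is only applied to
  differences of members of \<^const>\<open>W1_inf\<close>.\<close>

definition sup_norm :: "(real \<Rightarrow> 'a::real_normed_vector) \<Rightarrow> real" where
  "sup_norm x = (SUP t\<in>{0..}. norm (x t))"

definition gradient :: "(real^'n \<Rightarrow> real) \<Rightarrow> real^'n \<Rightarrow> real^'n" where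
  "gradient g x = (\<chi> i. frechet_derivative g (at x) (axis i 1))"

text \<open>The space \<open>\<real>\<^sup>s\<close> of the boundary conditions is written as the coordinate subspace of
  \<open>\<real>\<^sup>'k\<close> belonging to an index set \<open>I\<close> with \<open>card I = s\<close>. For \<open>I = UNIV\<close> this is the whole type
  \<^typ>\<open>real^'k\<close>; the case \<open>I = {}\<close>, i.e. \<open>s = 0\<close> (no condition at that end point), cannot be
  expressed by a type.\<close>

definition coord_space :: "'k set \<Rightarrow> (real^'k) set" where
  "coord_space I = {y. \<forall>i. i \<notin> I \<longrightarrow> y $ i = 0}"

definition cost ::
  "(real \<Rightarrow> real) \<Rightarrow> (real \<Rightarrow> real^'n \<Rightarrow> real^'m \<Rightarrow> real) \<Rightarrow>
   (real \<Rightarrow> real^'n) \<Rightarrow> (real \<Rightarrow> real^'m) \<Rightarrow> real" where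
  "cost \<omega> f x u = (LINT t|leb_half. \<omega> t * f t (x t) (u t))"

definition admissible ::
  "(real \<Rightarrow> real) \<Rightarrow> (real \<Rightarrow> real^'n \<Rightarrow> real^'m \<Rightarrow> real) \<Rightarrow>
   (real \<Rightarrow> real^'n \<Rightarrow> real^'m \<Rightarrow> real^'n) \<Rightarrow>
   (real^'n \<Rightarrow> real^'s0) \<Rightarrow> (real \<Rightarrow> real^'n \<Rightarrow> real^'s1) \<Rightarrow> (real^'m) set \<Rightarrow>
   (real \<Rightarrow> real^'n) \<Rightarrow> (real \<Rightarrow> real^'m) \<Rightarrow> bool" where
  "admissible \<omega> f \<phi> h0 h1 U x u \<longleftrightarrow>
     x \<in> W1_inf \<and> u \<in> L_inf U \<and>
     (AE t in leb_half. (x has_vector_derivative \<phi> t (x t) (u t)) (at t within {0..})) \<and>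
     h0 (x 0) = 0 \<and>
     ((\<lambda>t. h1 t (x t)) \<longlongrightarrow> 0) at_top \<and>
     integrable leb_half (\<lambda>t. \<omega> t * f t (x t) (u t))"

definition strong_local_min ::
  "(real \<Rightarrow> real) \<Rightarrow> (real \<Rightarrow> real^'n \<Rightarrow> real^'m \<Rightarrow> real) \<Rightarrow>
   (real \<Rightarrow> real^'n \<Rightarrow> real^'m \<Rightarrow> real^'n) \<Rightarrow>
   (real^'n \<Rightarrow> real^'s0) \<Rightarrow> (real \<Rightarrow> real^'n \<Rightarrow> real^'s1) \<Rightarrow> (real^'m) set \<Rightarrow>
   (real \<Rightarrow> real^'n) \<Rightarrow> (real \<Rightarrow> real^'m) \<Rightarrow> bool" where
  "strong_local_min \<omega> f \<phi> h0 h1 U xs us \<longleftrightarrow>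
     admissible \<omega> f \<phi> h0 h1 U xs us \<and>
     (\<exists>\<epsilon>>0. \<forall>x u. admissible \<omega> f \<phi> h0 h1 U x u \<and> sup_norm (\<lambda>t. x t - xs t) \<le> \<epsilon> \<longrightarrow>
        cost \<omega> f x u \<ge> cost \<omega> f xs us)"

text \<open>Uniform continuity on \<open>S \<subseteq> [0,\<infinity>) \<times> \<real>\<^sup>n \<times> \<real>\<^sup>m\<close> with respect to the metric
  \<open>\<bar>arctan t - arctan s\<bar>\<close> of the compactified half-line \<open>[0,\<infinity>]\<close> in the first argument: the
  time axis is reparametrised by \<open>\<tau> = arctan t \<in> [0,\<pi>/2)\<close>.\<close>

definition unif_cont_compactified ::
  "(real \<times> 'a::metric_space \<times> 'b::metric_space) set \<Rightarrow> (real \<Rightarrow> 'a \<Rightarrow> 'b \<Rightarrow> 'c::metric_space) \<Rightarrow> bool"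
where
  "unif_cont_compactified S g \<longleftrightarrow>
     uniformly_continuous_on ((\<lambda>(t, x, u). (arctan t, x, u)) ` S) (\<lambda>(\<tau>, x, u). g (tan \<tau>) x u)"

definition unif_C1_in_x ::
  "(real \<times> 'a::real_normed_vector \<times> 'b::metric_space) set \<Rightarrow>
   (real \<Rightarrow> 'a \<Rightarrow> 'b \<Rightarrow> 'c::real_normed_vector) \<Rightarrow> bool"
where
  "unif_C1_in_x S g \<longleftrightarrow>
     unif_cont_compactified S g \<and>
     (\<exists>D :: real \<Rightarrow> 'a \<Rightarrow> 'b \<Rightarrow> ('a \<Rightarrow>\<^sub>L 'c).
        (\<forall>(t, x, u)\<in>S. ((\<lambda>y. g t y u) has_derivative blinfun_apply (D t x u)) (at x)) \<and>
        unif_cont_compactified S D)"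

definition tube :: "(real \<Rightarrow> 'a::real_normed_vector) \<Rightarrow> real \<Rightarrow> 'b set \<Rightarrow> (real \<times> 'a \<times> 'b) set" where
  "tube xs \<gamma> U1 = {(t, x, u). 0 \<le> t \<and> norm (x - xs t) \<le> \<gamma> \<and> u \<in> U1}"

definition B_Lip ::
  "(real \<Rightarrow> real^'n \<Rightarrow> real^'m \<Rightarrow> real) \<Rightarrow>
   (real \<Rightarrow> real^'n \<Rightarrow> real^'m \<Rightarrow> real^'n) \<Rightarrow>
   (real^'n \<Rightarrow> real^'s0) \<Rightarrow> (real \<Rightarrow> real^'n \<Rightarrow> real^'s1) \<Rightarrow> (real \<Rightarrow> real^'n) set" where
  "B_Lip f \<phi> h0 h1 = {xs \<in> W1_inf. \<forall>U1 :: (real^'m) set. compact U1 \<longrightarrow>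
     (\<exists>\<gamma>>0. unif_C1_in_x (tube xs \<gamma> U1) f \<and>
            unif_C1_in_x (tube xs \<gamma> U1) \<phi> \<and>
            unif_C1_in_x (tube xs \<gamma> U1) (\<lambda>t x u. h0 x) \<and>
            unif_C1_in_x (tube xs \<gamma> U1) (\<lambda>t x u. h1 t x))}"

definition pontryagin ::
  "(real \<Rightarrow> real) \<Rightarrow> (real \<Rightarrow> real^'n \<Rightarrow> real^'m \<Rightarrow> real) \<Rightarrow>
   (real \<Rightarrow> real^'n \<Rightarrow> real^'m \<Rightarrow> real^'n) \<Rightarrow>
   real \<Rightarrow> real^'n \<Rightarrow> real^'m \<Rightarrow> real^'n \<Rightarrow> real \<Rightarrow> real" where
  "pontryagin \<omega> f \<phi> t x u p lam0 = p \<bullet> \<phi> t x u - lam0 * \<omega> t * f t x u"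

text \<open>The class of the adjoint function. The adjoint equation
  \<open>p' = - \<phi>\<^sub>x\<^sup>T p + lam0 \<omega> f\<^sub>x\<close> contains the merely integrable factor \<open>\<omega>\<close>, so \<open>p'\<close> need not be
  essentially bounded, and \<^const>\<open>W1_inf\<close> membership can only be claimed when \<open>\<omega>\<close> is. (With
  \<open>\<phi> = 0\<close>, \<open>U = {0}\<close>, \<open>f(t,x,u) = x\<^sub>1\<close>, \<open>h\<^sub>0(x) = x\<^sub>1\<close>, \<open>h\<^sub>1(t,x) = x\<^sub>2\<close> on \<open>\<real>\<^sup>2\<close>, the process
  \<open>(0,0)\<close> is optimal and \<open>p' = lam0 (\<omega>, 0)\<close>; for essentially unbounded \<open>\<omega>\<close>, membership in
  \<^const>\<open>W1_inf\<close> forces all multipliers to vanish.)\<close>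

definition adjoint_class :: "(real \<Rightarrow> real) \<Rightarrow> (real \<Rightarrow> real^'n) set" where
  "adjoint_class \<omega> = {p. bounded (p ` {0..}) \<and> locally_abs_cont p \<and>
                         (ess_bounded \<omega> \<longrightarrow> p \<in> W1_inf)}"

end

theory Submission
  imports Defs
begin

text \<open>
  Replacing the optimal control on short intervals (needles) and shifting the initial value changes
  the triple \<open>(J, h\<^sub>0, lim h\<^sub>1)\<close> to first order by the corresponding combination of certain vectors:
  pairing with a multiplier \<open>(\<lambda>\<^sub>0, l\<^sub>0, l\<^sub>1)\<close> expresses them through the bounded solution \<open>p\<close> of the
  adjoint equation with \<open>p(\<infinity>) = - h\<^sub>1\<^sub>x\<^sup>T l\<^sub>1\<close>, so that a needle with value \<open>v\<close> at \<open>t\<close> contributes the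
  difference of the Pontryagin functions at \<open>v\<close> and at the optimal control. The variations range over a
  set \<open>G\<close> of such vectors. If no nonzero functional is nonnegative on \<open>G\<close>, the cone of \<open>G\<close> is the
  whole space, and Brouwer's theorem applied to a finite family of needles produces an admissible
  process nearby with smaller cost. Hence a supporting functional exists; its components are
  \<open>\<lambda>\<^sub>0, l\<^sub>0, l\<^sub>1\<close>, and its sign on the needles is the maximum condition, first for a countable
  dense set of values and then for all by continuity.

  The perturbed trajectories on the half-line exist by Picard iteration in an exponentially
  weighted supremum norm. Its contraction property on \<open>[T,\<infinity>)\<close> is exactly what the tail condition
  and the integrability of \<open>\<phi>\<^sub>x\<close> provide; needles are placed in \<open>[0,T]\<close> only, and \<open>T\<close> is increased
  to reach all times.
\<close>

section \<open>Absolute continuity and indefinite integrals\<close>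

text \<open>Two circularities shape the argument. The null set of forbidden needle positions has to
  be fixed before the multiplier is known, whereas the gain of a needle involves the costate of that
  multiplier. Costates are therefore chosen only for a finite orthonormal basis \<open>B\<close> of
  the space \<open>W\<close> of end values, every other costate being a linear combination of them;
  together with the countable set of needle values this lets one null set serve all multipliers.
  Further, the estimates have constants that depend on a ball of control values and on
  \<open>T\<close>, while values and positions of the needles are bounded only after a finite family
  has been selected. Hence \<open>A\<close>, \<open>fx\<close>, \<open>H0\<close>, \<open>H1\<close>
  are defined without reference to ball, tube or \<open>T\<close>: \<open>costate\<close> and
  \<open>needle_gain\<close> mean the same in every instance of \<open>control_problem\<close>, and
  the instance is picked last. The first variation pairs the costate with the exact difference of
  two trajectories, so linearised trajectories never appear. As end values range over coordinate
  subspaces, separation, cones and Brouwer's theorem are all used inside \<open>W\<close>.\<close>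

lemma abs_cont_on_finite:
  fixes x :: "real \<Rightarrow> 'a::real_normed_vector"
  assumes "abs_cont_on s t x" "\<epsilon> > 0"
  shows "\<exists>\<delta>>0. \<forall>(I::'i set) a b. finite I \<and> (\<forall>i\<in>I. s \<le> a i \<and> a i \<le> b i \<and> b i \<le> t) \<and>
        (\<forall>i\<in>I. \<forall>j\<in>I. i \<noteq> j \<longrightarrow> {a i<..<b i} \<inter> {a j<..<b j} = {}) \<and>
        (\<Sum>i\<in>I. b i - a i) < \<delta> \<longrightarrow> (\<Sum>i\<in>I. norm (x (b i) - x (a i))) < \<epsilon>"
proof -
  obtain \<delta> where \<delta>: "\<delta> > 0"
    "\<forall>(N::nat) a b. (\<forall>i<N. s \<le> a i \<and> a i \<le> b i \<and> b i \<le> t) \<and>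
        (\<forall>i<N. \<forall>j<N. i \<noteq> j \<longrightarrow> {a i<..<b i} \<inter> {a j<..<b j} = {}) \<and>
        (\<Sum>i<N. b i - a i) < \<delta> \<longrightarrow> (\<Sum>i<N. norm (x (b i) - x (a i))) < \<epsilon>"
    using assms(1)[unfolded abs_cont_on_def, THEN spec, THEN mp, OF assms(2)]
    by (elim exE conjE) (rule that)
  show ?thesis
  proof (intro exI[of _ \<delta>] conjI \<delta>(1) allI impI, elim conjE)
    fix I :: "'i set" and a b :: "'i \<Rightarrow> real"
    assume I: "finite I" "\<forall>i\<in>I. s \<le> a i \<and> a i \<le> b i \<and> b i \<le> t"
        "\<forall>i\<in>I. \<forall>j\<in>I. i \<noteq> j \<longrightarrow> {a i<..<b i} \<inter> {a j<..<b j} = {}"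
        "(\<Sum>i\<in>I. b i - a i) < \<delta>"
    obtain g where g: "bij_betw g {0..<card I} I"
      using ex_bij_betw_nat_finite[OF I(1)] by blast
    then have gI: "g i \<in> I" if "i < card I" for i
      using that by (auto simp: bij_betw_def)
    have gn: "g i \<noteq> g j" if "i < card I" "j < card I" "i \<noteq> j" for i j
      using g that by (auto simp: bij_betw_def inj_on_def)
    have "(\<Sum>i<card I. b (g i) - a (g i)) < \<delta>"
      using I(4) sum.reindex_bij_betw[OF g, of "\<lambda>i. b i - a i"]
      by (simp add: atLeast0LessThan)
    then have "(\<Sum>i<card I. norm (x (b (g i)) - x (a (g i)))) < \<epsilon>"
      using I(2,3) gI gn by (intro \<delta>(2)[rule_format] conjI) auto
    then show "(\<Sum>i\<in>I. norm (x (b i) - x (a i))) < \<epsilon>"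
      using sum.reindex_bij_betw[OF g, of "\<lambda>i. norm (x (b i) - x (a i))"]
      by (simp add: atLeast0LessThan)
  qed
qed

text \<open>Cousin's lemma: the tags in the exceptional null set contribute intervals of small total
  length, which absolute continuity controls; all other tags are handled by differentiability.\<close>

lemma abs_cont_on_has_integral_derivative:
  fixes x :: "real \<Rightarrow> 'a::euclidean_space"
  assumes "s \<le> t" and ac: "abs_cont_on s t x" and N: "negligible N"
    and der: "\<And>r. r \<in> {s..t} - N \<Longrightarrow> (x has_vector_derivative x' r) (at r within {s..t})"
  shows "(x' has_integral (x t - x s)) {s..t}"
proof -
  \<comment> \<open>With \<open>g\<close> zero on \<open>N\<close>, the error of an interval tagged
    in \<open>N\<close> is just the increment of \<open>x\<close> over it.\<close>
  define g where "g r = (if r \<in> N then 0 else x' r)" for r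
  have "(g has_integral (x t - x s)) (cbox s t)"
    unfolding has_integral
  proof (intro allI impI)
    fix e :: real assume e: "e > 0"
    obtain \<delta> where \<delta>: "\<delta> > 0"
      "\<forall>(I::(real \<times> real set) set) a b. finite I \<and> (\<forall>i\<in>I. s \<le> a i \<and> a i \<le> b i \<and> b i \<le> t) \<and>
        (\<forall>i\<in>I. \<forall>j\<in>I. i \<noteq> j \<longrightarrow> {a i<..<b i} \<inter> {a j<..<b j} = {}) \<and>
        (\<Sum>i\<in>I. b i - a i) < \<delta> \<longrightarrow> (\<Sum>i\<in>I. norm (x (b i) - x (a i))) < e/2"
      using abs_cont_on_finite[OF ac half_gt_zero[OF e]] by blast
    obtain G where G: "open G" "N \<subseteq> G" "G \<in> lmeasurable" "measure lebesgue G < \<delta>"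
    proof -
      obtain G where G: "open G" "N \<subseteq> G" "G - N \<in> lmeasurable" "emeasure lebesgue (G - N) < ennreal \<delta>"
        using sets_lebesgue_outer_open[OF _ \<delta>(1), of N] N
        by (metis fmeasurableD negligible_imp_measurable)
      have "measure lebesgue (G - N) < \<delta>"
        using G(3,4) \<delta>(1) by (simp add: emeasure_eq_measure2 ennreal_less_iff)
      moreover have "G \<in> lmeasurable \<and> measure lebesgue G = measure lebesgue (G - N)"
      proof -
        have "G = (G - N) \<union> N" using G(2) by blast
        then show ?thesis
          using G(3) N by (metis lmeasurable_negligible_symdiff fmeasurable.Un measure_Un_null_set
              negligible_iff_null_sets negligible_imp_measurable fmeasurableD)
      qed
      ultimately show ?thesis using that G by auto
    qed
    \<comment> \<open>Tags outside \<open>N\<close> err by at most \<open>e1 * (t - s)\<close> in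
      total; the summand 1 keeps this below \<open>e/2\<close> and the quotient defined when
      \<open>s = t\<close>.\<close>
    define e1 where "e1 = e / (2 * (t - s + 1))"
    have e1: "e1 > 0" using e \<open>s \<le> t\<close> by (simp add: e1_def)
    have "\<exists>d>0. \<forall>y\<in>{s..t}. norm (y - r) < d \<longrightarrow>
        norm (x y - x r - (y - r) *\<^sub>R x' r) \<le> e1 * norm (y - r)" if "r \<in> {s..t} - N" for r
      using der[OF that] e1 that
      unfolding has_vector_derivative_def has_derivative_within_alt by blast
    then obtain d where d: "\<And>r. r \<in> {s..t} - N \<Longrightarrow> d r > 0"
      "\<And>r y. r \<in> {s..t} - N \<Longrightarrow> y \<in> {s..t} \<Longrightarrow> norm (y - r) < d r \<Longrightarrow>
        norm (x y - x r - (y - r) *\<^sub>R x' r) \<le> e1 * norm (y - r)" by metis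
    \<comment> \<open>Tags in \<open>N\<close> are confined to the open set \<open>G\<close>, so
      their intervals have total length below the \<open>\<delta>\<close> of absolute
      continuity.\<close>
    define \<gamma> where "\<gamma> r = (if r \<in> N then G else if r \<in> {s..t} then ball r (d r) else UNIV)" for r
    have "gauge \<gamma>"
      unfolding gauge_def \<gamma>_def using G d(1) by auto
    moreover have "norm ((\<Sum>(r, k)\<in>p. measure lborel k *\<^sub>R g r) - (x t - x s)) < e"
      if p: "p tagged_division_of cbox s t" and fine: "\<gamma> fine p" for p
    proof -
      note pD = tagged_division_ofD[OF p]
      have fin: "finite p" by (rule pD(1))
      have K: "\<exists>u v. K = {u..v} \<and> u \<le> r \<and> r \<le> v \<and> s \<le> u \<and> v \<le> t \<and> Inf K = u \<and> Sup K = v"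
        if rK: "(r, K) \<in> p" for r K
      proof -
        obtain u v where uv: "K = cbox u v" using pD(4)[OF rK] by blast
        moreover have "r \<in> K" "K \<subseteq> cbox s t" using pD(2,3)[OF rK] by auto
        ultimately show ?thesis by (intro exI[of _ u] exI[of _ v]) (auto simp: subset_iff)
      qed
      have tele: "(\<Sum>(r, K)\<in>p. x (Sup K) - x (Inf K)) = x t - x s"
        using additive_tagged_division_1[OF \<open>s \<le> t\<close>, of p x] p by simp
      let ?h = "\<lambda>(r, K). measure lborel K *\<^sub>R g r - (x (Sup K) - x (Inf K))"
      let ?P = "{i \<in> p. fst i \<in> N}" and ?Q = "{i \<in> p. fst i \<notin> N}"
      have "(\<Sum>(r, k)\<in>p. measure lborel k *\<^sub>R g r) - (x t - x s) = sum ?h p"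
        unfolding tele[symmetric] by (simp add: sum_subtractf case_prod_unfold)
      also have "\<dots> = sum ?h ?P + sum ?h ?Q"
        using sum.union_disjoint[of ?P ?Q ?h] fin
        by (simp add: Collect_disj_eq[symmetric] disjoint_iff conj_disj_distribL[symmetric])
      finally have eq: "(\<Sum>(r, k)\<in>p. measure lborel k *\<^sub>R g r) - (x t - x s) = sum ?h ?P + sum ?h ?Q" .
      have Q: "norm (sum ?h ?Q) < e/2"
      proof -
        have "norm (?h i) \<le> e1 * measure lborel (snd i)" if "i \<in> ?Q" for i
        proof -
          obtain r k where i: "i = (r, k)" by fastforce
          with that have rk: "(r, k) \<in> p" "r \<notin> N" by auto
          obtain u v where uv: "k = {u..v}" "u \<le> r" "r \<le> v" "s \<le> u" "v \<le> t" "Inf k = u" "Sup k = v"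
            using K[OF rk(1)] by blast
          have r: "r \<in> {s..t} - N" using uv rk by auto
          have sub: "k \<subseteq> ball r (d r)"
            using fineD[OF fine rk(1)] r by (auto simp: \<gamma>_def)
          have "u \<in> k" "v \<in> k" using uv by auto
          then have "u \<in> ball r (d r)" "v \<in> ball r (d r)" using sub by blast+
          then have "norm (v - r) < d r" "norm (u - r) < d r" by (auto simp: dist_real_def)
          then have "norm (x v - x r - (v - r) *\<^sub>R x' r) \<le> e1 * (v - r)"
            "norm (x u - x r - (u - r) *\<^sub>R x' r) \<le> e1 * (r - u)"
            using d(2)[OF r, of v] d(2)[OF r, of u] uv by auto
          moreover have "measure lborel k *\<^sub>R g r - (x (Sup k) - x (Inf k))
            = (x u - x r - (u - r) *\<^sub>R x' r) - (x v - x r - (v - r) *\<^sub>R x' r)"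
            using rk uv by (simp add: g_def algebra_simps)
          ultimately have "norm (measure lborel k *\<^sub>R g r - (x (Sup k) - x (Inf k))) \<le> e1 * (r - u) + e1 * (v - r)"
            using norm_triangle_ineq4[of "x u - x r - (u - r) *\<^sub>R x' r" "x v - x r - (v - r) *\<^sub>R x' r"]
            by (simp only:)
          also have "\<dots> = e1 * measure lborel k" using uv by (simp add: algebra_simps)
          finally show ?thesis by (simp add: i)
        qed
        then have "norm (sum ?h ?Q) \<le> (\<Sum>i\<in>?Q. e1 * measure lborel (snd i))"
          by (rule sum_norm_le)
        also have "\<dots> \<le> (\<Sum>i\<in>p. e1 * measure lborel (snd i))"
          using fin e1 by (intro sum_mono2) auto
        also have "\<dots> = e1 * (t - s)"
          using additive_content_tagged_division[OF p] \<open>s \<le> t\<close>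
          by (simp add: sum_distrib_left[symmetric] case_prod_unfold)
        also have "\<dots> < e/2"
          unfolding e1_def using e \<open>s \<le> t\<close> by (simp add: divide_simps algebra_simps)
        finally show ?thesis .
      qed
      have P: "norm (sum ?h ?P) < e/2"
      proof -
        have K1: "s \<le> Inf (snd i)" "Inf (snd i) \<le> Sup (snd i)" "Sup (snd i) \<le> t"
          and c: "measure lborel (snd i) = Sup (snd i) - Inf (snd i)"
          and int: "interior (snd i) = {Inf (snd i)<..<Sup (snd i)}"
          and sub: "{Inf (snd i)<..<Sup (snd i)} \<subseteq> snd i" if i: "i \<in> p" for i
        proof -
          obtain u v where uv: "snd i = {u..v}" "u \<le> v" "s \<le> u" "v \<le> t"
            using K[of "fst i" "snd i"] i by force
          then have [simp]: "Inf (snd i) = u" "Sup (snd i) = v" by auto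
          show "s \<le> Inf (snd i)" "Inf (snd i) \<le> Sup (snd i)" "Sup (snd i) \<le> t"
            "measure lborel (snd i) = Sup (snd i) - Inf (snd i)"
            "interior (snd i) = {Inf (snd i)<..<Sup (snd i)}"
            "{Inf (snd i)<..<Sup (snd i)} \<subseteq> snd i"
            using uv(2-4) by (auto simp: uv(1) interior_atLeastAtMost_real)
        qed
        have disj: "{Inf (snd i)<..<Sup (snd i)} \<inter> {Inf (snd j)<..<Sup (snd j)} = {}"
          if "i \<in> ?P" "j \<in> ?P" "i \<noteq> j" for i j
        proof -
          obtain r k r' k' where i: "i = (r, k)" and j: "j = (r', k')" by fastforce
          have "interior k \<inter> interior k' = {}"
            using pD(5)[of r k r' k'] that i j by auto
          moreover have "interior k = {Inf k<..<Sup k}" "interior k' = {Inf k'<..<Sup k'}"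
            using int[of "(r, k)"] int[of "(r', k')"] that i j by auto
          ultimately show ?thesis by (simp add: i j)
        qed
        have "(\<Sum>i\<in>?P. Sup (snd i) - Inf (snd i)) = (\<Sum>i\<in>?P. measure lborel (snd i))"
          using c by (intro sum.cong) auto
        also have "\<dots> = (\<Sum>i\<in>?P. measure lebesgue {Inf (snd i)<..<Sup (snd i)})"
          using c K1 by (intro sum.cong) (auto simp: measure_lborel_Ioo)
        also have "\<dots> = measure lebesgue (\<Union>i\<in>?P. {Inf (snd i)<..<Sup (snd i)})"
          using fin disj
          by (intro measure_UNION'[symmetric]) (auto simp: pairwise_def disjnt_def)
        also have "\<dots> \<le> measure lebesgue G"
        proof (rule measure_mono_fmeasurable)
          show "(\<Union>i\<in>?P. {Inf (snd i)<..<Sup (snd i)}) \<subseteq> G"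
          proof (rule UN_least)
            fix i assume i: "i \<in> ?P"
            have "snd i \<subseteq> \<gamma> (fst i)" using fineD[OF fine, of "fst i" "snd i"] i by simp
            then show "{Inf (snd i)<..<Sup (snd i)} \<subseteq> G" using sub[of i] i by (auto simp: \<gamma>_def)
          qed
          show "(\<Union>i\<in>?P. {Inf (snd i)<..<Sup (snd i)}) \<in> sets lebesgue"
            using fin by (intro sets.finite_UN) auto
        qed (rule G(3))
        finally have "(\<Sum>i\<in>?P. Sup (snd i) - Inf (snd i)) < \<delta>" using G by linarith
        moreover have "s \<le> Inf (snd i) \<and> Inf (snd i) \<le> Sup (snd i) \<and> Sup (snd i) \<le> t" if "i \<in> ?P" for i
          using K1 that by auto
        ultimately have "(\<Sum>i\<in>?P. norm (x (Sup (snd i)) - x (Inf (snd i)))) < e/2"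
          using disj fin by (intro \<delta>(2)[rule_format] conjI ballI impI) auto
        moreover have "norm (sum ?h ?P) \<le> (\<Sum>i\<in>?P. norm (x (Sup (snd i)) - x (Inf (snd i))))"
          by (rule sum_norm_le) (auto simp: g_def norm_minus_commute)
        ultimately show ?thesis by linarith
      qed
      show ?thesis unfolding eq using P Q norm_triangle_ineq[of "sum ?h ?P" "sum ?h ?Q"] by linarith
    qed
    ultimately show "\<exists>\<gamma>. gauge \<gamma> \<and> (\<forall>\<D>. \<D> tagged_division_of cbox s t \<and> \<gamma> fine \<D> \<longrightarrow>
        norm ((\<Sum>(x, k)\<in>\<D>. measure lborel k *\<^sub>R g x) - (x t - x s)) < e)"
      by (intro exI[of _ \<gamma>]) simp
  qed
  then have g: "(g has_integral (x t - x s)) {s..t}" by simp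
  show ?thesis
    by (rule has_integral_spike[OF N _ g]) (simp add: g_def)
qed

section \<open>Null sets on the half-line and differentiation of indefinite integrals\<close>

lemma AE_leb_half_iff_negligible:
  "(AE t in leb_half. P t) \<longleftrightarrow> negligible {t. 0 \<le> t \<and> \<not> P t}"
proof
  assume "AE t in leb_half. P t"
  then have "AE t in lebesgue. t \<in> {0..} \<longrightarrow> P t"
    by (subst (asm) AE_restrict_space_iff) auto
  then obtain N where "N \<in> null_sets lebesgue" "{t. \<not> (t \<in> {0..} \<longrightarrow> P t)} \<subseteq> N"
    unfolding eventually_ae_filter by auto
  then show "negligible {t. 0 \<le> t \<and> \<not> P t}"
    using negligible_subset[of N "{t. 0 \<le> t \<and> \<not> P t}"] by (auto simp: negligible_iff_null_sets)
next
  assume "negligible {t. 0 \<le> t \<and> \<not> P t}"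
  then have "AE t in lebesgue. t \<in> {0..} \<longrightarrow> P t"
    unfolding negligible_iff_null_sets by (rule AE_I') auto
  then show "AE t in leb_half. P t"
    by (subst AE_restrict_space_iff) auto
qed

lemma leb_half_AE_D: "AE t in leb_half. P t \<Longrightarrow> \<exists>N. negligible N \<and> (\<forall>t\<ge>0. t \<notin> N \<longrightarrow> P t)"
  unfolding AE_leb_half_iff_negligible by (rule exI[of _ "{t. 0 \<le> t \<and> \<not> P t}"]) auto

lemma leb_half_AE_I: "negligible N \<Longrightarrow> (\<And>t. t \<ge> 0 \<Longrightarrow> t \<notin> N \<Longrightarrow> P t) \<Longrightarrow> AE t in leb_half. P t"
  unfolding AE_leb_half_iff_negligible by (rule negligible_subset) auto

text \<open>Henstock's lemma bounds the total length of any finite disjoint family of intervals on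
  which the difference quotient at an end point is off by more than \<open>c\<close>; Vitali's covering
  theorem extracts from them an almost disjoint cover of the bad set.\<close>

lemma negligible_bad_difference_quotients:
  fixes g :: "real \<Rightarrow> 'a::euclidean_space"
  assumes g: "g integrable_on {a..b}" and c: "c > 0"
  shows "negligible {t \<in> {a<..<b}. \<forall>d>0. \<exists>h. h \<noteq> 0 \<and> \<bar>h\<bar> < d \<and> t + h \<in> {a..b} \<and>
      norm (integral {a..t + h} g - integral {a..t} g - h *\<^sub>R g t) > c * \<bar>h\<bar>}"
    (is "negligible ?S")
  unfolding negligible_outer_le
proof (intro allI impI)
  fix e :: real assume e: "e > 0"
  define F where "F t = integral {a..t} g" for t
  \<comment> \<open>Each bad interval has an error of at least \<open>c\<close> times its length, so
    a Henstock bound \<open>c * e\<close> limits the total length to \<open>e\<close>.\<close>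
  have "c * e > 0" using c e by simp
  then obtain \<gamma> where \<gamma>: "gauge \<gamma>"
    "\<And>p. \<lbrakk>p tagged_partial_division_of (cbox a b); \<gamma> fine p\<rbrakk> \<Longrightarrow>
       (\<Sum>(x,k)\<in>p. norm (measure lborel k *\<^sub>R g x - integral k g)) < c * e"
    using Henstock_lemma[of g a b "c * e"] g by auto
  \<comment> \<open>An index is a base point with a signed step; \<open>I\<close> is the interval
    between the two ends, and \<open>ce\<close>, \<open>r\<close> below present it as a ball for
    Vitali's theorem.\<close>
  define I where "I i = {min (fst i) (fst i + snd i)..max (fst i) (fst i + snd i :: real)}" for i
  define K where "K = {i. fst i \<in> ?S \<and> snd i \<noteq> 0 \<and> fst i + snd i \<in> {a..b} \<and> I i \<subseteq> \<gamma> (fst i) \<and>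
      norm (F (fst i + snd i) - F (fst i) - snd i *\<^sub>R g (fst i)) > c * \<bar>snd i\<bar>}"
  define ce where "ce i = fst i + snd i / 2" for i :: "real \<times> real"
  define r where "r i = \<bar>snd i\<bar> / 2" for i :: "real \<times> real"
  have cball: "cball (ce i) (r i) = I i" for i
    by (auto simp: cball_eq_atLeastAtMost ce_def r_def I_def min_def max_def)
  have cov: "\<exists>i. i \<in> K \<and> x \<in> cball (ce i) (r i) \<and> r i < d" if x: "x \<in> ?S" and d: "0 < d" for x d
  proof -
    obtain d' where d': "d' > 0" "ball x d' \<subseteq> \<gamma> x"
      using \<gamma>(1) unfolding gauge_def by (meson openE)
    have "min d d' > 0" using d d' by simp
    then obtain h where h: "h \<noteq> 0" "\<bar>h\<bar> < min d d'" "x + h \<in> {a..b}"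
      "norm (F (x + h) - F x - h *\<^sub>R g x) > c * \<bar>h\<bar>"
      using x unfolding F_def by blast
    have "I (x, h) \<subseteq> ball x d'"
      using h by (auto simp: I_def dist_real_def min_def max_def split: if_splits)
    then have "(x, h) \<in> K" using h x d' by (auto simp: K_def)
    moreover have "x \<in> cball (ce (x, h)) (r (x, h))"
      unfolding cball by (auto simp: I_def)
    moreover have "r (x, h) < d" using h d by (simp add: r_def)
    ultimately show ?thesis by blast
  qed
  have pos: "0 < r i" if "i \<in> K" for i using that by (simp add: K_def r_def)
  obtain C where C: "countable C" "C \<subseteq> K"
     "pairwise (\<lambda>i j. disjnt (cball (ce i) (r i)) (cball (ce j) (r j))) C"
     "negligible (?S - (\<Union>i \<in> C. cball (ce i) (r i)))"
    by (rule Vitali_covering_theorem_cballs[of K r ?S ce]; (erule pos | (rule cov; assumption) | (rule that; assumption)))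
  have disj: "I i \<inter> I j = {}" if "i \<in> C" "j \<in> C" "i \<noteq> j" for i j
    using C(3) that by (auto simp: pairwise_def disjnt_def cball)
  have mI: "measure lebesgue (I i) = \<bar>snd i\<bar>" for i
    by (auto simp: I_def min_def max_def)
  have bound: "measure lebesgue (\<Union>i\<in>C'. I i) \<le> e" if C': "C' \<subseteq> C" "finite C'" for C'
  proof -
    have KD: "fst i \<in> {a<..<b}" "snd i \<noteq> 0" "fst i + snd i \<in> {a..b}" "I i \<subseteq> \<gamma> (fst i)"
      "norm (F (fst i + snd i) - F (fst i) - snd i *\<^sub>R g (fst i)) > c * \<bar>snd i\<bar>" if "i \<in> C'" for i
      using C(2) C'(1) that unfolding K_def by auto
    let ?p = "(\<lambda>i. (fst i, I i)) ` C'"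
    have ne: "fst i \<in> I i" for i by (auto simp: I_def)
    have inj: "inj_on (\<lambda>i. (fst i, I i)) C'"
      using disj ne C'(1) by (intro inj_onI) (metis Pair_inject disjoint_iff subsetD)
    have "?p tagged_partial_division_of (cbox a b)"
      unfolding tagged_partial_division_of_def
    proof (intro conjI allI impI)
      show "finite ?p" using C'(2) by simp
      fix x k assume "(x, k) \<in> ?p"
      then obtain i where i: "i \<in> C'" "x = fst i" "k = I i" by auto
      show "x \<in> k" using i ne by simp
      show "k \<subseteq> cbox a b" using KD(1,3)[OF i(1)] by (auto simp: i I_def)
      show "\<exists>a b. k = cbox a b" unfolding i I_def by (metis box_real(2))
    next
      fix x k x' k' assume *: "(x, k) \<in> ?p \<and> (x', k') \<in> ?p \<and> (x, k) \<noteq> (x', k')"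
      then obtain i j where i: "i \<in> C'" "x = fst i" "k = I i" and j: "j \<in> C'" "x' = fst j" "k' = I j" by auto
      then have "i \<noteq> j" using * by auto
      then have "I i \<inter> I j = {}" using disj i(1) j(1) C'(1) by blast
      then show "interior k \<inter> interior k' = {}"
        using interior_subset[of k] interior_subset[of k'] i j by blast
    qed
    moreover have "\<gamma> fine ?p" using KD(4) by (auto simp: fine_def)
    ultimately have *: "(\<Sum>(x,k)\<in>?p. norm (measure lborel k *\<^sub>R g x - integral k g)) < c * e"
      by (rule \<gamma>(2))
    have "c * \<bar>snd i\<bar> \<le> norm (measure lborel (I i) *\<^sub>R g (fst i) - integral (I i) g)" if i: "i \<in> C'" for i
    proof -
      obtain t h where th: "i = (t, h)" by fastforce
      note k = KD[OF i, unfolded th fst_conv snd_conv]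
      have comb: "integral {a..u} g + integral {u..v} g = integral {a..v} g" if "a \<le> u" "u \<le> v" "v \<le> b" for u v
        using that by (intro Henstock_Kurzweil_Integration.integral_combine integrable_on_subinterval[OF g]) auto
      show ?thesis
      proof (cases "h > 0")
        case True
        then have "integral (I i) g = F (t + h) - F t"
          using comb[of t "t + h"] k by (simp add: th I_def F_def algebra_simps)
        moreover have "measure lborel (I i) = h" using True by (simp add: th I_def)
        ultimately show ?thesis using k(5) True
          by (simp add: th norm_minus_commute)
      next
        case False
        then have "integral (I i) g = F t - F (t + h)"
          using comb[of "t + h" t] k by (simp add: th I_def F_def algebra_simps min_def max_def)
        moreover have "measure lborel (I i) = - h" using False by (simp add: th I_def min_def max_def)
        ultimately have "measure lborel (I i) *\<^sub>R g t - integral (I i) g = F (t + h) - F t - h *\<^sub>R g t"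
          by simp
        then show ?thesis using k(5) by (simp add: th)
      qed
    qed
    then have "(\<Sum>i\<in>C'. c * \<bar>snd i\<bar>) \<le> (\<Sum>i\<in>C'. norm (measure lborel (I i) *\<^sub>R g (fst i) - integral (I i) g))"
      by (rule sum_mono)
    also have "\<dots> = (\<Sum>(x,k)\<in>?p. norm (measure lborel k *\<^sub>R g x - integral k g))"
      by (simp add: sum.reindex[OF inj])
    finally have "c * (\<Sum>i\<in>C'. \<bar>snd i\<bar>) \<le> c * e" using * by (simp add: sum_distrib_left)
    then have "(\<Sum>i\<in>C'. \<bar>snd i\<bar>) \<le> e" using c by simp
    moreover have "measure lebesgue (\<Union>i\<in>C'. I i) \<le> (\<Sum>i\<in>C'. measure lebesgue (I i))"
      by (rule measure_UNION_le[OF C'(2)]) (simp add: I_def)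
    ultimately show ?thesis by (simp add: mI)
  qed
  let ?T = "(?S - (\<Union>i \<in> C. I i)) \<union> (\<Union>i \<in> C. I i)"
  have neg: "negligible (?S - (\<Union>i \<in> C. I i))" using C(4) by (simp add: cball)
  have U: "(\<Union>i \<in> C. I i) \<in> lmeasurable" "measure lebesgue (\<Union>i \<in> C. I i) \<le> e"
  proof -
    show "(\<Union>i \<in> C. I i) \<in> lmeasurable"
      by (rule fmeasurable_UN_bound[OF C(1) _ bound]) (simp add: I_def)
    show "measure lebesgue (\<Union>i \<in> C. I i) \<le> e"
      by (rule measure_UN_bound[OF C(1) _ bound]) (simp add: I_def)
  qed
  have "measure lebesgue ?T \<le> measure lebesgue (?S - (\<Union>i \<in> C. I i)) + measure lebesgue (\<Union>i \<in> C. I i)"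
    using neg U by (intro measure_Un_le) (auto dest: negligible_imp_sets)
  also have "\<dots> \<le> e" using U negligible_imp_measure0[OF neg] by linarith
  finally have "measure lebesgue ?T \<le> e" .
  moreover have "?T \<in> lmeasurable"
    by (rule fmeasurable.Un[OF negligible_imp_measurable[OF neg] U(1)])
  moreover have "?S \<subseteq> ?T" by (simp only: Un_Diff_cancel2 Un_upper1)
  ultimately show "\<exists>T. ?S \<subseteq> T \<and> T \<in> lmeasurable \<and> measure lebesgue T \<le> e"
    by (intro exI[of _ ?T] conjI)
qed

text \<open>If \<open>g t\<close> is not the derivative at \<open>t\<close>, then for some
  \<open>n\<close> the difference quotients miss it by more than \<open>1/(n+1)\<close> at
  arbitrarily small steps, so the exceptional set lies in a countable union of the sets treated
  above.\<close>

lemma negligible_not_integral_has_vector_derivative: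
  fixes g :: "real \<Rightarrow> 'a::euclidean_space"
  assumes g: "g integrable_on {a..b}"
  shows "negligible {t \<in> {a<..<b}. \<not> ((\<lambda>t. integral {a..t} g) has_vector_derivative g t) (at t)}"
proof (rule negligible_subset)
  let ?S = "\<lambda>n::nat. {t \<in> {a<..<b}. \<forall>d>0. \<exists>h. h \<noteq> 0 \<and> \<bar>h\<bar> < d \<and> t + h \<in> {a..b} \<and>
      norm (integral {a..t + h} g - integral {a..t} g - h *\<^sub>R g t) > inverse (Suc n) * \<bar>h\<bar>}"
  show "negligible (\<Union>n. ?S n)"
    by (intro negligible_Union_nat negligible_bad_difference_quotients g) simp
  show "{t \<in> {a<..<b}. \<not> ((\<lambda>t. integral {a..t} g) has_vector_derivative g t) (at t)} \<subseteq> (\<Union>n. ?S n)"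
  proof (rule subsetI, rule ccontr)
    fix t assume t: "t \<in> {t \<in> {a<..<b}. \<not> ((\<lambda>t. integral {a..t} g) has_vector_derivative g t) (at t)}"
      and nS: "t \<notin> (\<Union>n. ?S n)"
    let ?F = "\<lambda>t. integral {a..t} g"
    have "\<exists>d>0. \<forall>y\<in>UNIV. norm (y - t) < d \<longrightarrow> norm (?F y - ?F t - (y - t) *\<^sub>R g t) \<le> e * norm (y - t)"
      if e: "e > 0" for e
    proof -
      obtain n where n: "inverse (real (Suc n)) < e" using reals_Archimedean[OF e] by blast
      have "t \<in> {a<..<b}" "t \<notin> ?S n" using nS t by blast+
      then have "\<exists>d>0. \<forall>h. h \<noteq> 0 \<longrightarrow> \<bar>h\<bar> < d \<longrightarrow> t + h \<in> {a..b} \<longrightarrow>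
        norm (?F (t + h) - ?F t - h *\<^sub>R g t) \<le> inverse (Suc n) * \<bar>h\<bar>"
        unfolding mem_Collect_eq not_less[symmetric] by blast
      then obtain d where d: "d > 0" "\<And>h. h \<noteq> 0 \<Longrightarrow> \<bar>h\<bar> < d \<Longrightarrow> t + h \<in> {a..b} \<Longrightarrow>
        norm (?F (t + h) - ?F t - h *\<^sub>R g t) \<le> inverse (Suc n) * \<bar>h\<bar>"
        by blast
      \<comment> \<open>Staying within the distances to \<open>a\<close> and \<open>b\<close> makes
        the restriction \<open>t + h \<in> {a..b}\<close> automatic, which yields a two-sided
        derivative.\<close>
      define d' where "d' = min d (min (t - a) (b - t))"
      have "d' > 0" using d(1) t by (auto simp: d'_def)
      moreover have "norm (?F y - ?F t - (y - t) *\<^sub>R g t) \<le> e * norm (y - t)" if y: "norm (y - t) < d'" for y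
      proof (cases "y = t")
        case False
        have "t + (y - t) \<in> {a..b}" using y by (auto simp: d'_def)
        then have "norm (?F (t + (y - t)) - ?F t - (y - t) *\<^sub>R g t) \<le> inverse (Suc n) * \<bar>y - t\<bar>"
          using y False by (intro d(2)) (auto simp: d'_def)
        also have "\<dots> \<le> e * \<bar>y - t\<bar>" using n by (intro mult_right_mono) auto
        finally show ?thesis by simp
      qed simp
      ultimately show ?thesis by blast
    qed
    then have "(?F has_vector_derivative g t) (at t)"
      unfolding has_vector_derivative_def has_derivative_within_alt
      by (auto intro: bounded_linear_scaleR_left)
    then show False using t by blast
  qed
qed

lemma integral_has_vector_derivative_AE:
  fixes g :: "real \<Rightarrow> 'a::euclidean_space"
  assumes g: "\<And>b. g integrable_on {0..b}"
  shows "AE t in leb_half. ((\<lambda>t. integral {0..t} g) has_vector_derivative g t) (at t within {0..})"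
proof (rule leb_half_AE_I)
  let ?B = "\<lambda>b. {t \<in> {0<..<b}. \<not> ((\<lambda>t. integral {0..t} g) has_vector_derivative g t) (at t)}"
  show "negligible ({0} \<union> (\<Union>n::nat. ?B n))"
    by (intro negligible_Un negligible_Union_nat negligible_not_integral_has_vector_derivative g negligible_sing)
  fix t :: real assume t: "t \<ge> 0" "t \<notin> {0} \<union> (\<Union>n::nat. ?B n)"
  obtain n :: nat where "t < n" using reals_Archimedean2 by blast
  then have "((\<lambda>t. integral {0..t} g) has_vector_derivative g t) (at t)" using t by auto
  then show "((\<lambda>t. integral {0..t} g) has_vector_derivative g t) (at t within {0..})"
    by (rule has_vector_derivative_at_within)
qed

text \<open>Truncation at a suitable level \<open>n\<close> changes the integral of the norm over
  \<open>S\<close> by less than \<open>e/2\<close>, and the truncated function contributes at most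
  \<open>n\<close> times the measure of \<open>E\<close>.\<close>

lemma absolutely_integrable_small_sets:
  fixes g :: "'b::euclidean_space \<Rightarrow> 'a::euclidean_space"
  assumes g: "g absolutely_integrable_on S" and S: "S \<in> sets lebesgue" and e: "e > 0"
  shows "\<exists>\<delta>>0. \<forall>E. E \<in> lmeasurable \<longrightarrow> E \<subseteq> S \<longrightarrow> measure lebesgue E < \<delta> \<longrightarrow> integral E (\<lambda>t. norm (g t)) < e"
proof -
  let ?h = "\<lambda>n::nat. \<lambda>t. min (norm (g t)) (real n)"
  have ng: "(\<lambda>t. norm (g t)) absolutely_integrable_on S"
    using g by (rule absolutely_integrable_norm[unfolded o_def])
  have gm: "g \<in> borel_measurable (lebesgue_on S)"
    by (rule absolutely_integrable_imp_borel_measurable[OF g S])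
  have hai: "?h n absolutely_integrable_on S" for n
    by (rule measurable_bounded_by_integrable_imp_absolutely_integrable[OF _ S, of _ "\<lambda>t. norm (g t)"])
      (use gm ng in \<open>auto simp: absolutely_integrable_on_def\<close>)
  have "(\<lambda>n. integral S (?h n)) \<longlonglongrightarrow> integral S (\<lambda>t. norm (g t))"
  proof (rule dominated_convergence(2))
    show "(\<lambda>t. norm (g t)) integrable_on S" using ng by (simp add: absolutely_integrable_on_def)
    show "?h k integrable_on S" for k using hai by (simp add: absolutely_integrable_on_def)
    fix t
    obtain n0 :: nat where n0: "norm (g t) \<le> n0" using real_arch_simple by blast
    show "(\<lambda>n. ?h n t) \<longlonglongrightarrow> norm (g t)"
      by (rule tendsto_eventually, rule eventually_sequentiallyI[of n0]) (use n0 in auto)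
  qed auto
  then obtain n where "norm (integral S (?h n) - integral S (\<lambda>t. norm (g t))) < e/2"
    using e by (meson LIMSEQ_D half_gt_zero le_refl)
  then have n: "integral S (\<lambda>t. norm (g t)) - integral S (?h n) < e/2"
    unfolding real_norm_def by linarith
  \<comment> \<open>The bound on the measure makes the truncated part at most \<open>e/2\<close>;
    the summand 1 covers \<open>n = 0\<close>.\<close>
  show ?thesis
  proof (intro exI[of _ "e / (2 * (n + 1))"] conjI allI impI)
    fix E assume E: "E \<in> lmeasurable" "E \<subseteq> S" "measure lebesgue E < e / (2 * (n + 1))"
    have EL: "E \<in> sets lebesgue" using E by auto
    have ngE: "(\<lambda>t. norm (g t)) integrable_on E"
      and hE: "?h n integrable_on E"
      using set_integrable_subset[OF ng EL E(2)] set_integrable_subset[OF hai EL E(2)]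
      by (auto simp: absolutely_integrable_on_def)
    have "integral E (\<lambda>t. norm (g t)) = integral E (\<lambda>t. norm (g t) - ?h n t) + integral E (?h n)"
      by (subst integral_diff[OF ngE hE]) simp
    also have "integral E (\<lambda>t. norm (g t) - ?h n t) \<le> integral S (\<lambda>t. norm (g t) - ?h n t)"
      using ngE hE ng hai E(2)
      by (intro integral_subset_le integrable_diff) (auto simp: absolutely_integrable_on_def)
    also have "\<dots> = integral S (\<lambda>t. norm (g t)) - integral S (?h n)"
      using ng hai by (intro integral_diff) (auto simp: absolutely_integrable_on_def)
    also have "integral E (?h n) \<le> integral E (\<lambda>t. real n)"
      using hE E(1) by (intro integral_le integrable_on_const) auto
    also have "\<dots> = n * measure lebesgue E"
      using E(1) by (simp add: lmeasure_integral[OF E(1)] integral_mult_right[symmetric])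
    also have "\<dots> \<le> n * (e / (2 * (n + 1)))" using E(3) by (intro mult_left_mono) auto
    also have "\<dots> \<le> e / 2" using e by (simp add: divide_simps)
    finally show "integral E (\<lambda>t. norm (g t)) < e" using n by simp
  qed (use e in simp)
qed

lemma abs_cont_on_integral:
  fixes g :: "real \<Rightarrow> 'a::euclidean_space"
  assumes g: "g absolutely_integrable_on {s..t}"
  shows "abs_cont_on s t (\<lambda>r. c + integral {s..r} g)"
  unfolding abs_cont_on_def
proof (intro allI impI)
  fix e :: real assume e: "e > 0"
  obtain \<delta> where \<delta>: "\<delta> > 0" "\<And>E. E \<in> lmeasurable \<Longrightarrow> E \<subseteq> {s..t} \<Longrightarrow> measure lebesgue E < \<delta> \<Longrightarrow>
      integral E (\<lambda>t. norm (g t)) < e"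
    using absolutely_integrable_small_sets[OF g _ e] by auto
  have gi: "g integrable_on {s..t}" and ngi: "(\<lambda>t. norm (g t)) integrable_on {s..t}"
    using g by (auto simp: absolutely_integrable_on_def)
  show "\<exists>\<delta>>0. \<forall>(N::nat) a b. (\<forall>i<N. s \<le> a i \<and> a i \<le> b i \<and> b i \<le> t) \<and>
        (\<forall>i<N. \<forall>j<N. i \<noteq> j \<longrightarrow> {a i<..<b i} \<inter> {a j<..<b j} = {}) \<and>
        (\<Sum>i<N. b i - a i) < \<delta> \<longrightarrow>
        (\<Sum>i<N. norm (c + integral {s..b i} g - (c + integral {s..a i} g))) < e"
  proof (intro exI[of _ \<delta>] conjI \<delta>(1) allI impI, elim conjE)
    fix N :: nat and a b
    assume ab: "\<forall>i<N. s \<le> a i \<and> a i \<le> b i \<and> b i \<le> t"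
      "\<forall>i<N. \<forall>j<N. i \<noteq> j \<longrightarrow> {a i<..<b i} \<inter> {a j<..<b j} = {}"
      "(\<Sum>i<N. b i - a i) < \<delta>"
    let ?E = "\<Union>i<N. {a i<..<b i}"
    have "norm (c + integral {s..b i} g - (c + integral {s..a i} g)) \<le> integral {a i<..<b i} (\<lambda>t. norm (g t))"
      if i: "i < N" for i
    proof -
      have sub: "{a i..b i} \<subseteq> {s..t}" using ab(1) i by auto
      have "integral {s..a i} g + integral {a i..b i} g = integral {s..b i} g"
        using ab(1) i by (intro Henstock_Kurzweil_Integration.integral_combine integrable_on_subinterval[OF gi]) auto
      then have "c + integral {s..b i} g - (c + integral {s..a i} g) = integral {a i..b i} g"
        by (simp add: algebra_simps)
      also have "norm \<dots> \<le> integral {a i..b i} (\<lambda>t. norm (g t))"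
        by (intro integral_norm_bound_integral integrable_on_subinterval[OF gi sub]
            integrable_on_subinterval[OF ngi sub]) auto
      finally show ?thesis by (simp add: integral_open_interval_real)
    qed
    then have "(\<Sum>i<N. norm (c + integral {s..b i} g - (c + integral {s..a i} g)))
      \<le> (\<Sum>i<N. integral {a i<..<b i} (\<lambda>t. norm (g t)))"
      by (intro sum_mono) auto
    also have "\<dots> = integral ?E (\<lambda>t. norm (g t))"
    proof (rule integral_unique[symmetric], rule has_integral_UN)
      fix i assume "i \<in> {..<N}"
      then have "{a i..b i} \<subseteq> {s..t}" using ab(1) by auto
      then have "(\<lambda>t. norm (g t)) integrable_on {a i<..<b i}"
        using integrable_on_subinterval[OF ngi] by (simp add: integrable_on_open_interval_real)
      then show "((\<lambda>t. norm (g t)) has_integral integral {a i<..<b i} (\<lambda>t. norm (g t))) {a i<..<b i}"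
        by (rule integrable_integral)
    qed (use ab(2) in \<open>auto simp: pairwise_def\<close>)
    also have "\<dots> < e"
    proof (rule \<delta>(2))
      show "?E \<in> lmeasurable" by (intro fmeasurable.finite_UN) auto
      show "?E \<subseteq> {s..t}" using ab(1) by fastforce
      have "measure lebesgue ?E \<le> (\<Sum>i<N. measure lebesgue {a i<..<b i})"
        by (rule measure_UNION_le) auto
      also have "\<dots> = (\<Sum>i<N. b i - a i)" using ab(1) by (intro sum.cong) auto
      finally show "measure lebesgue ?E < \<delta>" using ab(3) by linarith
    qed
    finally show "(\<Sum>i<N. norm (c + integral {s..b i} g - (c + integral {s..a i} g))) < e" .
  qed
qed

text \<open>One criterion for three uses: inner products of bounded absolutely continuous functions,
  Lipschitz images (with \<open>x1 = x2\<close>), and replacing a function by one that agrees with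
  it on the interval.\<close>

lemma abs_cont_on_dominated:
  fixes x1 :: "real \<Rightarrow> 'a::real_normed_vector" and x2 :: "real \<Rightarrow> 'b::real_normed_vector"
    and y :: "real \<Rightarrow> 'c::real_normed_vector"
  assumes x: "abs_cont_on s t x1" "abs_cont_on s t x2"
    and le: "\<And>r r'. \<lbrakk>r \<in> {s..t}; r' \<in> {s..t}\<rbrakk> \<Longrightarrow>
      norm (y r - y r') \<le> L * (norm (x1 r - x1 r') + norm (x2 r - x2 r'))"
    and L: "L > 0"
  shows "abs_cont_on s t y"
  unfolding abs_cont_on_def
proof (intro allI impI)
  fix e :: real assume e: "e > 0"
  have e': "e / (2 * L) > 0" using e L by simp
  obtain d1 where d1: "d1 > 0" "\<forall>(N::nat) a b. (\<forall>i<N. s \<le> a i \<and> a i \<le> b i \<and> b i \<le> t) \<and>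
        (\<forall>i<N. \<forall>j<N. i \<noteq> j \<longrightarrow> {a i<..<b i} \<inter> {a j<..<b j} = {}) \<and>
        (\<Sum>i<N. b i - a i) < d1 \<longrightarrow> (\<Sum>i<N. norm (x1 (b i) - x1 (a i))) < e / (2 * L)"
    using x(1)[unfolded abs_cont_on_def, THEN spec, THEN mp, OF e']
    by (elim exE conjE) (rule that)
  obtain d2 where d2: "d2 > 0" "\<forall>(N::nat) a b. (\<forall>i<N. s \<le> a i \<and> a i \<le> b i \<and> b i \<le> t) \<and>
        (\<forall>i<N. \<forall>j<N. i \<noteq> j \<longrightarrow> {a i<..<b i} \<inter> {a j<..<b j} = {}) \<and>
        (\<Sum>i<N. b i - a i) < d2 \<longrightarrow> (\<Sum>i<N. norm (x2 (b i) - x2 (a i))) < e / (2 * L)"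
    using x(2)[unfolded abs_cont_on_def, THEN spec, THEN mp, OF e']
    by (elim exE conjE) (rule that)
  show "\<exists>\<delta>>0. \<forall>(N::nat) a b. (\<forall>i<N. s \<le> a i \<and> a i \<le> b i \<and> b i \<le> t) \<and>
        (\<forall>i<N. \<forall>j<N. i \<noteq> j \<longrightarrow> {a i<..<b i} \<inter> {a j<..<b j} = {}) \<and>
        (\<Sum>i<N. b i - a i) < \<delta> \<longrightarrow> (\<Sum>i<N. norm (y (b i) - y (a i))) < e"
  proof (intro exI[of _ "min d1 d2"] conjI allI impI)
    show "min d1 d2 > 0" using d1 d2 by simp
    fix N :: nat and a b
    assume ab: "(\<forall>i<N. s \<le> a i \<and> a i \<le> b i \<and> b i \<le> t) \<and>
        (\<forall>i<N. \<forall>j<N. i \<noteq> j \<longrightarrow> {a i<..<b i} \<inter> {a j<..<b j} = {}) \<and>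
        (\<Sum>i<N. b i - a i) < min d1 d2"
    have s1: "(\<Sum>i<N. norm (x1 (b i) - x1 (a i))) < e / (2 * L)"
      using ab by (intro d1(2)[rule_format]) auto
    have s2: "(\<Sum>i<N. norm (x2 (b i) - x2 (a i))) < e / (2 * L)"
      using ab by (intro d2(2)[rule_format]) auto
    have "(\<Sum>i<N. norm (y (b i) - y (a i))) \<le>
        (\<Sum>i<N. L * (norm (x1 (b i) - x1 (a i)) + norm (x2 (b i) - x2 (a i))))"
      using ab by (intro sum_mono le) fastforce+
    also have "\<dots> = L * ((\<Sum>i<N. norm (x1 (b i) - x1 (a i))) + (\<Sum>i<N. norm (x2 (b i) - x2 (a i))))"
      by (simp add: sum_distrib_left sum.distrib distrib_left)
    also have "\<dots> < L * (e / (2 * L) + e / (2 * L))"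
      using s1 s2 L by (intro mult_strict_left_mono) auto
    also have "\<dots> = e" using L by (simp add: field_simps)
    finally show "(\<Sum>i<N. norm (y (b i) - y (a i))) < e" .
  qed
qed

section \<open>Integration over the half-line and integration by parts\<close>

lemma absolutely_integrable_leb_half_iff:
  fixes g :: "real \<Rightarrow> 'a::euclidean_space"
  shows "integrable leb_half g \<longleftrightarrow> g absolutely_integrable_on {0..}"
  by (simp add: integrable_restrict_space set_integrable_def)

lemma integral_leb_half:
  fixes g :: "real \<Rightarrow> 'a::euclidean_space"
  assumes "g absolutely_integrable_on {0..}"
  shows "(LINT t|leb_half. g t) = integral {0..} g"
  using assms by (simp add: lebesgue_integral_eq_integral absolutely_integrable_leb_half_iff)

lemma tendsto_integral_half_line:
  fixes g :: "real \<Rightarrow> 'a::euclidean_space"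
  assumes g: "g absolutely_integrable_on {0..}"
  shows "((\<lambda>R. integral {0..R} g) \<longlongrightarrow> integral {0..} g) at_top"
proof (rule tendsto_at_topI_sequentially)
  fix X :: "nat \<Rightarrow> real" assume X: "filterlim X at_top sequentially"
  have gi: "g integrable_on {0..}" and ng: "(\<lambda>t. norm (g t)) integrable_on {0..}"
    using g by (auto simp: absolutely_integrable_on_def)
  have Xi: "{0..X k} \<inter> {0..} = {0..X k}" for k by auto
  have eq: "integral {0..X k} g = integral {0..} (\<lambda>t. if t \<in> {0..X k} then g t else 0)" for k
    by (simp only: integral_restrict_Int Xi)
  show "(\<lambda>k. integral {0..X k} g) \<longlonglongrightarrow> integral {0..} g"
    unfolding eq
  proof (rule dominated_convergence(2)[OF _ ng])
    show "(\<lambda>t. if t \<in> {0..X k} then g t else 0) integrable_on {0..}" for k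
      unfolding integrable_restrict_Int Xi by (rule integrable_on_subinterval[OF gi]) auto
    show "(\<lambda>k. if t \<in> {0..X k} then g t else 0) \<longlonglongrightarrow> g t" if "t \<in> {0..}" for t
    proof (rule tendsto_eventually)
      have "\<forall>\<^sub>F k in sequentially. t \<le> X k" using X by (simp add: filterlim_at_top)
      then show "\<forall>\<^sub>F k in sequentially. (if t \<in> {0..X k} then g t else 0) = g t"
        by eventually_elim (use that in auto)
    qed
  qed auto
qed

lemma integral_diff_interval:
  fixes g :: "real \<Rightarrow> 'a::banach"
  assumes "g integrable_on {a..t}" "a \<le> s" "s \<le> t"
  shows "integral {a..t} g - integral {a..s} g = integral {s..t} g"
  using Henstock_Kurzweil_Integration.integral_combine[OF assms(2,3,1)] by (simp add: algebra_simps)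

text \<open>The product of two indefinite integrals is absolutely continuous and obeys the product
  rule almost everywhere, so it is recovered from its derivative.\<close>

lemma inner_has_integral_by_parts:
  fixes p z p' z' :: "real \<Rightarrow> 'a::euclidean_space"
  assumes R: "0 \<le> R" and p': "p' absolutely_integrable_on {0..R}" and z': "z' absolutely_integrable_on {0..R}"
    and p: "\<And>t. t \<in> {0..R} \<Longrightarrow> p t = p 0 + integral {0..t} p'"
    and z: "\<And>t. t \<in> {0..R} \<Longrightarrow> z t = z 0 + integral {0..t} z'"
  shows "((\<lambda>t. p' t \<bullet> z t + p t \<bullet> z' t) has_integral p R \<bullet> z R - p 0 \<bullet> z 0) {0..R}"
proof -
  \<comment> \<open>\<open>P\<close> and \<open>Z\<close> replace \<open>p\<close> and
    \<open>z\<close>, about which nothing is known outside \<open>{0..R}\<close>.\<close>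
  define P where "P t = p 0 + integral {0..t} p'" for t
  define Z where "Z t = z 0 + integral {0..t} z'" for t
  have ints: "p' integrable_on {0..R}" "z' integrable_on {0..R}"
    using p' z' by (auto simp: absolutely_integrable_on_def)
  have "continuous_on {0..R} P" "continuous_on {0..R} Z"
    unfolding P_def Z_def by (intro continuous_intros indefinite_integral_continuous_1 ints)+
  then have "bounded (P ` {0..R})" "bounded (Z ` {0..R})"
    by (auto intro: compact_imp_bounded compact_continuous_image)
  then obtain B1 B2 where B: "\<And>t. t \<in> {0..R} \<Longrightarrow> norm (P t) \<le> B1" "\<And>t. t \<in> {0..R} \<Longrightarrow> norm (Z t) \<le> B2"
    unfolding bounded_iff by (meson imageI)
  define L where "L = max 1 (max B1 B2)"
  have ac: "abs_cont_on 0 R (\<lambda>t. P t \<bullet> Z t)"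
  proof (rule abs_cont_on_dominated[where L=L])
    show "abs_cont_on 0 R P" "abs_cont_on 0 R Z"
      unfolding P_def Z_def by (intro abs_cont_on_integral p' z')+
    fix r r' assume r: "r \<in> {0..R}" "r' \<in> {0..R}"
    have "P r \<bullet> Z r - P r' \<bullet> Z r' = (P r - P r') \<bullet> Z r + P r' \<bullet> (Z r - Z r')"
      by (simp add: algebra_simps)
    also have "norm \<dots> \<le> norm (P r - P r') * norm (Z r) + norm (P r') * norm (Z r - Z r')"
      by (intro norm_triangle_le add_mono) (auto simp: Cauchy_Schwarz_ineq2)
    also have "\<dots> \<le> norm (P r - P r') * L + L * norm (Z r - Z r')"
      using B(1)[OF r(2)] B(2)[OF r(1)] by (intro add_mono mult_mono) (auto simp: L_def)
    finally show "norm (P r \<bullet> Z r - P r' \<bullet> Z r') \<le> L * (norm (P r - P r') + norm (Z r - Z r'))"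
      by (simp add: algebra_simps)
  qed (simp add: L_def)
  let ?N = "{0, R} \<union> {t \<in> {0<..<R}. \<not> ((\<lambda>t. integral {0..t} p') has_vector_derivative p' t) (at t)}
    \<union> {t \<in> {0<..<R}. \<not> ((\<lambda>t. integral {0..t} z') has_vector_derivative z' t) (at t)}"
  have "((\<lambda>t. p' t \<bullet> Z t + P t \<bullet> z' t) has_integral P R \<bullet> Z R - P 0 \<bullet> Z 0) {0..R}"
  proof (rule abs_cont_on_has_integral_derivative[OF R ac])
    show "negligible ?N"
      by (intro negligible_Un negligible_not_integral_has_vector_derivative ints) auto
    fix r assume r: "r \<in> {0..R} - ?N"
    then have 1: "((\<lambda>t. integral {0..t} p') has_vector_derivative p' r) (at r)"
      "((\<lambda>t. integral {0..t} z') has_vector_derivative z' r) (at r)" by auto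
    have "(P has_vector_derivative p' r) (at r within {0..R})"
      "(Z has_vector_derivative z' r) (at r within {0..R})"
      unfolding P_def Z_def
      using has_vector_derivative_add[OF has_vector_derivative_const 1(1), of "p 0"]
        has_vector_derivative_add[OF has_vector_derivative_const 1(2), of "z 0"]
      by (auto intro: has_vector_derivative_at_within)
    from bounded_bilinear.has_vector_derivative[OF bounded_bilinear_inner this]
    show "((\<lambda>t. P t \<bullet> Z t) has_vector_derivative p' r \<bullet> Z r + P r \<bullet> z' r) (at r within {0..R})"
      by (simp add: add.commute)
  qed
  moreover have eq: "P t = p t" "Z t = z t" if "t \<in> {0..R}" for t
    using p[OF that] z[OF that] by (auto simp: P_def Z_def)
  ultimately have "((\<lambda>t. p' t \<bullet> Z t + P t \<bullet> z' t) has_integral p R \<bullet> z R - p 0 \<bullet> z 0) {0..R}"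
    using R by simp
  then show ?thesis
    by (rule has_integral_eq[rotated]) (simp add: eq)
qed

section \<open>Weighted fixed points on the half-line\<close>

text \<open>The chain rule for an exponent that is only absolutely continuous. It is why exponential
  weights work: \<open>m\<close> times the weight integrates to an increment of the weight divided
  by \<open>k\<close>, and \<open>k = 2\<close> or \<open>k = -2\<close> gives the contraction
  constant 1/2.\<close>

lemma exp_integral_has_integral:
  fixes m :: "real \<Rightarrow> real" and k :: real
  assumes s: "0 \<le> s" "s \<le> t" and m: "m absolutely_integrable_on {0..t}"
  defines "W \<equiv> \<lambda>t. exp (k * integral {0..t} m)"
  shows "((\<lambda>r. k * m r * W r) has_integral W t - W s) {s..t}"
proof -
  have mi: "m integrable_on {0..t}" using m by (auto simp: absolutely_integrable_on_def)
  have W: "W r = exp (k * integral {0..s} m) * exp (k * integral {s..r} m)" if "r \<in> {s..t}" for r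
  proof -
    have "integral {0..r} m = integral {0..s} m + integral {s..r} m"
      using that s integrable_on_subinterval[OF mi, of 0 r]
      by (subst Henstock_Kurzweil_Integration.integral_combine) auto
    then show ?thesis by (simp add: W_def exp_add[symmetric] distrib_left)
  qed
  define M where "M r = integral {0..r} m" for r
  have "continuous_on {0..t} M"
    unfolding M_def by (intro indefinite_integral_continuous_1 mi)
  then have "bounded (M ` {0..t})"
    by (auto intro: compact_imp_bounded compact_continuous_image)
  then obtain B where B: "\<And>r. r \<in> {0..t} \<Longrightarrow> \<bar>M r\<bar> \<le> B"
    unfolding bounded_iff by (metis imageI real_norm_def)
  have ac0: "abs_cont_on 0 t M"
    using abs_cont_on_integral[OF m, of 0] by (simp add: M_def[abs_def])
  \<comment> \<open>A Lipschitz constant of the exponential on the range of \<open>k * M r\<close>,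
    times the modulus of \<open>k\<close>; the 1 makes it positive also for
    \<open>k = 0\<close>.\<close>
  define L where "L = exp (\<bar>k\<bar> * B) * \<bar>k\<bar> + 1"
  have acW: "abs_cont_on 0 t W"
  proof (rule abs_cont_on_dominated[OF ac0 ac0, where L=L])
    fix r r' assume r: "r \<in> {0..t}" "r' \<in> {0..t}"
    have "\<bar>exp x - exp y\<bar> \<le> exp (\<bar>k\<bar> * B) * \<bar>x - y\<bar>"
      if "\<bar>x\<bar> \<le> \<bar>k\<bar> * B" "\<bar>y\<bar> \<le> \<bar>k\<bar> * B" for x y :: real
    proof (rule field_differentiable_bound[of "{- (\<bar>k\<bar> * B)..\<bar>k\<bar> * B}" exp exp "exp (\<bar>k\<bar> * B)" x y, unfolded real_norm_def])
      show "(exp has_field_derivative exp z) (at z within {- (\<bar>k\<bar> * B)..\<bar>k\<bar> * B})" for z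
        by (auto intro!: derivative_eq_intros)
    qed (use that in auto)
    moreover have "\<bar>k * M r\<bar> \<le> \<bar>k\<bar> * B" "\<bar>k * M r'\<bar> \<le> \<bar>k\<bar> * B"
      using B[OF r(1)] B[OF r(2)] by (auto simp: abs_mult intro: mult_left_mono)
    ultimately have "\<bar>W r - W r'\<bar> \<le> exp (\<bar>k\<bar> * B) * \<bar>k * M r - k * M r'\<bar>"
      unfolding W_def M_def by blast
    also have "\<dots> = exp (\<bar>k\<bar> * B) * \<bar>k\<bar> * \<bar>M r - M r'\<bar>"
      by (simp add: abs_mult right_diff_distrib[symmetric])
    also have "\<dots> \<le> L * \<bar>M r - M r'\<bar>" unfolding L_def by (intro mult_right_mono) auto
    also have "\<dots> \<le> L * (\<bar>M r - M r'\<bar> + \<bar>M r - M r'\<bar>)"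
      by (intro mult_left_mono) (auto simp: L_def)
    finally show "norm (W r - W r') \<le> L * (norm (M r - M r') + norm (M r - M r'))" by simp
  qed (simp add: L_def add_nonneg_pos)
  let ?N = "{0, t} \<union> {r \<in> {0<..<t}. \<not> ((\<lambda>t. integral {0..t} m) has_vector_derivative m r) (at r)}"
  have FTC: "((\<lambda>r. k * m r * W r) has_integral W b - W 0) {0..b}" if b: "b \<in> {0..t}" for b
  proof (rule abs_cont_on_has_integral_derivative)
    show "0 \<le> b" using b by simp
    show "abs_cont_on 0 b W"
      unfolding abs_cont_on_def
    proof (intro allI impI)
      fix e :: real assume "e > 0"
      then obtain d where d: "d > 0" "\<forall>(N::nat) u v. (\<forall>i<N. 0 \<le> u i \<and> u i \<le> v i \<and> v i \<le> t) \<and>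
        (\<forall>i<N. \<forall>j<N. i \<noteq> j \<longrightarrow> {u i<..<v i} \<inter> {u j<..<v j} = {}) \<and>
        (\<Sum>i<N. v i - u i) < d \<longrightarrow> (\<Sum>i<N. norm (W (v i) - W (u i))) < e"
        using acW[unfolded abs_cont_on_def, THEN spec, THEN mp, OF \<open>e > 0\<close>] by (elim exE conjE) (rule that)
      show "\<exists>\<delta>>0. \<forall>(N::nat) u v. (\<forall>i<N. 0 \<le> u i \<and> u i \<le> v i \<and> v i \<le> b) \<and>
        (\<forall>i<N. \<forall>j<N. i \<noteq> j \<longrightarrow> {u i<..<v i} \<inter> {u j<..<v j} = {}) \<and>
        (\<Sum>i<N. v i - u i) < \<delta> \<longrightarrow> (\<Sum>i<N. norm (W (v i) - W (u i))) < e"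
        by (intro exI[of _ d] conjI d(1) allI impI d(2)[rule_format]) (use b in force)+
    qed
    show "negligible ?N"
      by (intro negligible_Un negligible_not_integral_has_vector_derivative mi) auto
    fix r assume r: "r \<in> {0..b} - ?N"
    then have "((\<lambda>t. integral {0..t} m) has_real_derivative m r) (at r)"
      using b by (auto simp: has_real_derivative_iff_has_vector_derivative)
    then have "((\<lambda>t. integral {0..t} m) has_real_derivative m r) (at r within {0..b})"
      by (rule has_field_derivative_at_within)
    from DERIV_chain2[OF DERIV_exp DERIV_cmult[OF this]]
    have "(W has_real_derivative k * m r * W r) (at r within {0..b})"
      unfolding W_def by (simp add: mult.commute mult.left_commute)
    then show "(W has_vector_derivative k * m r * W r) (at r within {0..b})"
      by (simp add: has_real_derivative_iff_has_vector_derivative)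
  qed
  have "((\<lambda>r. k * m r * W r) has_integral W s - W 0) {0..s}" "((\<lambda>r. k * m r * W r) has_integral W t - W 0) {0..t}"
    using FTC s by auto
  then have "integral {s..t} (\<lambda>r. k * m r * W r) = W t - W s" "(\<lambda>r. k * m r * W r) integrable_on {0..t}"
    using integral_diff_interval[of "\<lambda>r. k * m r * W r" 0 t s] s
    by (auto simp: integral_unique has_integral_integrable)
  then show ?thesis
    using integrable_on_subinterval[of "\<lambda>r. k * m r * W r" "{0..t}" s t] s by (metis atLeastatMost_subset_iff has_integral_integral order_refl)
qed

text \<open>Banach iteration with distances expressed by bounds \<open>B * w\<close>, so that no
  norm on functions is introduced. \<open>X\<close> is not assumed closed: the limit comes with its
  rate of convergence, and membership in \<open>X\<close> and the fixed point equation are left to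
  the applications.\<close>

lemma picard_weighted:
  fixes S :: "(real \<Rightarrow> 'a::banach) \<Rightarrow> real \<Rightarrow> 'a"
  assumes q: "0 \<le> q" "q < 1" and w: "\<And>t. t \<ge> 0 \<Longrightarrow> 0 \<le> w t"
    and x0: "x0 \<in> X" and S: "\<And>x. x \<in> X \<Longrightarrow> S x \<in> X"
    and B0: "\<And>t. t \<ge> 0 \<Longrightarrow> norm (S x0 t - x0 t) \<le> B0 * w t" "B0 \<ge> 0"
    and contr: "\<And>x y B. \<lbrakk>x \<in> X; y \<in> X; B \<ge> 0; \<forall>t\<ge>0. norm (x t - y t) \<le> B * w t\<rbrakk> \<Longrightarrow>
       \<forall>t\<ge>0. norm (S x t - S y t) \<le> q * B * w t"
  obtains xseq x C where "\<And>k. xseq k \<in> X" "\<And>k. xseq (Suc k) = S (xseq k)" "C \<ge> 0"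
    "\<And>k t. t \<ge> 0 \<Longrightarrow> norm (xseq k t - x t) \<le> C * q ^ k * w t"
proof -
  define xseq where "xseq k = (S ^^ k) x0" for k
  have X: "xseq k \<in> X" for k by (induction k) (auto simp: xseq_def x0 S)
  have step: "xseq (Suc k) = S (xseq k)" for k by (simp add: xseq_def)
  have d: "\<forall>t\<ge>0. norm (xseq (Suc k) t - xseq k t) \<le> (q ^ k * B0) * w t" for k
  proof (induction k)
    case 0
    then show ?case using B0 by (simp add: xseq_def)
  next
    case (Suc k)
    show ?case using contr[OF X X _ Suc] B0(2) q by (simp add: step mult.assoc)
  qed
  \<comment> \<open>\<open>B0 / (1 - q)\<close> is the sum of the geometric series; the factor
    \<open>1 - q ^ j\<close> in \<open>dist\<close> is its partial sum and lets the induction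
    close.\<close>
  define C where "C = B0 / (1 - q)"
  have C: "C \<ge> 0" using B0 q by (simp add: C_def)
  have dist: "norm (xseq (k + j) t - xseq k t) \<le> C * q ^ k * (1 - q ^ j) * w t" if t: "t \<ge> 0" for k j t
  proof (induction j)
    case (Suc j)
    have "norm (xseq (k + Suc j) t - xseq k t) \<le>
      norm (xseq (Suc (k + j)) t - xseq (k + j) t) + norm (xseq (k + j) t - xseq k t)"
      using norm_triangle_ineq[of "xseq (Suc (k + j)) t - xseq (k + j) t" "xseq (k + j) t - xseq k t"] by simp
    also have "\<dots> \<le> (q ^ (k + j) * B0) * w t + C * q ^ k * (1 - q ^ j) * w t"
      using d t Suc by (intro add_mono) auto
    also have "B0 = C * (1 - q)" using q by (simp add: C_def)
    finally show ?case by (simp add: algebra_simps power_add)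
  qed simp
  have dist': "norm (xseq n t - xseq k t) \<le> C * q ^ k * w t" if t: "t \<ge> 0" and "k \<le> n" for k n t
  proof -
    have "norm (xseq n t - xseq k t) \<le> C * q ^ k * (1 - q ^ (n - k)) * w t"
      using dist[OF t, of k "n - k"] \<open>k \<le> n\<close> by simp
    also have "\<dots> \<le> C * q ^ k * 1 * w t"
      using C q w[OF t] by (intro mult_right_mono mult_left_mono) auto
    finally show ?thesis by simp
  qed
  have lim0: "(\<lambda>k. C * q ^ k * w t) \<longlonglongrightarrow> 0" for t
    using q by (auto intro!: tendsto_eq_intros LIMSEQ_power_zero)
  have "convergent (\<lambda>k. xseq k t)" if t: "t \<ge> 0" for t
  proof -
    have "Cauchy (\<lambda>k. xseq k t)"
    proof (rule CauchyI')
      fix e :: real assume "e > 0"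
      then obtain M where M: "\<forall>k\<ge>M. norm (C * q ^ k * w t - 0) < e" using LIMSEQ_D[OF lim0] by blast
      show "\<exists>M. \<forall>m\<ge>M. \<forall>n>m. dist (xseq m t) (xseq n t) < e"
      proof (intro exI[of _ M] allI impI)
        fix m n assume mn: "m \<ge> M" "n > m"
        have "norm (xseq n t - xseq m t) \<le> C * q ^ m * w t" using mn by (intro dist' t) auto
        also have "\<dots> < e" using M mn by auto
        finally show "dist (xseq m t) (xseq n t) < e" by (simp add: dist_norm norm_minus_commute)
      qed
    qed
    then show ?thesis by (simp add: Cauchy_convergent_iff)
  qed
  then have lim: "(\<lambda>n. xseq n t) \<longlonglongrightarrow> lim (\<lambda>k. xseq k t)" if "t \<ge> 0" for t
    using that by (simp add: convergent_LIMSEQ_iff)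
  show ?thesis
  proof (rule that[of xseq C "\<lambda>t. lim (\<lambda>k. xseq k t)", OF X step C])
    fix k t assume t: "(t::real) \<ge> 0"
    have "(\<lambda>n. norm (xseq k t - xseq n t)) \<longlonglongrightarrow> norm (xseq k t - lim (\<lambda>k. xseq k t))"
      by (intro tendsto_intros lim t)
    then show "norm (xseq k t - lim (\<lambda>k. xseq k t)) \<le> C * q ^ k * w t"
      by (rule LIMSEQ_le_const2) (auto intro!: exI[of _ k] dist' t simp: norm_minus_commute)
  qed
qed

text \<open>The bound \<open>B0\<close> may be arbitrarily bad: iterating
  \<open>B \<mapsto> q * B + d\<close> drives it to the fixed point
  \<open>d / (1 - q)\<close>.\<close>

lemma weighted_bound_improve:
  fixes v w :: "real \<Rightarrow> real"
  assumes q: "0 \<le> q" "q < 1" and d: "d \<ge> 0" and B0: "B0 \<ge> 0" "\<forall>t\<ge>0. v t \<le> B0 * w t"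
    and step: "\<And>B. \<lbrakk>B \<ge> 0; \<forall>t\<ge>0. v t \<le> B * w t\<rbrakk> \<Longrightarrow> \<forall>t\<ge>0. v t \<le> (q * B + d) * w t"
    and t: "t \<ge> 0" and w: "\<And>t. t \<ge> 0 \<Longrightarrow> 0 \<le> w t"
  shows "v t \<le> d / (1 - q) * w t"
proof -
  define E where "E = d / (1 - q)"
  have E: "E \<ge> 0" "q * E + d = E" using d q by (auto simp: E_def field_simps)
  have bd: "\<forall>t\<ge>0. v t \<le> (q ^ n * B0 + E) * w t" for n
  proof (induction n)
    case 0
    have "B0 * w t \<le> (q ^ 0 * B0 + E) * w t" if "t \<ge> 0" for t
      using w[OF that] E by (intro mult_right_mono) auto
    then show ?case using B0(2) order_trans by blast
  next
    case (Suc n)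
    have "q * (q ^ n * B0 + E) + d = q ^ Suc n * B0 + E" using E by (simp add: algebra_simps)
    then show ?case using step[OF _ Suc] q B0 E by simp
  qed
  have "(\<lambda>n. (q ^ n * B0 + E) * w t) \<longlonglongrightarrow> (0 * B0 + E) * w t"
    using q by (intro tendsto_intros LIMSEQ_power_zero) auto
  then have "v t \<le> (0 * B0 + E) * w t"
    by (rule LIMSEQ_le_const) (intro exI[of _ 0] allI impI bd[rule_format] t)
  then show ?thesis by (simp add: E_def)
qed

section \<open>Curves given by integrals, and the class \<open>W1_inf\<close>\<close>

lemma measurable_half_subinterval:
  "g \<in> borel_measurable leb_half \<Longrightarrow> 0 \<le> s \<Longrightarrow> g \<in> borel_measurable (lebesgue_on {s..t})"
  by (erule measurable_restrict_mono) auto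

lemma bounded_measurable_absolutely_integrable:
  fixes g :: "real \<Rightarrow> 'a::euclidean_space"
  assumes "g \<in> borel_measurable leb_half" "\<And>t. t \<ge> 0 \<Longrightarrow> norm (g t) \<le> M"
  shows "g absolutely_integrable_on {0..R}"
  by (rule measurable_bounded_by_integrable_imp_absolutely_integrable[of _ _ "\<lambda>_. M"])
    (use assms in \<open>auto intro: measurable_half_subinterval\<close>)

lemma
  fixes g :: "real \<Rightarrow> 'a::euclidean_space"
  assumes g: "\<And>R. g absolutely_integrable_on {0..R}" and x: "\<And>t. t \<ge> 0 \<Longrightarrow> x t = c + integral {0..t} g"
  shows locally_abs_cont_integral: "locally_abs_cont x"
    and integral_derivative_AE: "AE t in leb_half. (x has_vector_derivative g t) (at t within {0..})"
    and continuous_on_integral: "continuous_on {0..} x"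
proof -
  let ?F = "\<lambda>t. c + integral {0..t} g"
  have gi: "g integrable_on {0..b}" for b using g by (auto simp: absolutely_integrable_on_def)
  show "locally_abs_cont x"
    unfolding locally_abs_cont_def
  proof (intro allI impI)
    fix T :: real assume "T > 0"
    show "abs_cont_on 0 T x"
      by (rule abs_cont_on_dominated[where y=x and L=1, OF abs_cont_on_integral[OF g, where c=c] abs_cont_on_integral[OF g, where c=c]])
        (simp_all add: x)
  qed
  have "AE t in leb_half. ((\<lambda>t. integral {0..t} g) has_vector_derivative g t) (at t within {0..})"
    by (rule integral_has_vector_derivative_AE[OF gi])
  then obtain N where N: "negligible N" "\<And>t. t \<ge> 0 \<Longrightarrow> t \<notin> N \<Longrightarrow>
      ((\<lambda>t. integral {0..t} g) has_vector_derivative g t) (at t within {0..})"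
    using leb_half_AE_D by blast
  show "AE t in leb_half. (x has_vector_derivative g t) (at t within {0..})"
  proof (rule leb_half_AE_I[OF N(1)])
    fix t assume t: "t \<ge> 0" "t \<notin> N"
    have "(?F has_vector_derivative g t) (at t within {0..})"
      using has_vector_derivative_add[OF has_vector_derivative_const N(2)[OF t], of c] by simp
    then show "(x has_vector_derivative g t) (at t within {0..})"
      by (rule has_vector_derivative_transform[rotated 2]) (use t x in auto)
  qed
  show "continuous_on {0..} x"
    unfolding continuous_on_eq_continuous_within
  proof (rule ballI)
    fix t :: real assume "t \<in> {0..}"
    then have t: "0 \<le> t" by simp
    have "continuous_on {0..t + 1} ?F"
      by (intro continuous_intros indefinite_integral_continuous_1 gi)
    then have "continuous_on {0..t + 1} x"
      by (rule continuous_on_cong[THEN iffD2, rotated 2]) (auto simp: x)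
    then have "continuous (at t within {0..t + 1}) x"
      using t by (simp add: continuous_on_eq_continuous_within)
    moreover have "at t within {0..t + 1} = at t within {0..}"
      by (rule at_within_nhd[of t "{..<t + 1}"]) auto
    ultimately show "continuous (at t within {0..}) x" by simp
  qed
qed

lemma W1_inf_integralI:
  fixes g :: "real \<Rightarrow> 'a::euclidean_space"
  assumes g: "g \<in> borel_measurable leb_half" "\<And>t. t \<ge> 0 \<Longrightarrow> norm (g t) \<le> M"
    and x: "\<And>t. t \<ge> 0 \<Longrightarrow> x t = c + integral {0..t} g" and bdd: "bounded (x ` {0..})"
  shows "x \<in> W1_inf"
proof -
  have ai: "g absolutely_integrable_on {0..R}" for R
    using g by (rule bounded_measurable_absolutely_integrable)
  have "ess_bounded g"
    unfolding ess_bounded_def by (rule exI[of _ M], rule leb_half_AE_I[OF negligible_empty]) (use g in auto)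
  then show ?thesis
    using locally_abs_cont_integral[OF ai x] integral_derivative_AE[OF ai x] bdd
    unfolding W1_inf_def by blast
qed

lemma W1_inf_has_integral:
  fixes x :: "real \<Rightarrow> 'a::euclidean_space"
  assumes x: "x \<in> W1_inf" and der: "AE t in leb_half. (x has_vector_derivative g t) (at t within {0..})"
    and t: "t \<ge> 0"
  shows "(g has_integral x t - x 0) {0..t}"
proof (cases "t = 0")
  case False
  obtain N where N: "negligible N" "\<And>t. t \<ge> 0 \<Longrightarrow> t \<notin> N \<Longrightarrow> (x has_vector_derivative g t) (at t within {0..})"
    using leb_half_AE_D[OF der] by blast
  show ?thesis
  proof (rule abs_cont_on_has_integral_derivative[OF t _ N(1)])
    show "abs_cont_on 0 t x" using x t False by (auto simp: W1_inf_def locally_abs_cont_def)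
    show "(x has_vector_derivative g r) (at r within {0..t})" if "r \<in> {0..t} - N" for r
      using N(2)[of r] that by (auto intro: has_vector_derivative_within_subset)
  qed
qed auto

lemma W1_inf_continuous_on:
  fixes x :: "real \<Rightarrow> 'a::euclidean_space"
  assumes "x \<in> W1_inf" shows "continuous_on {0..} x"
proof -
  have "continuous (at t within {0..}) x" if t: "t \<ge> 0" for t
    unfolding continuous_within Lim_within
  proof (intro allI impI)
    fix e :: real assume e: "e > 0"
    have "abs_cont_on 0 (t + 1) x"
      using assms t by (auto simp: W1_inf_def locally_abs_cont_def)
    \<comment> \<open>Continuity uses a single interval, hence the index type
      \<open>unit\<close>.\<close>
    from abs_cont_on_finite[OF this e] obtain d where d: "d > 0"
      "\<forall>(I::unit set) a b. finite I \<and> (\<forall>i\<in>I. 0 \<le> a i \<and> a i \<le> b i \<and> b i \<le> t + 1) \<and>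
        (\<forall>i\<in>I. \<forall>j\<in>I. i \<noteq> j \<longrightarrow> {a i<..<b i} \<inter> {a j<..<b j} = {}) \<and>
        (\<Sum>i\<in>I. b i - a i) < d \<longrightarrow> (\<Sum>i\<in>I. norm (x (b i) - x (a i))) < e"
      by (elim exE conjE) (rule that)
    have *: "norm (x v - x u) < e" if "0 \<le> u" "u \<le> v" "v \<le> t + 1" "v - u < d" for u v
      using d(2)[THEN spec[of _ "{()}"], THEN spec[of _ "\<lambda>_. u"], THEN spec[of _ "\<lambda>_. v"]] that by simp
    show "\<exists>d>0. \<forall>y\<in>{0..}. 0 < dist y t \<and> dist y t < d \<longrightarrow> dist (x y) (x t) < e"
    proof (intro exI[of _ "min d 1"] conjI ballI impI)
      fix y assume y: "y \<in> {0::real..}" "0 < dist y t \<and> dist y t < min d 1"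
      show "dist (x y) (x t) < e"
        using *[of y t] *[of t y] y t
        by (cases "y \<le> t") (auto simp: dist_norm norm_minus_commute)
    qed (use d in auto)
  qed
  then show ?thesis by (simp add: continuous_on_eq_continuous_within)
qed

lemma continuous_on_measurable_half:
  fixes x :: "real \<Rightarrow> 'a::euclidean_space"
  assumes "continuous_on {0..} x" shows "x \<in> borel_measurable leb_half"
  using assms by (rule continuous_imp_measurable_on_sets_lebesgue) auto

text \<open>Terminal value problem for a linear equation with integrable coefficients: the integral
  operator is a contraction for the weight \<open>exp (2 \<integral>\<^sub>t\<^sup>\<infinity> a)\<close>.\<close>

lemma linear_terminal_value_problem:
  fixes L :: "real \<Rightarrow> 'a::euclidean_space \<Rightarrow> 'a" and b :: "real \<Rightarrow> 'a" and c :: 'a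
  assumes a: "a absolutely_integrable_on {0..}" and a0: "\<And>t. t \<ge> 0 \<Longrightarrow> 0 \<le> a t"
    and L: "\<And>t x y. t \<ge> 0 \<Longrightarrow> norm (L t x - L t y) \<le> a t * norm (x - y)" "\<And>t. t \<ge> 0 \<Longrightarrow> L t 0 = 0"
    and meas: "\<And>x. x \<in> borel_measurable leb_half \<Longrightarrow> (\<lambda>t. L t (x t)) \<in> borel_measurable leb_half"
    and b: "b absolutely_integrable_on {0..}"
  obtains p where "bounded (p ` {0..})" "(\<lambda>t. L t (p t) + b t) absolutely_integrable_on {0..}"
    "\<And>t. t \<ge> 0 \<Longrightarrow> p t = p 0 + integral {0..t} (\<lambda>t. L t (p t) + b t)" "(p \<longlongrightarrow> c) at_top"
proof -
  define G where "G p t = L t (p t) + b t" for p t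
  define X where "X = {p :: real \<Rightarrow> 'a. p \<in> borel_measurable leb_half \<and> (\<exists>B. \<forall>t\<ge>0. norm (p t) \<le> B)}"
  have ai: "a integrable_on {0..}" using a by (auto simp: absolutely_integrable_on_def)
  have am: "a \<in> borel_measurable leb_half"
    by (rule absolutely_integrable_imp_borel_measurable[OF a]) simp
  have bm: "b \<in> borel_measurable leb_half"
    by (rule absolutely_integrable_imp_borel_measurable[OF b]) simp
  have G: "G p absolutely_integrable_on {0..}" if pX: "p \<in> X" for p
  proof -
    obtain B where B: "\<forall>t\<ge>0. norm (p t) \<le> B" "p \<in> borel_measurable leb_half" using pX unfolding X_def by blast
    have "(\<lambda>t. L t (p t)) absolutely_integrable_on {0..}"
    proof (rule measurable_bounded_by_integrable_imp_absolutely_integrable)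
      show "(\<lambda>t. a t * B) integrable_on {0..}" using ai by (rule integrable_on_mult_left)
      fix t :: real assume "t \<in> {0..}"
      then have "norm (L t (p t)) \<le> a t * norm (p t)" using L(1)[of t "p t" 0] L(2)[of t] by simp
      also have "\<dots> \<le> a t * B" using B \<open>t \<in> {0..}\<close> a0 by (intro mult_left_mono) auto
      finally show "norm (L t (p t)) \<le> a t * B" .
    qed (use meas B in auto)
    then show ?thesis unfolding G_def using b by (rule set_integral_add(1))
  qed
  have Gi: "G p integrable_on {0..}" if "p \<in> X" for p
    using G[OF that] by (auto simp: absolutely_integrable_on_def)
  have GiT: "G p integrable_on {0..T}" if "p \<in> X" for p T
    by (rule integrable_on_subinterval[OF Gi[OF that]]) auto
  \<comment> \<open>This is \<open>c\<close> minus the integral over \<open>{t..}\<close>, written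
    with integrals from 0 so that continuity and the limit \<open>c\<close> at infinity are
    immediate.\<close>
  define S where "S p t = (c - integral {0..} (G p)) + integral {0..t} (G p)" for p t
  have SX: "S p \<in> X" if p: "p \<in> X" for p
  proof -
    have "continuous_on {0..} (S p)"
      by (rule continuous_on_integral[of "G p" _ "c - integral {0..} (G p)"])
        (auto simp: S_def intro: absolutely_integrable_on_subinterval[OF G[OF p]])
    moreover have "norm (S p t) \<le> norm (c - integral {0..} (G p)) + integral {0..} (\<lambda>t. norm (G p t))" if "t \<ge> 0" for t
    proof -
      have ni: "(\<lambda>t. norm (G p t)) integrable_on {0..}"
        using G[OF p] by (auto simp: absolutely_integrable_on_def)
      have "norm (integral {0..t} (G p)) \<le> integral {0..t} (\<lambda>t. norm (G p t))"
        by (intro integral_norm_bound_integral GiT p integrable_on_subinterval[OF ni]) auto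
      also have "\<dots> \<le> integral {0..} (\<lambda>t. norm (G p t))"
        by (intro integral_subset_le ni integrable_on_subinterval[OF ni]) auto
      finally show ?thesis unfolding S_def by (intro norm_triangle_le add_left_mono)
    qed
    ultimately show ?thesis by (auto simp: X_def continuous_on_measurable_half)
  qed
  define Ai where "Ai = integral {0..} a"
  define w where "w t = exp (2 * Ai) * exp (- 2 * integral {0..t} a)" for t
  have aiT: "a absolutely_integrable_on {0..T}" for T
    by (rule absolutely_integrable_on_subinterval[OF a]) auto
  have w1: "w t \<ge> 1" if "t \<ge> 0" for t
  proof -
    have "integral {0..t} a \<le> Ai"
      unfolding Ai_def using aiT[of t] a0
      by (intro integral_subset_le ai) (auto simp: absolutely_integrable_on_def)
    then show ?thesis by (simp add: w_def exp_add[symmetric])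
  qed
  have w_int: "integral {t..R} (\<lambda>s. a s * w s) \<le> w t / 2" "(\<lambda>s. a s * w s) integrable_on {t..R}"
    if "0 \<le> t" "t \<le> R" for t R
  proof -
    have "((\<lambda>r. - 2 * a r * exp (- 2 * integral {0..r} a)) has_integral
      exp (- 2 * integral {0..R} a) - exp (- 2 * integral {0..t} a)) {t..R}"
      using exp_integral_has_integral[OF that aiT, of "-2"] by simp
    from has_integral_mult_right[OF this, of "- (exp (2 * Ai) / 2)"]
    have "((\<lambda>r. a r * w r) has_integral (w t - w R) / 2) {t..R}"
      by (simp add: w_def algebra_simps diff_divide_distrib)
    moreover have "w R \<ge> 0" by (simp add: w_def)
    ultimately show "integral {t..R} (\<lambda>s. a s * w s) \<le> w t / 2" "(\<lambda>s. a s * w s) integrable_on {t..R}"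
      by (auto simp: integral_unique has_integral_integrable)
  qed
  have contr: "\<forall>t\<ge>0. norm (S x t - S y t) \<le> 1/2 * B * w t"
    if x: "x \<in> X" and y: "y \<in> X" and B: "B \<ge> 0" "\<forall>t\<ge>0. norm (x t - y t) \<le> B * w t" for x y B
  proof (intro allI impI)
    fix t :: real assume t: "t \<ge> 0"
    \<comment> \<open>The integral over \<open>{t..}\<close> is approached through bounded intervals
      \<open>{t..R}\<close>, on which \<open>w_int\<close> integrates the weight.\<close>
    let ?D = "\<lambda>R. (integral {0..t} (G x) - integral {0..R} (G x)) - (integral {0..t} (G y) - integral {0..R} (G y))"
    have "(?D \<longlongrightarrow> (integral {0..t} (G x) - integral {0..} (G x)) - (integral {0..t} (G y) - integral {0..} (G y))) at_top"
      by (intro tendsto_intros tendsto_integral_half_line G x y)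
    then have "(?D \<longlongrightarrow> S x t - S y t) at_top" by (simp add: S_def algebra_simps)
    moreover have "\<forall>\<^sub>F R in at_top. norm (?D R) \<le> 1/2 * B * w t"
      using eventually_ge_at_top[of t]
    proof eventually_elim
      case (elim R)
      have sub: "{t..R} \<subseteq> {0..}" using t by auto
      have "?D R = - integral {t..R} (\<lambda>s. G x s - G y s)"
        using integral_diff_interval[OF GiT[OF x] t elim] integral_diff_interval[OF GiT[OF y] t elim]
          integral_diff[OF integrable_on_subinterval[OF Gi[OF x] sub] integrable_on_subinterval[OF Gi[OF y] sub]]
        by (simp add: algebra_simps)
      moreover have "norm (integral {t..R} (\<lambda>s. G x s - G y s)) \<le> integral {t..R} (\<lambda>s. B * (a s * w s))"
      proof (rule integral_norm_bound_integral)
        show "(\<lambda>s. G x s - G y s) integrable_on {t..R}"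
          by (intro integrable_diff integrable_on_subinterval[OF Gi[OF x] sub] integrable_on_subinterval[OF Gi[OF y] sub])
        show "(\<lambda>s. B * (a s * w s)) integrable_on {t..R}"
          by (intro integrable_on_mult_right w_int t elim)
        fix s assume "s \<in> {t..R}"
        then have s: "s \<ge> 0" using t by auto
        have "norm (G x s - G y s) \<le> a s * norm (x s - y s)" using L(1)[OF s] by (simp add: G_def)
        also have "\<dots> \<le> a s * (B * w s)" using B s a0 by (intro mult_left_mono) auto
        finally show "norm (G x s - G y s) \<le> B * (a s * w s)" by (simp add: mult_ac)
      qed
      moreover have "\<dots> = B * integral {t..R} (\<lambda>s. a s * w s)" by simp
      moreover have "\<dots> \<le> B * (w t / 2)" by (intro mult_left_mono w_int t elim B)
      ultimately show ?case by simp
    qed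
    ultimately show "norm (S x t - S y t) \<le> 1/2 * B * w t"
      by (intro Lim_norm_ubound[of at_top ?D]) auto
  qed
  have w0: "0 \<le> w t" for t by (simp add: w_def)
  have zX: "(\<lambda>_. 0) \<in> X" by (auto simp: X_def)
  obtain B0 where B0: "\<forall>t\<ge>0. norm (S (\<lambda>_. 0) t) \<le> B0" using SX[OF zX] by (auto simp: X_def)
  have B0': "B0 \<ge> 0" using B0 norm_ge_zero order_trans by blast
  have init: "norm (S (\<lambda>_. 0) t - 0) \<le> B0 * w t" if "t \<ge> 0" for t
  proof -
    have "norm (S (\<lambda>_. 0) t) \<le> B0 * 1" using B0 that by simp
    also have "\<dots> \<le> B0 * w t" using w1[OF that] B0' by (intro mult_left_mono) auto
    finally show ?thesis by simp
  qed
  obtain xseq p C where xs: "\<And>k. xseq k \<in> X" "\<And>k. xseq (Suc k) = S (xseq k)" "C \<ge> 0"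
    "\<And>k t. t \<ge> 0 \<Longrightarrow> norm (xseq k t - p t) \<le> C * (1/2) ^ k * w t"
    by (rule picard_weighted[of "1/2" w "\<lambda>_. 0" X S B0])
      (use w0 zX SX init B0' contr in auto)
  have lim: "(\<lambda>k. xseq k t) \<longlonglongrightarrow> p t" if "t \<ge> 0" for t
  proof (rule LIM_zero_cancel, rule tendsto_norm_zero_cancel, rule tendsto_sandwich[OF _ _ tendsto_const])
    show "(\<lambda>k. C * (1/2) ^ k * w t) \<longlonglongrightarrow> 0"
      by (auto intro!: tendsto_eq_intros LIMSEQ_power_zero)
  qed (use xs(4)[OF that] in auto)
  have pX: "p \<in> X"
  proof -
    have "p \<in> borel_measurable leb_half"
      by (rule borel_measurable_LIMSEQ_metric[of xseq]) (use xs(1) lim in \<open>auto simp: X_def\<close>)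
    moreover obtain B where B: "\<forall>t\<ge>0. norm (xseq 0 t) \<le> B" using xs(1)[of 0] by (auto simp: X_def)
    have "norm (p t) \<le> B + C * exp (2 * Ai)" if "t \<ge> 0" for t
    proof -
      have "integral {0..t} a \<ge> 0"
        using aiT[of t] a0 by (intro integral_nonneg) (auto simp: absolutely_integrable_on_def)
      then have "w t \<le> exp (2 * Ai)" by (simp add: w_def mult_le_cancel_left1)
      then have "C * w t \<le> C * exp (2 * Ai)" using xs(3) by (intro mult_left_mono)
      moreover have "norm (p t) \<le> norm (xseq 0 t) + norm (xseq 0 t - p t)"
        by (metis norm_minus_commute norm_triangle_sub)
      ultimately show ?thesis using xs(4)[OF that, of 0] B that by fastforce
    qed
    ultimately show ?thesis by (auto simp: X_def)
  qed
  \<comment> \<open>Both \<open>S p t\<close> and \<open>p t\<close> lie within a multiple of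
    \<open>(1/2) ^ k\<close> of \<open>xseq (Suc k) t\<close>, so they coincide.\<close>
  have fix_p: "S p t = p t" if t: "t \<ge> 0" for t
  proof -
    have bnd: "norm (S p t - p t) \<le> 2 * (C * (1/2) ^ k * w t)" for k
    proof -
      have "\<forall>t\<ge>0. norm (xseq k t - p t) \<le> (C * (1/2) ^ k) * w t" using xs(4) by blast
      from contr[OF xs(1) pX _ this]
      have "norm (xseq (Suc k) t - S p t) \<le> 1/2 * (C * (1/2) ^ k) * w t" using xs(2,3) t by simp
      moreover have "norm (xseq (Suc k) t - p t) \<le> C * (1/2) ^ Suc k * w t" by (rule xs(4)[OF t])
      moreover have "norm (S p t - p t) \<le> norm (xseq (Suc k) t - p t) + norm (xseq (Suc k) t - S p t)"
        using norm_triangle_ineq4[of "xseq (Suc k) t - p t" "xseq (Suc k) t - S p t"] by simp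
      moreover have "0 \<le> C * (1/2) ^ k * w t" using xs(3) w0 by simp
      ultimately show ?thesis by simp
    qed
    have lim0: "(\<lambda>k. 2 * (C * (1/2) ^ k * w t)) \<longlonglongrightarrow> 0"
      by (auto intro!: tendsto_eq_intros LIMSEQ_power_zero)
    have "norm (S p t - p t) \<le> 0"
      by (rule LIMSEQ_le_const[OF lim0]) (intro exI[of _ 0] allI impI bnd)
    then show ?thesis by simp
  qed
  show ?thesis
  proof (rule that[of p])
    show "bounded (p ` {0..})" using pX by (auto simp: X_def bounded_iff)
    show "(\<lambda>t. L t (p t) + b t) absolutely_integrable_on {0..}" using G[OF pX] by (simp add: G_def[abs_def])
    show "p t = p 0 + integral {0..t} (\<lambda>t. L t (p t) + b t)" if "t \<ge> 0" for t
      using fix_p[OF that] fix_p[of 0] by (simp add: S_def G_def[abs_def])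
    have "((\<lambda>t. (c - integral {0..} (G p)) + integral {0..t} (G p)) \<longlongrightarrow> (c - integral {0..} (G p)) + integral {0..} (G p)) at_top"
      by (intro tendsto_intros tendsto_integral_half_line G pX)
    then have "((\<lambda>t. S p t) \<longlongrightarrow> c) at_top" by (simp add: S_def)
    then show "(p \<longlongrightarrow> c) at_top"
      by (rule Lim_transform_eventually) (rule eventually_mono[OF eventually_ge_at_top[of 0]], rule fix_p)
  qed
qed

section \<open>Uniform continuity on the compactified tube\<close>

lemma in_compactified_tube:
  assumes "0 \<le> t" "norm (x - xs t) \<le> \<gamma>" "u \<in> U1"
  shows "(arctan t, x, u) \<in> (\<lambda>(t, x, u). (arctan t, x, u)) ` tube xs \<gamma> U1"
  using assms by (intro image_eqI[of _ _ "(t, x, u)"]) (auto simp: tube_def)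

lemma bounded_compactified_tube:
  fixes xs :: "real \<Rightarrow> 'a::real_normed_vector" and U1 :: "'b::real_normed_vector set"
  assumes "bounded (xs ` {0..})" "bounded U1"
  shows "bounded ((\<lambda>(t, x, u). (arctan t, x, u)) ` tube xs \<gamma> U1)"
proof -
  obtain B where B: "\<And>t. t \<ge> 0 \<Longrightarrow> norm (xs t) \<le> B" using assms(1) by (auto simp: bounded_iff)
  have "(\<lambda>(t, x, u). (arctan t, x, u)) ` tube xs \<gamma> U1 \<subseteq> {- (pi/2)..pi/2} \<times> cball 0 (B + \<gamma>) \<times> U1"
  proof (rule image_subsetI)
    fix z assume "z \<in> tube xs \<gamma> U1"
    then obtain t x u where z: "z = (t, x, u)" and t: "0 \<le> (t::real)" "norm (x - xs t) \<le> \<gamma>" "(u::'b) \<in> U1"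
      by (auto simp: tube_def)
    have "norm x \<le> norm (xs t) + norm (x - xs t)" by (rule norm_triangle_sub)
    then show "(\<lambda>(t, x, u). (arctan t, x, u)) z \<in> {- (pi/2)..pi/2} \<times> cball 0 (B + \<gamma>) \<times> U1"
      using B[OF t(1)] t arctan_bounded[of t] by (auto simp: z)
  qed
  then show ?thesis
    by (rule bounded_subset[rotated]) (intro bounded_Times assms bounded_cball bounded_closed_interval)
qed

text \<open>The reparametrisation by \<open>arctan\<close> makes the domain a bounded subset of a
  finite-dimensional space, where uniform continuity forces boundedness.\<close>

lemma unif_cont_compactified_bounded:
  fixes xs :: "real \<Rightarrow> 'a::euclidean_space" and U1 :: "'b::euclidean_space set"
    and g :: "real \<Rightarrow> 'a \<Rightarrow> 'b \<Rightarrow> 'c::{heine_borel,real_normed_vector}"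
  assumes uc: "unif_cont_compactified (tube xs \<gamma> U1) g" and "bounded (xs ` {0..})" "bounded U1"
  obtains M where "M > 0" "\<And>t x u. \<lbrakk>0 \<le> t; norm (x - xs t) \<le> \<gamma>; u \<in> U1\<rbrakk> \<Longrightarrow> norm (g t x u) \<le> M"
proof -
  have "bounded ((\<lambda>(\<tau>, x, u). g (tan \<tau>) x u) ` (\<lambda>(t, x, u). (arctan t, x, u)) ` tube xs \<gamma> U1)"
    using uc[unfolded unif_cont_compactified_def] bounded_compactified_tube[OF assms(2,3)]
    by (rule bounded_uniformly_continuous_image)
  then obtain M where M: "M > 0" "\<And>z. z \<in> (\<lambda>(\<tau>, x, u). g (tan \<tau>) x u) ` (\<lambda>(t, x, u). (arctan t, x, u)) ` tube xs \<gamma> U1 \<Longrightarrow> norm z \<le> M"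
    unfolding bounded_pos by blast
  show ?thesis
  proof (rule that[OF M(1)])
    fix t x u assume t: "0 \<le> t" "norm (x - xs t) \<le> \<gamma>" "u \<in> U1"
    have "norm ((\<lambda>(\<tau>, x, u). g (tan \<tau>) x u) (arctan t, x, u)) \<le> M"
      by (intro M(2) imageI in_compactified_tube t)
    then show "norm (g t x u) \<le> M" by (simp only: prod.case tan_arctan)
  qed
qed

text \<open>Only points over the same \<open>t\<close> are compared, so their compactified distance
  in time is zero.\<close>

lemma unif_cont_compactified_D:
  assumes uc: "unif_cont_compactified (tube xs \<gamma> U1) g" and e: "e > 0"
  obtains d where "d > 0" "\<And>t x y u v. \<lbrakk>0 \<le> t; norm (x - xs t) \<le> \<gamma>; norm (y - xs t) \<le> \<gamma>; u \<in> U1; v \<in> U1;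
     dist x y < d; dist u v < d\<rbrakk> \<Longrightarrow> dist (g t x u) (g t y v) < e"
proof -
  obtain d where d: "d > 0" "\<And>z z'. \<lbrakk>z \<in> (\<lambda>(t, x, u). (arctan t, x, u)) ` tube xs \<gamma> U1;
      z' \<in> (\<lambda>(t, x, u). (arctan t, x, u)) ` tube xs \<gamma> U1; dist z' z < d\<rbrakk> \<Longrightarrow>
      dist ((\<lambda>(\<tau>, x, u). g (tan \<tau>) x u) z') ((\<lambda>(\<tau>, x, u). g (tan \<tau>) x u) z) < e"
    using uc e unfolding unif_cont_compactified_def uniformly_continuous_on_def by metis
  show ?thesis
  proof (rule that[of "d/2"])
    fix t x y u v
    assume t: "0 \<le> t" "norm (x - xs t) \<le> \<gamma>" "norm (y - xs t) \<le> \<gamma>" "u \<in> U1" "v \<in> U1"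
      and dd: "dist x y < d/2" "dist u v < d/2"
    have "dist (arctan t, x, u) (arctan t, y, v) = sqrt ((dist x y)\<^sup>2 + (dist u v)\<^sup>2)"
      by (simp add: dist_Pair_Pair)
    also have "\<dots> \<le> dist x y + dist u v" by (rule sqrt_sum_squares_le_sum) auto
    also have "\<dots> < d" using dd by simp
    finally have "dist ((\<lambda>(\<tau>, x, u). g (tan \<tau>) x u) (arctan t, x, u)) ((\<lambda>(\<tau>, x, u). g (tan \<tau>) x u) (arctan t, y, v)) < e"
      by (intro d(2) in_compactified_tube t)
    then show "dist (g t x u) (g t y v) < e" by (simp only: prod.case tan_arctan)
  qed (use d in simp)
qed

text \<open>Uniform continuity gives joint continuity in \<open>(arctan t, x, u)\<close>, and the
  composition runs through a measurable map from the half-line into that domain.\<close>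

lemma measurable_compose_tube:
  fixes xs :: "real \<Rightarrow> 'a::euclidean_space" and U1 :: "'b::euclidean_space set"
    and g :: "real \<Rightarrow> 'a \<Rightarrow> 'b \<Rightarrow> 'c::metric_space"
  assumes uc: "unif_cont_compactified (tube xs \<gamma> U1) g"
    and x: "x \<in> borel_measurable leb_half" and u: "u \<in> borel_measurable leb_half"
    and tube: "\<And>t. t \<ge> 0 \<Longrightarrow> norm (x t - xs t) \<le> \<gamma>" "\<And>t. t \<ge> 0 \<Longrightarrow> u t \<in> U1"
  shows "(\<lambda>t. g t (x t) (u t)) \<in> borel_measurable leb_half"
proof -
  let ?S = "(\<lambda>(t, x, u). (arctan t, x, u)) ` tube xs \<gamma> U1"
  have "continuous_on ?S (\<lambda>(\<tau>, x, u). g (tan \<tau>) x u)"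
    using uc unfolding unif_cont_compactified_def by (rule uniformly_continuous_imp_continuous)
  then have G: "(\<lambda>(\<tau>, x, u). g (tan \<tau>) x u) \<in> borel_measurable (restrict_space borel ?S)"
    by (rule borel_measurable_continuous_on_restrict)
  have "(\<lambda>t::real. arctan t) \<in> borel_measurable leb_half"
    by (intro continuous_on_measurable_half continuous_intros)
  then have "(\<lambda>t. (arctan t, x t, u t)) \<in> borel_measurable leb_half"
    using x u by (intro borel_measurable_Pair)
  then have "(\<lambda>t. (arctan t, x t, u t)) \<in> measurable leb_half (restrict_space borel ?S)"
    by (rule measurable_restrict_space2[rotated])
      (intro funcsetI in_compactified_tube tube; simp only: space_lebesgue_on atLeast_iff)
  from measurable_compose[OF this G]
  show ?thesis by (simp only: prod.case tan_arctan)
qed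

text \<open>The uniformly continuous function extends to the closure of its domain, which contains
  the limit point over \<open>t = \<infinity>\<close>, that is
  \<open>arctan t = pi/2\<close>.\<close>

lemma compactified_limit_exists:
  fixes g :: "real \<Rightarrow> 'a::real_normed_vector \<Rightarrow> 'b::metric_space \<Rightarrow> 'c::complete_space"
  assumes uc: "unif_cont_compactified (tube xs \<gamma> U1) g" and u: "u \<in> U1"
    and x: "(x \<longlongrightarrow> l) at_top" and tube: "\<And>t. t \<ge> 0 \<Longrightarrow> norm (x t - xs t) \<le> \<gamma>"
  obtains z where "((\<lambda>t. g t (x t) u) \<longlongrightarrow> z) at_top"
proof -
  let ?S = "(\<lambda>(t, x, u). (arctan t, x, u)) ` tube xs \<gamma> U1"
  obtain G where G: "uniformly_continuous_on (closure ?S) G" "\<And>z. z \<in> ?S \<Longrightarrow> (\<lambda>(\<tau>, x, u). g (tan \<tau>) x u) z = G z"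
    by (rule uniformly_continuous_on_extension_on_closure[OF uc[unfolded unif_cont_compactified_def]]) (rule that)
  have lim: "((\<lambda>t. (arctan t, x t, u)) \<longlongrightarrow> (pi/2, l, u)) at_top"
    by (intro tendsto_Pair tendsto_arctan_at_top x tendsto_const)
  have ev: "\<forall>\<^sub>F t in at_top. (arctan t, x t, u) \<in> ?S"
    using eventually_ge_at_top[of 0] by eventually_elim (intro in_compactified_tube tube u)
  then have evc: "\<forall>\<^sub>F t in at_top. (arctan t, x t, u) \<in> closure ?S"
    by eventually_elim (rule subsetD[OF closure_subset])
  have cl: "(pi/2, l, u) \<in> closure ?S"
    by (rule Lim_in_closed_set[OF closed_closure evc _ lim]) simp
  have "((\<lambda>t. G (arctan t, x t, u)) \<longlongrightarrow> G (pi/2, l, u)) at_top"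
    by (rule continuous_on_tendsto_compose[OF uniformly_continuous_imp_continuous[OF G(1)] lim cl evc])
  then have "((\<lambda>t. g t (x t) u) \<longlongrightarrow> G (pi/2, l, u)) at_top"
  proof (rule Lim_transform_eventually)
    show "\<forall>\<^sub>F t in at_top. G (arctan t, x t, u) = g t (x t) u"
      using ev by eventually_elim (simp only: G(2)[symmetric] prod.case tan_arctan)
  qed
  then show ?thesis by (rule that)
qed

text \<open>The bounds come from uniform continuity on a bounded domain, the Lipschitz estimate from
  the mean value theorem. For the last clause the mean value theorem is applied to \<open>g\<close>
  minus its linear part at \<open>xs t\<close>, whose derivative is small by uniform continuity of
  \<open>D\<close>; hence \<open>\<rho>\<close> depends neither on \<open>t\<close> nor on
  \<open>u\<close>.\<close>

lemma unif_C1_in_x_estimates: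
  fixes xs :: "real \<Rightarrow> 'a::euclidean_space" and U1 :: "'b::euclidean_space set"
    and g :: "real \<Rightarrow> 'a \<Rightarrow> 'b \<Rightarrow> 'c::euclidean_space"
  assumes C1: "unif_C1_in_x (tube xs \<gamma> U1) g" and \<gamma>: "\<gamma> > 0"
    and bdd: "bounded (xs ` {0..})" "bounded U1"
  obtains D K where
    "unif_cont_compactified (tube xs \<gamma> U1) g" "unif_cont_compactified (tube xs \<gamma> U1) D" "K > 0"
    "\<And>t x u. \<lbrakk>0 \<le> t; norm (x - xs t) \<le> \<gamma>; u \<in> U1\<rbrakk> \<Longrightarrow>
       ((\<lambda>y. g t y u) has_derivative blinfun_apply (D t x u)) (at x)"
    "\<And>t x u. \<lbrakk>0 \<le> t; norm (x - xs t) \<le> \<gamma>; u \<in> U1\<rbrakk> \<Longrightarrow> norm (g t x u) \<le> K"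
    "\<And>t x u. \<lbrakk>0 \<le> t; norm (x - xs t) \<le> \<gamma>; u \<in> U1\<rbrakk> \<Longrightarrow> norm (D t x u) \<le> K"
    "\<And>t x y u. \<lbrakk>0 \<le> t; norm (x - xs t) \<le> \<gamma>; norm (y - xs t) \<le> \<gamma>; u \<in> U1\<rbrakk> \<Longrightarrow>
       norm (g t x u - g t y u) \<le> K * norm (x - y)"
    "\<And>e. e > 0 \<Longrightarrow> \<exists>\<rho>>0. \<rho> \<le> \<gamma> \<and> (\<forall>t\<ge>0. \<forall>u\<in>U1. \<forall>x. norm (x - xs t) \<le> \<rho> \<longrightarrow>
       norm (g t x u - g t (xs t) u - D t (xs t) u (x - xs t)) \<le> e * norm (x - xs t))"
proof -
  obtain D :: "real \<Rightarrow> 'a \<Rightarrow> 'b \<Rightarrow> ('a \<Rightarrow>\<^sub>L 'c)" where uc: "unif_cont_compactified (tube xs \<gamma> U1) g"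
    and der0: "\<forall>(t, x, u)\<in>tube xs \<gamma> U1. ((\<lambda>y. g t y u) has_derivative blinfun_apply (D t x u)) (at x)"
    and ucD: "unif_cont_compactified (tube xs \<gamma> U1) D"
    using C1 unfolding unif_C1_in_x_def by blast
  have der: "((\<lambda>y. g t y u) has_derivative blinfun_apply (D t x u)) (at x)"
    if "0 \<le> t" "norm (x - xs t) \<le> \<gamma>" "u \<in> U1" for t x u
    using der0 that by (auto simp: tube_def)
  obtain M1 where M1: "M1 > 0" "\<And>t x u. \<lbrakk>0 \<le> t; norm (x - xs t) \<le> \<gamma>; u \<in> U1\<rbrakk> \<Longrightarrow> norm (g t x u) \<le> M1"
    using unif_cont_compactified_bounded[OF uc bdd] by blast
  obtain M2 where M2: "M2 > 0" "\<And>t x u. \<lbrakk>0 \<le> t; norm (x - xs t) \<le> \<gamma>; u \<in> U1\<rbrakk> \<Longrightarrow> norm (D t x u) \<le> M2"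
    using unif_cont_compactified_bounded[OF ucD bdd] by blast
  have lip: "norm (g t x u - g t y u) \<le> M2 * norm (x - y)"
    if "0 \<le> t" "norm (x - xs t) \<le> \<gamma>" "norm (y - xs t) \<le> \<gamma>" "u \<in> U1" for t x y u
  proof (rule differentiable_bound[of "cball (xs t) \<gamma>" "\<lambda>y. g t y u" "\<lambda>y. blinfun_apply (D t y u)"])
    fix z assume "z \<in> cball (xs t) \<gamma>"
    then have z: "norm (z - xs t) \<le> \<gamma>" by (simp add: dist_norm norm_minus_commute)
    show "((\<lambda>y. g t y u) has_derivative blinfun_apply (D t z u)) (at z within cball (xs t) \<gamma>)"
      using der[OF that(1) z that(4)] by (rule has_derivative_at_withinI)
    show "onorm (blinfun_apply (D t z u)) \<le> M2"
      using M2(2)[OF that(1) z that(4)] by (simp add: norm_blinfun.rep_eq)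
  qed (use that in \<open>auto simp: dist_norm norm_minus_commute\<close>)
  show ?thesis
  proof (rule that[of D "max M1 M2", OF uc ucD _ der])
    fix t x y u assume t: "0 \<le> t" "norm (x - xs t) \<le> \<gamma>" "u \<in> U1"
    show "norm (g t x u) \<le> max M1 M2" using M1(2)[OF t] by simp
    show "norm (D t x u) \<le> max M1 M2" using M2(2)[OF t] by simp
    assume y: "norm (y - xs t) \<le> \<gamma>"
    have "norm (g t x u - g t y u) \<le> M2 * norm (x - y)" by (rule lip[OF t(1,2) y t(3)])
    also have "\<dots> \<le> max M1 M2 * norm (x - y)" by (intro mult_right_mono) auto
    finally show "norm (g t x u - g t y u) \<le> max M1 M2 * norm (x - y)" .
  next
    fix e :: real assume e: "e > 0"
    obtain d where d: "d > 0" "\<And>t x y u v. \<lbrakk>0 \<le> t; norm (x - xs t) \<le> \<gamma>; norm (y - xs t) \<le> \<gamma>; u \<in> U1; v \<in> U1;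
     dist x y < d; dist u v < d\<rbrakk> \<Longrightarrow> dist (D t x u) (D t y v) < e"
      using unif_cont_compactified_D[OF ucD e] by blast
    show "\<exists>\<rho>>0. \<rho> \<le> \<gamma> \<and> (\<forall>t\<ge>0. \<forall>u\<in>U1. \<forall>x. norm (x - xs t) \<le> \<rho> \<longrightarrow>
       norm (g t x u - g t (xs t) u - D t (xs t) u (x - xs t)) \<le> e * norm (x - xs t))"
    proof (intro exI[of _ "min \<gamma> (d/2)"] conjI allI impI ballI)
      fix t u x assume t: "0 \<le> t" "u \<in> U1" "norm (x - xs t) \<le> min \<gamma> (d/2)"
      let ?h = "\<lambda>y. g t y u - D t (xs t) u y"
      have "norm (?h x - ?h (xs t)) \<le> e * norm (x - xs t)"
      proof (rule differentiable_bound[of "cball (xs t) (min \<gamma> (d/2))" ?h "\<lambda>y. blinfun_apply (D t y u - D t (xs t) u)"])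
        fix z assume "z \<in> cball (xs t) (min \<gamma> (d/2))"
        then have z: "norm (z - xs t) \<le> \<gamma>" "dist z (xs t) < d"
          using d(1) by (auto simp: dist_norm norm_minus_commute)
        have "(?h has_derivative (\<lambda>v. D t z u v - D t (xs t) u v)) (at z)"
          by (intro has_derivative_diff der t z bounded_linear_imp_has_derivative blinfun.bounded_linear_right)
        then show "(?h has_derivative blinfun_apply (D t z u - D t (xs t) u)) (at z within cball (xs t) (min \<gamma> (d/2)))"
          by (rule has_derivative_at_withinI[OF has_derivative_eq_rhs]) (auto simp: blinfun.diff_left)
        have "dist (D t z u) (D t (xs t) u) < e"
          using t z \<gamma> d(1) by (intro d(2)) auto
        then show "onorm (blinfun_apply (D t z u - D t (xs t) u)) \<le> e"
          by (simp add: norm_blinfun.rep_eq[symmetric] dist_norm)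
      qed (use t \<gamma> d in \<open>auto simp: dist_norm norm_minus_commute\<close>)
      moreover have "?h x - ?h (xs t) = g t x u - g t (xs t) u - D t (xs t) u (x - xs t)"
        by (simp add: blinfun.diff_right)
      ultimately show "norm (g t x u - g t (xs t) u - D t (xs t) u (x - xs t)) \<le> e * norm (x - xs t)" by simp
    qed (use \<gamma> d in auto)
  qed (use M1 in auto)
qed

section \<open>Jacobian matrices and gradients\<close>

lemma jacobian_mult_eq:
  fixes g :: "real^'n \<Rightarrow> real^'m"
  assumes "(g has_derivative g') (at x)"
  shows "jacobian g (at x) *v v = g' v"
proof -
  have "(g has_derivative (\<lambda>v. jacobian g (at x) *v v)) (at x)"
    using assms jacobian_works differentiableI by blast
  from has_derivative_unique[OF this assms] show ?thesis by (rule fun_cong)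
qed

lemma gradient_inner_eq:
  fixes g :: "real^'n \<Rightarrow> real"
  assumes "(g has_derivative g') (at x)"
  shows "gradient g x \<bullet> v = g' v"
proof -
  have eq: "frechet_derivative g (at x) = g'" using frechet_derivative_at[OF assms] by simp
  have lin: "linear g'" by (rule has_derivative_linear[OF assms])
  have "g' v = g' (\<Sum>i\<in>UNIV. (v $ i) *s axis i 1)" by (simp add: basis_expansion)
  also have "\<dots> = (\<Sum>i\<in>UNIV. v $ i * g' (axis i 1))"
    by (simp add: linear_sum[OF lin] linear_cmul[OF lin] scalar_mult_eq_scaleR)
  also have "\<dots> = gradient g x \<bullet> v"
    by (simp add: inner_vec_def gradient_def eq mult.commute)
  finally show ?thesis by simp
qed

lemma inner_transpose_mult:
  fixes A :: "real^'n^'m"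
  shows "(transpose A *v p) \<bullet> v = p \<bullet> (A *v v)"
  by (metis dot_lmul_matrix inner_commute transpose_matrix_vector)

lemma ident_measurable_half [measurable]: "(\<lambda>t::real. t) \<in> borel_measurable leb_half"
  by (intro continuous_on_measurable_half continuous_on_id)

section \<open>Perturbed trajectories\<close>

text \<open>The dynamics near \<open>xs\<close> for controls with values in \<open>U1\<close>. The
  curves in \<open>tail0\<close> are integrals of densities bounded by \<open>K\<close> because the
  Picard iterates have this form. The constant there cancels the possible growth of the weight after
  \<open>T\<close> and leaves 1/4, to be added to the 1/2 contributed by the linear growth.\<close>

locale controlled_system =
  fixes \<phi> :: "real \<Rightarrow> 'a::euclidean_space \<Rightarrow> 'b::euclidean_space \<Rightarrow> 'a"
    and xs :: "real \<Rightarrow> 'a" and us :: "real \<Rightarrow> 'b" and U1 :: "'b set"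
    and \<gamma> K T :: real and A :: "real \<Rightarrow> 'a \<Rightarrow>\<^sub>L 'a"
  assumes pos: "\<gamma> > 0" "K > 0" "T \<ge> 0"
    and phi_uc: "unif_cont_compactified (tube xs \<gamma> U1) \<phi>"
    and phi_bound: "\<And>t x u. \<lbrakk>0 \<le> t; norm (x - xs t) \<le> \<gamma>; u \<in> U1\<rbrakk> \<Longrightarrow> norm (\<phi> t x u) \<le> K"
    and phi_lip: "\<And>t x y u. \<lbrakk>0 \<le> t; norm (x - xs t) \<le> \<gamma>; norm (y - xs t) \<le> \<gamma>; u \<in> U1\<rbrakk> \<Longrightarrow>
       norm (\<phi> t x u - \<phi> t y u) \<le> K * norm (x - y)"
    and us: "us \<in> borel_measurable leb_half" "\<And>t. t \<ge> 0 \<Longrightarrow> us t \<in> U1"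
    and xs: "\<And>t. t \<ge> 0 \<Longrightarrow> xs t = xs 0 + integral {0..t} (\<lambda>t. \<phi> t (xs t) (us t))"
    and xs_meas: "xs \<in> borel_measurable leb_half"
    and phi_int: "(\<lambda>t. \<phi> t (xs t) (us t)) absolutely_integrable_on {0..}"
    and A_int: "(\<lambda>t. norm (A t)) absolutely_integrable_on {0..}"
    and A_meas: "\<And>z. z \<in> borel_measurable leb_half \<Longrightarrow> (\<lambda>t. A t (z t)) \<in> borel_measurable leb_half"
    and tail0: "\<And>x x' g g' c c' B. \<lbrakk>g \<in> borel_measurable leb_half; g' \<in> borel_measurable leb_half;
       \<And>t. t \<ge> 0 \<Longrightarrow> norm (g t) \<le> K; \<And>t. t \<ge> 0 \<Longrightarrow> norm (g' t) \<le> K;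
       \<And>t. t \<ge> 0 \<Longrightarrow> x t = c + integral {0..t} g; \<And>t. t \<ge> 0 \<Longrightarrow> x' t = c' + integral {0..t} g';
       \<And>t. t \<ge> 0 \<Longrightarrow> norm (x t - xs t) \<le> \<gamma>; \<And>t. t \<ge> 0 \<Longrightarrow> norm (x' t - xs t) \<le> \<gamma>;
       \<And>t. t \<ge> 0 \<Longrightarrow> norm (x t - x' t) \<le> B\<rbrakk> \<Longrightarrow>
       (\<lambda>t. norm (\<phi> t (x t) (us t) - \<phi> t (x' t) (us t) - A t (x t - x' t))) integrable_on {T..} \<and>
       integral {T..} (\<lambda>t. norm (\<phi> t (x t) (us t) - \<phi> t (x' t) (us t) - A t (x t - x' t)))
         \<le> exp (- 2 * integral {0..} (\<lambda>t. norm (A t))) / 4 * B"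
begin

text \<open>Exactly the curves to which \<open>tail0\<close> applies; the limit of the Picard
  iteration is shown to be one of them again.\<close>

definition traj :: "(real \<Rightarrow> 'a) \<Rightarrow> bool" where
  "traj x \<longleftrightarrow> (\<exists>c g. g \<in> borel_measurable leb_half \<and> (\<forall>t\<ge>0. norm (g t) \<le> K) \<and>
     (\<forall>t\<ge>0. x t = c + integral {0..t} g)) \<and> (\<forall>t\<ge>0. norm (x t - xs t) \<le> \<gamma>)"

text \<open>Variations stay within \<open>{0..T}\<close>, since the tail condition speaks about
  \<open>us\<close> only.\<close>

definition ctrl :: "(real \<Rightarrow> 'b) \<Rightarrow> bool" where
  "ctrl u \<longleftrightarrow> u \<in> borel_measurable leb_half \<and> (\<forall>t\<ge>0. u t \<in> U1) \<and> (\<forall>t>T. u t = us t)"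

definition sol :: "'a \<Rightarrow> (real \<Rightarrow> 'b) \<Rightarrow> (real \<Rightarrow> 'a) \<Rightarrow> bool" where
  "sol y u x \<longleftrightarrow> traj x \<and> ctrl u \<and> (\<forall>t\<ge>0. x t = xs 0 + y + integral {0..t} (\<lambda>t. \<phi> t (x t) (u t)))"

definition rem :: "(real \<Rightarrow> 'a) \<Rightarrow> (real \<Rightarrow> 'a) \<Rightarrow> real \<Rightarrow> real" where
  "rem x x' t = norm (\<phi> t (x t) (us t) - \<phi> t (x' t) (us t) - A t (x t - x' t))"

text \<open>Relative to \<open>wt\<close> the Picard map is a contraction: \<open>growth\<close> is the Lipschitz
  constant \<open>K\<close> up to \<open>T\<close> and \<open>\<parallel>A t\<parallel>\<close> afterwards, and the nonlinear remainder on \<open>[T,\<infinity>)\<close> is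
  absorbed by the constant in \<open>tail0\<close>. The weight is bounded since \<open>A\<close> is integrable.\<close>

definition growth :: "real \<Rightarrow> real" where
  "growth t = (if t \<le> T then K else norm (A t))"

definition wt :: "real \<Rightarrow> real" where
  "wt t = exp (2 * integral {0..t} growth)"

definition wmax :: real where
  "wmax = exp (2 * K * T + 2 * integral {0..} (\<lambda>t. norm (A t)))"

lemma traj_close: "traj x \<Longrightarrow> t \<ge> 0 \<Longrightarrow> norm (x t - xs t) \<le> \<gamma>"
  by (simp add: traj_def)

lemma traj_continuous: "traj x \<Longrightarrow> continuous_on {0..} x"
  unfolding traj_def
  by (elim conjE exE) (rule continuous_on_integral, rule bounded_measurable_absolutely_integrable, auto)

lemma traj_measurable: "traj x \<Longrightarrow> x \<in> borel_measurable leb_half"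
  by (rule continuous_on_measurable_half[OF traj_continuous])

lemma phi_measurable:
  assumes "x \<in> borel_measurable leb_half" "\<And>t. t \<ge> 0 \<Longrightarrow> norm (x t - xs t) \<le> \<gamma>"
    "u \<in> borel_measurable leb_half" "\<And>t. t \<ge> 0 \<Longrightarrow> u t \<in> U1"
  shows "(\<lambda>t. \<phi> t (x t) (u t)) \<in> borel_measurable leb_half"
  using phi_uc assms(1,3,2,4) by (rule measurable_compose_tube)

lemma phi_traj:
  assumes "traj x" "ctrl u"
  shows "(\<lambda>t. \<phi> t (x t) (u t)) \<in> borel_measurable leb_half"
    and "\<And>t. t \<ge> 0 \<Longrightarrow> norm (\<phi> t (x t) (u t)) \<le> K"
    and "(\<lambda>t. \<phi> t (x t) (u t)) absolutely_integrable_on {0..R}"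
proof -
  show 1: "(\<lambda>t. \<phi> t (x t) (u t)) \<in> borel_measurable leb_half"
    using assms by (intro phi_measurable traj_measurable) (auto simp: traj_def ctrl_def)
  show 2: "norm (\<phi> t (x t) (u t)) \<le> K" if "t \<ge> 0" for t
    using that assms by (intro phi_bound) (auto simp: traj_def ctrl_def)
  show "(\<lambda>t. \<phi> t (x t) (u t)) absolutely_integrable_on {0..R}"
    using 1 2 by (rule bounded_measurable_absolutely_integrable)
qed

lemma phi_traj_integrable:
  "traj x \<Longrightarrow> ctrl u \<Longrightarrow> (\<lambda>t. \<phi> t (x t) (u t)) integrable_on {0..R}"
  using phi_traj(3) by (auto simp: absolutely_integrable_on_def)

lemma ctrl_us: "ctrl us" using us by (simp add: ctrl_def)

lemma traj_xs: "traj xs"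
proof -
  have "(\<lambda>t. \<phi> t (xs t) (us t)) \<in> borel_measurable leb_half" "\<forall>t\<ge>0. norm (\<phi> t (xs t) (us t)) \<le> K"
    using pos us by (auto intro!: phi_measurable phi_bound xs_meas)
  then show ?thesis
    unfolding traj_def using pos
    by (intro conjI exI[of _ "xs 0"] exI[of _ "\<lambda>t. \<phi> t (xs t) (us t)"] allI impI xs) simp_all
qed

lemma growth_int: "growth absolutely_integrable_on {0..R}"
proof -
  have "(\<lambda>t. norm (A t)) \<in> borel_measurable leb_half"
    by (rule absolutely_integrable_imp_borel_measurable[OF A_int]) simp
  then have "growth \<in> borel_measurable leb_half"
    unfolding growth_def[abs_def] by measurable
  then have m: "growth \<in> borel_measurable (lebesgue_on {0..R})" by (rule measurable_half_subinterval) simp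
  show ?thesis
  proof (rule measurable_bounded_by_integrable_imp_absolutely_integrable[OF m])
    show "(\<lambda>t. K + norm (A t)) integrable_on {0..R}"
      using absolutely_integrable_on_subinterval[OF A_int, of 0 R]
      by (intro integrable_add) (auto simp: absolutely_integrable_on_def)
  qed (use pos in \<open>auto simp: growth_def\<close>)
qed

lemma growth_nonneg: "0 \<le> growth t" using pos by (simp add: growth_def)

lemma growth_integrable: "growth integrable_on {0..R}"
  using growth_int by (auto simp: absolutely_integrable_on_def)

lemma A_int_interval: "(\<lambda>t. norm (A t)) integrable_on {s..R}" if "s \<ge> 0" for s R
  using absolutely_integrable_on_subinterval[OF A_int, of s R] that by (auto simp: absolutely_integrable_on_def)

lemma A_int_le: "integral {s..R} (\<lambda>t. norm (A t)) \<le> integral {0..} (\<lambda>t. norm (A t))" if "s \<ge> 0" for s R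
  using A_int_interval[OF that, of R] A_int that
  by (intro integral_subset_le) (auto simp: absolutely_integrable_on_def)

lemma wt_ge1: "t \<ge> 0 \<Longrightarrow> 1 \<le> wt t"
  unfolding wt_def using integral_nonneg[OF growth_integrable, of t] growth_nonneg by simp

lemma wt_step:
  assumes "0 \<le> s" "s \<le> t"
  shows "wt t = wt s * exp (2 * integral {s..t} growth)"
  using Henstock_Kurzweil_Integration.integral_combine[OF assms growth_integrable]
  by (simp add: wt_def exp_add[symmetric] algebra_simps)

lemma wt_mono: "0 \<le> s \<Longrightarrow> s \<le> t \<Longrightarrow> wt s \<le> wt t"
proof -
  assume st: "0 \<le> s" "s \<le> t"
  have "growth integrable_on {s..t}"
    by (rule integrable_on_subinterval[OF growth_integrable[of t]]) (use st in auto)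
  then have "0 \<le> integral {s..t} growth" using growth_nonneg by (simp add: integral_nonneg)
  then have "wt s * 1 \<le> wt s * exp (2 * integral {s..t} growth)"
    by (intro mult_left_mono) (auto simp: wt_def)
  then show ?thesis using wt_step[OF st] by simp
qed

lemma growth_int_tail:
  assumes "T \<le> s" "s \<le> t"
  shows "integral {s..t} growth \<le> integral {0..} (\<lambda>t. norm (A t))"
proof -
  have "integral {s..t} growth = integral {s..t} (\<lambda>t. norm (A t))"
    by (rule integral_spike[of "{T}"]) (use assms in \<open>auto simp: growth_def\<close>)
  then show ?thesis using A_int_le[of s t] assms pos by simp
qed

lemma wt_tail: "T \<le> s \<Longrightarrow> wt s \<le> exp (2 * integral {0..} (\<lambda>t. norm (A t))) * wt T"
  using growth_int_tail[of T s] wt_step[OF pos(3), of s] by (simp add: wt_def mult.commute)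

lemma wt_le_wmax:
  assumes t: "t \<ge> 0" shows "wt t \<le> wmax"
proof -
  have T: "integral {0..T} growth = K * T"
  proof -
    have "integral {0..T} growth = integral {0..T} (\<lambda>_. K)"
      by (rule integral_cong) (auto simp: growth_def)
    then show ?thesis using pos by simp
  qed
  have "wt (max t T) \<le> exp (2 * integral {0..} (\<lambda>t. norm (A t))) * wt T"
    by (rule wt_tail) simp
  also have "\<dots> = wmax" by (simp add: wmax_def wt_def T exp_add[symmetric] algebra_simps)
  finally show ?thesis using wt_mono[of t "max t T"] t by simp
qed

lemma wt_integral:
  assumes "t \<ge> 0"
  shows "((\<lambda>s. growth s * wt s) has_integral (wt t - 1) / 2) {0..t}"
proof -
  have "((\<lambda>s. 2 * growth s * wt s) has_integral wt t - wt 0) {0..t}"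
    unfolding wt_def using exp_integral_has_integral[OF _ assms growth_int, where k=2] by simp
  from has_integral_mult_right[OF this, of "1/2"]
  show ?thesis by (simp add: wt_def mult_ac)
qed

lemma rem_measurable:
  assumes "traj x" "traj x'"
  shows "rem x x' \<in> borel_measurable leb_half"
  unfolding rem_def[abs_def]
  using phi_traj(1)[OF assms(1) ctrl_us] phi_traj(1)[OF assms(2) ctrl_us] A_meas[of "\<lambda>t. x t - x' t"]
    traj_measurable[OF assms(1)] traj_measurable[OF assms(2)] by measurable

text \<open>Freezing the difference to \<open>xs\<close> on \<open>[0,T]\<close> makes only the values on \<open>[T,\<infinity>)\<close> count in the
  supremum norm of the tail condition. This matters since \<open>T\<close> depends on \<open>\<delta>\<close>.\<close>

lemma traj_freeze:
  assumes x: "traj x"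
  defines "z \<equiv> \<lambda>t. if t \<le> T then xs t + (x T - xs T) else x t"
  shows "traj z"
proof -
  obtain c g where g: "g \<in> borel_measurable leb_half" "\<forall>t\<ge>0. norm (g t) \<le> K"
    "\<forall>t\<ge>0. x t = c + integral {0..t} g" using x unfolding traj_def by blast
  let ?f = "\<lambda>t. \<phi> t (xs t) (us t)"
  let ?h = "\<lambda>t. if t \<le> T then ?f t else g t"
  note f = phi_traj[OF traj_xs ctrl_us]
  have hm: "?h \<in> borel_measurable leb_half" using g(1) f(1) by measurable
  have hb: "norm (?h t) \<le> K" if "t \<ge> 0" for t using g(2) f(2)[OF that] that by simp
  have gi: "g integrable_on {0..R}" and hi: "?h integrable_on {0..R}" for R
    using bounded_measurable_absolutely_integrable[OF g(1), of K R] g(2)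
      bounded_measurable_absolutely_integrable[OF hm hb, of R]
    by (auto simp: absolutely_integrable_on_def)
  have h1: "integral {0..t} ?h = integral {0..t} ?f" if "t \<le> T" for t
    by (rule integral_cong) (use that in auto)
  have "z t = xs 0 + (x T - xs T) + integral {0..t} ?h" if t: "t \<ge> 0" for t
  proof (cases "t \<le> T")
    case True
    then show ?thesis using xs[OF t] by (simp add: z_def h1)
  next
    case False
    then have Tt: "T \<le> t" by simp
    have "integral {T..t} ?h = integral {T..t} g"
      by (rule integral_spike[of "{T}"]) auto
    then have "integral {0..t} ?h = integral {0..T} ?f + integral {T..t} g"
      using Henstock_Kurzweil_Integration.integral_combine[OF pos(3) Tt hi] h1[of T] by simp
    moreover have "x t = x T + integral {T..t} g"
      using Henstock_Kurzweil_Integration.integral_combine[OF pos(3) Tt gi] g(3) t pos(3) by (auto simp: algebra_simps)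
    ultimately show ?thesis using xs[OF pos(3)] False by (simp add: z_def)
  qed
  moreover have "norm (z t - xs t) \<le> \<gamma>" if "t \<ge> 0" for t
    using traj_close[OF x that] traj_close[OF x pos(3)] by (simp add: z_def)
  ultimately show ?thesis unfolding traj_def using hm hb by blast
qed

lemma tail:
  assumes x: "traj x" and x': "traj x'" and B: "\<And>t. t \<ge> T \<Longrightarrow> norm (x t - x' t) \<le> B"
  shows "rem x x' integrable_on {T..}"
    and "integral {T..} (rem x x') \<le> exp (- 2 * integral {0..} (\<lambda>t. norm (A t))) / 4 * B"
proof -
  let ?z = "\<lambda>t. if t \<le> T then xs t + (x T - xs T) else x t"
  let ?z' = "\<lambda>t. if t \<le> T then xs t + (x' T - xs T) else x' t"
  obtain c g where g: "g \<in> borel_measurable leb_half" "\<forall>t\<ge>0. norm (g t) \<le> K"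
    "\<forall>t\<ge>0. ?z t = c + integral {0..t} g" "\<forall>t\<ge>0. norm (?z t - xs t) \<le> \<gamma>"
    using traj_freeze[OF x] unfolding traj_def by blast
  obtain c' g' where g': "g' \<in> borel_measurable leb_half" "\<forall>t\<ge>0. norm (g' t) \<le> K"
    "\<forall>t\<ge>0. ?z' t = c' + integral {0..t} g'" "\<forall>t\<ge>0. norm (?z' t - xs t) \<le> \<gamma>"
    using traj_freeze[OF x'] unfolding traj_def by blast
  have "norm (?z t - ?z' t) \<le> B" if "t \<ge> 0" for t
    using B[of t] B[of T] by auto
  then have *: "rem ?z ?z' integrable_on {T..} \<and>
    integral {T..} (rem ?z ?z') \<le> exp (- 2 * integral {0..} (\<lambda>t. norm (A t))) / 4 * B"
    unfolding rem_def[abs_def]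
    using g g' by (intro tail0[of g g' ?z c ?z' c' B]) blast+
  have eq: "rem x x' t = rem ?z ?z' t" if "t \<in> {T..}" for t
    using that by (cases "t = T") (auto simp: rem_def)
  show "rem x x' integrable_on {T..}"
    using * eq by (metis (no_types, lifting) integrable_cong)
  show "integral {T..} (rem x x') \<le> exp (- 2 * integral {0..} (\<lambda>t. norm (A t))) / 4 * B"
    using * integral_cong[of "{T..}" "rem x x'" "rem ?z ?z'"] eq by simp
qed

text \<open>Integrating \<open>growth * wt\<close> gives half the increment of \<open>wt\<close>,
  and the nonlinear remainder after \<open>T\<close> adds at most a quarter of \<open>wt\<close>;
  together the factor is 3/4.\<close>

lemma contraction:
  assumes x: "traj x" and x': "traj x'" and u: "ctrl u" and B: "B \<ge> 0"
    and le: "\<And>t. t \<ge> 0 \<Longrightarrow> norm (x t - x' t) \<le> B * wt t" and t: "t \<ge> 0"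
  shows "norm (integral {0..t} (\<lambda>t. \<phi> t (x t) (u t)) - integral {0..t} (\<lambda>t. \<phi> t (x' t) (u t))) \<le> 3/4 * B * wt t"
proof -
  let ?f = "\<lambda>t. \<phi> t (x t) (u t) - \<phi> t (x' t) (u t)"
  let ?r = "\<lambda>s. if s \<le> T then 0 else rem x x' s"
  let ?E = "exp (2 * integral {0..} (\<lambda>t. norm (A t)))"
  \<comment> \<open>After \<open>T\<close> the weight exceeds \<open>wt T\<close> at most by the
    factor \<open>?E\<close>, so the weighted bound becomes a uniform one; \<open>?E\<close> then
    cancels against the constant of \<open>tail0\<close>.\<close>
  have BT: "norm (x s - x' s) \<le> B * (?E * wt T)" if "s \<ge> T" for s
    using le[of s] mult_left_mono[OF wt_tail[OF that] B] that pos by linarith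
  note tl = tail[OF x x' BT]
  have ri: "?r integrable_on {0..t}" and r_le: "integral {0..t} ?r \<le> B * wt t / 4"
  proof -
    have "?r integrable_on {0..t} \<and> integral {0..t} ?r \<le> B * wt t / 4"
    proof (cases "t \<le> T")
      case True
      then have "(?r has_integral 0) {0..t}" by (intro has_integral_is_0) auto
      then show ?thesis using B wt_ge1[OF t] by (auto simp: integral_unique has_integral_integrable)
    next
      case False
      have 1: "(?r has_integral 0) {0..T}" by (intro has_integral_is_0) auto
      have "rem x x' integrable_on {T..t}" by (rule integrable_on_subinterval[OF tl(1)]) auto
      then have 2: "(?r has_integral integral {T..t} (rem x x')) {T..t}"
        by (intro has_integral_spike[OF negligible_sing[of T] _ integrable_integral]) auto
      have 3: "(?r has_integral 0 + integral {T..t} (rem x x')) {0..t}"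
        by (rule has_integral_combine[OF pos(3) _ 1 2]) (use False in simp)
      have "integral {T..t} (rem x x') \<le> integral {T..} (rem x x')"
        by (intro integral_subset_le tl integrable_on_subinterval[OF tl(1)]) (auto simp: rem_def)
      also have "\<dots> \<le> exp (- 2 * integral {0..} (\<lambda>t. norm (A t))) / 4 * (B * (?E * wt T))" by (rule tl(2))
      also have "\<dots> = B * wt T / 4" by (simp add: exp_minus field_simps)
      also have "\<dots> \<le> B * wt t / 4" using B wt_mono[OF pos(3), of t] False by (simp add: mult_left_mono)
      finally show ?thesis using 3 by (auto simp: integral_unique has_integral_integrable)
    qed
    then show "?r integrable_on {0..t}" "integral {0..t} ?r \<le> B * wt t / 4" by auto
  qed
  note xi = phi_traj_integrable[OF x u, of t] phi_traj_integrable[OF x' u, of t]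
  have wi: "(\<lambda>s. B * (growth s * wt s)) integrable_on {0..t}"
    using wt_integral[OF t] by (intro integrable_on_mult_right) (auto simp: has_integral_integrable)
  have "norm (integral {0..t} ?f) \<le> integral {0..t} (\<lambda>s. B * (growth s * wt s) + ?r s)"
  proof (rule integral_norm_bound_integral)
    show "?f integrable_on {0..t}" by (intro integrable_diff xi)
    show "(\<lambda>s. B * (growth s * wt s) + ?r s) integrable_on {0..t}" by (intro integrable_add wi ri)
    fix s assume "s \<in> {0..t}"
    then have s: "s \<ge> 0" by simp
    show "norm (?f s) \<le> B * (growth s * wt s) + ?r s"
    proof (cases "s \<le> T")
      case True
      have "norm (?f s) \<le> K * norm (x s - x' s)"
        using u s traj_close[OF x s] traj_close[OF x' s] by (intro phi_lip) (auto simp: ctrl_def)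
      also have "\<dots> \<le> K * (B * wt s)" using le[OF s] pos by (intro mult_left_mono) auto
      finally show ?thesis using True by (simp add: growth_def mult_ac)
    next
      case False
      then have "u s = us s" using u by (simp add: ctrl_def)
      then have "norm (?f s) \<le> rem x x' s + norm (A s (x s - x' s))"
        unfolding rem_def using norm_triangle_sub[of "?f s" "A s (x s - x' s)"] by simp
      also have "norm (A s (x s - x' s)) \<le> norm (A s) * (B * wt s)"
        using norm_blinfun[of "A s" "x s - x' s"] le[OF s] mult_left_mono[OF le[OF s] norm_ge_zero[of "A s"]] by linarith
      finally show ?thesis using False by (simp add: growth_def mult_ac)
    qed
  qed
  also have "\<dots> = B * ((wt t - 1) / 2) + integral {0..t} ?r"
    using wt_integral[OF t] by (simp add: integral_add[OF wi ri] integral_unique)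
  also have "\<dots> \<le> B * (wt t / 2) + B * wt t / 4"
    using B by (intro add_mono r_le mult_left_mono) auto
  finally show ?thesis by (simp add: integral_diff[OF xi])
qed

text \<open>The number 4 is \<open>1 / (1 - 3/4)\<close>: since
  \<open>3/4 * (4 * d) + d = 4 * d\<close>, the weighted ball of radius \<open>4 * d\<close> is
  mapped into itself, and \<open>small\<close> keeps it inside the tube.\<close>

lemma sol_exists:
  assumes u: "ctrl u" and d: "\<And>t. t \<ge> 0 \<Longrightarrow>
      norm (y + (integral {0..t} (\<lambda>t. \<phi> t (xs t) (u t)) - integral {0..t} (\<lambda>t. \<phi> t (xs t) (us t)))) \<le> d"
    and small: "4 * d * wmax \<le> \<gamma>"
  shows "\<exists>x. sol y u x \<and> (\<forall>t\<ge>0. norm (x t - xs t) \<le> 4 * d * wt t)"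
proof -
  have d0: "d \<ge> 0" using d[of 0] norm_ge_zero order_trans by blast
  define S where "S x t = xs 0 + y + integral {0..t} (\<lambda>t. \<phi> t (x t) (u t))" for x t
  define X where "X = {x. traj x \<and> (\<forall>t\<ge>0. norm (x t - xs t) \<le> 4 * d * wt t)}"
  have d_small: "4 * d * wt t \<le> \<gamma>" if "t \<ge> 0" for t
    using mult_left_mono[OF wt_le_wmax[OF that], of "4 * d"] d0 small by linarith
  have Sxs: "norm (S xs t - xs t) \<le> d" if "t \<ge> 0" for t
    using d[OF that] xs[OF that] by (simp add: S_def algebra_simps)
  have SX: "S x \<in> X" if "x \<in> X" for x
  proof -
    have x: "traj x" "\<And>t. t \<ge> 0 \<Longrightarrow> norm (x t - xs t) \<le> 4 * d * wt t" using that by (auto simp: X_def)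
    have *: "norm (S x t - xs t) \<le> 4 * d * wt t" if t: "t \<ge> 0" for t
    proof -
      have "norm (S x t - S xs t) \<le> 3/4 * (4 * d) * wt t"
        using contraction[OF x(1) traj_xs u _ x(2) t] d0 by (simp add: S_def)
      moreover have "norm (S xs t - xs t) \<le> d * wt t"
        using Sxs[OF t] mult_left_mono[OF wt_ge1[OF t] d0] by simp
      ultimately show ?thesis
        using norm_triangle_ineq[of "S x t - S xs t" "S xs t - xs t"] by simp
    qed
    have "traj (S x)"
      unfolding traj_def
    proof (intro conjI exI[of _ "xs 0 + y"] exI[of _ "\<lambda>t. \<phi> t (x t) (u t)"] allI impI)
      fix t :: real assume t: "0 \<le> t"
      show "norm (S x t - xs t) \<le> \<gamma>" using *[OF t] d_small[OF t] by linarith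
    qed (auto simp: S_def phi_traj[OF x(1) u])
    then show ?thesis using * by (simp add: X_def)
  qed
  have xsX: "xs \<in> X" using traj_xs d0 wt_ge1 by (fastforce simp: X_def)
  have contr: "\<forall>t\<ge>0. norm (S x t - S y t) \<le> 3/4 * B * wt t"
    if "x \<in> X" "y \<in> X" "B \<ge> 0" "\<forall>t\<ge>0. norm (x t - y t) \<le> B * wt t" for x y B
    using contraction[of x y u B] that u by (simp add: S_def X_def)
  have init: "norm (S xs t - xs t) \<le> d * wt t" if "t \<ge> 0" for t
    using Sxs[OF that] mult_left_mono[OF wt_ge1[OF that] d0] by simp
  obtain xseq x C where xseq: "\<And>k. xseq k \<in> X" "\<And>k. xseq (Suc k) = S (xseq k)" "C \<ge> 0"
    "\<And>k t. t \<ge> 0 \<Longrightarrow> norm (xseq k t - x t) \<le> C * (3/4) ^ k * wt t"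
    by (rule picard_weighted[of "3/4" wt xs X S d])
      (use xsX SX init d0 contr in \<open>auto simp: wt_def\<close>)
  have lim: "(\<lambda>k. xseq k t) \<longlonglongrightarrow> x t" if "t \<ge> 0" for t
  proof (rule LIM_zero_cancel, rule tendsto_norm_zero_cancel, rule tendsto_sandwich[OF _ _ tendsto_const])
    show "(\<lambda>k. C * (3/4) ^ k * wt t) \<longlonglongrightarrow> 0"
      by (auto intro!: tendsto_eq_intros LIMSEQ_power_zero)
  qed (use xseq(4)[OF that] in auto)
  have xm: "x \<in> borel_measurable leb_half"
    by (rule borel_measurable_LIMSEQ_metric[of xseq]) (use xseq(1) lim traj_measurable in \<open>auto simp: X_def\<close>)
  have close: "norm (x t - xs t) \<le> 4 * d * wt t" if t: "t \<ge> 0" for t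
  proof (rule LIMSEQ_le_const2)
    show "(\<lambda>k. norm (xseq k t - xs t)) \<longlonglongrightarrow> norm (x t - xs t)" by (intro tendsto_intros lim t)
    show "\<exists>N. \<forall>n\<ge>N. norm (xseq n t - xs t) \<le> 4 * d * wt t" using xseq(1) t by (auto simp: X_def)
  qed
  have close\<gamma>: "norm (x t - xs t) \<le> \<gamma>" if "t \<ge> 0" for t using close[OF that] d_small[OF that] by linarith
  have uU: "u t \<in> U1" if "t \<ge> 0" for t using u that by (simp add: ctrl_def)
  have fm: "(\<lambda>t. \<phi> t (x t) (u t)) \<in> borel_measurable leb_half"
    using u unfolding ctrl_def by (intro phi_measurable xm close\<gamma>) auto
  have eq: "x t = xs 0 + y + integral {0..t} (\<lambda>t. \<phi> t (x t) (u t))" if t: "t \<ge> 0" for t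
  proof (rule LIMSEQ_unique)
    show "(\<lambda>k. xseq (Suc k) t) \<longlonglongrightarrow> x t" by (rule LIMSEQ_Suc[OF lim[OF t]])
    \<comment> \<open>\<open>contraction\<close> cannot be applied to the limit before it is known
      to be a \<open>traj\<close>, for which this equation is required; dominated convergence with
      the constant \<open>K\<close> takes its place.\<close>
    have "(\<lambda>k. integral {0..t} (\<lambda>t. \<phi> t (xseq k t) (u t))) \<longlonglongrightarrow> integral {0..t} (\<lambda>t. \<phi> t (x t) (u t))"
    proof (rule dominated_convergence(2)[where h="\<lambda>_. K"])
      fix k s assume "s \<in> {0..t}"
      then have s: "s \<ge> 0" by simp
      have trk: "traj (xseq k)" for k using xseq(1) by (simp add: X_def)
      show "norm (\<phi> s (xseq k s) (u s)) \<le> K" by (rule phi_traj(2)[OF trk u s])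
      show "(\<lambda>k. \<phi> s (xseq k s) (u s)) \<longlonglongrightarrow> \<phi> s (x s) (u s)"
      proof (rule LIM_zero_cancel, rule tendsto_norm_zero_cancel, rule tendsto_sandwich[OF _ _ tendsto_const])
        have "(\<lambda>k. K * norm (xseq k s - x s)) \<longlonglongrightarrow> K * norm (x s - x s)"
          by (intro tendsto_intros lim s)
        then show "(\<lambda>k. K * norm (xseq k s - x s)) \<longlonglongrightarrow> 0" by simp
        show "\<forall>\<^sub>F k in sequentially. norm (\<phi> s (xseq k s) (u s) - \<phi> s (x s) (u s)) \<le> K * norm (xseq k s - x s)"
          by (intro always_eventually allI phi_lip s traj_close[OF trk] close\<gamma> uU)
      qed auto
    qed (use phi_traj_integrable[OF _ u] xseq(1) in \<open>auto simp: X_def\<close>)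
    then show "(\<lambda>k. xseq (Suc k) t) \<longlonglongrightarrow> xs 0 + y + integral {0..t} (\<lambda>t. \<phi> t (x t) (u t))"
      by (auto simp: xseq(2) S_def intro!: tendsto_intros)
  qed
  have "traj x"
    unfolding traj_def
    by (intro conjI exI[of _ "xs 0 + y"] exI[of _ "\<lambda>t. \<phi> t (x t) (u t)"] allI impI fm eq close\<gamma> phi_bound uU)
  then show ?thesis using u eq close by (auto simp: sol_def)
qed

text \<open>The defect \<open>d\<close> is measured along \<open>x2\<close> only;
  \<open>contraction\<close> turns it into a bound by improving the crude estimate
  \<open>2 * \<gamma>\<close>, available because both curves stay in the tube.\<close>

lemma sol_stable:
  assumes s1: "sol y1 u1 x1" and s2: "sol y2 u2 x2" and d: "\<And>t. t \<ge> 0 \<Longrightarrow>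
      norm (y1 - y2 + (integral {0..t} (\<lambda>t. \<phi> t (x2 t) (u1 t)) - integral {0..t} (\<lambda>t. \<phi> t (x2 t) (u2 t)))) \<le> d"
    and t: "t \<ge> 0"
  shows "norm (x1 t - x2 t) \<le> 4 * d * wt t"
proof -
  have tr: "traj x1" "traj x2" and u: "ctrl u1" using s1 s2 by (auto simp: sol_def)
  have d0: "d \<ge> 0" using d[of 0] norm_ge_zero order_trans by blast
  have "norm (x1 t - x2 t) \<le> d / (1 - 3/4) * wt t"
  proof (rule weighted_bound_improve[of "3/4" d "2 * \<gamma>" "\<lambda>t. norm (x1 t - x2 t)" wt t])
    show "\<forall>t\<ge>0. norm (x1 t - x2 t) \<le> 2 * \<gamma> * wt t"
    proof (intro allI impI)
      fix t :: real assume t: "t \<ge> 0"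
      have "norm (x1 t - x2 t) \<le> norm (x1 t - xs t) + norm (x2 t - xs t)"
        using norm_triangle_ineq4[of "x1 t - xs t" "x2 t - xs t"] by simp
      also have "\<dots> \<le> 2 * \<gamma> * 1" using traj_close[OF tr(1) t] traj_close[OF tr(2) t] by simp
      also have "\<dots> \<le> 2 * \<gamma> * wt t" using wt_ge1[OF t] pos by (intro mult_left_mono) auto
      finally show "norm (x1 t - x2 t) \<le> 2 * \<gamma> * wt t" .
    qed
  next
    fix B :: real assume B: "0 \<le> B" "\<forall>t\<ge>0. norm (x1 t - x2 t) \<le> B * wt t"
    show "\<forall>t\<ge>0. norm (x1 t - x2 t) \<le> (3/4 * B + d) * wt t"
    proof (intro allI impI)
      fix t :: real assume t: "t \<ge> 0"
      let ?I = "\<lambda>x u. integral {0..t} (\<lambda>t. \<phi> t (x t) (u t))"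
      have "x1 t - x2 t = (?I x1 u1 - ?I x2 u1) + (y1 - y2 + (?I x2 u1 - ?I x2 u2))"
        using s1 s2 t by (simp add: sol_def algebra_simps)
      also have "norm \<dots> \<le> 3/4 * B * wt t + d"
        using B by (intro norm_triangle_le add_mono contraction[OF tr u _ _ t] d t) auto
      also have "\<dots> \<le> 3/4 * B * wt t + d * wt t"
        using mult_left_mono[OF wt_ge1[OF t] d0] by simp
      finally show "norm (x1 t - x2 t) \<le> (3/4 * B + d) * wt t" by (simp add: algebra_simps)
    qed
  qed (use pos d0 t in \<open>auto simp: wt_def\<close>)
  then show ?thesis by simp
qed

text \<open>After \<open>T\<close> the speed is bounded by that of \<open>xs\<close>, plus
  \<open>norm (A t) * \<gamma>\<close>, plus the remainder, all of which are integrable. As a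
  consequence every solution has a limit at infinity.\<close>

lemma sol_integrable:
  assumes s: "sol y u x"
  shows "(\<lambda>t. \<phi> t (x t) (u t)) absolutely_integrable_on {0..}"
proof -
  have tr: "traj x" and u: "ctrl u" using s by (auto simp: sol_def)
  have tl: "rem x xs integrable_on {T..}"
    using tail(1)[OF tr traj_xs, of \<gamma>] traj_close[OF tr] pos by auto
  let ?h = "\<lambda>t. norm (\<phi> t (xs t) (us t)) + norm (A t) * \<gamma>"
  have h: "?h integrable_on {T..}"
  proof -
    have "?h absolutely_integrable_on {0..}"
      by (intro set_integral_add(1) absolutely_integrable_norm[OF phi_int, unfolded o_def]
          set_integrable_mult_left A_int)
    from set_integrable_subset[OF this, of "{T..}"] show ?thesis
      using pos by (auto simp: absolutely_integrable_on_def)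
  qed
  have "(\<lambda>t. \<phi> t (x t) (u t)) absolutely_integrable_on {T..}"
  proof (rule measurable_bounded_by_integrable_imp_absolutely_integrable[of _ _ "\<lambda>t. ?h t + rem x xs t + (if t = T then K else 0)"])
    show "(\<lambda>t. \<phi> t (x t) (u t)) \<in> borel_measurable (lebesgue_on {T..})"
      using phi_traj(1)[OF tr u] by (rule measurable_restrict_mono) (use pos in auto)
    \<comment> \<open>A control follows \<open>us\<close> only strictly after \<open>T\<close>; the
      term at the single point \<open>T\<close> covers the value there.\<close>
    have "((\<lambda>t. if t = T then K else 0) has_integral 0) {T..}"
      by (rule has_integral_spike[OF negligible_sing[of T] _ has_integral_0]) auto
    then show "(\<lambda>t. ?h t + rem x xs t + (if t = T then K else 0)) integrable_on {T..}"
      by (intro integrable_add h tl) (auto simp: has_integral_integrable)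
    fix t assume t: "t \<in> {T..}"
    then have t0: "t \<ge> 0" using pos by simp
    show "norm (\<phi> t (x t) (u t)) \<le> ?h t + rem x xs t + (if t = T then K else 0)"
    proof (cases "t = T")
      case True
      then show ?thesis using phi_traj(2)[OF tr u t0] pos by (simp add: rem_def add_nonneg_nonneg add_increasing)
    next
      case False
      then have ut: "u t = us t" using u t by (simp add: ctrl_def)
      let ?a = "\<phi> t (x t) (us t)" and ?b = "\<phi> t (xs t) (us t)" and ?c = "A t (x t - xs t)"
      have "norm ?a \<le> norm (?a - ?b - ?c) + (norm ?b + norm ?c)"
        using norm_triangle_ineq[of "?a - ?b - ?c" "?b + ?c"] norm_triangle_ineq[of ?b ?c] by simp
      moreover have "norm ?c \<le> norm (A t) * \<gamma>"
        using norm_blinfun[of "A t" "x t - xs t"] mult_left_mono[OF traj_close[OF tr t0] norm_ge_zero[of "A t"]] by linarith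
      ultimately show ?thesis using False ut by (simp add: rem_def)
    qed
  qed simp
  then have "(\<lambda>t. \<phi> t (x t) (u t)) absolutely_integrable_on ({0..T} \<union> {T..})"
    by (intro absolutely_integrable_Un phi_traj tr u)
  moreover have "{0..T} \<union> {T..} = {0..}" using pos by auto
  ultimately show ?thesis by simp
qed

lemma sol_converges:
  assumes "sol y u x"
  shows "(x \<longlongrightarrow> xs 0 + y + integral {0..} (\<lambda>t. \<phi> t (x t) (u t))) at_top"
proof -
  have "((\<lambda>t. xs 0 + y + integral {0..t} (\<lambda>t. \<phi> t (x t) (u t))) \<longlongrightarrow>
      xs 0 + y + integral {0..} (\<lambda>t. \<phi> t (x t) (u t))) at_top"
    by (intro tendsto_intros tendsto_integral_half_line sol_integrable[OF assms])
  then show ?thesis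
    by (rule Lim_transform_eventually)
      (rule eventually_mono[OF eventually_ge_at_top[of 0]], use assms in \<open>auto simp: sol_def\<close>)
qed

end

section \<open>First variation and the adjoint equation\<close>

lemma absolutely_integrable_inner_bounded:
  fixes p g :: "real \<Rightarrow> 'a::euclidean_space"
  assumes p: "p \<in> borel_measurable leb_half" "\<And>t. t \<ge> 0 \<Longrightarrow> norm (p t) \<le> P"
    and g: "g absolutely_integrable_on {0..}"
  shows "(\<lambda>t. p t \<bullet> g t) absolutely_integrable_on {0..}"
proof (rule measurable_bounded_by_integrable_imp_absolutely_integrable[of _ _ "\<lambda>t. P * norm (g t)"])
  have "g \<in> borel_measurable leb_half"
    by (rule absolutely_integrable_imp_borel_measurable[OF g]) simp
  then show "(\<lambda>t. p t \<bullet> g t) \<in> borel_measurable leb_half" using p by measurable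
  show "(\<lambda>t. P * norm (g t)) integrable_on {0..}"
    using g by (intro integrable_on_mult_right) (auto simp: absolutely_integrable_on_def)
  fix t assume "t \<in> {0::real..}"
  then have "norm (p t) * norm (g t) \<le> P * norm (g t)" using p(2) by (intro mult_right_mono) auto
  then show "norm (p t \<bullet> g t) \<le> P * norm (g t)"
    using Cauchy_Schwarz_ineq2[of "p t" "g t"] by simp
qed simp

lemma adjoint_blinfun:
  fixes L :: "'x::euclidean_space \<Rightarrow>\<^sub>L 'y::euclidean_space"
  shows "adjoint L p \<bullet> v = p \<bullet> L v" "norm (adjoint L p) \<le> norm L * norm p"
proof -
  show 1: "adjoint L p \<bullet> v = p \<bullet> L v" for v
    using adjoint_works[of L v p] by (simp add: inner_commute blinfun.bounded_linear_right bounded_linear.linear)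
  have "norm (adjoint L p) * norm (adjoint L p) = p \<bullet> L (adjoint L p)"
    using 1[of "adjoint L p"] by (simp add: dot_square_norm power2_eq_square)
  also have "\<dots> \<le> norm p * (norm L * norm (adjoint L p))"
    using Cauchy_Schwarz_ineq2[of p "L (adjoint L p)"] mult_left_mono[OF norm_blinfun[of L "adjoint L p"] norm_ge_zero[of p]]
    by linarith
  finally show "norm (adjoint L p) \<le> norm L * norm p"
    by (cases "norm (adjoint L p) = 0") (auto simp: mult_ac)
qed

lemma adjoint_blinfun_linear: "linear (adjoint (blinfun_apply (L :: 'x::euclidean_space \<Rightarrow>\<^sub>L 'y::euclidean_space)))"
  by (intro adjoint_linear bounded_linear.linear blinfun.bounded_linear_right)

text \<open>The linearisation errors are small relative to \<open>norm (x - xs t)\<close>, uniformly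
  in \<open>t\<close>. For the dynamics this does not suffice, since a uniform pointwise error has
  no finite integral over the half-line; \<open>tail_small\<close> supplies the missing smallness
  near infinity.\<close>

locale control_problem = controlled_system \<phi> xs us U1 \<gamma> K T A
  for \<phi> :: "real \<Rightarrow> 'a::euclidean_space \<Rightarrow> 'b::euclidean_space \<Rightarrow> 'a"
    and xs :: "real \<Rightarrow> 'a" and us :: "real \<Rightarrow> 'b" and U1 :: "'b set"
    and \<gamma> K T :: real and A :: "real \<Rightarrow> 'a \<Rightarrow>\<^sub>L 'a" +
  fixes \<omega> :: "real \<Rightarrow> real" and f :: "real \<Rightarrow> 'a \<Rightarrow> 'b \<Rightarrow> real" and fx :: "real \<Rightarrow> 'a"
    and h0 :: "'a \<Rightarrow> 'c::euclidean_space" and h1 :: "real \<Rightarrow> 'a \<Rightarrow> 'd::euclidean_space"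
    and H0 :: "'a \<Rightarrow>\<^sub>L 'c" and H1 :: "real \<Rightarrow> 'a \<Rightarrow>\<^sub>L 'd" and H1inf :: "'a \<Rightarrow>\<^sub>L 'd"
  assumes omega: "\<omega> absolutely_integrable_on {0..}"
    and f_uc: "unif_cont_compactified (tube xs \<gamma> U1) f"
    and f_bound: "\<And>t x u. \<lbrakk>0 \<le> t; norm (x - xs t) \<le> \<gamma>; u \<in> U1\<rbrakk> \<Longrightarrow> norm (f t x u) \<le> K"
    and f_lip: "\<And>t x y u. \<lbrakk>0 \<le> t; norm (x - xs t) \<le> \<gamma>; norm (y - xs t) \<le> \<gamma>; u \<in> U1\<rbrakk> \<Longrightarrow>
       norm (f t x u - f t y u) \<le> K * norm (x - y)"
    and fx: "fx \<in> borel_measurable leb_half" "\<And>t. t \<ge> 0 \<Longrightarrow> norm (fx t) \<le> K"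
    and A_bound: "\<And>t. t \<ge> 0 \<Longrightarrow> norm (A t) \<le> K"
    and phi_lin: "\<And>e. e > 0 \<Longrightarrow> \<exists>\<rho>>0. \<forall>t\<ge>0. \<forall>x. norm (x - xs t) \<le> \<rho> \<longrightarrow>
       norm (\<phi> t x (us t) - \<phi> t (xs t) (us t) - A t (x - xs t)) \<le> e * norm (x - xs t)"
    and f_lin: "\<And>e. e > 0 \<Longrightarrow> \<exists>\<rho>>0. \<forall>t\<ge>0. \<forall>x. norm (x - xs t) \<le> \<rho> \<longrightarrow>
       norm (f t x (us t) - f t (xs t) (us t) - fx t \<bullet> (x - xs t)) \<le> e * norm (x - xs t)"
    and tail_small: "\<And>e. e > 0 \<Longrightarrow> \<exists>T'\<ge>T. \<forall>x B. traj x \<longrightarrow> (\<forall>t\<ge>0. norm (x t - xs t) \<le> B) \<longrightarrow>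
       integral {T'..} (rem x xs) \<le> e * B"
    and h0_lip: "\<And>x y. \<lbrakk>norm (x - xs 0) \<le> \<gamma>; norm (y - xs 0) \<le> \<gamma>\<rbrakk> \<Longrightarrow> norm (h0 x - h0 y) \<le> K * norm (x - y)"
    and h0_der: "(h0 has_derivative H0) (at (xs 0))"
    and h1_lip: "\<And>t x y. \<lbrakk>0 \<le> t; norm (x - xs t) \<le> \<gamma>; norm (y - xs t) \<le> \<gamma>\<rbrakk> \<Longrightarrow>
       norm (h1 t x - h1 t y) \<le> K * norm (x - y)"
    and h1_lin: "\<And>e. e > 0 \<Longrightarrow> \<exists>\<rho>>0. \<forall>t\<ge>0. \<forall>x. norm (x - xs t) \<le> \<rho> \<longrightarrow>
       norm (h1 t x - h1 t (xs t) - H1 t (x - xs t)) \<le> e * norm (x - xs t)"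
    and h1_conv: "\<And>x l. traj x \<Longrightarrow> (x \<longlongrightarrow> l) at_top \<Longrightarrow> \<exists>z. ((\<lambda>t. h1 t (x t)) \<longlongrightarrow> z) at_top"
    and H1_lim: "(H1 \<longlongrightarrow> H1inf) at_top"
begin

definition J :: "(real \<Rightarrow> 'a) \<Rightarrow> (real \<Rightarrow> 'b) \<Rightarrow> real" where
  "J x u = integral {0..} (\<lambda>t. \<omega> t * f t (x t) (u t))"

definition h1lim :: "(real \<Rightarrow> 'a) \<Rightarrow> 'd" where
  "h1lim x = Lim at_top (\<lambda>t. h1 t (x t))"

definition diffset :: "(real \<Rightarrow> 'b) \<Rightarrow> (real \<Rightarrow> 'b) \<Rightarrow> real set" where
  "diffset u v = {t. 0 \<le> t \<and> u t \<noteq> v t}"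

definition adjoint_rhs :: "real \<Rightarrow> (real \<Rightarrow> 'a) \<Rightarrow> real \<Rightarrow> 'a" where
  "adjoint_rhs lam0 p t = - adjoint (A t) (p t) + (lam0 * \<omega> t) *\<^sub>R fx t"

text \<open>The adjoint equation in integral form, which carries absolute continuity with it; the
  limit at infinity is the transversality condition for \<open>l1\<close>.\<close>

definition costate :: "real \<Rightarrow> 'd \<Rightarrow> (real \<Rightarrow> 'a) \<Rightarrow> bool" where
  "costate lam0 l1 p \<longleftrightarrow> bounded (p ` {0..}) \<and> adjoint_rhs lam0 p absolutely_integrable_on {0..} \<and>
     (\<forall>t\<ge>0. p t = p 0 + integral {0..t} (adjoint_rhs lam0 p)) \<and> (p \<longlongrightarrow> - adjoint H1inf l1) at_top"

text \<open>The increment of the Pontryagin function along \<open>xs\<close> when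
  \<open>us t\<close> is replaced by \<open>v\<close>.\<close>

definition needle_gain :: "real \<Rightarrow> (real \<Rightarrow> 'a) \<Rightarrow> real \<Rightarrow> 'b \<Rightarrow> real" where
  "needle_gain lam0 p t v = p t \<bullet> (\<phi> t (xs t) v - \<phi> t (xs t) (us t)) - lam0 * \<omega> t * (f t (xs t) v - f t (xs t) (us t))"

lemma sol_us: "sol 0 us xs"
  unfolding sol_def by (intro conjI traj_xs ctrl_us allI impI) (simp only: add_0_right, rule xs)

lemma sol_traj: "sol y u x \<Longrightarrow> traj x" and sol_ctrl: "sol y u x \<Longrightarrow> ctrl u"
  by (auto simp: sol_def)

lemma sol_0: "sol y u x \<Longrightarrow> x 0 = xs 0 + y"
  by (auto simp: sol_def)

lemma f_traj:
  assumes "traj x" "ctrl u"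
  shows "(\<lambda>t. f t (x t) (u t)) \<in> borel_measurable leb_half"
    and "\<And>t. t \<ge> 0 \<Longrightarrow> norm (f t (x t) (u t)) \<le> K"
    and "(\<lambda>t. \<omega> t * f t (x t) (u t)) absolutely_integrable_on {0..}"
proof -
  show 1: "(\<lambda>t. f t (x t) (u t)) \<in> borel_measurable leb_half"
    using assms by (intro measurable_compose_tube[OF f_uc] traj_measurable) (auto simp: traj_def ctrl_def)
  show 2: "norm (f t (x t) (u t)) \<le> K" if "t \<ge> 0" for t
    using that assms by (intro f_bound) (auto simp: traj_def ctrl_def)
  show "(\<lambda>t. \<omega> t * f t (x t) (u t)) absolutely_integrable_on {0..}"
    using absolutely_integrable_inner_bounded[OF 1 2 omega] by (simp add: mult.commute)
qed

lemma h1lim: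
  assumes "sol y u x"
  shows "((\<lambda>t. h1 t (x t)) \<longlongrightarrow> h1lim x) at_top"
proof -
  obtain z where z: "((\<lambda>t. h1 t (x t)) \<longlongrightarrow> z) at_top"
    using h1_conv[OF sol_traj[OF assms] sol_converges[OF assms]] by blast
  then have "h1lim x = z" unfolding h1lim_def by (intro tendsto_Lim) auto
  then show ?thesis using z by simp
qed

lemma diffset:
  assumes "ctrl u" "ctrl v"
  shows "diffset u v \<subseteq> {0..T}" "diffset u v \<in> lmeasurable"
proof -
  show sub: "diffset u v \<subseteq> {0..T}"
    using assms by (auto simp: diffset_def ctrl_def) (metis not_less)
  have "u \<in> borel_measurable leb_half" "v \<in> borel_measurable leb_half"
    using assms unfolding ctrl_def by blast+
  then have "(\<lambda>t. norm (u t - v t)) \<in> borel_measurable leb_half" by measurable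
  from measurable_sets[OF this, of "- {0}"]
  have "{t \<in> space leb_half. u t \<noteq> v t} \<in> sets leb_half"
    by (simp add: vimage_def Int_def conj_commute)
  then have "diffset u v \<in> sets lebesgue"
    by (simp add: diffset_def sets_restrict_space_iff space_restrict_space)
  then show "diffset u v \<in> lmeasurable"
    by (rule bounded_set_imp_lmeasurable[rotated]) (use sub in \<open>auto intro: bounded_subset[OF bounded_closed_interval]\<close>)
qed

lemma ind_diffset_has_integral:
  assumes "ctrl u" "ctrl v"
  shows "((\<lambda>t. if t \<in> diffset u v then c else 0) has_integral c * measure lebesgue (diffset u v)) {0..}"
proof -
  have "((\<lambda>t. 1) has_integral measure lebesgue (diffset u v)) (diffset u v)"
    using diffset(2)[OF assms] by (simp add: lmeasure_integral lmeasurable_iff_integrable_on integrable_integral)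
  from has_integral_mult_right[OF this, of c]
  have "((\<lambda>t. c) has_integral c * measure lebesgue (diffset u v)) (diffset u v)" by simp
  then show ?thesis
    by (subst has_integral_restrict) (auto simp: diffset_def)
qed

lemma omega_diffset:
  assumes "ctrl u" "ctrl v"
  shows "(\<lambda>t. if t \<in> diffset u v then c * \<bar>\<omega> t\<bar> else 0) integrable_on {0..}"
    "integral {0..} (\<lambda>t. if t \<in> diffset u v then c * \<bar>\<omega> t\<bar> else 0) = c * integral (diffset u v) (\<lambda>t. norm (\<omega> t))"
proof -
  have sub: "diffset u v \<inter> {0..} = diffset u v" by (auto simp: diffset_def)
  have "\<omega> absolutely_integrable_on (diffset u v)"
    using diffset(2)[OF assms] by (intro set_integrable_subset[OF omega]) (auto simp: diffset_def)
  then show "(\<lambda>t. if t \<in> diffset u v then c * \<bar>\<omega> t\<bar> else 0) integrable_on {0..}"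
    unfolding integrable_restrict_Int sub
    by (intro integrable_on_mult_right) (auto simp: absolutely_integrable_on_def)
  show "integral {0..} (\<lambda>t. if t \<in> diffset u v then c * \<bar>\<omega> t\<bar> else 0) = c * integral (diffset u v) (\<lambda>t. norm (\<omega> t))"
    unfolding integral_restrict_Int sub by simp
qed

lemma rem_half_line:
  assumes "traj x"
  shows "rem x xs absolutely_integrable_on {0..}"
proof -
  have "rem x xs absolutely_integrable_on {0..T}"
  proof (rule bounded_measurable_absolutely_integrable[OF rem_measurable[OF assms traj_xs]])
    fix t :: real assume t: "t \<ge> 0"
    let ?a = "\<phi> t (x t) (us t)" and ?b = "\<phi> t (xs t) (us t)" and ?c = "A t (x t - xs t)"
    have "norm (?a - ?b - ?c) \<le> norm ?a + norm ?b + norm ?c"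
      using norm_triangle_ineq4[of "?a - ?b" ?c] norm_triangle_ineq4[of ?a ?b] by simp
    moreover have "norm ?c \<le> K * \<gamma>"
      using norm_blinfun[of "A t" "x t - xs t"] mult_mono[OF A_bound[OF t] traj_close[OF assms t]] pos by auto
    ultimately show "norm (rem x xs t) \<le> K + K + K * \<gamma>"
      using phi_traj(2)[OF assms ctrl_us t] phi_traj(2)[OF traj_xs ctrl_us t] by (simp add: rem_def)
  qed
  moreover have "rem x xs absolutely_integrable_on {T..}"
    using tail(1)[OF assms traj_xs, of \<gamma>] traj_close[OF assms] pos
    by (intro nonnegative_absolutely_integrable_1) (auto simp: rem_def)
  ultimately have "rem x xs absolutely_integrable_on ({0..T} \<union> {T..})" by (rule absolutely_integrable_Un)
  moreover have "{0..T} \<union> {T..} = {0..}" using pos by auto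
  ultimately show ?thesis by simp
qed

text \<open>Up to a late time \<open>T'\<close> the remainder is pointwise small by
  \<open>phi_lin\<close>, at the cost of a factor \<open>T'\<close>; beyond it
  \<open>tail_small\<close> takes over.\<close>

lemma rem_small:
  assumes e: "e > 0"
  shows "\<exists>\<rho>>0. \<forall>x B. traj x \<longrightarrow> B \<le> \<rho> \<longrightarrow> (\<forall>t\<ge>0. norm (x t - xs t) \<le> B) \<longrightarrow> integral {0..} (rem x xs) \<le> e * B"
proof -
  obtain T' where T': "T' \<ge> T" "\<And>x B. traj x \<Longrightarrow> (\<forall>t\<ge>0. norm (x t - xs t) \<le> B) \<Longrightarrow>
      integral {T'..} (rem x xs) \<le> (e/2) * B"
    using tail_small[of "e/2"] e by auto
  have T0: "T' \<ge> 0" using T' pos by linarith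
  define e' where "e' = e / (2 * (T' + 1))"
  have e': "e' > 0" using e T0 by (simp add: e'_def)
  obtain \<rho> where \<rho>: "\<rho> > 0" "\<And>t x. t \<ge> 0 \<Longrightarrow> norm (x - xs t) \<le> \<rho> \<Longrightarrow>
       norm (\<phi> t x (us t) - \<phi> t (xs t) (us t) - A t (x - xs t)) \<le> e' * norm (x - xs t)"
    using phi_lin[OF e'] by blast
  show ?thesis
  proof (intro exI[of _ \<rho>] conjI \<rho>(1) allI impI)
    fix x B assume x: "traj x" and B: "B \<le> \<rho>" "\<forall>t\<ge>0. norm (x t - xs t) \<le> B"
    have B0: "B \<ge> 0" using B(2) norm_ge_zero order_trans by blast
    have ri: "rem x xs integrable_on {0..}"
      using rem_half_line[OF x] by (auto simp: absolutely_integrable_on_def)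
    have "integral {0..T'} (rem x xs) \<le> integral {0..T'} (\<lambda>_. e' * B)"
    proof (rule integral_le)
      show "rem x xs integrable_on {0..T'}" by (rule integrable_on_subinterval[OF ri]) auto
      fix t assume t: "t \<in> {0..T'}"
      have "rem x xs t \<le> e' * norm (x t - xs t)"
        unfolding rem_def using t B by (intro \<rho>(2)) (auto intro: order_trans)
      also have "\<dots> \<le> e' * B" using t B e' by (intro mult_left_mono) auto
      finally show "rem x xs t \<le> e' * B" .
    qed auto
    also have "\<dots> = e' * T' * B" using T0 by simp
    also have "\<dots> \<le> (e/2) * B"
      using e T0 B0 by (intro mult_right_mono) (auto simp: e'_def field_simps)
    finally have 1: "integral {0..T'} (rem x xs) \<le> (e/2) * B" .
    have "(rem x xs has_integral integral {0..T'} (rem x xs) + integral {T'..} (rem x xs)) ({0..T'} \<union> {T'..})"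
    proof (rule has_integral_Un)
      show "(rem x xs has_integral integral {0..T'} (rem x xs)) {0..T'}"
        by (intro integrable_integral integrable_on_subinterval[OF ri]) auto
      have "rem x xs absolutely_integrable_on {T'..}"
        using T0 by (intro set_integrable_subset[OF rem_half_line[OF x]]) auto
      then show "(rem x xs has_integral integral {T'..} (rem x xs)) {T'..}"
        by (intro integrable_integral) (auto simp: absolutely_integrable_on_def)
      have "{0..T'} \<inter> {T'..} = {T'}" using T0 by auto
      then show "negligible ({0..T'} \<inter> {T'..})" by simp
    qed
    moreover have "{0..T'} \<union> {T'..} = {0..}" using T0 by auto
    ultimately have "integral {0..} (rem x xs) = integral {0..T'} (rem x xs) + integral {T'..} (rem x xs)"
      by (simp add: integral_unique)
    then show "integral {0..} (rem x xs) \<le> e * B" using 1 T'(2)[OF x B(2)] by (simp add: field_simps)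
  qed
qed

section \<open>Costates and the expansion of cost and end values\<close>

lemma costate_exists: "\<exists>p. costate lam0 l1 p"
proof -
  let ?L = "\<lambda>t p. - adjoint (A t) p" and ?b = "\<lambda>t. (lam0 * \<omega> t) *\<^sub>R fx t"
  have b: "?b absolutely_integrable_on {0..}"
  proof (rule measurable_bounded_by_integrable_imp_absolutely_integrable[of _ _ "\<lambda>t. \<bar>lam0\<bar> * norm (\<omega> t) * K"])
    have "\<omega> \<in> borel_measurable leb_half" by (rule absolutely_integrable_imp_borel_measurable[OF omega]) simp
    then show "?b \<in> borel_measurable leb_half" using fx(1) by measurable
    show "(\<lambda>t. \<bar>lam0\<bar> * norm (\<omega> t) * K) integrable_on {0..}"
      using omega by (intro integrable_on_mult_left integrable_on_mult_right) (auto simp: absolutely_integrable_on_def)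
    show "norm (?b t) \<le> \<bar>lam0\<bar> * norm (\<omega> t) * K" if "t \<in> {0..}" for t
      using fx(2)[of t] that by (auto simp: abs_mult intro!: mult_left_mono)
  qed simp
  have 1: "norm (?L t x - ?L t y) \<le> norm (A t) * norm (x - y)" for t x y
  proof -
    have "?L t x - ?L t y = ?L t (x - y)"
      by (simp add: linear_diff[OF adjoint_blinfun_linear])
    then show ?thesis using adjoint_blinfun(2)[of "A t" "x - y"] by simp
  qed
  have 2: "?L t 0 = 0" for t by (simp add: linear_0[OF adjoint_blinfun_linear])
  have 3: "(\<lambda>t. ?L t (x t)) \<in> borel_measurable leb_half" if x: "x \<in> borel_measurable leb_half" for x
  proof -
    \<comment> \<open>Coordinatewise, the adjoint is moved onto the constant vector
      \<open>i\<close>, where \<open>A_meas\<close> applies.\<close>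
    have "(\<lambda>t. ?L t (x t) \<bullet> i) \<in> borel_measurable leb_half" for i
      using A_meas[of "\<lambda>_. i"] x by (simp add: adjoint_blinfun(1))
    then show ?thesis by (subst borel_measurable_euclidean_space) blast
  qed
  obtain p where p: "bounded (p ` {0..})" "(\<lambda>t. ?L t (p t) + ?b t) absolutely_integrable_on {0..}"
    "\<And>t. t \<ge> 0 \<Longrightarrow> p t = p 0 + integral {0..t} (\<lambda>t. ?L t (p t) + ?b t)" "(p \<longlongrightarrow> - adjoint H1inf l1) at_top"
    by (rule linear_terminal_value_problem[OF A_int norm_ge_zero 1 2 3 b, of "- adjoint H1inf l1"];
        (assumption | (rule that; assumption)))
  then have "costate lam0 l1 p" unfolding costate_def adjoint_rhs_def[abs_def] by blast
  then show ?thesis by blast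
qed

lemma costate_measurable:
  assumes "costate lam0 l1 p" shows "p \<in> borel_measurable leb_half"
proof -
  have ai: "adjoint_rhs lam0 p absolutely_integrable_on {0..}"
    and eq: "\<And>t. t \<ge> 0 \<Longrightarrow> p t = p 0 + integral {0..t} (adjoint_rhs lam0 p)"
    using assms unfolding costate_def by blast+
  have "adjoint_rhs lam0 p absolutely_integrable_on {0..R}" for R
    by (rule absolutely_integrable_on_subinterval[OF ai]) auto
  from continuous_on_integral[OF this eq] show ?thesis by (rule continuous_on_measurable_half)
qed

lemma costate_bounded:
  assumes "costate lam0 l1 p" obtains P where "P \<ge> 0" "\<And>t. t \<ge> 0 \<Longrightarrow> norm (p t) \<le> P"
proof -
  obtain P where P: "\<And>t. t \<ge> 0 \<Longrightarrow> norm (p t) \<le> P"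
  proof -
    have "bounded (p ` {0..})" using assms unfolding costate_def by blast
    then show ?thesis using that unfolding bounded_iff by auto
  qed
  then have "P \<ge> 0" using norm_ge_zero order_trans by blast
  then show ?thesis using that P by blast
qed

lemma linear_terms_integrable:
  assumes p: "costate lam0 l1 p" and x: "sol y u x"
  shows "(\<lambda>t. \<omega> t * (fx t \<bullet> (x t - xs t))) absolutely_integrable_on {0..}"
    and "(\<lambda>t. p t \<bullet> (\<phi> t (x t) (u t) - \<phi> t (xs t) (us t) - A t (x t - xs t))) absolutely_integrable_on {0..}"
proof -
  have zm: "(\<lambda>t. x t - xs t) \<in> borel_measurable leb_half"
    using traj_measurable[OF sol_traj[OF x]] traj_measurable[OF traj_xs] by measurable
  have zb: "norm (x t - xs t) \<le> \<gamma>" if "t \<ge> 0" for t by (rule traj_close[OF sol_traj[OF x] that])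
  have "norm (fx t \<bullet> (x t - xs t)) \<le> K * \<gamma>" if "t \<ge> 0" for t
    using Cauchy_Schwarz_ineq2[of "fx t" "x t - xs t"] mult_mono[OF fx(2)[OF that] zb[OF that]] pos by auto
  moreover have "(\<lambda>t. fx t \<bullet> (x t - xs t)) \<in> borel_measurable leb_half" using fx(1) zm by measurable
  ultimately show "(\<lambda>t. \<omega> t * (fx t \<bullet> (x t - xs t))) absolutely_integrable_on {0..}"
    using absolutely_integrable_inner_bounded[of "\<lambda>t. fx t \<bullet> (x t - xs t)" "K * \<gamma>" \<omega>] omega
    by (simp add: mult.commute)
  have "(\<lambda>t. A t (x t - xs t)) absolutely_integrable_on {0..}"
  proof (rule measurable_bounded_by_integrable_imp_absolutely_integrable[of _ _ "\<lambda>t. norm (A t) * \<gamma>"])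
    show "(\<lambda>t. norm (A t) * \<gamma>) integrable_on {0..}"
      using A_int by (intro integrable_on_mult_left) (auto simp: absolutely_integrable_on_def)
    show "norm (A t (x t - xs t)) \<le> norm (A t) * \<gamma>" if "t \<in> {0..}" for t
      using norm_blinfun[of "A t" "x t - xs t"] mult_left_mono[OF zb norm_ge_zero[of "A t"]] that
      by (meson atLeast_iff order_trans)
  qed (use A_meas[OF zm] in auto)
  then have "(\<lambda>t. \<phi> t (x t) (u t) - \<phi> t (xs t) (us t) - A t (x t - xs t)) absolutely_integrable_on {0..}"
    by (intro set_integral_diff(1) sol_integrable[OF x] phi_int)
  moreover obtain P where "\<And>t. t \<ge> 0 \<Longrightarrow> norm (p t) \<le> P" using costate_bounded[OF p] by blast
  ultimately show "(\<lambda>t. p t \<bullet> (\<phi> t (x t) (u t) - \<phi> t (xs t) (us t) - A t (x t - xs t))) absolutely_integrable_on {0..}"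
    by (intro absolutely_integrable_inner_bounded costate_measurable[OF p])
qed

text \<open>The derivative of \<open>p t \<bullet> (x t - xs t)\<close> is integrated over the
  half-line: the terms with \<open>A\<close> cancel through the adjoint equation, the end at
  infinity yields \<open>- (l1 \<bullet> H1inf zinf)\<close> and the initial one
  \<open>- p 0 \<bullet> y\<close>. The identity is exact for the nonlinear trajectory.\<close>

lemma adjoint_pairing:
  assumes p: "costate lam0 l1 p" and x: "sol y u x" and z: "((\<lambda>t. x t - xs t) \<longlongrightarrow> zinf) at_top"
  shows "lam0 * integral {0..} (\<lambda>t. \<omega> t * (fx t \<bullet> (x t - xs t))) +
      integral {0..} (\<lambda>t. p t \<bullet> (\<phi> t (x t) (u t) - \<phi> t (xs t) (us t) - A t (x t - xs t)))
      = - (l1 \<bullet> H1inf zinf) - p 0 \<bullet> y"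
proof -
  let ?z = "\<lambda>t. x t - xs t" and ?z' = "\<lambda>t. \<phi> t (x t) (u t) - \<phi> t (xs t) (us t)"
  let ?F1 = "\<lambda>t. \<omega> t * (fx t \<bullet> ?z t)" and ?F2 = "\<lambda>t. p t \<bullet> (?z' t - A t (?z t))"
  note F = linear_terms_integrable[OF p x]
  have pai: "adjoint_rhs lam0 p absolutely_integrable_on {0..}"
    and peq: "\<And>t. t \<ge> 0 \<Longrightarrow> p t = p 0 + integral {0..t} (adjoint_rhs lam0 p)"
    and plim: "(p \<longlongrightarrow> - adjoint H1inf l1) at_top"
    using p unfolding costate_def by blast+
  note xi = phi_traj_integrable[OF sol_traj[OF x] sol_ctrl[OF x]] phi_traj_integrable[OF traj_xs ctrl_us]
  have z0: "?z 0 = y" using sol_0[OF x] by simp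
  have zeq: "?z t = ?z 0 + integral {0..t} ?z'" if "t \<ge> 0" for t
    unfolding z0 integral_diff[OF xi] using x xs[OF that] that by (simp add: sol_def)
  have FS: "(\<lambda>t. lam0 * ?F1 t + ?F2 t) absolutely_integrable_on {0..}"
    by (intro set_integral_add(1) set_integrable_mult_right F)
  have "integral {0..R} (\<lambda>t. lam0 * ?F1 t + ?F2 t) = p R \<bullet> ?z R - p 0 \<bullet> y" if R: "R \<ge> 0" for R
  proof -
    have "((\<lambda>t. adjoint_rhs lam0 p t \<bullet> ?z t + p t \<bullet> ?z' t) has_integral p R \<bullet> ?z R - p 0 \<bullet> ?z 0) {0..R}"
    proof (rule inner_has_integral_by_parts[OF R])
      show "adjoint_rhs lam0 p absolutely_integrable_on {0..R}"
        by (rule absolutely_integrable_on_subinterval[OF pai]) auto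
      show "?z' absolutely_integrable_on {0..R}"
        by (intro set_integral_diff(1) phi_traj(3) sol_traj[OF x] sol_ctrl[OF x] traj_xs ctrl_us)
      show "p t = p 0 + integral {0..t} (adjoint_rhs lam0 p)" if "t \<in> {0..R}" for t
        using that by (intro peq) simp
      show "?z t = ?z 0 + integral {0..t} ?z'" if "t \<in> {0..R}" for t
        using that by (intro zeq) simp
    qed
    moreover have "adjoint_rhs lam0 p t \<bullet> ?z t + p t \<bullet> ?z' t = lam0 * ?F1 t + ?F2 t" for t
    proof -
      have h1: "adjoint_rhs lam0 p t \<bullet> ?z t = - (p t \<bullet> A t (?z t)) + lam0 * \<omega> t * (fx t \<bullet> ?z t)"
        by (simp only: adjoint_rhs_def inner_add_left inner_minus_left inner_scaleR_left adjoint_blinfun(1))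
      have h2: "?F2 t = p t \<bullet> ?z' t - p t \<bullet> A t (?z t)" by (rule inner_diff_right)
      show ?thesis unfolding h1 h2 mult.assoc by linarith
    qed
    ultimately show ?thesis unfolding z0 by (simp add: integral_unique)
  qed
  then have "\<forall>\<^sub>F R in at_top. p R \<bullet> ?z R - p 0 \<bullet> y = integral {0..R} (\<lambda>t. lam0 * ?F1 t + ?F2 t)"
    by (intro eventually_mono[OF eventually_ge_at_top[of 0]]) simp
  moreover have "((\<lambda>R. p R \<bullet> ?z R - p 0 \<bullet> y) \<longlongrightarrow> - adjoint H1inf l1 \<bullet> zinf - p 0 \<bullet> y) at_top"
    by (intro tendsto_intros plim z)
  ultimately have "((\<lambda>R. integral {0..R} (\<lambda>t. lam0 * ?F1 t + ?F2 t)) \<longlongrightarrow> - adjoint H1inf l1 \<bullet> zinf - p 0 \<bullet> y) at_top"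
    by (rule Lim_transform_eventually[rotated])
  with tendsto_integral_half_line[OF FS]
  have "integral {0..} (\<lambda>t. lam0 * ?F1 t + ?F2 t) = - adjoint H1inf l1 \<bullet> zinf - p 0 \<bullet> y"
    by (intro tendsto_unique[of at_top]) auto
  moreover have "integral {0..} (\<lambda>t. lam0 * ?F1 t + ?F2 t) = lam0 * integral {0..} ?F1 + integral {0..} ?F2"
    using F by (subst integral_add) (auto simp: absolutely_integrable_on_def intro: integrable_on_mult_right)
  ultimately show ?thesis by (simp add: adjoint_blinfun)
qed

lemma control_increment_integrable:
  assumes "ctrl u"
  shows "(\<lambda>t. \<phi> t (xs t) (u t) - \<phi> t (xs t) (us t)) absolutely_integrable_on {0..}"
proof (rule measurable_bounded_by_integrable_imp_absolutely_integrable[of _ _ "\<lambda>t. if t \<in> diffset u us then 2 * K else 0"])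
  show "(\<lambda>t. \<phi> t (xs t) (u t) - \<phi> t (xs t) (us t)) \<in> borel_measurable leb_half"
    using phi_traj(1)[OF traj_xs assms] phi_traj(1)[OF traj_xs ctrl_us] by measurable
  show "(\<lambda>t. if t \<in> diffset u us then 2 * K else 0) integrable_on {0..}"
    using ind_diffset_has_integral[OF assms ctrl_us] by (auto simp: has_integral_integrable)
  fix t assume "t \<in> {0::real..}"
  then have "norm (\<phi> t (xs t) (u t)) \<le> K" "norm (\<phi> t (xs t) (us t)) \<le> K" "t \<notin> diffset u us \<Longrightarrow> u t = us t"
    using phi_traj(2)[OF traj_xs assms] phi_traj(2)[OF traj_xs ctrl_us] by (auto simp: diffset_def)
  then show "norm (\<phi> t (xs t) (u t) - \<phi> t (xs t) (us t)) \<le> (if t \<in> diffset u us then 2 * K else 0)"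
    using norm_triangle_ineq4[of "\<phi> t (xs t) (u t)" "\<phi> t (xs t) (us t)"] by auto
qed simp

text \<open>Where \<open>u\<close> equals \<open>us\<close>, the increments of the dynamics paired
  with \<open>p\<close> differ by \<open>rem\<close> in norm; on the small set where the controls
  differ, the Lipschitz bounds give \<open>2 * K * B\<close>.\<close>

lemma dynamics_remainder:
  assumes p: "costate lam0 l1 p" and P: "\<And>t. t \<ge> 0 \<Longrightarrow> norm (p t) \<le> P"
    and x: "sol y u x" and B: "\<And>t. t \<ge> 0 \<Longrightarrow> norm (x t - xs t) \<le> B"
  shows "\<bar>integral {0..} (\<lambda>t. p t \<bullet> (\<phi> t (x t) (u t) - \<phi> t (xs t) (us t) - A t (x t - xs t)))
      - integral {0..} (\<lambda>t. p t \<bullet> (\<phi> t (xs t) (u t) - \<phi> t (xs t) (us t)))\<bar>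
    \<le> P * (integral {0..} (rem x xs) + 2 * K * B * measure lebesgue (diffset u us))"
proof -
  let ?z = "\<lambda>t. A t (x t - xs t)"
  let ?F2 = "\<lambda>t. p t \<bullet> (\<phi> t (x t) (u t) - \<phi> t (xs t) (us t) - ?z t)"
  let ?F3 = "\<lambda>t. p t \<bullet> (\<phi> t (xs t) (u t) - \<phi> t (xs t) (us t))"
  let ?N = "diffset u us"
  note u = sol_ctrl[OF x] and tr = sol_traj[OF x]
  have P0: "P \<ge> 0" using P[of 0] norm_ge_zero order_trans by blast
  have F2: "?F2 integrable_on {0..}" using linear_terms_integrable(2)[OF p x] by (auto simp: absolutely_integrable_on_def)
  have F3: "?F3 integrable_on {0..}"
    using absolutely_integrable_inner_bounded[OF costate_measurable[OF p] P control_increment_integrable[OF u]]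
    by (auto simp: absolutely_integrable_on_def)
  note N = ind_diffset_has_integral[OF u ctrl_us, of "2 * K * B"]
  have ri: "rem x xs integrable_on {0..}" using rem_half_line[OF tr] by (auto simp: absolutely_integrable_on_def)
  have "norm (integral {0..} (\<lambda>t. ?F2 t - ?F3 t)) \<le>
    integral {0..} (\<lambda>t. P * (rem x xs t + (if t \<in> ?N then 2 * K * B else 0)))"
  proof (rule integral_norm_bound_integral)
    show "(\<lambda>t. P * (rem x xs t + (if t \<in> ?N then 2 * K * B else 0))) integrable_on {0..}"
      by (intro integrable_on_mult_right integrable_add ri has_integral_integrable[OF N])
    fix t assume "t \<in> {0::real..}"
    then have t: "t \<ge> 0" by simp
    have "norm (\<phi> t (x t) (u t) - \<phi> t (xs t) (u t) - ?z t) \<le> rem x xs t + (if t \<in> ?N then 2 * K * B else 0)"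
    proof (cases "t \<in> ?N")
      case True
      have 1: "norm (\<phi> t (x t) (u t) - \<phi> t (xs t) (u t)) \<le> K * norm (x t - xs t)"
        using u t pos traj_close[OF tr t] by (intro phi_lip) (auto simp: ctrl_def)
      have 2: "norm (?z t) \<le> K * norm (x t - xs t)"
        using norm_blinfun[of "A t" "x t - xs t"] mult_right_mono[OF A_bound[OF t] norm_ge_zero[of "x t - xs t"]] by linarith
      have 3: "K * norm (x t - xs t) \<le> K * B" using B[OF t] pos by (intro mult_left_mono) auto
      have "0 \<le> rem x xs t" by (simp add: rem_def)
      with 1 2 3 show ?thesis
        using norm_triangle_ineq4[of "\<phi> t (x t) (u t) - \<phi> t (xs t) (u t)" "?z t"] True by simp
    next
      case False
      then have "u t = us t" using t by (simp add: diffset_def)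
      then show ?thesis using False by (simp add: rem_def)
    qed
    then have "norm (p t) * norm (\<phi> t (x t) (u t) - \<phi> t (xs t) (u t) - ?z t)
      \<le> P * (rem x xs t + (if t \<in> ?N then 2 * K * B else 0))"
      using P[OF t] P0 by (intro mult_mono) auto
    moreover have "?F2 t - ?F3 t = p t \<bullet> (\<phi> t (x t) (u t) - \<phi> t (xs t) (u t) - ?z t)"
      by (simp add: inner_diff_right)
    ultimately show "norm (?F2 t - ?F3 t) \<le> P * (rem x xs t + (if t \<in> ?N then 2 * K * B else 0))"
      using Cauchy_Schwarz_ineq2[of "p t" "\<phi> t (x t) (u t) - \<phi> t (xs t) (u t) - ?z t"] by simp
  qed (intro integrable_diff F2 F3)
  also have "\<dots> = P * (integral {0..} (rem x xs) + 2 * K * B * measure lebesgue ?N)"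
    using N by (simp add: integral_add[OF ri has_integral_integrable[OF N]] integral_unique[OF N])
  finally show ?thesis by (simp add: integral_diff[OF F2 F3])
qed

text \<open>The same splitting as for the dynamics; here the factor \<open>\<omega>\<close> makes a
  uniform pointwise error integrable over the half-line.\<close>

lemma cost_remainder:
  assumes x: "sol y u x" and B: "\<And>t. t \<ge> 0 \<Longrightarrow> norm (x t - xs t) \<le> B" and e: "e \<ge> 0"
    and lin: "\<And>t. t \<ge> 0 \<Longrightarrow> norm (f t (x t) (us t) - f t (xs t) (us t) - fx t \<bullet> (x t - xs t)) \<le> e * B"
  shows "\<bar>J x u - J xs us - integral {0..} (\<lambda>t. \<omega> t * (fx t \<bullet> (x t - xs t)))
      - integral {0..} (\<lambda>t. \<omega> t * (f t (xs t) (u t) - f t (xs t) (us t)))\<bar>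
    \<le> e * B * integral {0..} (\<lambda>t. norm (\<omega> t)) + 2 * K * B * integral (diffset u us) (\<lambda>t. norm (\<omega> t))"
proof -
  let ?N = "diffset u us"
  note u = sol_ctrl[OF x] and tr = sol_traj[OF x]
  have B0: "B \<ge> 0" using B[of 0] norm_ge_zero order_trans by blast
  \<comment> \<open>Any costate will do; it only serves to invoke
    \<open>linear_terms_integrable\<close>.\<close>
  obtain p where p: "costate 0 0 p" using costate_exists by blast
  have I: "(\<lambda>t. \<omega> t * f t (x t) (u t)) integrable_on {0..}" "(\<lambda>t. \<omega> t * f t (xs t) (us t)) integrable_on {0..}"
    "(\<lambda>t. \<omega> t * f t (xs t) (u t)) integrable_on {0..}"
    "(\<lambda>t. \<omega> t * (fx t \<bullet> (x t - xs t))) integrable_on {0..}"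
    using f_traj(3)[OF tr u] f_traj(3)[OF traj_xs ctrl_us] f_traj(3)[OF traj_xs u] linear_terms_integrable(1)[OF p x]
    by (auto simp: absolutely_integrable_on_def)
  have wi: "(\<lambda>t. norm (\<omega> t)) integrable_on {0..}" using omega by (auto simp: absolutely_integrable_on_def)
  note N = omega_diffset[OF u ctrl_us, of "2 * K * B"]
  let ?q = "\<lambda>t. \<omega> t * f t (x t) (u t) - \<omega> t * f t (xs t) (us t) - \<omega> t * (fx t \<bullet> (x t - xs t))
    - (\<omega> t * f t (xs t) (u t) - \<omega> t * f t (xs t) (us t))"
  have "norm (integral {0..} ?q) \<le> integral {0..} (\<lambda>t. e * B * norm (\<omega> t) + (if t \<in> ?N then 2 * K * B * \<bar>\<omega> t\<bar> else 0))"
  proof (rule integral_norm_bound_integral)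
    show "?q integrable_on {0..}" by (intro integrable_diff I)
    show "(\<lambda>t. e * B * norm (\<omega> t) + (if t \<in> ?N then 2 * K * B * \<bar>\<omega> t\<bar> else 0)) integrable_on {0..}"
      by (intro integrable_add integrable_on_mult_right wi N)
    fix t assume "t \<in> {0::real..}"
    then have t: "t \<ge> 0" by simp
    let ?r = "f t (x t) (u t) - f t (xs t) (u t) - fx t \<bullet> (x t - xs t)"
    have "\<bar>?r\<bar> \<le> e * B + (if t \<in> ?N then 2 * K * B else 0)"
    proof (cases "t \<in> ?N")
      case True
      have "norm (f t (x t) (u t) - f t (xs t) (u t)) \<le> K * norm (x t - xs t)"
        using u t pos traj_close[OF tr t] by (intro f_lip) (auto simp: ctrl_def)
      moreover have "\<bar>fx t \<bullet> (x t - xs t)\<bar> \<le> K * norm (x t - xs t)"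
        using Cauchy_Schwarz_ineq2[of "fx t" "x t - xs t"] mult_right_mono[OF fx(2)[OF t] norm_ge_zero[of "x t - xs t"]] by linarith
      moreover have "K * norm (x t - xs t) \<le> K * B" using B[OF t] pos by (intro mult_left_mono) auto
      moreover have "0 \<le> e * B" using e B0 by simp
      ultimately show ?thesis using True by (auto simp: abs_le_iff)
    next
      case False
      then have "u t = us t" using t by (simp add: diffset_def)
      then show ?thesis using False lin[OF t] by simp
    qed
    then have le: "\<bar>\<omega> t\<bar> * \<bar>?r\<bar> \<le> \<bar>\<omega> t\<bar> * (e * B + (if t \<in> ?N then 2 * K * B else 0))"
      by (intro mult_left_mono) auto
    have q: "?q t = \<omega> t * ?r" by (simp add: algebra_simps)
    have "norm (?q t) = \<bar>\<omega> t\<bar> * \<bar>?r\<bar>" unfolding q by (simp only: real_norm_def abs_mult)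
    also note le
    also have "\<bar>\<omega> t\<bar> * (e * B + (if t \<in> ?N then 2 * K * B else 0)) =
      e * B * norm (\<omega> t) + (if t \<in> ?N then 2 * K * B * \<bar>\<omega> t\<bar> else 0)"
      by (simp add: algebra_simps)
    finally show "norm (?q t) \<le> e * B * norm (\<omega> t) + (if t \<in> ?N then 2 * K * B * \<bar>\<omega> t\<bar> else 0)" .
  qed
  also have "\<dots> = e * B * integral {0..} (\<lambda>t. norm (\<omega> t)) + 2 * K * B * integral ?N (\<lambda>t. norm (\<omega> t))"
    using N wi by (subst integral_add) (auto intro: integrable_on_mult_right)
  finally have "norm (integral {0..} ?q) \<le> e * B * integral {0..} (\<lambda>t. norm (\<omega> t)) + 2 * K * B * integral ?N (\<lambda>t. norm (\<omega> t))" .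
  moreover have "integral {0..} ?q = J x u - J xs us - integral {0..} (\<lambda>t. \<omega> t * (fx t \<bullet> (x t - xs t)))
      - integral {0..} (\<lambda>t. \<omega> t * (f t (xs t) (u t) - f t (xs t) (us t)))"
    unfolding J_def right_diff_distrib[of "\<omega> _" "f _ _ _" "f _ _ _"]
    by (simp only: integral_diff integrable_diff I)
  ultimately show ?thesis by simp
qed

text \<open>\<open>adjoint_pairing\<close> eliminates the displacement of the state from the
  expansions of \<open>J\<close> and \<open>h1lim\<close>, leaving the direct effects of the control
  change and of the initial shift. The error is small relative to any bound \<open>B\<close> of the
  displacement.\<close>

lemma variation_formula:
  assumes p: "costate lam0 l1 p" and e: "e > 0"
  shows "\<exists>\<rho>>0. \<forall>y u x B. sol y u x \<longrightarrow> B \<le> \<rho> \<longrightarrow> (\<forall>t\<ge>0. norm (x t - xs t) \<le> B) \<longrightarrow>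
    measure lebesgue (diffset u us) \<le> \<rho> \<longrightarrow>
    \<bar>lam0 * (J x u - J xs us) + l0 \<bullet> (h0 (x 0) - h0 (xs 0)) + l1 \<bullet> (h1lim x - h1lim xs)
      + integral {0..} (\<lambda>t. needle_gain lam0 p t (u t)) - (adjoint H0 l0 - p 0) \<bullet> y\<bar> \<le> e * B"
proof -
  obtain P where P: "P \<ge> 0" "\<And>t. t \<ge> 0 \<Longrightarrow> norm (p t) \<le> P" using costate_bounded[OF p] by blast
  define \<Omega> where "\<Omega> = integral {0..} (\<lambda>t. norm (\<omega> t))"
  have wi: "(\<lambda>t. norm (\<omega> t)) integrable_on {0..}" using omega by (auto simp: absolutely_integrable_on_def)
  have \<Omega>: "\<Omega> \<ge> 0" unfolding \<Omega>_def by (rule integral_nonneg[OF wi]) simp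
  \<comment> \<open>The sum of the coefficients with which the four estimates \<open>e1\<close> to
    \<open>e4\<close> enter; the 1 keeps it positive.\<close>
  define M where "M = P * (1 + 2 * K) + \<bar>lam0\<bar> * (\<Omega> + 2 * K) + norm l0 + norm l1 + 1"
  have M: "M > 0" unfolding M_def using P \<Omega> pos by (intro add_nonneg_pos add_nonneg_nonneg) auto
  define \<eta> where "\<eta> = e / M"
  have \<eta>: "\<eta> > 0" "\<eta> * M = e" using e M by (auto simp: \<eta>_def)
  obtain r1 where r1: "r1 > 0" "\<And>x B. traj x \<Longrightarrow> B \<le> r1 \<Longrightarrow> (\<forall>t\<ge>0. norm (x t - xs t) \<le> B) \<Longrightarrow>
      integral {0..} (rem x xs) \<le> \<eta> * B" using rem_small[OF \<eta>(1)] by blast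
  obtain r2 where r2: "r2 > 0" "\<And>t x. t \<ge> 0 \<Longrightarrow> norm (x - xs t) \<le> r2 \<Longrightarrow>
       norm (f t x (us t) - f t (xs t) (us t) - fx t \<bullet> (x - xs t)) \<le> \<eta> * norm (x - xs t)"
    using f_lin[OF \<eta>(1)] by blast
  obtain r3 where r3: "r3 > 0" "\<And>E. E \<in> lmeasurable \<Longrightarrow> E \<subseteq> {0..} \<Longrightarrow> measure lebesgue E < r3 \<Longrightarrow>
      integral E (\<lambda>t. norm (\<omega> t)) < \<eta>" using absolutely_integrable_small_sets[OF omega _ \<eta>(1)] by auto
  obtain r4 where r4: "r4 > 0" "\<And>y. norm (y - xs 0) < r4 \<Longrightarrow>
      norm (h0 y - h0 (xs 0) - H0 (y - xs 0)) \<le> \<eta> * norm (y - xs 0)"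
    using h0_der \<eta>(1) unfolding has_derivative_at_alt by blast
  obtain r5 where r5: "r5 > 0" "\<And>t x. t \<ge> 0 \<Longrightarrow> norm (x - xs t) \<le> r5 \<Longrightarrow>
       norm (h1 t x - h1 t (xs t) - H1 t (x - xs t)) \<le> \<eta> * norm (x - xs t)"
    using h1_lin[OF \<eta>(1)] by blast
  \<comment> \<open>\<open>r3\<close> and \<open>r4\<close> are halved because their estimates ask
    for strict inequality; \<open>\<eta>\<close> is included so that the measure of
    \<open>diffset u us\<close> is at most \<open>\<eta>\<close> in \<open>e1\<close>.\<close>
  define \<rho> where "\<rho> = Min {r1, r2, r3/2, r4/2, r5, \<eta>}"
  have \<rho>: "\<rho> > 0" "\<rho> \<le> r1" "\<rho> \<le> r2" "\<rho> < r3" "\<rho> < r4" "\<rho> \<le> r5" "\<rho> \<le> \<eta>"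
    using r1(1) r2(1) r3(1) r4(1) r5(1) \<eta>(1) by (auto simp: \<rho>_def min_def)
  show ?thesis
  proof (intro exI[of _ \<rho>] conjI \<rho>(1) allI impI)
    fix y u x B
    assume x: "sol y u x" and B\<rho>: "B \<le> \<rho>" and B: "\<forall>t\<ge>0. norm (x t - xs t) \<le> B"
      and N: "measure lebesgue (diffset u us) \<le> \<rho>"
    note u = sol_ctrl[OF x] and tr = sol_traj[OF x]
    have B0: "B \<ge> 0" using B norm_ge_zero order_trans by blast
    have bnd: "norm (x t - xs t) \<le> B" if "t \<ge> 0" for t using B that by blast
    have zlt: "norm (x t - xs t) \<le> \<rho>" if "t \<ge> 0" for t using bnd[OF that] B\<rho> by linarith
    have x0: "x 0 - xs 0 = y" using sol_0[OF x] by simp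
    have lin\<eta>: "\<eta> * norm (x t - xs t) \<le> \<eta> * B" if "t \<ge> 0" for t
      using bnd[OF that] \<eta>(1) by (intro mult_left_mono) auto
    \<comment> \<open>The summand 0 matches the form of \<open>sol_converges\<close> for
      \<open>sol 0 us xs\<close>.\<close>
    define zinf where "zinf = (xs 0 + y + integral {0..} (\<lambda>t. \<phi> t (x t) (u t))) - (xs 0 + 0 + integral {0..} (\<lambda>t. \<phi> t (xs t) (us t)))"
    have z: "((\<lambda>t. x t - xs t) \<longlongrightarrow> zinf) at_top"
      unfolding zinf_def by (intro tendsto_diff sol_converges x sol_us)
    define I1 where "I1 = integral {0..} (\<lambda>t. \<omega> t * (fx t \<bullet> (x t - xs t)))"
    define I2 where "I2 = integral {0..} (\<lambda>t. p t \<bullet> (\<phi> t (x t) (u t) - \<phi> t (xs t) (us t) - A t (x t - xs t)))"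
    define I3 where "I3 = integral {0..} (\<lambda>t. p t \<bullet> (\<phi> t (xs t) (u t) - \<phi> t (xs t) (us t)))"
    define I4 where "I4 = integral {0..} (\<lambda>t. \<omega> t * (f t (xs t) (u t) - f t (xs t) (us t)))"
    have pair: "lam0 * I1 + I2 = - (l1 \<bullet> H1inf zinf) - p 0 \<bullet> y"
      unfolding I1_def I2_def by (rule adjoint_pairing[OF p x z])
    have gain: "integral {0..} (\<lambda>t. needle_gain lam0 p t (u t)) = I3 - lam0 * I4"
    proof -
      have 1: "(\<lambda>t. p t \<bullet> (\<phi> t (xs t) (u t) - \<phi> t (xs t) (us t))) integrable_on {0..}"
        using absolutely_integrable_inner_bounded[OF costate_measurable[OF p] P(2) control_increment_integrable[OF u]]
        by (auto simp: absolutely_integrable_on_def)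
      have 2: "(\<lambda>t. \<omega> t * (f t (xs t) (u t) - f t (xs t) (us t))) integrable_on {0..}"
        using f_traj(3)[OF traj_xs u] f_traj(3)[OF traj_xs ctrl_us]
        unfolding right_diff_distrib by (intro integrable_diff) (auto simp: absolutely_integrable_on_def)
      show ?thesis
        unfolding needle_gain_def mult.assoc I3_def I4_def
        by (simp only: integral_diff[OF 1 integrable_on_mult_right[OF 2]] integral_mult_right)
    qed
    have e1: "\<bar>I2 - I3\<bar> \<le> \<eta> * B * (P * (1 + 2 * K))"
    proof -
      have "\<bar>I2 - I3\<bar> \<le> P * (integral {0..} (rem x xs) + 2 * K * B * measure lebesgue (diffset u us))"
        unfolding I2_def I3_def by (rule dynamics_remainder[OF p P(2) x bnd])
      also have "\<dots> \<le> P * (\<eta> * B + 2 * K * B * \<eta>)"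
      proof (intro mult_left_mono add_mono P)
        show "integral {0..} (rem x xs) \<le> \<eta> * B" using r1(2)[OF tr _ B] B\<rho> \<rho> by simp
      qed (use N \<rho> pos B0 in auto)
      also have "\<dots> = \<eta> * B * (P * (1 + 2 * K))" by (simp add: algebra_simps)
      finally show ?thesis .
    qed
    have e2: "\<bar>J x u - J xs us - I1 - I4\<bar> \<le> \<eta> * B * (\<Omega> + 2 * K)"
    proof -
      have "\<bar>J x u - J xs us - I1 - I4\<bar> \<le> \<eta> * B * \<Omega> + 2 * K * B * integral (diffset u us) (\<lambda>t. norm (\<omega> t))"
        unfolding I1_def I4_def \<Omega>_def
      proof (rule cost_remainder[OF x bnd])
        fix t :: real assume t: "t \<ge> 0"
        have "norm (x t - xs t) \<le> r2" using zlt[OF t] \<rho> by linarith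
        from r2(2)[OF t this] show "norm (f t (x t) (us t) - f t (xs t) (us t) - fx t \<bullet> (x t - xs t)) \<le> \<eta> * B"
          using lin\<eta>[OF t] by linarith
      qed (use \<eta> in auto)
      also have "integral (diffset u us) (\<lambda>t. norm (\<omega> t)) \<le> \<eta>"
        using r3(2)[OF diffset(2)[OF u ctrl_us]] diffset(1)[OF u ctrl_us] N \<rho> by fastforce
      then have "\<eta> * B * \<Omega> + 2 * K * B * integral (diffset u us) (\<lambda>t. norm (\<omega> t)) \<le> \<eta> * B * \<Omega> + 2 * K * B * \<eta>"
        using pos B0 by (intro add_left_mono mult_left_mono) auto
      also have "\<dots> = \<eta> * B * (\<Omega> + 2 * K)" by (simp add: algebra_simps)
      finally show ?thesis .
    qed
    have e3: "\<bar>l0 \<bullet> (h0 (x 0) - h0 (xs 0)) - l0 \<bullet> H0 y\<bar> \<le> \<eta> * B * norm l0"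
    proof -
      have "norm (x 0 - xs 0) < r4" using zlt[of 0] \<rho> by simp
      from r4(2)[OF this] have "norm (h0 (x 0) - h0 (xs 0) - H0 y) \<le> \<eta> * B"
        using lin\<eta>[of 0] unfolding x0 by simp
      then have "norm l0 * norm (h0 (x 0) - h0 (xs 0) - H0 y) \<le> norm l0 * (\<eta> * B)"
        by (intro mult_left_mono) auto
      then show ?thesis
        using Cauchy_Schwarz_ineq2[of l0 "h0 (x 0) - h0 (xs 0) - H0 y"] by (simp add: inner_diff_right mult.commute)
    qed
    have e4: "\<bar>l1 \<bullet> (h1lim x - h1lim xs) - l1 \<bullet> H1inf zinf\<bar> \<le> \<eta> * B * norm l1"
    proof -
      have lim: "((\<lambda>t. norm (h1 t (x t) - h1 t (xs t) - H1 t (x t - xs t))) \<longlongrightarrow>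
          norm (h1lim x - h1lim xs - H1inf zinf)) at_top"
        by (intro tendsto_intros h1lim[OF x] h1lim[OF sol_us] z blinfun.tendsto H1_lim)
      have "norm (h1lim x - h1lim xs - H1inf zinf) \<le> \<eta> * B"
      proof (rule tendsto_upperbound[OF lim])
        show "\<forall>\<^sub>F t in at_top. norm (h1 t (x t) - h1 t (xs t) - H1 t (x t - xs t)) \<le> \<eta> * B"
          using eventually_ge_at_top[of 0]
        proof eventually_elim
          case (elim t)
          have "norm (x t - xs t) \<le> r5" using zlt[OF elim] \<rho> by linarith
          from r5(2)[OF elim this] show ?case using lin\<eta>[OF elim] by linarith
        qed
      qed simp
      then have "norm l1 * norm (h1lim x - h1lim xs - H1inf zinf) \<le> norm l1 * (\<eta> * B)"
        by (intro mult_left_mono) auto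
      then show ?thesis
        using Cauchy_Schwarz_ineq2[of l1 "h1lim x - h1lim xs - H1inf zinf"] by (simp add: inner_diff_right mult.commute)
    qed
    have adj: "adjoint H0 l0 \<bullet> y = l0 \<bullet> H0 y" by (rule adjoint_blinfun)
    have e2': "\<bar>lam0 * (J x u - J xs us) - lam0 * I1 - lam0 * I4\<bar> \<le> \<bar>lam0\<bar> * (\<eta> * B * (\<Omega> + 2 * K))"
    proof -
      have "lam0 * (J x u - J xs us) - lam0 * I1 - lam0 * I4 = lam0 * (J x u - J xs us - I1 - I4)"
        by (simp add: algebra_simps)
      then show ?thesis using mult_left_mono[OF e2 abs_ge_zero[of lam0]] by (simp add: abs_mult)
    qed
    have "\<bar>lam0 * (J x u - J xs us) + l0 \<bullet> (h0 (x 0) - h0 (xs 0)) + l1 \<bullet> (h1lim x - h1lim xs)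
      + integral {0..} (\<lambda>t. needle_gain lam0 p t (u t)) - (adjoint H0 l0 - p 0) \<bullet> y\<bar> \<le>
      \<eta> * B * (P * (1 + 2 * K)) + \<bar>lam0\<bar> * (\<eta> * B * (\<Omega> + 2 * K)) + \<eta> * B * norm l0 + \<eta> * B * norm l1"
      using e1 e2' e3 e4 pair gain adj unfolding inner_diff_left by linarith
    also have "\<dots> = \<eta> * B * (M - 1)" by (simp add: M_def algebra_simps)
    also have "\<dots> \<le> \<eta> * B * M" using \<eta> B0 by (intro mult_left_mono) auto
    also have "\<dots> = e * B" using \<eta>(2) by (simp add: mult_ac)
    finally show "\<bar>lam0 * (J x u - J xs us) + l0 \<bullet> (h0 (x 0) - h0 (xs 0)) + l1 \<bullet> (h1lim x - h1lim xs)
      + integral {0..} (\<lambda>t. needle_gain lam0 p t (u t)) - (adjoint H0 l0 - p 0) \<bullet> y\<bar> \<le> e * B" .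
  qed
qed

text \<open>Prepares the continuity of the end values that Brouwer's theorem requires. The integral
  of \<open>norm (\<omega> t)\<close> over \<open>diffset u1 u2\<close> is kept, because for
  unbounded \<open>\<omega>\<close> it has no bound linear in the measure of that set.\<close>

lemma end_map_lipschitz:
  assumes x1: "sol y1 u1 x1" and x2: "sol y2 u2 x2"
    and B: "\<And>t. t \<ge> 0 \<Longrightarrow> norm (x1 t - x2 t) \<le> B"
  shows "norm (h0 (x1 0) - h0 (x2 0)) \<le> K * B"
    and "norm (h1lim x1 - h1lim x2) \<le> K * B"
    and "\<bar>J x1 u1 - J x2 u2\<bar> \<le> K * B * integral {0..} (\<lambda>t. norm (\<omega> t)) + 2 * K * integral (diffset u1 u2) (\<lambda>t. norm (\<omega> t))"
proof -
  note u = sol_ctrl[OF x1] sol_ctrl[OF x2] and tr = sol_traj[OF x1] sol_traj[OF x2]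
  have KB: "K * norm (x1 t - x2 t) \<le> K * B" if "t \<ge> 0" for t
    using B[OF that] pos by (intro mult_left_mono) auto
  show "norm (h0 (x1 0) - h0 (x2 0)) \<le> K * B"
    using h0_lip[of "x1 0" "x2 0"] traj_close[OF tr(1), of 0] traj_close[OF tr(2), of 0] KB[of 0] by simp
  have lim: "((\<lambda>t. norm (h1 t (x1 t) - h1 t (x2 t))) \<longlongrightarrow> norm (h1lim x1 - h1lim x2)) at_top"
    by (intro tendsto_intros h1lim[OF x1] h1lim[OF x2])
  show "norm (h1lim x1 - h1lim x2) \<le> K * B"
  proof (rule tendsto_upperbound[OF lim])
    show "\<forall>\<^sub>F t in at_top. norm (h1 t (x1 t) - h1 t (x2 t)) \<le> K * B"
      using eventually_ge_at_top[of 0]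
    proof eventually_elim
      case (elim t)
      show ?case
        using h1_lip[OF elim traj_close[OF tr(1) elim] traj_close[OF tr(2) elim]] KB[OF elim] by linarith
    qed
  qed simp
  have I: "(\<lambda>t. \<omega> t * f t (x1 t) (u1 t)) integrable_on {0..}" "(\<lambda>t. \<omega> t * f t (x2 t) (u2 t)) integrable_on {0..}"
    using f_traj(3)[OF tr(1) u(1)] f_traj(3)[OF tr(2) u(2)] by (auto simp: absolutely_integrable_on_def)
  have wi: "(\<lambda>t. norm (\<omega> t)) integrable_on {0..}" using omega by (auto simp: absolutely_integrable_on_def)
  note N = omega_diffset[OF u, of "2 * K"]
  have "norm (integral {0..} (\<lambda>t. \<omega> t * f t (x1 t) (u1 t) - \<omega> t * f t (x2 t) (u2 t))) \<le>
    integral {0..} (\<lambda>t. K * B * norm (\<omega> t) + (if t \<in> diffset u1 u2 then 2 * K * \<bar>\<omega> t\<bar> else 0))"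
  proof (rule integral_norm_bound_integral)
    show "(\<lambda>t. K * B * norm (\<omega> t) + (if t \<in> diffset u1 u2 then 2 * K * \<bar>\<omega> t\<bar> else 0)) integrable_on {0..}"
      by (intro integrable_add integrable_on_mult_right wi N)
    fix t assume "t \<in> {0::real..}"
    then have t: "t \<ge> 0" by simp
    have 1: "\<bar>f t (x1 t) (u1 t) - f t (x2 t) (u1 t)\<bar> \<le> K * B"
      using f_lip[OF t traj_close[OF tr(1) t] traj_close[OF tr(2) t], of "u1 t"] u t KB[OF t] by (auto simp: ctrl_def)
    have 2: "\<bar>f t (x2 t) (u1 t) - f t (x2 t) (u2 t)\<bar> \<le> (if t \<in> diffset u1 u2 then 2 * K else 0)"
      using f_traj(2)[OF tr(2) u(1) t] f_traj(2)[OF tr(2) u(2) t] t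
      by (auto simp: diffset_def abs_le_iff)
    have "\<bar>f t (x1 t) (u1 t) - f t (x2 t) (u2 t)\<bar> \<le> K * B + (if t \<in> diffset u1 u2 then 2 * K else 0)"
      using 1 2 by linarith
    then have le: "\<bar>\<omega> t\<bar> * \<bar>f t (x1 t) (u1 t) - f t (x2 t) (u2 t)\<bar> \<le> \<bar>\<omega> t\<bar> * (K * B + (if t \<in> diffset u1 u2 then 2 * K else 0))"
      by (intro mult_left_mono) auto
    have "norm (\<omega> t * f t (x1 t) (u1 t) - \<omega> t * f t (x2 t) (u2 t)) = \<bar>\<omega> t\<bar> * \<bar>f t (x1 t) (u1 t) - f t (x2 t) (u2 t)\<bar>"
      unfolding right_diff_distrib[symmetric] by (simp only: real_norm_def abs_mult)
    also note le
    also have "\<bar>\<omega> t\<bar> * (K * B + (if t \<in> diffset u1 u2 then 2 * K else 0)) =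
      K * B * norm (\<omega> t) + (if t \<in> diffset u1 u2 then 2 * K * \<bar>\<omega> t\<bar> else 0)"
      by (simp add: algebra_simps)
    finally show "norm (\<omega> t * f t (x1 t) (u1 t) - \<omega> t * f t (x2 t) (u2 t)) \<le>
      K * B * norm (\<omega> t) + (if t \<in> diffset u1 u2 then 2 * K * \<bar>\<omega> t\<bar> else 0)" .
  qed (intro integrable_diff I)
  also have "\<dots> = K * B * integral {0..} (\<lambda>t. norm (\<omega> t)) + 2 * K * integral (diffset u1 u2) (\<lambda>t. norm (\<omega> t))"
    using N wi by (subst integral_add) (auto intro: integrable_on_mult_right)
  finally show "\<bar>J x1 u1 - J x2 u2\<bar> \<le> K * B * integral {0..} (\<lambda>t. norm (\<omega> t)) + 2 * K * integral (diffset u1 u2) (\<lambda>t. norm (\<omega> t))"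
    by (simp add: J_def integral_diff[OF I])
qed

end

section \<open>Convex cones and Brouwer's theorem\<close>

text \<open>If \<open>w\<close> were outside the cone \<open>K\<close>, the convex set of all
  \<open>k - r *\<^sub>R w\<close> with \<open>k \<in> K\<close> and \<open>r > 0\<close> would miss
  0. A hyperplane separating it from 0, with its normal in the span of the set and hence in
  \<open>W\<close>, is nonnegative on \<open>G\<close>, against \<open>sep\<close>.\<close>

lemma cone_alternative:
  fixes G W :: "'e::euclidean_space set"
  assumes W: "subspace W" "G \<subseteq> W" and G: "G \<noteq> {}"
    and sep: "\<nexists>l. l \<in> W \<and> l \<noteq> 0 \<and> (\<forall>g\<in>G. 0 \<le> l \<bullet> g)"
    and w: "w \<in> W"
  obtains S c where "finite S" "S \<subseteq> G" "\<And>g. 0 \<le> c g" "w = (\<Sum>g\<in>S. c g *\<^sub>R g)"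
proof -
  define K where "K = {c *\<^sub>R x | c x. 0 \<le> c \<and> x \<in> convex hull G}"
  have GK: "c *\<^sub>R g \<in> K" if "g \<in> G" "c \<ge> 0" for g c
    using hull_inc[OF that(1), of convex] that(2) unfolding K_def by blast
  have hullW: "convex hull G \<subseteq> W"
    by (rule hull_minimal[OF W(2)]) (rule subspace_imp_convex[OF W(1)])
  have K_W: "K \<subseteq> W" using hullW W(1) by (auto simp: K_def subspace_def)
  have K_add: "k1 + k2 \<in> K" if "k1 \<in> K" "k2 \<in> K" for k1 k2
  proof -
    obtain c1 x1 c2 x2 where *: "k1 = c1 *\<^sub>R x1" "k2 = c2 *\<^sub>R x2" "c1 \<ge> 0" "c2 \<ge> 0"
      "x1 \<in> convex hull G" "x2 \<in> convex hull G" using \<open>k1 \<in> K\<close> \<open>k2 \<in> K\<close> unfolding K_def by blast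
    show ?thesis
    proof (cases "c1 + c2 = 0")
      case True
      then have "c1 = 0" "c2 = 0" using * by linarith+
      then show ?thesis using * that(1) by simp
    next
      case False
      have "(c1 / (c1 + c2)) *\<^sub>R x1 + (c2 / (c1 + c2)) *\<^sub>R x2 \<in> convex hull G"
        by (rule convexD[OF convex_convex_hull]) (use * False in \<open>auto simp: add_divide_distrib[symmetric]\<close>)
      moreover have "k1 + k2 = (c1 + c2) *\<^sub>R ((c1 / (c1 + c2)) *\<^sub>R x1 + (c2 / (c1 + c2)) *\<^sub>R x2)"
        using False * by (simp add: scaleR_add_right)
      ultimately show ?thesis unfolding K_def using * by fastforce
    qed
  qed
  have K_scale: "c *\<^sub>R k \<in> K" if "k \<in> K" "c \<ge> 0" for k c
  proof -
    obtain c1 x1 where "k = c1 *\<^sub>R x1" "c1 \<ge> 0" "x1 \<in> convex hull G" using \<open>k \<in> K\<close> unfolding K_def by blast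
    then show ?thesis using that(2) unfolding K_def by (intro CollectI exI[of _ "c * c1"] exI[of _ x1]) auto
  qed
  have "w \<in> K"
  proof (rule ccontr)
    assume nK: "w \<notin> K"
    define T where "T = {k - r *\<^sub>R w | k r. k \<in> K \<and> r > 0}"
    have "convex T"
      unfolding convex_def
    proof (intro ballI allI impI)
      fix x y and u v :: real assume "x \<in> T" "y \<in> T" and uv: "0 \<le> u" "0 \<le> v" "u + v = 1"
      then obtain k1 r1 k2 r2 where *: "x = k1 - r1 *\<^sub>R w" "y = k2 - r2 *\<^sub>R w" "k1 \<in> K" "k2 \<in> K" "r1 > 0" "r2 > 0"
        unfolding T_def by blast
      have "u *\<^sub>R k1 + v *\<^sub>R k2 \<in> K" using * uv by (intro K_add K_scale)
      moreover have "u * r1 + v * r2 > 0"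
        using convexD[OF convex_real_interval(3)[of 0], of r1 r2 u v] * uv by simp
      moreover have "u *\<^sub>R x + v *\<^sub>R y = (u *\<^sub>R k1 + v *\<^sub>R k2) - (u * r1 + v * r2) *\<^sub>R w"
        by (simp add: * algebra_simps)
      ultimately show "u *\<^sub>R x + v *\<^sub>R y \<in> T" unfolding T_def by blast
    qed
    moreover have "T \<noteq> {}"
    proof -
      obtain g where "g \<in> G" using G by blast
      then have "1 *\<^sub>R g - 1 *\<^sub>R w \<in> T" unfolding T_def using GK[of g 1] by fastforce
      then show ?thesis by blast
    qed
    moreover have "0 \<notin> T"
    proof
      assume "0 \<in> T"
      then obtain k r where "k = r *\<^sub>R w" "k \<in> K" "r > 0" unfolding T_def by auto
      then have "w = (1 / r) *\<^sub>R k" by simp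
      then show False using nK K_scale[OF \<open>k \<in> K\<close>, of "1 / r"] \<open>r > 0\<close> by simp
    qed
    ultimately obtain l where l: "l \<in> span T" "l \<noteq> 0" "\<And>x. x \<in> T \<Longrightarrow> 0 \<le> l \<bullet> x"
      using separating_hyperplane_set_0_inspan by metis
    have "T \<subseteq> W"
      using K_W W(1) w unfolding T_def by (auto intro!: subspace_diff subspace_scale)
    then have "l \<in> W" using l(1) span_minimal[OF _ W(1)] by blast
    moreover have "0 \<le> l \<bullet> g" if g: "g \<in> G" for g
    proof (rule field_le_epsilon)
      fix e :: real assume e: "e > 0"
      \<comment> \<open>So small that \<open>r * (l \<bullet> w)\<close> is at most \<open>e\<close>
        in absolute value: the contribution of \<open>w\<close> disappears in the limit.\<close>
      define r where "r = e / (\<bar>l \<bullet> w\<bar> + 1)"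
      have r: "r > 0" using e by (simp add: r_def add_nonneg_pos)
      have "g - r *\<^sub>R w \<in> T" unfolding T_def using GK[OF g, of 1] r by fastforce
      then have "0 \<le> l \<bullet> g - r * (l \<bullet> w)" using l(3) by (fastforce simp: inner_diff_right)
      moreover have "- (r * (l \<bullet> w)) \<le> r * (\<bar>l \<bullet> w\<bar> + 1)"
        using r mult_left_mono[of "- (l \<bullet> w)" "\<bar>l \<bullet> w\<bar> + 1" r] by simp
      moreover have "r * (\<bar>l \<bullet> w\<bar> + 1) = e" by (simp add: r_def add_nonneg_pos less_imp_neq[THEN not_sym])
      ultimately show "0 \<le> l \<bullet> g + e" by linarith
    qed
    ultimately show False using sep l(2) by blast
  qed
  then obtain c0 x where cx: "w = c0 *\<^sub>R x" "c0 \<ge> 0" "x \<in> convex hull G" unfolding K_def by blast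
  then obtain S u where S: "finite S" "S \<subseteq> G" "\<forall>v\<in>S. 0 \<le> u v" "(\<Sum>v\<in>S. u v *\<^sub>R v) = x"
    unfolding convex_hull_explicit by blast
  show ?thesis
  proof (rule that[OF S(1,2), of "\<lambda>g. if g \<in> S then c0 * u g else 0"])
    show "0 \<le> (if g \<in> S then c0 * u g else 0)" for g using S(3) cx(2) by simp
    have "w = (\<Sum>g\<in>S. (c0 * u g) *\<^sub>R g)"
      unfolding cx(1) S(4)[symmetric] by (simp add: scaleR_sum_right)
    then show "w = (\<Sum>g\<in>S. (if g \<in> S then c0 * u g else 0) *\<^sub>R g)" by simp
  qed
qed

text \<open>The positive and negative parts of the coordinates of \<open>y\<close> give coefficients that are
  nonnegative and yet continuous in \<open>y\<close>.\<close>

lemma cone_param: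
  fixes G W :: "'e::euclidean_space set"
  assumes W: "subspace W" "G \<subseteq> W" and G: "G \<noteq> {}"
    and sep: "\<nexists>l. l \<in> W \<and> l \<noteq> 0 \<and> (\<forall>g\<in>G. 0 \<le> l \<bullet> g)"
    and e: "e \<in> W"
  obtains S \<alpha> where "finite S" "S \<subseteq> G" "\<And>g. continuous_on UNIV (\<alpha> g)" "\<And>g y. 0 \<le> \<alpha> g y"
    "\<And>y. y \<in> W \<Longrightarrow> (\<Sum>g\<in>S. \<alpha> g y *\<^sub>R g) = y + e"
proof -
  have "\<exists>S c. finite S \<and> S \<subseteq> G \<and> (\<forall>g. 0 \<le> c g) \<and> w = (\<Sum>g\<in>S. c g *\<^sub>R g)" if "w \<in> W" for w
    using cone_alternative[OF W G sep that] by metis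
  then obtain S c where S: "\<And>w. w \<in> W \<Longrightarrow> finite (S w)" "\<And>w. w \<in> W \<Longrightarrow> S w \<subseteq> G"
    "\<And>w g. w \<in> W \<Longrightarrow> 0 \<le> c w g" "\<And>w. w \<in> W \<Longrightarrow> w = (\<Sum>g\<in>S w. c w g *\<^sub>R g)" by metis
  \<comment> \<open>Extended by zero, the coefficients of the different target vectors can be summed
    over one common finite set \<open>S'\<close>.\<close>
  define c' where "c' w g = (if g \<in> S w then c w g else 0)" for w g
  obtain B where B: "B \<subseteq> W" "pairwise orthogonal B" "\<And>x. x \<in> B \<Longrightarrow> norm x = 1" "independent B" "span B = W"
    using orthonormal_basis_subspace[OF W(1)] by metis
  have finB: "finite B" using B(4) by (rule independent_imp_finite)
  have nB: "- b \<in> W" if "b \<in> B" for b using B(1) that subspace_neg[OF W(1)] by blast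
  define S' where "S' = S e \<union> (\<Union>b\<in>B. S b \<union> S (- b))"
  have finS: "finite S'" unfolding S'_def using finB S(1) e B(1) nB by blast
  have SG: "S' \<subseteq> G" unfolding S'_def using S(2) e B(1) nB by blast
  have rep: "(\<Sum>g\<in>S'. c' w g *\<^sub>R g) = w" if "w \<in> W" "S w \<subseteq> S'" for w
  proof -
    have "(\<Sum>g\<in>S'. c' w g *\<^sub>R g) = (\<Sum>g\<in>S w. c' w g *\<^sub>R g)"
      using that finS by (intro sum.mono_neutral_right) (auto simp: c'_def)
    also have "\<dots> = (\<Sum>g\<in>S w. c w g *\<^sub>R g)" by (intro sum.cong) (auto simp: c'_def)
    finally show ?thesis using S(4)[OF that(1)] by simp
  qed
  define \<alpha> where "\<alpha> g y = c' e g + (\<Sum>b\<in>B. max 0 (y \<bullet> b) * c' b g + max 0 (- (y \<bullet> b)) * c' (- b) g)" for g y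
  show ?thesis
  proof (rule that[OF finS SG, of \<alpha>])
    show "continuous_on UNIV (\<alpha> g)" for g unfolding \<alpha>_def[abs_def] by (intro continuous_intros)
    show "0 \<le> \<alpha> g y" for g y
      unfolding \<alpha>_def c'_def using S(3) e B(1) nB
      by (intro add_nonneg_nonneg sum_nonneg mult_nonneg_nonneg) auto
    fix y assume y: "y \<in> W"
    have "(\<Sum>g\<in>S'. \<alpha> g y *\<^sub>R g) = (\<Sum>g\<in>S'. c' e g *\<^sub>R g) +
      (\<Sum>g\<in>S'. \<Sum>b\<in>B. max 0 (y \<bullet> b) *\<^sub>R (c' b g *\<^sub>R g) + max 0 (- (y \<bullet> b)) *\<^sub>R (c' (- b) g *\<^sub>R g))"
      by (simp add: \<alpha>_def scaleR_add_left scaleR_sum_left sum.distrib)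
    also have "\<dots> = e + (\<Sum>b\<in>B. \<Sum>g\<in>S'. max 0 (y \<bullet> b) *\<^sub>R (c' b g *\<^sub>R g) + max 0 (- (y \<bullet> b)) *\<^sub>R (c' (- b) g *\<^sub>R g))"
      using rep[OF e] by (subst sum.swap) (simp add: S'_def)
    also have "\<dots> = e + (\<Sum>b\<in>B. max 0 (y \<bullet> b) *\<^sub>R b + max 0 (- (y \<bullet> b)) *\<^sub>R (- b))"
    proof (intro arg_cong[where f="(+) e"] sum.cong refl)
      fix b assume b: "b \<in> B"
      have "(\<Sum>g\<in>S'. c' b g *\<^sub>R g) = b" "(\<Sum>g\<in>S'. c' (- b) g *\<^sub>R g) = - b"
      proof -
        have "S b \<subseteq> S'" "S (- b) \<subseteq> S'" using b unfolding S'_def by blast+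
        then show "(\<Sum>g\<in>S'. c' b g *\<^sub>R g) = b" "(\<Sum>g\<in>S'. c' (- b) g *\<^sub>R g) = - b"
          using b B(1) nB by (auto intro!: rep)
      qed
      then show "(\<Sum>g\<in>S'. max 0 (y \<bullet> b) *\<^sub>R (c' b g *\<^sub>R g) + max 0 (- (y \<bullet> b)) *\<^sub>R (c' (- b) g *\<^sub>R g))
        = max 0 (y \<bullet> b) *\<^sub>R b + max 0 (- (y \<bullet> b)) *\<^sub>R (- b)"
        by (simp only: sum.distrib scaleR_sum_right[symmetric])
    qed
    also have "(\<Sum>b\<in>B. max 0 (y \<bullet> b) *\<^sub>R b + max 0 (- (y \<bullet> b)) *\<^sub>R (- b)) = (\<Sum>b\<in>B. (y \<bullet> b) *\<^sub>R b)"
      by (intro sum.cong) (auto simp: max_def scaleR_left_diff_distrib[symmetric])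
    also have "\<dots> = y" using B y finB by (intro orthonormal_basis_expand) auto
    finally show "(\<Sum>g\<in>S'. \<alpha> g y *\<^sub>R g) = y + e" by (simp add: add.commute)
  qed
qed

text \<open>A fixed point of \<open>y \<mapsto> y + e - (1 / r) *\<^sub>R F y\<close> is a solution
  of \<open>F y = r *\<^sub>R e\<close>, and \<open>close\<close> says that the values of this map
  have norm at most 1.\<close>

lemma brouwer_hits:
  fixes W :: "'e::euclidean_space set"
  assumes W: "subspace W" and e: "e \<in> W" and r: "r > 0"
    and F: "continuous_on (cball 0 1 \<inter> W) F" "\<And>y. y \<in> cball 0 1 \<inter> W \<Longrightarrow> F y \<in> W"
    and close: "\<And>y. y \<in> cball 0 1 \<inter> W \<Longrightarrow> norm (F y - r *\<^sub>R (y + e)) \<le> r"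
  obtains y where "y \<in> cball 0 1 \<inter> W" "F y = r *\<^sub>R e"
proof -
  let ?f = "\<lambda>y. y + e - (1 / r) *\<^sub>R F y"
  obtain y where y: "y \<in> cball 0 1 \<inter> W" "?f y = y"
  proof (rule brouwer[of "cball 0 1 \<inter> W" ?f])
    show "compact (cball 0 1 \<inter> W)" using closed_subspace[OF W] by (simp add: compact_Int_closed)
    show "convex (cball 0 1 \<inter> W)" by (intro convex_Int convex_cball subspace_imp_convex W)
    have "0 \<in> cball 0 1 \<inter> W" using subspace_0[OF W] by simp
    then show "cball 0 1 \<inter> W \<noteq> {}" by blast
    show "continuous_on (cball 0 1 \<inter> W) ?f" by (intro continuous_intros F)
    show "?f \<in> (cball 0 1 \<inter> W) \<rightarrow> cball 0 1 \<inter> W"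
    proof
      fix y assume y: "y \<in> cball 0 1 \<inter> W"
      have "?f y = (- 1 / r) *\<^sub>R (F y - r *\<^sub>R (y + e))" using r by (simp add: algebra_simps)
      then have "norm (?f y) = norm (F y - r *\<^sub>R (y + e)) / r" using r by simp
      also have "\<dots> \<le> 1" using close[OF y] r by simp
      finally have "norm (?f y) \<le> 1" .
      moreover have "?f y \<in> W"
        using y F(2)[OF y] e W by (intro subspace_diff subspace_add subspace_scale) auto
      ultimately show "?f y \<in> cball 0 1 \<inter> W" by simp
    qed
  qed (rule that)
  then have "e = (1 / r) *\<^sub>R F y" by (simp add: algebra_simps)
  then have "F y = r *\<^sub>R e" using r by simp
  then show ?thesis using that y by blast
qed

section \<open>Needle variations\<close>

definition needle_start :: "(nat \<Rightarrow> real) \<Rightarrow> (nat \<Rightarrow> real) \<Rightarrow> nat \<Rightarrow> real" where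
  "needle_start \<tau> a i = \<tau> i + (\<Sum>j<i. a j)"

text \<open>Half-open, so that adjoining needles are disjoint and a needle of length 0 is
  empty.\<close>

definition needle_interval :: "(nat \<Rightarrow> real) \<Rightarrow> (nat \<Rightarrow> real) \<Rightarrow> nat \<Rightarrow> real set" where
  "needle_interval \<tau> a i = {needle_start \<tau> a i<..needle_start \<tau> a i + a i}"

primrec needles :: "(nat \<Rightarrow> real) \<Rightarrow> (nat \<Rightarrow> 'b) \<Rightarrow> (real \<Rightarrow> 'b) \<Rightarrow> (nat \<Rightarrow> real) \<Rightarrow> nat \<Rightarrow> real \<Rightarrow> 'b" where
  "needles \<tau> v u a 0 t = u t"
| "needles \<tau> v u a (Suc n) t = (if t \<in> needle_interval \<tau> a n then v n else needles \<tau> v u a n t)"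

lemma needles_cases:
  "needles \<tau> v u a n t = u t \<or> (\<exists>i<n. t \<in> needle_interval \<tau> a i \<and> needles \<tau> v u a n t = v i)"
  by (induction n) (auto simp: less_Suc_eq)

lemma needles_differ:
  "needles \<tau> v u a n t \<noteq> needles \<tau> v u b n t \<Longrightarrow>
    \<exists>i<n. (t \<in> needle_interval \<tau> a i) \<noteq> (t \<in> needle_interval \<tau> b i)"
  by (induction n) (auto simp: less_Suc_eq split: if_splits)

lemma needles_measurable:
  "u \<in> borel_measurable M \<Longrightarrow> (\<And>s t. {s<..t} \<inter> space M \<in> sets M) \<Longrightarrow>
    needles \<tau> v u a n \<in> borel_measurable (M :: real measure)"
proof (induction n)
  case 0
  then show ?case by (simp add: needles.simps(1)[abs_def])
next
  case (Suc n)
  have "{t \<in> space M. t \<in> needle_interval \<tau> a n} \<in> sets M"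
    using Suc.prems(2)[of "needle_start \<tau> a n" "needle_start \<tau> a n + a n"]
    by (simp add: needle_interval_def Int_def conj_commute)
  then show ?case
    unfolding needles.simps(2)[abs_def] using Suc by (intro measurable_If) auto
qed

lemma needle_interval_bounds:
  assumes "i < n" "\<And>j. 0 \<le> a j" "t \<in> needle_interval \<tau> a i"
  shows "\<tau> i < t" "t \<le> \<tau> i + (\<Sum>j<n. a j)"
proof -
  have 0: "0 \<le> (\<Sum>j<i. a j)" using assms(2) by (intro sum_nonneg) auto
  then show "\<tau> i < t" using assms(3) by (auto simp: needle_interval_def needle_start_def)
  have "(\<Sum>j<i. a j) + a i = (\<Sum>j<Suc i. a j)" by simp
  also have "\<dots> \<le> (\<Sum>j<n. a j)" using assms(1,2) by (intro sum_mono2) auto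
  finally show "t \<le> \<tau> i + (\<Sum>j<n. a j)" using assms(3) by (auto simp: needle_interval_def needle_start_def)
qed

text \<open>Needles attached to the same point are laid side by side, so no disjointness of the points
  \<open>\<tau> i\<close> has to be assumed.\<close>

lemma needle_intervals_disjoint:
  assumes a: "\<And>j. 0 \<le> a j" and sep: "\<And>i j. i < n \<Longrightarrow> j < n \<Longrightarrow> \<tau> i \<noteq> \<tau> j \<Longrightarrow> (\<Sum>j<n. a j) \<le> \<bar>\<tau> i - \<tau> j\<bar>"
    and ij: "i < j" "j < n"
  shows "needle_interval \<tau> a i \<inter> needle_interval \<tau> a j = {}"
proof (rule ccontr)
  assume "needle_interval \<tau> a i \<inter> needle_interval \<tau> a j \<noteq> {}"
  then obtain t where t: "t \<in> needle_interval \<tau> a i" "t \<in> needle_interval \<tau> a j" by blast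
  have i: "i < n" using ij by simp
  note bi = needle_interval_bounds[OF i a t(1)] and bj = needle_interval_bounds[OF ij(2) a t(2)]
  show False
  proof (cases "\<tau> i = \<tau> j")
    case True
    have "(\<Sum>j<i. a j) + a i = (\<Sum>j<Suc i. a j)" by simp
    also have "\<dots> \<le> (\<Sum>k<j. a k)" using ij(1) a by (intro sum_mono2) auto
    finally show False using t True by (auto simp: needle_interval_def needle_start_def)
  next
    case False
    then show False using sep[OF i ij(2) False] bi bj by linarith
  qed
qed

text \<open>The symmetric difference lies in the two segments swept by the left and the right end,
  each of which moves by at most the sum of the changes of length.\<close>

lemma needle_interval_symdiff_measure:
  fixes a b \<tau> :: "nat \<Rightarrow> real" and i :: nat
  assumes "\<And>j. 0 \<le> a j" "\<And>j. 0 \<le> b j"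
  defines "E \<equiv> {t. (t \<in> needle_interval \<tau> a i) \<noteq> (t \<in> needle_interval \<tau> b i)}"
  shows "E \<in> lmeasurable" "measure lebesgue E \<le> 2 * (\<Sum>j<Suc i. \<bar>a j - b j\<bar>)"
proof -
  let ?s = "needle_start \<tau> a i" and ?r = "needle_start \<tau> b i"
  let ?C = "{min ?s ?r..max ?s ?r} \<union> {min (?s + a i) (?r + b i)..max (?s + a i) (?r + b i)}"
  have eq: "E = (needle_interval \<tau> a i - needle_interval \<tau> b i) \<union> (needle_interval \<tau> b i - needle_interval \<tau> a i)"
    by (auto simp: E_def)
  show El: "E \<in> lmeasurable"
  proof -
    have "{s<..t} \<in> lmeasurable" for s t :: real
      by (rule bounded_set_imp_lmeasurable) (auto intro: bounded_subset[of "{s..t}"])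
    then show ?thesis
      unfolding eq needle_interval_def by (intro fmeasurable.Un fmeasurable_Diff fmeasurableD)
  qed
  have "E \<subseteq> ?C" by (auto simp: E_def needle_interval_def min_def max_def)
  then have "measure lebesgue E \<le> measure lebesgue ?C"
    using El by (intro measure_mono_fmeasurable fmeasurable.Un) (auto dest: fmeasurableD)
  also have "\<dots> \<le> measure lebesgue {min ?s ?r..max ?s ?r} + measure lebesgue {min (?s + a i) (?r + b i)..max (?s + a i) (?r + b i)}"
    by (intro measure_Un_le) auto
  also have "\<dots> = \<bar>?s - ?r\<bar> + \<bar>(?s + a i) - (?r + b i)\<bar>" by (simp add: min_def max_def)
  also have "?s - ?r = (\<Sum>j<i. a j - b j)" by (simp add: needle_start_def sum_subtractf)
  also have "(?s + a i) - (?r + b i) = (\<Sum>j<Suc i. a j - b j)" by (simp add: needle_start_def sum_subtractf)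
  also have "\<bar>\<Sum>j<i. a j - b j\<bar> \<le> (\<Sum>j<Suc i. \<bar>a j - b j\<bar>)"
    using sum_abs[of "\<lambda>j. a j - b j" "{..<i}"] by (simp add: add_increasing2)
  also have "\<bar>\<Sum>j<Suc i. a j - b j\<bar> \<le> (\<Sum>j<Suc i. \<bar>a j - b j\<bar>)" by (rule sum_abs)
  finally show "measure lebesgue E \<le> 2 * (\<Sum>j<Suc i. \<bar>a j - b j\<bar>)" by simp
qed

lemma needles_integral:
  fixes g :: "real \<Rightarrow> 'b \<Rightarrow> real"
  assumes a: "\<And>j. 0 \<le> a j" and sep: "\<And>i j. i < n \<Longrightarrow> j < n \<Longrightarrow> \<tau> i \<noteq> \<tau> j \<Longrightarrow> (\<Sum>j<n. a j) \<le> \<bar>\<tau> i - \<tau> j\<bar>"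
    and g0: "\<And>t. g t (u t) = 0" and \<tau>: "\<And>i. i < n \<Longrightarrow> 0 < \<tau> i"
    and gi: "\<And>i R. i < n \<Longrightarrow> (\<lambda>t. g t (v i)) integrable_on {0..R}"
  shows "((\<lambda>t. g t (needles \<tau> v u a n t)) has_integral
    (\<Sum>i<n. integral {needle_start \<tau> a i..needle_start \<tau> a i + a i} (\<lambda>t. g t (v i)))) {0..}"
proof -
  have "((\<lambda>t. g t (needles \<tau> v u a m t)) has_integral
    (\<Sum>i<m. integral {needle_start \<tau> a i..needle_start \<tau> a i + a i} (\<lambda>t. g t (v i)))) {0..}" if "m \<le> n" for m
    using that
  proof (induction m)
    case 0
    then show ?case by (simp add: g0)
  next
    case (Suc m)
    have m: "m < n" using Suc by simp
    let ?I = "needle_interval \<tau> a m" and ?s = "needle_start \<tau> a m"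
    have s0: "0 \<le> ?s" using \<tau>[OF m] a by (simp add: needle_start_def sum_nonneg add_nonneg_nonneg less_imp_le)
    have "(\<lambda>t. g t (v m)) integrable_on {?s..?s + a m}"
      by (rule integrable_on_subinterval[OF gi[OF m, of "?s + a m"]]) (use s0 in auto)
    then have "((\<lambda>t. g t (v m)) has_integral integral {?s..?s + a m} (\<lambda>t. g t (v m))) {?s..?s + a m}"
      by (rule integrable_integral)
    then have "((\<lambda>t. if t \<in> {?s..?s + a m} then g t (v m) else 0) has_integral integral {?s..?s + a m} (\<lambda>t. g t (v m))) {0..}"
      by (subst has_integral_restrict) (use s0 in auto)
    then have 1: "((\<lambda>t. if t \<in> ?I then g t (v m) else 0) has_integral integral {?s..?s + a m} (\<lambda>t. g t (v m))) {0..}"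
      by (rule has_integral_spike[OF negligible_sing[of ?s], rotated]) (auto simp: needle_interval_def)
    have 2: "((\<lambda>t. g t (needles \<tau> v u a m t)) has_integral
      (\<Sum>i<m. integral {needle_start \<tau> a i..needle_start \<tau> a i + a i} (\<lambda>t. g t (v i)))) {0..}"
      using Suc by simp
    \<comment> \<open>Inside the new interval no earlier needle is active, so the old integrand
      vanishes there by \<open>g0\<close>.\<close>
    have "g t (needles \<tau> v u a (Suc m) t) = g t (needles \<tau> v u a m t) + (if t \<in> ?I then g t (v m) else 0)" for t
    proof (cases "t \<in> ?I")
      case True
      have "needle_interval \<tau> a i \<inter> ?I = {}" if "i < m" for i
        by (rule needle_intervals_disjoint[where n=n, OF a _ that m]) (rule sep; assumption)
      then have "\<not> (\<exists>i<m. t \<in> needle_interval \<tau> a i)" using True by blast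
      then have "needles \<tau> v u a m t = u t" using needles_cases by metis
      then show ?thesis using True by (simp add: g0)
    qed simp
    then show ?case using has_integral_add[OF 2 1] by simp
  qed
  then show ?thesis by simp
qed

text \<open>The needle starts not at \<open>\<tau> i\<close> but shifted by the lengths of the
  earlier ones, so its integral is a difference of two values of the primitive, each expanded at
  \<open>\<tau> i\<close>. The error is therefore relative to the total length of all needles, not
  to \<open>a i\<close>.\<close>

lemma needle_integral_asymptotics:
  fixes g :: "real \<Rightarrow> real"
  assumes g: "\<And>R. g integrable_on {0..R}" and \<tau>: "\<tau> i > 0"
    and der: "((\<lambda>t. integral {0..t} g) has_vector_derivative g (\<tau> i)) (at (\<tau> i))" and e: "e > 0"
  shows "\<exists>r>0. \<forall>a n. (\<forall>j. 0 \<le> a j) \<longrightarrow> i < n \<longrightarrow> (\<Sum>j<n. a j) \<le> r \<longrightarrow>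
    \<bar>integral {needle_start \<tau> a i..needle_start \<tau> a i + a i} g - a i * g (\<tau> i)\<bar> \<le> e * (\<Sum>j<n. a j)"
proof -
  let ?F = "\<lambda>t. integral {0..t} g"
  have "e / 2 > 0" using e by simp
  then obtain d where d: "d > 0" "\<And>y. norm (y - \<tau> i) < d \<Longrightarrow>
      norm (?F y - ?F (\<tau> i) - (y - \<tau> i) *\<^sub>R g (\<tau> i)) \<le> e/2 * norm (y - \<tau> i)"
    using der unfolding has_vector_derivative_def has_derivative_at_alt by blast
  show ?thesis
  proof (intro exI[of _ "d/2"] conjI allI impI)
    fix a :: "nat \<Rightarrow> real" and n assume a: "\<forall>j. 0 \<le> a j" and n: "i < n" and s: "(\<Sum>j<n. a j) \<le> d/2"
    let ?s = "needle_start \<tau> a i"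
    define A1 where "A1 = (\<Sum>j<i. a j)"
    have A1: "0 \<le> A1" unfolding A1_def using a by (intro sum_nonneg) auto
    have "A1 + a i = (\<Sum>j<Suc i. a j)" by (simp add: A1_def)
    also have "\<dots> \<le> (\<Sum>j<n. a j)" using n a by (intro sum_mono2) auto
    finally have A2: "A1 + a i \<le> (\<Sum>j<n. a j)" .
    have ai: "0 \<le> a i" using a by blast
    have st: "?s = \<tau> i + A1" by (simp add: needle_start_def A1_def)
    have 1: "\<bar>?F ?s - ?F (\<tau> i) - A1 * g (\<tau> i)\<bar> \<le> e/2 * A1"
      using d(2)[of ?s] A1 A2 ai s d(1) by (simp add: st)
    have 2: "\<bar>?F (?s + a i) - ?F (\<tau> i) - (A1 + a i) * g (\<tau> i)\<bar> \<le> e/2 * (A1 + a i)"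
      using d(2)[of "?s + a i"] A1 A2 ai s d(1) by (simp add: st add.assoc)
    have "integral {?s..?s + a i} g = ?F (?s + a i) - ?F ?s"
      using integral_diff_interval[OF g, of ?s "?s + a i"] \<tau> A1 ai by (simp add: st)
    moreover have "e/2 * A1 + e/2 * (A1 + a i) \<le> e * (\<Sum>j<n. a j)"
    proof -
      have "e/2 * (A1 + (A1 + a i)) \<le> e/2 * (2 * (\<Sum>j<n. a j))"
        using A2 ai e by (intro mult_left_mono) auto
      then show ?thesis by (simp only: distrib_left)
    qed
    moreover have "(A1 + a i) * g (\<tau> i) = A1 * g (\<tau> i) + a i * g (\<tau> i)" by (rule distrib_right)
    ultimately show "\<bar>integral {?s..?s + a i} g - a i * g (\<tau> i)\<bar> \<le> e * (\<Sum>j<n. a j)"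
      using 1 2 by linarith
  qed (use d in simp)
qed

lemma finite_positive_lower_bound:
  fixes f :: "'i \<Rightarrow> real"
  assumes "finite A" "\<forall>a\<in>A. f a > 0"
  shows "\<exists>r>0. \<forall>a\<in>A. r \<le> f a"
proof (intro exI conjI ballI)
  show "Min (insert 1 (f ` A)) > 0" using assms by (subst Min_gr_iff) auto
  show "Min (insert 1 (f ` A)) \<le> f a" if "a \<in> A" for a using assms(1) that by (intro Min_le) auto
qed

section \<open>Needle controls and the descent argument\<close>

context control_problem
begin

lemma ctrl_needles:
  assumes a: "\<And>j. 0 \<le> a j" and v: "\<And>i. i < n \<Longrightarrow> v i \<in> U1"
    and T: "\<And>i. i < n \<Longrightarrow> \<tau> i + (\<Sum>j<n. a j) \<le> T"
  shows "ctrl (needles \<tau> v us a n)"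
  unfolding ctrl_def
proof (intro conjI allI impI)
  show "needles \<tau> v us a n \<in> borel_measurable leb_half"
  proof (rule needles_measurable[OF us(1)])
    fix s t :: real
    have "{0..} \<inter> {s<..t} \<in> sets leb_half"
      unfolding sets_restrict_space by (rule imageI) simp
    then show "{s<..t} \<inter> space leb_half \<in> sets leb_half" by (simp add: Int_commute)
  qed
  show "needles \<tau> v us a n t \<in> U1" if "0 \<le> t" for t
    using needles_cases[of \<tau> v us a n t] v us(2)[OF that] by auto
  show "needles \<tau> v us a n t = us t" if "T < t" for t
    using needles_cases[of \<tau> v us a n t] needle_interval_bounds(2)[OF _ a] T that by fastforce
qed

lemma measure_diffset_needles_us:
  assumes a: "\<And>j. 0 \<le> a j" and u: "ctrl (needles \<tau> v us a n)"
  shows "measure lebesgue (diffset (needles \<tau> v us a n) us) \<le> (\<Sum>j<n. a j)"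
proof -
  have lm: "needle_interval \<tau> a i \<in> lmeasurable" for i
    unfolding needle_interval_def
    by (rule bounded_set_imp_lmeasurable)
      (auto intro: bounded_subset[of "{needle_start \<tau> a i..needle_start \<tau> a i + a i}"])
  have "measure lebesgue (diffset (needles \<tau> v us a n) us) \<le> measure lebesgue (\<Union>i<n. needle_interval \<tau> a i)"
  proof (rule measure_mono_fmeasurable)
    show "diffset (needles \<tau> v us a n) us \<subseteq> (\<Union>i<n. needle_interval \<tau> a i)"
      using needles_cases[of \<tau> v us a n] by (fastforce simp: diffset_def)
    show "diffset (needles \<tau> v us a n) us \<in> sets lebesgue" using diffset(2)[OF u ctrl_us] by (rule fmeasurableD)
    show "(\<Union>i<n. needle_interval \<tau> a i) \<in> lmeasurable" using lm by (intro fmeasurable.finite_UN) auto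
  qed
  also have "\<dots> \<le> (\<Sum>i<n. measure lebesgue (needle_interval \<tau> a i))"
    by (rule measure_UNION_le) (auto intro: fmeasurableD lm)
  also have "\<dots> = (\<Sum>j<n. a j)" using a by (intro sum.cong) (auto simp: needle_interval_def)
  finally show ?thesis .
qed

lemma measure_diffset_needles:
  assumes a: "\<And>j. 0 \<le> a j" and b: "\<And>j. 0 \<le> b j"
    and u: "ctrl (needles \<tau> v us a n)" "ctrl (needles \<tau> v us b n)"
  shows "measure lebesgue (diffset (needles \<tau> v us a n) (needles \<tau> v us b n)) \<le> n * (2 * (\<Sum>j<n. \<bar>a j - b j\<bar>))"
proof -
  let ?E = "\<lambda>i. {t. (t \<in> needle_interval \<tau> a i) \<noteq> (t \<in> needle_interval \<tau> b i)}"
  note E = needle_interval_symdiff_measure[of a b, OF a b]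
  have "measure lebesgue (diffset (needles \<tau> v us a n) (needles \<tau> v us b n)) \<le> measure lebesgue (\<Union>i<n. ?E i)"
  proof (rule measure_mono_fmeasurable)
    show "diffset (needles \<tau> v us a n) (needles \<tau> v us b n) \<subseteq> (\<Union>i<n. ?E i)"
      using needles_differ[of \<tau> v us a n _ b] by (fastforce simp: diffset_def)
    show "diffset (needles \<tau> v us a n) (needles \<tau> v us b n) \<in> sets lebesgue" using diffset(2)[OF u] by (rule fmeasurableD)
    show "(\<Union>i<n. ?E i) \<in> lmeasurable" using E(1) by (intro fmeasurable.finite_UN) auto
  qed
  also have "\<dots> \<le> (\<Sum>i<n. measure lebesgue (?E i))"
    by (rule measure_UNION_le[OF finite_lessThan fmeasurableD[OF E(1)]])
  also have "\<dots> \<le> (\<Sum>i<n. 2 * (\<Sum>j<n. \<bar>a j - b j\<bar>))"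
  proof (rule sum_mono)
    fix i assume "i \<in> {..<n}"
    then have "(\<Sum>j<Suc i. \<bar>a j - b j\<bar>) \<le> (\<Sum>j<n. \<bar>a j - b j\<bar>)" by (intro sum_mono2) auto
    then show "measure lebesgue (?E i) \<le> 2 * (\<Sum>j<n. \<bar>a j - b j\<bar>)" using E(2)[of \<tau> i] by linarith
  qed
  also have "\<dots> = n * (2 * (\<Sum>j<n. \<bar>a j - b j\<bar>))" by simp
  finally show ?thesis .
qed

text \<open>Bounds the defect that \<open>sol_exists\<close> and \<open>sol_stable\<close> ask for,
  uniformly in \<open>t\<close>: velocities differ by at most \<open>2 * K\<close>, and only where
  the controls differ.\<close>

lemma control_change_bound:
  assumes x: "traj x" and u: "ctrl u" and v: "ctrl v"
  shows "norm (integral {0..t} (\<lambda>t. \<phi> t (x t) (u t)) - integral {0..t} (\<lambda>t. \<phi> t (x t) (v t)))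
    \<le> 2 * K * measure lebesgue (diffset u v)"
proof -
  note N = ind_diffset_has_integral[OF u v, of "2 * K"]
  note I = phi_traj_integrable[OF x u, of t] phi_traj_integrable[OF x v, of t]
  have Ni: "(\<lambda>t. if t \<in> diffset u v then 2 * K else 0) integrable_on {0..t}"
    by (rule integrable_on_subinterval[OF has_integral_integrable[OF N]]) auto
  have "norm (integral {0..t} (\<lambda>t. \<phi> t (x t) (u t) - \<phi> t (x t) (v t))) \<le>
    integral {0..t} (\<lambda>t. if t \<in> diffset u v then 2 * K else 0)"
  proof (rule integral_norm_bound_integral[OF integrable_diff[OF I] Ni])
    fix s assume "s \<in> {0..t}"
    then have s: "s \<ge> 0" by simp
    show "norm (\<phi> s (x s) (u s) - \<phi> s (x s) (v s)) \<le> (if s \<in> diffset u v then 2 * K else 0)"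
    proof (cases "s \<in> diffset u v")
      case True
      then show ?thesis
        using norm_triangle_ineq4[of "\<phi> s (x s) (u s)" "\<phi> s (x s) (v s)"] phi_traj(2)[OF x u s] phi_traj(2)[OF x v s] by simp
    next
      case False
      then have "u s = v s" using s by (simp add: diffset_def)
      then show ?thesis using False by simp
    qed
  qed
  also have "\<dots> \<le> integral {0..} (\<lambda>t. if t \<in> diffset u v then 2 * K else 0)"
    using pos by (intro integral_subset_le Ni has_integral_integrable[OF N]) auto
  also have "\<dots> = 2 * K * measure lebesgue (diffset u v)" by (rule integral_unique[OF N])
  finally show ?thesis by (simp add: integral_diff[OF I])
qed

lemma needle_gain_integrable:
  assumes p: "costate lam0 l1 p" and v: "v \<in> U1"
  shows "(\<lambda>t. needle_gain lam0 p t v) integrable_on {0..R}"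
proof -
  obtain P where P: "P \<ge> 0" "\<And>t. t \<ge> 0 \<Longrightarrow> norm (p t) \<le> P" using costate_bounded[OF p] by blast
  have vm: "(\<lambda>t::real. v) \<in> borel_measurable leb_half" by simp
  have z: "norm (xs t - xs t) \<le> \<gamma>" for t using pos by simp
  have m: "(\<lambda>t. \<phi> t (xs t) v) \<in> borel_measurable leb_half" "(\<lambda>t. f t (xs t) v) \<in> borel_measurable leb_half"
    using measurable_compose_tube[OF phi_uc xs_meas vm z v] measurable_compose_tube[OF f_uc xs_meas vm z v] by auto
  have b: "norm (\<phi> t (xs t) v) \<le> K" "norm (f t (xs t) v) \<le> K" if "t \<ge> 0" for t
    using phi_bound[OF that z v] f_bound[OF that z v] by auto
  have "(\<lambda>t. p t \<bullet> (\<phi> t (xs t) v - \<phi> t (xs t) (us t))) absolutely_integrable_on {0..R}"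
  proof (rule bounded_measurable_absolutely_integrable)
    show "(\<lambda>t. p t \<bullet> (\<phi> t (xs t) v - \<phi> t (xs t) (us t))) \<in> borel_measurable leb_half"
      using costate_measurable[OF p] m(1) phi_traj(1)[OF traj_xs ctrl_us] by measurable
    fix t :: real assume t: "t \<ge> 0"
    have "norm (\<phi> t (xs t) v - \<phi> t (xs t) (us t)) \<le> 2 * K"
      using norm_triangle_ineq4[of "\<phi> t (xs t) v" "\<phi> t (xs t) (us t)"] b(1)[OF t] phi_traj(2)[OF traj_xs ctrl_us t] by simp
    then show "norm (p t \<bullet> (\<phi> t (xs t) v - \<phi> t (xs t) (us t))) \<le> P * (2 * K)"
      using Cauchy_Schwarz_ineq2[of "p t" "\<phi> t (xs t) v - \<phi> t (xs t) (us t)"]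
        mult_mono[OF P(2)[OF t] _ P(1) norm_ge_zero] by (metis order_trans real_norm_def)
  qed
  moreover have "(\<lambda>t. lam0 * (\<omega> t * (f t (xs t) v - f t (xs t) (us t)))) absolutely_integrable_on {0..}"
  proof -
    have "norm (f t (xs t) v - f t (xs t) (us t)) \<le> 2 * K" if t: "t \<ge> 0" for t
      using norm_triangle_ineq4[of "f t (xs t) v" "f t (xs t) (us t)"] b(2)[OF t] f_traj(2)[OF traj_xs ctrl_us t] by simp
    moreover have "(\<lambda>t. f t (xs t) v - f t (xs t) (us t)) \<in> borel_measurable leb_half"
      using m(2) f_traj(1)[OF traj_xs ctrl_us] by measurable
    ultimately have "(\<lambda>t. (f t (xs t) v - f t (xs t) (us t)) \<bullet> \<omega> t) absolutely_integrable_on {0..}"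
      using omega by (intro absolutely_integrable_inner_bounded) auto
    then show ?thesis by (intro set_integrable_mult_right) (simp add: mult.commute)
  qed
  then have "(\<lambda>t. lam0 * (\<omega> t * (f t (xs t) v - f t (xs t) (us t)))) absolutely_integrable_on {0..R}"
    by (rule absolutely_integrable_on_subinterval) auto
  ultimately have "(\<lambda>t. p t \<bullet> (\<phi> t (xs t) v - \<phi> t (xs t) (us t))) integrable_on {0..R}"
    "(\<lambda>t. lam0 * (\<omega> t * (f t (xs t) v - f t (xs t) (us t)))) integrable_on {0..R}"
    by (auto simp: absolutely_integrable_on_def)
  then show ?thesis unfolding needle_gain_def mult.assoc by (rule integrable_diff)
qed

text \<open>For \<open>y\<close> in the unit ball of \<open>W\<close>, needles of lengths \<open>\<rho> \<alpha> i y\<close> move the end point by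
  \<open>\<rho> (y + e) + o(\<rho>)\<close>. By Brouwer some \<open>y\<close> moves it by exactly \<open>\<rho> e\<close>, where \<open>e\<close> lowers the cost
  and keeps the boundary conditions.\<close>

lemma needle_descent:
  fixes W B :: "(real \<times> 'c \<times> 'd) set" and p :: "real \<times> 'c \<times> 'd \<Rightarrow> real \<Rightarrow> 'a"
    and N :: nat and g :: "nat \<Rightarrow> real \<times> 'c \<times> 'd" and \<alpha> :: "nat \<Rightarrow> real \<times> 'c \<times> 'd \<Rightarrow> real"
    and s :: "nat \<Rightarrow> real" and y0 :: "nat \<Rightarrow> 'a" and \<tau> :: "nat \<Rightarrow> real" and v :: "nat \<Rightarrow> 'b"
  assumes W: "subspace W" and B: "finite B" "B \<subseteq> W" "pairwise orthogonal B" "\<And>b. b \<in> B \<Longrightarrow> norm b = 1" "span B = W"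
    and p: "\<And>b. b \<in> B \<Longrightarrow> costate (fst b) (snd (snd b)) (p b)"
    and g: "\<And>b i. b \<in> B \<Longrightarrow> i < N \<Longrightarrow> b \<bullet> g i = fst b * s i
        + (adjoint H0 (fst (snd b)) - p b 0) \<bullet> y0 i - needle_gain (fst b) (p b) (\<tau> i) (v i)"
    and \<tau>: "\<And>i. i < N \<Longrightarrow> 0 < \<tau> i" "\<And>i. i < N \<Longrightarrow> \<tau> i < T" and v: "\<And>i. i < N \<Longrightarrow> v i \<in> U1"
    and s: "\<And>i. i < N \<Longrightarrow> 0 \<le> s i"
    and der: "\<And>b i. b \<in> B \<Longrightarrow> i < N \<Longrightarrow> ((\<lambda>t. integral {0..t} (\<lambda>t. needle_gain (fst b) (p b) t (v i)))
        has_vector_derivative needle_gain (fst b) (p b) (\<tau> i) (v i)) (at (\<tau> i))"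
    and \<alpha>: "\<And>i. continuous_on UNIV (\<alpha> i)" "\<And>i y. 0 \<le> \<alpha> i y"
    and e: "e = (-1, 0, 0)" "e \<in> W" "\<And>y. y \<in> W \<Longrightarrow> (\<Sum>i<N. \<alpha> i y *\<^sub>R g i) = y + e"
    and range: "\<And>y u x r. sol y u x \<Longrightarrow> (r, h0 (x 0), h1lim x) \<in> W"
    and feas: "h0 (xs 0) = 0" "h1lim xs = 0" and \<epsilon>: "\<epsilon> > 0"
  shows "\<exists>y u x. sol y u x \<and> (\<forall>t\<ge>0. norm (x t - xs t) \<le> \<epsilon>) \<and> J x u < J xs us \<and> h0 (x 0) = 0 \<and> h1lim x = 0 \<and>
    (\<forall>t. u t = us t \<or> (\<exists>i<N. u t = v i))"
proof -
  let ?Q = "cball 0 1 \<inter> W"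
  have compQ: "compact ?Q" using closed_subspace[OF W] by (simp add: compact_Int_closed)
  have contS: "continuous_on ?Q (\<lambda>y. \<Sum>i<N. \<alpha> i y)"
    by (intro continuous_intros continuous_on_subset[OF \<alpha>(1)]) auto
  obtain Am where Am: "Am > 0" "\<And>y. y \<in> ?Q \<Longrightarrow> (\<Sum>i<N. \<alpha> i y) \<le> Am"
  proof -
    have "bounded ((\<lambda>y. \<Sum>i<N. \<alpha> i y) ` ?Q)"
      by (intro compact_imp_bounded compact_continuous_image contS compQ)
    then obtain A' where A': "A' > 0" "\<forall>z\<in>(\<lambda>y. \<Sum>i<N. \<alpha> i y) ` ?Q. norm z \<le> A'" unfolding bounded_pos by blast
    show ?thesis
    proof (rule that[OF A'(1)])
      fix y assume "y \<in> ?Q"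
      then have "norm (\<Sum>i<N. \<alpha> i y) \<le> A'" using A'(2) by blast
      then show "(\<Sum>i<N. \<alpha> i y) \<le> A'" by simp
    qed
  qed
  define Ym where "Ym = (\<Sum>i<N. norm (y0 i))"
  have Ym: "Ym \<ge> 0" by (simp add: Ym_def sum_nonneg)
  \<comment> \<open>With needles of total length at most \<open>\<rho> * Am\<close>, initial shift
    and control change together cause a defect of at most \<open>c1 * \<rho>\<close>.\<close>
  define c1 where "c1 = (Ym + 2 * K) * Am"
  have c1: "c1 > 0" unfolding c1_def using Ym pos Am by (intro mult_pos_pos) auto
  have wm: "wmax > 0" by (simp add: wmax_def)
  \<comment> \<open>Per unit of \<open>\<rho>\<close>, the first term bounds the displacement of the
    trajectory and the second the total needle length.\<close>
  define M where "M = 4 * c1 * wmax + Am"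
  have M: "M > 0" unfolding M_def using c1 wm Am by (intro add_pos_pos mult_pos_pos) auto
  \<comment> \<open>Makes each of the \<open>card B\<close> coordinates of the error at most
    \<open>\<rho> / (card B + 1)\<close>, so that the whole error stays within
    \<open>\<rho>\<close>.\<close>
  define e1 where "e1 = 1 / ((card B + 1) * M)"
  have e1: "e1 > 0" using M by (simp add: e1_def)
  have e1': "e1 / (N + 1) > 0" using e1 by simp
  obtain rv where rv: "\<And>b. b \<in> B \<Longrightarrow> rv b > 0"
    "\<And>b y u x Bx. b \<in> B \<Longrightarrow> sol y u x \<Longrightarrow> Bx \<le> rv b \<Longrightarrow> (\<forall>t\<ge>0. norm (x t - xs t) \<le> Bx) \<Longrightarrow>
      measure lebesgue (diffset u us) \<le> rv b \<Longrightarrow>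
      \<bar>fst b * (J x u - J xs us) + fst (snd b) \<bullet> (h0 (x 0) - h0 (xs 0)) + snd (snd b) \<bullet> (h1lim x - h1lim xs)
      + integral {0..} (\<lambda>t. needle_gain (fst b) (p b) t (u t)) - (adjoint H0 (fst (snd b)) - p b 0) \<bullet> y\<bar> \<le> e1 * Bx"
  proof -
    have "\<forall>b\<in>B. \<exists>\<rho>>0. \<forall>y u x Bx. sol y u x \<longrightarrow> Bx \<le> \<rho> \<longrightarrow> (\<forall>t\<ge>0. norm (x t - xs t) \<le> Bx) \<longrightarrow>
      measure lebesgue (diffset u us) \<le> \<rho> \<longrightarrow>
      \<bar>fst b * (J x u - J xs us) + fst (snd b) \<bullet> (h0 (x 0) - h0 (xs 0)) + snd (snd b) \<bullet> (h1lim x - h1lim xs)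
      + integral {0..} (\<lambda>t. needle_gain (fst b) (p b) t (u t)) - (adjoint H0 (fst (snd b)) - p b 0) \<bullet> y\<bar> \<le> e1 * Bx"
      using variation_formula[OF p e1] by blast
    from bchoice[OF this] show ?thesis using that by blast
  qed
  obtain rn where rn: "\<And>b i. b \<in> B \<Longrightarrow> i < N \<Longrightarrow> rn b i > 0"
    "\<And>b i a. b \<in> B \<Longrightarrow> i < N \<Longrightarrow> (\<forall>j. 0 \<le> a j) \<Longrightarrow> (\<Sum>j<N. a j) \<le> rn b i \<Longrightarrow>
      \<bar>integral {needle_start \<tau> a i..needle_start \<tau> a i + a i} (\<lambda>t. needle_gain (fst b) (p b) t (v i))
        - a i * needle_gain (fst b) (p b) (\<tau> i) (v i)\<bar> \<le> e1 / (N + 1) * (\<Sum>j<N. a j)"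
  proof -
    have "\<exists>r>0. \<forall>a. (\<forall>j. 0 \<le> a j) \<longrightarrow> (\<Sum>j<N. a j) \<le> r \<longrightarrow>
      \<bar>integral {needle_start \<tau> a i..needle_start \<tau> a i + a i} (\<lambda>t. needle_gain (fst b) (p b) t (v i))
        - a i * needle_gain (fst b) (p b) (\<tau> i) (v i)\<bar> \<le> e1 / (N + 1) * (\<Sum>j<N. a j)" if "b \<in> B" "i < N" for b i
      using needle_integral_asymptotics[where \<tau>=\<tau> and i=i and g="\<lambda>t. needle_gain (fst b) (p b) t (v i)",
          OF needle_gain_integrable[OF p[OF that(1)] v[OF that(2)]] \<tau>(1)[OF that(2)] der[OF that] e1'] that(2)
      by blast
    then show ?thesis using that by metis
  qed
  obtain R1 where R1: "R1 > 0" "\<And>b. b \<in> B \<Longrightarrow> R1 \<le> rv b"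
    using finite_positive_lower_bound[of B rv] B(1) rv(1) by blast
  obtain R2 where R2: "R2 > 0" "\<And>b i. b \<in> B \<Longrightarrow> i < N \<Longrightarrow> R2 \<le> rn b i"
  proof -
    have "\<exists>r>0. \<forall>z\<in>B \<times> {..<N}. r \<le> rn (fst z) (snd z)"
      using B(1) rn(1) by (intro finite_positive_lower_bound) auto
    then show ?thesis using that by auto
  qed
  obtain R3 where R3: "R3 > 0" "\<And>i j. i < N \<Longrightarrow> j < N \<Longrightarrow> \<tau> i \<noteq> \<tau> j \<Longrightarrow> R3 \<le> \<bar>\<tau> i - \<tau> j\<bar>"
  proof -
    have "finite ({(i, j). i < N \<and> j < N \<and> \<tau> i \<noteq> \<tau> j})"
      by (rule finite_subset[of _ "{..<N} \<times> {..<N}"]) auto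
    then have "\<exists>r>0. \<forall>z\<in>{(i, j). i < N \<and> j < N \<and> \<tau> i \<noteq> \<tau> j}. r \<le> \<bar>\<tau> (fst z) - \<tau> (snd z)\<bar>"
      by (intro finite_positive_lower_bound) auto
    then show ?thesis using that by auto
  qed
  obtain R4 where R4: "R4 > 0" "\<And>i. i < N \<Longrightarrow> R4 \<le> T - \<tau> i"
  proof -
    have "\<exists>r>0. \<forall>i\<in>{..<N}. r \<le> T - \<tau> i"
      using \<tau>(2) by (intro finite_positive_lower_bound) auto
    then show ?thesis using that by auto
  qed
  \<comment> \<open>Respects the ranges of \<open>variation_formula\<close> and of the needle
    asymptotics, the gaps between distinct positions, the distance to \<open>T\<close>, the tube and
    \<open>\<epsilon>\<close>.\<close>
  define m0 where "m0 = Min {R1, R2, R3, R4, \<gamma>, \<epsilon>}"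
  have m0: "m0 > 0" "m0 \<le> R1" "m0 \<le> R2" "m0 \<le> R3" "m0 \<le> R4" "m0 \<le> \<gamma>" "m0 \<le> \<epsilon>"
    using R1(1) R2(1) R3(1) R4(1) pos \<epsilon> by (auto simp: m0_def)
  define \<rho> where "\<rho> = m0 / M"
  have \<rho>: "\<rho> > 0" "\<rho> * M = m0" using m0 M by (auto simp: \<rho>_def)
  have \<rho>c: "\<rho> * (4 * c1 * wmax) \<le> m0" "\<rho> * Am \<le> m0"
  proof -
    have "\<rho> * (4 * c1 * wmax) \<le> \<rho> * M" "\<rho> * Am \<le> \<rho> * M"
      using \<rho>(1) c1 wm Am(1) by (intro mult_left_mono; simp add: M_def)+
    then show "\<rho> * (4 * c1 * wmax) \<le> m0" "\<rho> * Am \<le> m0" using \<rho>(2) by simp_all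
  qed
  define a where "a y i = \<rho> * \<alpha> i y" for y i
  have a0: "0 \<le> a y j" for y j using \<alpha>(2) \<rho>(1) by (simp add: a_def)
  have aS: "(\<Sum>j<N. a y j) \<le> \<rho> * Am" if "y \<in> ?Q" for y
    unfolding a_def sum_distrib_left[symmetric] using Am(2)[OF that] \<rho>(1) by (intro mult_left_mono) auto
  have aS': "(\<Sum>j<N. a y j) \<le> m0" if "y \<in> ?Q" for y using aS[OF that] \<rho>c by linarith
  define u where "u y = needles \<tau> v us (a y) N" for y
  define yy where "yy y = (\<Sum>i<N. a y i *\<^sub>R y0 i)" for y
  have uc: "ctrl (u y)" if y: "y \<in> ?Q" for y
    unfolding u_def
  proof (rule ctrl_needles[OF a0 v])
    show "\<tau> i + (\<Sum>j<N. a y j) \<le> T" if "i < N" for i using R4(2)[OF that] aS'[OF y] m0 by linarith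
  qed
  have du: "measure lebesgue (diffset (u y) us) \<le> (\<Sum>j<N. a y j)" if "y \<in> ?Q" for y
    unfolding u_def by (rule measure_diffset_needles_us[OF a0 uc[OF that, unfolded u_def]])
  have nyy: "norm (yy y) \<le> Ym * (\<Sum>j<N. a y j)" for y
  proof -
    have "norm (yy y) \<le> (\<Sum>i<N. a y i * norm (y0 i))"
      unfolding yy_def using a0 by (intro sum_norm_le) simp
    also have "\<dots> \<le> (\<Sum>i<N. a y i * Ym)"
      unfolding Ym_def by (intro sum_mono mult_left_mono a0 member_le_sum) auto
    finally show ?thesis by (simp add: sum_distrib_left mult.commute)
  qed
  define Bx where "Bx = 4 * (c1 * \<rho>) * wmax"
  have Bx: "Bx \<le> m0" "Bx \<ge> 0" using \<rho>c(1) c1 \<rho> wm by (auto simp: Bx_def mult_ac)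
  have "\<exists>x. sol (yy y) (u y) x \<and> (\<forall>t\<ge>0. norm (x t - xs t) \<le> Bx)" if y: "y \<in> ?Q" for y
  proof -
    have "\<exists>x. sol (yy y) (u y) x \<and> (\<forall>t\<ge>0. norm (x t - xs t) \<le> 4 * (c1 * \<rho>) * wt t)"
    proof (rule sol_exists[OF uc[OF y]])
      fix t :: real assume "t \<ge> 0"
      have "norm (yy y + (integral {0..t} (\<lambda>t. \<phi> t (xs t) (u y t)) - integral {0..t} (\<lambda>t. \<phi> t (xs t) (us t))))
        \<le> Ym * (\<Sum>j<N. a y j) + 2 * K * measure lebesgue (diffset (u y) us)"
        by (intro norm_triangle_le add_mono nyy control_change_bound traj_xs uc[OF y] ctrl_us)
      also have "\<dots> \<le> Ym * (\<Sum>j<N. a y j) + 2 * K * (\<Sum>j<N. a y j)"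
        using du[OF y] pos by (intro add_left_mono mult_left_mono) auto
      also have "\<dots> = (Ym + 2 * K) * (\<Sum>j<N. a y j)" by (simp add: algebra_simps)
      also have "\<dots> \<le> (Ym + 2 * K) * (\<rho> * Am)" using aS[OF y] Ym pos by (intro mult_left_mono) auto
      also have "\<dots> = c1 * \<rho>" by (simp add: c1_def)
      finally show "norm (yy y + (integral {0..t} (\<lambda>t. \<phi> t (xs t) (u y t)) - integral {0..t} (\<lambda>t. \<phi> t (xs t) (us t)))) \<le> c1 * \<rho>" .
    next
      show "4 * (c1 * \<rho>) * wmax \<le> \<gamma>" using Bx m0 by (simp add: Bx_def)
    qed
    then obtain x where x: "sol (yy y) (u y) x" "\<And>t. t \<ge> 0 \<Longrightarrow> norm (x t - xs t) \<le> 4 * (c1 * \<rho>) * wt t" by blast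
    moreover have "4 * (c1 * \<rho>) * wt t \<le> Bx" if "t \<ge> 0" for t
      unfolding Bx_def using wt_le_wmax[OF that] c1 \<rho> by (intro mult_left_mono) auto
    ultimately show ?thesis using order_trans by blast
  qed
  then obtain X where X: "\<And>y. y \<in> ?Q \<Longrightarrow> sol (yy y) (u y) (X y)"
    "\<And>y t. y \<in> ?Q \<Longrightarrow> t \<ge> 0 \<Longrightarrow> norm (X y t - xs t) \<le> Bx" by metis
  \<comment> \<open>The slacks \<open>s i\<close> are added to the cost with the needle lengths as
    coefficients; being nonnegative, they can only make the final decrease of \<open>J\<close>
    larger.\<close>
  define F where "F y = (J (X y) (u y) - J xs us + (\<Sum>i<N. a y i * s i), h0 (X y 0), h1lim (X y))" for y
  have FW: "F y \<in> W" if "y \<in> ?Q" for y unfolding F_def by (rule range[OF X(1)[OF that]])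
  have close: "norm (F y - \<rho> *\<^sub>R (y + e)) \<le> \<rho>" if y: "y \<in> ?Q" for y
  proof -
    let ?S = "\<Sum>j<N. a y j"
    have S0: "?S \<ge> 0" using a0 by (simp add: sum_nonneg)
    have each: "\<bar>b \<bullet> (F y - \<rho> *\<^sub>R (y + e))\<bar> \<le> \<rho> / (card B + 1)" if b: "b \<in> B" for b
    proof -
      let ?G = "\<lambda>t v. needle_gain (fst b) (p b) t v"
      let ?I = "\<Sum>i<N. integral {needle_start \<tau> (a y) i..needle_start \<tau> (a y) i + a y i} (\<lambda>t. ?G t (v i))"
      have I: "integral {0..} (\<lambda>t. ?G t (u y t)) = ?I"
        unfolding u_def
      proof (rule integral_unique, rule needles_integral[OF a0])
        show "(\<Sum>j<N. a y j) \<le> \<bar>\<tau> i - \<tau> j\<bar>" if "i < N" "j < N" "\<tau> i \<noteq> \<tau> j" for i j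
          using R3(2)[OF that] aS'[OF y] m0 by linarith
        show "?G t (us t) = 0" for t by (simp add: needle_gain_def)
        show "(\<lambda>t. ?G t (v i)) integrable_on {0..R}" if "i < N" for i R
          by (rule needle_gain_integrable[OF p[OF b] v[OF that]])
      qed (rule \<tau>)
      have n1: "\<bar>?I - (\<Sum>i<N. a y i * ?G (\<tau> i) (v i))\<bar> \<le> e1 * ?S"
      proof -
        have "\<bar>?I - (\<Sum>i<N. a y i * ?G (\<tau> i) (v i))\<bar> \<le> (\<Sum>i<N. e1 / (N + 1) * ?S)"
          unfolding sum_subtractf[symmetric]
        proof (rule order_trans[OF sum_abs sum_mono])
          fix i assume "i \<in> {..<N}"
          then have i: "i < N" by simp
          show "\<bar>integral {needle_start \<tau> (a y) i..needle_start \<tau> (a y) i + a y i} (\<lambda>t. ?G t (v i)) - a y i * ?G (\<tau> i) (v i)\<bar>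
            \<le> e1 / (N + 1) * ?S"
            using R2(2)[OF b i] aS'[OF y] m0 a0 by (intro rn(2)[OF b i]) auto
        qed
        also have "\<dots> = (N / (N + 1)) * (e1 * ?S)" by simp
        also have "\<dots> \<le> 1 * (e1 * ?S)" using e1 S0 by (intro mult_right_mono) auto
        finally show ?thesis by simp
      qed
      have n2: "\<bar>fst b * (J (X y) (u y) - J xs us) + fst (snd b) \<bullet> (h0 (X y 0) - h0 (xs 0)) + snd (snd b) \<bullet> (h1lim (X y) - h1lim xs)
        + ?I - (adjoint H0 (fst (snd b)) - p b 0) \<bullet> yy y\<bar> \<le> e1 * Bx"
        unfolding I[symmetric]
      proof (rule rv(2)[OF b X(1)[OF y]])
        show "Bx \<le> rv b" using Bx m0 R1(2)[OF b] by linarith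
        show "\<forall>t\<ge>0. norm (X y t - xs t) \<le> Bx" using X(2)[OF y] by blast
        show "measure lebesgue (diffset (u y) us) \<le> rv b" using du[OF y] aS'[OF y] m0 R1(2)[OF b] by linarith
      qed
      have "b \<bullet> (\<rho> *\<^sub>R (y + e)) = b \<bullet> (\<Sum>i<N. a y i *\<^sub>R g i)"
        using e(3)[of y] y by (simp add: a_def scaleR_sum_right[symmetric] flip: scaleR_scaleR)
      also have "\<dots> = (\<Sum>i<N. a y i * (fst b * s i + (adjoint H0 (fst (snd b)) - p b 0) \<bullet> y0 i - ?G (\<tau> i) (v i)))"
        by (simp add: inner_sum_right g[OF b])
      also have "\<dots> = fst b * (\<Sum>i<N. a y i * s i) + (adjoint H0 (fst (snd b)) - p b 0) \<bullet> yy y - (\<Sum>i<N. a y i * ?G (\<tau> i) (v i))"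
        by (simp add: yy_def inner_sum_right sum_distrib_left sum.distrib sum_subtractf right_diff_distrib distrib_left mult_ac)
      finally have be: "b \<bullet> (\<rho> *\<^sub>R (y + e)) = fst b * (\<Sum>i<N. a y i * s i)
        + (adjoint H0 (fst (snd b)) - p b 0) \<bullet> yy y - (\<Sum>i<N. a y i * ?G (\<tau> i) (v i))" .
      have "b \<bullet> F y = fst b * (J (X y) (u y) - J xs us + (\<Sum>i<N. a y i * s i)) + fst (snd b) \<bullet> h0 (X y 0) + snd (snd b) \<bullet> h1lim (X y)"
        by (cases b) (simp add: F_def)
      then have bF: "b \<bullet> F y = fst b * (J (X y) (u y) - J xs us) + fst b * (\<Sum>i<N. a y i * s i)
        + fst (snd b) \<bullet> h0 (X y 0) + snd (snd b) \<bullet> h1lim (X y)" by (simp only: distrib_left)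
      \<comment> \<open>The first-order gains cancel between \<open>be\<close> and
        \<open>n2\<close>, after \<open>n1\<close> has replaced the integrals over the needles by
        their leading terms.\<close>
      have "\<bar>b \<bullet> F y - b \<bullet> (\<rho> *\<^sub>R (y + e))\<bar> \<le> e1 * Bx + e1 * ?S"
        using n1 n2 unfolding be bF feas diff_0_right by linarith
      also have "\<dots> \<le> e1 * (4 * (c1 * \<rho>) * wmax) + e1 * (\<rho> * Am)"
        unfolding Bx_def using aS[OF y] e1 by (intro add_left_mono mult_left_mono) auto
      also have "\<dots> = e1 * M * \<rho>" by (simp add: M_def algebra_simps)
      also have "\<dots> = \<rho> / (card B + 1)" using M by (simp add: e1_def)
      finally show ?thesis by (simp only: inner_diff_right)
    qed
    have "F y - \<rho> *\<^sub>R (y + e) \<in> span B"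
      unfolding B(5) using FW[OF y] y e(2) W by (intro subspace_diff subspace_scale subspace_add) auto
    \<comment> \<open>The error lies in \<open>W\<close>, so its norm is controlled by the
      coordinates estimated in \<open>each\<close>.\<close>
    from orthonormal_basis_expand[OF B(3,4) this B(1)]
    have "norm (F y - \<rho> *\<^sub>R (y + e)) = norm (\<Sum>b\<in>B. ((F y - \<rho> *\<^sub>R (y + e)) \<bullet> b) *\<^sub>R b)" by simp
    also have "\<dots> \<le> (\<Sum>b\<in>B. \<rho> / (card B + 1))"
      using each B(4) by (intro sum_norm_le) (simp add: inner_commute)
    also have "\<dots> = (card B / (card B + 1)) * \<rho>" by simp
    also have "\<dots> \<le> 1 * \<rho>" using \<rho>(1) by (intro mult_right_mono) auto
    finally show ?thesis by simp
  qed
  have cont: "continuous_on ?Q F"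
    unfolding continuous_on_def
  proof
    fix z assume z: "z \<in> ?Q"
    let ?at = "at z within ?Q"
    have \<alpha>t: "(\<alpha> i \<longlongrightarrow> \<alpha> i z) ?at" for i
      using continuous_on_subset[OF \<alpha>(1), of ?Q i] z by (simp add: continuous_on_def)
    have at: "((\<lambda>y. a y i) \<longlongrightarrow> a z i) ?at" for i unfolding a_def by (intro tendsto_intros \<alpha>t)
    \<comment> \<open>Bounds the measure of the set where the controls for \<open>y\<close> and
      \<open>z\<close> differ.\<close>
    define dm where "dm y = N * (2 * (\<Sum>j<N. \<bar>a y j - a z j\<bar>))" for y
    have dm: "(dm \<longlongrightarrow> 0) ?at"
    proof -
      have "(dm \<longlongrightarrow> N * (2 * (\<Sum>j<N. \<bar>a z j - a z j\<bar>))) ?at"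
        unfolding dm_def by (intro tendsto_intros at)
      then show ?thesis by simp
    qed
    have dml: "measure lebesgue (diffset (u y) (u z)) \<le> dm y" if y: "y \<in> ?Q" for y
      unfolding u_def dm_def by (rule measure_diffset_needles[OF a0 a0 uc[OF y, unfolded u_def] uc[OF z, unfolded u_def]])
    define dd where "dd y = norm (yy y - yy z) + 2 * K * dm y" for y
    have dd: "(dd \<longlongrightarrow> 0) ?at"
    proof -
      have "(dd \<longlongrightarrow> norm (yy z - yy z) + 2 * K * 0) ?at"
        unfolding dd_def yy_def by (intro tendsto_intros at dm)
      then show ?thesis by simp
    qed
    define BB where "BB y = 4 * dd y * wmax" for y
    have BB: "(BB \<longlongrightarrow> 0) ?at" unfolding BB_def using dd by (auto intro!: tendsto_eq_intros)
    have xB: "norm (X y t - X z t) \<le> BB y" if y: "y \<in> ?Q" and t: "t \<ge> 0" for y t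
    proof -
      have "norm (X y t - X z t) \<le> 4 * dd y * wt t"
      proof (rule sol_stable[OF X(1)[OF y] X(1)[OF z] _ t])
        fix r :: real assume "r \<ge> 0"
        have "norm (yy y - yy z + (integral {0..r} (\<lambda>t. \<phi> t (X z t) (u y t)) - integral {0..r} (\<lambda>t. \<phi> t (X z t) (u z t))))
          \<le> norm (yy y - yy z) + 2 * K * measure lebesgue (diffset (u y) (u z))"
          by (intro norm_triangle_le add_left_mono control_change_bound sol_traj[OF X(1)[OF z]] uc y z)
        also have "\<dots> \<le> dd y" unfolding dd_def using dml[OF y] pos by (intro add_left_mono mult_left_mono) auto
        finally show "norm (yy y - yy z + (integral {0..r} (\<lambda>t. \<phi> t (X z t) (u y t)) - integral {0..r} (\<lambda>t. \<phi> t (X z t) (u z t)))) \<le> dd y" .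
      qed
      also have "\<dots> \<le> BB y"
      proof -
        have "dd y \<ge> 0" unfolding dd_def dm_def using pos by (intro add_nonneg_nonneg mult_nonneg_nonneg sum_nonneg) auto
        then show ?thesis unfolding BB_def using wt_le_wmax[OF t] by (intro mult_left_mono) auto
      qed
      finally show ?thesis .
    qed
    define iw where "iw y = integral (diffset (u y) (u z)) (\<lambda>t. norm (\<omega> t))" for y
    have evQ: "\<forall>\<^sub>F y in ?at. y \<in> ?Q" by (simp add: eventually_at_filter)
    \<comment> \<open>No Lipschitz bound is available for a merely integrable
      \<open>\<omega>\<close>; absolute continuity of its integral gives the limit.\<close>
    have iw: "(iw \<longlongrightarrow> 0) ?at"
    proof (rule tendstoI)
      fix \<delta> :: real assume "\<delta> > 0"
      obtain r where r: "r > 0" "\<And>E. E \<in> lmeasurable \<Longrightarrow> E \<subseteq> {0..} \<Longrightarrow> measure lebesgue E < r \<Longrightarrow>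
        integral E (\<lambda>t. norm (\<omega> t)) < \<delta>" using absolutely_integrable_small_sets[OF omega _ \<open>\<delta> > 0\<close>] by auto
      have "\<forall>\<^sub>F y in ?at. dm y < r" using dm r(1) by (rule order_tendstoD(2))
      then show "\<forall>\<^sub>F y in ?at. dist (iw y) 0 < \<delta>" using evQ
      proof eventually_elim
        case (elim y)
        note uu = uc[OF elim(2)] uc[OF z]
        have sub: "diffset (u y) (u z) \<subseteq> {0..}" by (auto simp: diffset_def)
        have "iw y < \<delta>" unfolding iw_def
          using dml[OF elim(2)] elim(1) by (intro r(2) diffset(2)[OF uu] sub) linarith
        moreover have "iw y \<ge> 0" unfolding iw_def
        proof (rule integral_nonneg)
          have "\<omega> absolutely_integrable_on diffset (u y) (u z)"
            by (rule set_integrable_subset[OF omega fmeasurableD[OF diffset(2)[OF uu]] sub])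
          then show "(\<lambda>t. norm (\<omega> t)) integrable_on diffset (u y) (u z)" by (auto simp: absolutely_integrable_on_def)
        qed simp
        ultimately show ?case by simp
      qed
    qed
    note lips = end_map_lipschitz[OF X(1) X(1)[OF z] xB]
    have J: "((\<lambda>y. J (X y) (u y)) \<longlongrightarrow> J (X z) (u z)) ?at"
    proof (rule Lim_transform_bound[where g="\<lambda>y. K * BB y * integral {0..} (\<lambda>t. norm (\<omega> t)) + 2 * K * iw y", THEN LIM_zero_cancel])
      show "\<forall>\<^sub>F y in ?at. norm (J (X y) (u y) - J (X z) (u z)) \<le> norm (K * BB y * integral {0..} (\<lambda>t. norm (\<omega> t)) + 2 * K * iw y)"
        using evQ
      proof eventually_elim
        case (elim y)
        show ?case using lips(3)[OF elim elim] unfolding iw_def real_norm_def by linarith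
      qed
      show "((\<lambda>y. K * BB y * integral {0..} (\<lambda>t. norm (\<omega> t)) + 2 * K * iw y) \<longlongrightarrow> 0) ?at"
        using BB iw by (auto intro!: tendsto_eq_intros)
    qed
    have KBB: "((\<lambda>y. K * BB y) \<longlongrightarrow> 0) ?at" using BB by (auto intro!: tendsto_eq_intros)
    have h0t: "((\<lambda>y. h0 (X y 0)) \<longlongrightarrow> h0 (X z 0)) ?at"
    proof (rule Lim_transform_bound[where g="\<lambda>y. K * BB y", OF _ KBB, THEN LIM_zero_cancel])
      show "\<forall>\<^sub>F y in ?at. norm (h0 (X y 0) - h0 (X z 0)) \<le> norm (K * BB y)"
        using evQ
      proof eventually_elim
        case (elim y)
        show ?case using lips(1)[OF elim elim] unfolding real_norm_def by linarith
      qed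
    qed
    have h1t: "((\<lambda>y. h1lim (X y)) \<longlongrightarrow> h1lim (X z)) ?at"
    proof (rule Lim_transform_bound[where g="\<lambda>y. K * BB y", OF _ KBB, THEN LIM_zero_cancel])
      show "\<forall>\<^sub>F y in ?at. norm (h1lim (X y) - h1lim (X z)) \<le> norm (K * BB y)"
        using evQ
      proof eventually_elim
        case (elim y)
        show ?case using lips(2)[OF elim elim] unfolding real_norm_def by linarith
      qed
    qed
    show "(F \<longlongrightarrow> F z) ?at"
      unfolding F_def by (intro tendsto_intros J h0t h1t at)
  qed
  obtain y where y: "y \<in> ?Q" "F y = \<rho> *\<^sub>R e"
    by (rule brouwer_hits[OF W e(2) \<rho>(1) cont FW close])
  have Fy: "J (X y) (u y) - J xs us + (\<Sum>i<N. a y i * s i) = - \<rho>" "h0 (X y 0) = 0" "h1lim (X y) = 0"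
    using y(2) by (auto simp: F_def e(1))
  have "0 \<le> (\<Sum>i<N. a y i * s i)" using a0 s by (intro sum_nonneg) auto
  then have "J (X y) (u y) < J xs us" using Fy(1) \<rho>(1) by linarith
  moreover have "norm (X y t - xs t) \<le> \<epsilon>" if "t \<ge> 0" for t using X(2)[OF y(1) that] Bx m0 by linarith
  moreover have "u y t = us t \<or> (\<exists>i<N. u y t = v i)" for t
    using needles_cases[of \<tau> v us "a y" N t] unfolding u_def by blast
  ultimately show ?thesis using X(1)[OF y(1)] Fy(2,3) by blast
qed

end

section \<open>The linearised problem along the optimal process\<close>

lemma unif_C1_in_x_subset:
  assumes "unif_C1_in_x S g" "S' \<subseteq> S" shows "unif_C1_in_x S' g"
proof -
  have sub: "(\<lambda>(t, x, u). (arctan t, x, u)) ` S' \<subseteq> (\<lambda>(t, x, u). (arctan t, x, u)) ` S"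
    using assms(2) by (rule image_mono)
  obtain D where "unif_cont_compactified S g" "unif_cont_compactified S D"
    "\<forall>(t, x, u)\<in>S. ((\<lambda>y. g t y u) has_derivative blinfun_apply (D t x u)) (at x)"
    using assms(1) unfolding unif_C1_in_x_def by blast
  then show ?thesis
    unfolding unif_C1_in_x_def unif_cont_compactified_def
    using sub assms(2) unfolding uniformly_continuous_on_def
    by (intro conjI exI[of _ D]) (meson subsetD)+
qed

text \<open>Passes from the extended nonnegative integral of the tail condition to the gauge
  integral, and at the same time allows the starting time to be increased.\<close>

lemma nn_integral_tail_le:
  fixes g :: "real \<Rightarrow> real"
  assumes g: "g \<in> borel_measurable leb_half" "\<And>t. 0 \<le> g t"
    and le: "(\<integral>\<^sup>+t. ennreal (g t) \<partial>lebesgue_on {T..}) \<le> ennreal c" and T: "0 \<le> T" "T \<le> T'" and c: "0 \<le> c"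
  shows "g integrable_on {T'..}" "integral {T'..} g \<le> c"
proof -
  have m: "g \<in> borel_measurable (lebesgue_on {T'..})"
    using g(1) by (rule measurable_restrict_mono) (use T in auto)
  have "(\<integral>\<^sup>+t. ennreal (g t) \<partial>lebesgue_on {T'..}) \<le> (\<integral>\<^sup>+t. ennreal (g t) \<partial>lebesgue_on {T..})"
    using T by (subst (1 2) nn_integral_restrict_space) (auto intro!: nn_integral_mono split: split_indicator)
  then have le': "(\<integral>\<^sup>+t. ennreal (g t) \<partial>lebesgue_on {T'..}) \<le> ennreal c" using le by simp
  have i: "integrable (lebesgue_on {T'..}) g"
  proof (rule integrableI_bounded[OF m])
    have "(\<integral>\<^sup>+t. ennreal (norm (g t)) \<partial>lebesgue_on {T'..}) \<le> ennreal c" using le' g(2) by simp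
    then show "(\<integral>\<^sup>+t. ennreal (norm (g t)) \<partial>lebesgue_on {T'..}) < \<infinity>"
      using ennreal_less_top le_less_trans by (metis infinity_ennreal_def)
  qed
  show "g integrable_on {T'..}" using i by (rule integrable_on_lebesgue_on) simp
  have "ennreal (integral\<^sup>L (lebesgue_on {T'..}) g) = (\<integral>\<^sup>+t. ennreal (g t) \<partial>lebesgue_on {T'..})"
    using g(2) by (intro nn_integral_eq_integral[symmetric] i) auto
  then have "ennreal (integral\<^sup>L (lebesgue_on {T'..}) g) \<le> ennreal c" using le' by simp
  then show "integral {T'..} g \<le> c"
    using c by (simp add: lebesgue_integral_eq_integral[OF i])
qed

lemma Blinfun_frechet_derivative:
  assumes "(g has_derivative blinfun_apply D) (at x)"
  shows "Blinfun (frechet_derivative g (at x)) = D"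
  using frechet_derivative_at[OF assms, symmetric] by (simp add: blinfun_apply_inverse)

text \<open>Expanding \<open>z t\<close> in a basis leaves only the functions \<open>L t b\<close>
  for fixed \<open>b\<close>, measurable because evaluation at \<open>b\<close> is
  continuous.\<close>

lemma blinfun_apply_measurable:
  fixes L :: "real \<Rightarrow> 'a::euclidean_space \<Rightarrow>\<^sub>L 'b::euclidean_space"
  assumes L: "L \<in> borel_measurable M" and z: "z \<in> borel_measurable M"
  shows "(\<lambda>t. L t (z t)) \<in> borel_measurable M"
proof -
  have "(\<lambda>t. L t b) \<in> borel_measurable M" for b
    using L by (rule measurable_compose) (intro borel_measurable_continuous_onI continuous_intros)
  then have "(\<lambda>t. \<Sum>b\<in>Basis. (z t \<bullet> b) *\<^sub>R L t b) \<in> borel_measurable M"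
    using z by measurable
  moreover have "L t (z t) = (\<Sum>b\<in>Basis. (z t \<bullet> b) *\<^sub>R L t b)" for t
  proof -
    have "L t (z t) = L t (\<Sum>b\<in>Basis. (z t \<bullet> b) *\<^sub>R b)" by (simp add: euclidean_representation)
    also have "\<dots> = (\<Sum>b\<in>Basis. (z t \<bullet> b) *\<^sub>R L t b)" by (simp add: blinfun.sum_right blinfun.scaleR_right)
    finally show ?thesis .
  qed
  ultimately show ?thesis by simp
qed

lemma sup_norm_le:
  assumes "\<And>t. t \<ge> 0 \<Longrightarrow> norm (x t) \<le> B" shows "sup_norm x \<le> B"
  unfolding sup_norm_def by (rule cSUP_least) (use assms in auto)

lemma nn_integral_finite_absolutely_integrable:
  fixes g :: "real \<Rightarrow> 'a::euclidean_space"
  assumes "g \<in> borel_measurable leb_half" "(\<integral>\<^sup>+t. ennreal (norm (g t)) \<partial>leb_half) < \<infinity>"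
  shows "g absolutely_integrable_on {0..}"
  using integrableI_bounded[OF assms] by (simp add: absolutely_integrable_leb_half_iff)

locale pontryagin_data =
  fixes \<omega> :: "real \<Rightarrow> real"
    and f :: "real \<Rightarrow> real^'n \<Rightarrow> real^'m \<Rightarrow> real"
    and \<phi> :: "real \<Rightarrow> real^'n \<Rightarrow> real^'m \<Rightarrow> real^'n"
    and h0 :: "real^'n \<Rightarrow> real^'s0"
    and h1 :: "real \<Rightarrow> real^'n \<Rightarrow> real^'s1"
    and xs :: "real \<Rightarrow> real^'n" and us :: "real \<Rightarrow> real^'m" and C :: real
  assumes omega_L1: "integrable leb_half \<omega>"
    and us_meas: "us \<in> borel_measurable leb_half"
    and us_bounded: "\<And>t. t \<ge> 0 \<Longrightarrow> norm (us t) \<le> C"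
    and xs_der: "AE t in leb_half. (xs has_vector_derivative \<phi> t (xs t) (us t)) (at t within {0..})"
    and reg: "xs \<in> B_Lip f \<phi> h0 h1"
    and phi_int: "(\<integral>\<^sup>+t. ennreal (norm (\<phi> t (xs t) (us t))) \<partial>leb_half) < \<infinity>"
    and phix_int:
      "(\<integral>\<^sup>+t. ennreal (onorm ((*v) (jacobian (\<lambda>y. \<phi> t y (us t)) (at (xs t))))) \<partial>leb_half) < \<infinity>"
    and tail:
      "\<exists>\<gamma>>0. \<forall>\<delta>>0. \<exists>T>0. \<forall>x\<in>W1_inf. \<forall>x'\<in>W1_inf.
         sup_norm (\<lambda>t. x t - xs t) < \<gamma> \<and> sup_norm (\<lambda>t. x' t - xs t) < \<gamma> \<longrightarrow>
         (\<integral>\<^sup>+t. ennreal (norm (\<phi> t (x t) (us t) - \<phi> t (x' t) (us t)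
              - jacobian (\<lambda>y. \<phi> t y (us t)) (at (xs t)) *v (x t - x' t))) \<partial>lebesgue_on {T..})
           \<le> ennreal (\<delta> * sup_norm (\<lambda>t. x t - x' t))"
begin

text \<open>Total through \<open>frechet_derivative\<close>; for \<open>t \<ge> 0\<close> it agrees
  with the derivative supplied by \<open>B_Lip\<close>, whatever tube and control ball are
  chosen.\<close>

definition A :: "real \<Rightarrow> (real^'n) \<Rightarrow>\<^sub>L (real^'n)" where
  "A t = Blinfun (frechet_derivative (\<lambda>y. \<phi> t y (us t)) (at (xs t)))"

definition fx :: "real \<Rightarrow> real^'n" where
  "fx t = gradient (\<lambda>y. f t y (us t)) (xs t)"

definition H0 :: "(real^'n) \<Rightarrow>\<^sub>L (real^'s0)" where
  "H0 = Blinfun (frechet_derivative h0 (at (xs 0)))"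

definition H1 :: "real \<Rightarrow> (real^'n) \<Rightarrow>\<^sub>L (real^'s1)" where
  "H1 t = Blinfun (frechet_derivative (h1 t) (at (xs t)))"

lemma xs_W1: "xs \<in> W1_inf" using reg by (simp add: B_Lip_def)

lemma xs_bounded: "bounded (xs ` {0..})" using xs_W1 by (simp add: W1_inf_def)

lemma xs_measurable: "xs \<in> borel_measurable leb_half"
  by (rule continuous_on_measurable_half[OF W1_inf_continuous_on[OF xs_W1]])

lemma xs_eq:
  assumes "t \<ge> 0" shows "xs t = xs 0 + integral {0..t} (\<lambda>t. \<phi> t (xs t) (us t))"
  using integral_unique[OF W1_inf_has_integral[OF xs_W1 xs_der assms]] by simp

lemma us_cball: "t \<ge> 0 \<Longrightarrow> C \<le> R \<Longrightarrow> us t \<in> cball 0 R"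
  using us_bounded[of t] by simp

text \<open>One radius and one constant for all four functions. The radius can be forced below
  \<open>\<gamma>1\<close>, so that the tail condition is at hand in the same tube.\<close>

lemma tube_estimates:
  assumes R: "C \<le> R" and \<gamma>1: "\<gamma>1 > 0"
  obtains \<gamma> K :: real and D1 :: "real \<Rightarrow> real^'n \<Rightarrow> real^'m \<Rightarrow> (real^'n) \<Rightarrow>\<^sub>L (real^'n)"
    and D2 :: "real \<Rightarrow> real^'n \<Rightarrow> real^'m \<Rightarrow> (real^'n) \<Rightarrow>\<^sub>L real"
    and D3 :: "(real^'n) \<Rightarrow>\<^sub>L (real^'s0)"
    and D4 :: "real \<Rightarrow> real^'n \<Rightarrow> real^'m \<Rightarrow> (real^'n) \<Rightarrow>\<^sub>L (real^'s1)"
    where "0 < \<gamma>" "\<gamma> \<le> \<gamma>1" "K > 0"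
    "unif_cont_compactified (tube xs \<gamma> (cball 0 R)) \<phi>" "unif_cont_compactified (tube xs \<gamma> (cball 0 R)) f"
    "unif_cont_compactified (tube xs \<gamma> (cball (0::real^'m) R)) (\<lambda>t x u. h1 t x)"
    "unif_cont_compactified (tube xs \<gamma> (cball 0 R)) D1" "unif_cont_compactified (tube xs \<gamma> (cball 0 R)) D2"
    "unif_cont_compactified (tube xs \<gamma> (cball 0 R)) D4"
    "\<And>t x u. \<lbrakk>0 \<le> t; norm (x - xs t) \<le> \<gamma>; u \<in> cball 0 R\<rbrakk> \<Longrightarrow> norm (\<phi> t x u) \<le> K"
    "\<And>t x u. \<lbrakk>0 \<le> t; norm (x - xs t) \<le> \<gamma>; u \<in> cball 0 R\<rbrakk> \<Longrightarrow> norm (f t x u) \<le> K"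
    "\<And>t x u. \<lbrakk>0 \<le> t; norm (x - xs t) \<le> \<gamma>; u \<in> cball 0 R\<rbrakk> \<Longrightarrow> norm (D1 t x u) \<le> K"
    "\<And>t x u. \<lbrakk>0 \<le> t; norm (x - xs t) \<le> \<gamma>; u \<in> cball 0 R\<rbrakk> \<Longrightarrow> norm (D2 t x u) \<le> K"
    "\<And>t x y u. \<lbrakk>0 \<le> t; norm (x - xs t) \<le> \<gamma>; norm (y - xs t) \<le> \<gamma>; u \<in> cball 0 R\<rbrakk> \<Longrightarrow> norm (\<phi> t x u - \<phi> t y u) \<le> K * norm (x - y)"
    "\<And>t x y u. \<lbrakk>0 \<le> t; norm (x - xs t) \<le> \<gamma>; norm (y - xs t) \<le> \<gamma>; u \<in> cball 0 R\<rbrakk> \<Longrightarrow> norm (f t x u - f t y u) \<le> K * norm (x - y)"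
    "\<And>x y. \<lbrakk>norm (x - xs 0) \<le> \<gamma>; norm (y - xs 0) \<le> \<gamma>\<rbrakk> \<Longrightarrow> norm (h0 x - h0 y) \<le> K * norm (x - y)"
    "\<And>t x y. \<lbrakk>0 \<le> t; norm (x - xs t) \<le> \<gamma>; norm (y - xs t) \<le> \<gamma>\<rbrakk> \<Longrightarrow> norm (h1 t x - h1 t y) \<le> K * norm (x - y)"
    "\<And>t. 0 \<le> t \<Longrightarrow> ((\<lambda>y. \<phi> t y (us t)) has_derivative D1 t (xs t) (us t)) (at (xs t))"
    "\<And>t. 0 \<le> t \<Longrightarrow> ((\<lambda>y. f t y (us t)) has_derivative D2 t (xs t) (us t)) (at (xs t))"
    "(h0 has_derivative blinfun_apply D3) (at (xs 0))"
    "\<And>t u. 0 \<le> t \<Longrightarrow> u \<in> cball 0 R \<Longrightarrow> (h1 t has_derivative D4 t (xs t) u) (at (xs t))"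
    "\<And>e. e > 0 \<Longrightarrow> \<exists>\<rho>>0. \<forall>t\<ge>0. \<forall>x. norm (x - xs t) \<le> \<rho> \<longrightarrow>
       norm (\<phi> t x (us t) - \<phi> t (xs t) (us t) - D1 t (xs t) (us t) (x - xs t)) \<le> e * norm (x - xs t)"
    "\<And>e. e > 0 \<Longrightarrow> \<exists>\<rho>>0. \<forall>t\<ge>0. \<forall>x. norm (x - xs t) \<le> \<rho> \<longrightarrow>
       norm (f t x (us t) - f t (xs t) (us t) - D2 t (xs t) (us t) (x - xs t)) \<le> e * norm (x - xs t)"
    "\<And>e. e > 0 \<Longrightarrow> \<exists>\<rho>>0. \<forall>t\<ge>0. \<forall>x. norm (x - xs t) \<le> \<rho> \<longrightarrow>
       norm (h1 t x - h1 t (xs t) - D4 t (xs t) (us t) (x - xs t)) \<le> e * norm (x - xs t)"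
proof -
  let ?U = "cball (0::real^'m) R"
  obtain \<gamma>0 where \<gamma>0: "\<gamma>0 > 0" "unif_C1_in_x (tube xs \<gamma>0 ?U) f" "unif_C1_in_x (tube xs \<gamma>0 ?U) \<phi>"
    "unif_C1_in_x (tube xs \<gamma>0 ?U) (\<lambda>t x u. h0 x)" "unif_C1_in_x (tube xs \<gamma>0 ?U) (\<lambda>t x u. h1 t x)"
    using reg compact_cball unfolding B_Lip_def by blast
  define \<gamma> where "\<gamma> = min \<gamma>0 \<gamma>1"
  have \<gamma>: "\<gamma> > 0" "\<gamma> \<le> \<gamma>1" using \<gamma>0(1) \<gamma>1 by (auto simp: \<gamma>_def)
  have sub: "tube xs \<gamma> ?U \<subseteq> tube xs \<gamma>0 ?U" by (auto simp: tube_def \<gamma>_def)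
  note C1 = \<gamma>0(2-5)[THEN unif_C1_in_x_subset[OF _ sub]]
  have bU: "bounded ?U" by simp
  have u0: "us t \<in> ?U" if "t \<ge> 0" for t using us_cball[OF that R] .
  have z: "norm (xs t - xs t) \<le> \<gamma>" for t using \<gamma> by simp
  obtain D2 :: "real \<Rightarrow> real^'n \<Rightarrow> real^'m \<Rightarrow> (real^'n) \<Rightarrow>\<^sub>L real" and K2 where f: "unif_cont_compactified (tube xs \<gamma> ?U) f" "unif_cont_compactified (tube xs \<gamma> ?U) D2" "K2 > 0"
    "\<And>t x u. \<lbrakk>0 \<le> t; norm (x - xs t) \<le> \<gamma>; u \<in> ?U\<rbrakk> \<Longrightarrow> ((\<lambda>y. f t y u) has_derivative blinfun_apply (D2 t x u)) (at x)"
    "\<And>t x u. \<lbrakk>0 \<le> t; norm (x - xs t) \<le> \<gamma>; u \<in> ?U\<rbrakk> \<Longrightarrow> norm (f t x u) \<le> K2"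
    "\<And>t x u. \<lbrakk>0 \<le> t; norm (x - xs t) \<le> \<gamma>; u \<in> ?U\<rbrakk> \<Longrightarrow> norm (D2 t x u) \<le> K2"
    "\<And>t x y u. \<lbrakk>0 \<le> t; norm (x - xs t) \<le> \<gamma>; norm (y - xs t) \<le> \<gamma>; u \<in> ?U\<rbrakk> \<Longrightarrow> norm (f t x u - f t y u) \<le> K2 * norm (x - y)"
    "\<And>e. e > 0 \<Longrightarrow> \<exists>\<rho>>0. \<rho> \<le> \<gamma> \<and> (\<forall>t\<ge>0. \<forall>u\<in>?U. \<forall>x. norm (x - xs t) \<le> \<rho> \<longrightarrow>
       norm (f t x u - f t (xs t) u - D2 t (xs t) u (x - xs t)) \<le> e * norm (x - xs t))"
    by (rule unif_C1_in_x_estimates[OF C1(1) \<gamma>(1) xs_bounded bU]; blast)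
  obtain D1 :: "real \<Rightarrow> real^'n \<Rightarrow> real^'m \<Rightarrow> (real^'n) \<Rightarrow>\<^sub>L (real^'n)" and K1 where phi: "unif_cont_compactified (tube xs \<gamma> ?U) \<phi>" "unif_cont_compactified (tube xs \<gamma> ?U) D1" "K1 > 0"
    "\<And>t x u. \<lbrakk>0 \<le> t; norm (x - xs t) \<le> \<gamma>; u \<in> ?U\<rbrakk> \<Longrightarrow> ((\<lambda>y. \<phi> t y u) has_derivative blinfun_apply (D1 t x u)) (at x)"
    "\<And>t x u. \<lbrakk>0 \<le> t; norm (x - xs t) \<le> \<gamma>; u \<in> ?U\<rbrakk> \<Longrightarrow> norm (\<phi> t x u) \<le> K1"
    "\<And>t x u. \<lbrakk>0 \<le> t; norm (x - xs t) \<le> \<gamma>; u \<in> ?U\<rbrakk> \<Longrightarrow> norm (D1 t x u) \<le> K1"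
    "\<And>t x y u. \<lbrakk>0 \<le> t; norm (x - xs t) \<le> \<gamma>; norm (y - xs t) \<le> \<gamma>; u \<in> ?U\<rbrakk> \<Longrightarrow> norm (\<phi> t x u - \<phi> t y u) \<le> K1 * norm (x - y)"
    "\<And>e. e > 0 \<Longrightarrow> \<exists>\<rho>>0. \<rho> \<le> \<gamma> \<and> (\<forall>t\<ge>0. \<forall>u\<in>?U. \<forall>x. norm (x - xs t) \<le> \<rho> \<longrightarrow>
       norm (\<phi> t x u - \<phi> t (xs t) u - D1 t (xs t) u (x - xs t)) \<le> e * norm (x - xs t))"
    by (rule unif_C1_in_x_estimates[OF C1(2) \<gamma>(1) xs_bounded bU]; blast)
  obtain D3 :: "real \<Rightarrow> real^'n \<Rightarrow> real^'m \<Rightarrow> (real^'n) \<Rightarrow>\<^sub>L (real^'s0)" and K3 where h0: "K3 > 0"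
    "\<And>t x u. \<lbrakk>0 \<le> t; norm (x - xs t) \<le> \<gamma>; u \<in> ?U\<rbrakk> \<Longrightarrow> ((\<lambda>y. h0 y) has_derivative blinfun_apply (D3 t x u)) (at x)"
    "\<And>t x y u. \<lbrakk>0 \<le> t; norm (x - xs t) \<le> \<gamma>; norm (y - xs t) \<le> \<gamma>; u \<in> ?U\<rbrakk> \<Longrightarrow> norm (h0 x - h0 y) \<le> K3 * norm (x - y)"
    by (rule unif_C1_in_x_estimates[OF C1(3) \<gamma>(1) xs_bounded bU]; blast)
  obtain D4 :: "real \<Rightarrow> real^'n \<Rightarrow> real^'m \<Rightarrow> (real^'n) \<Rightarrow>\<^sub>L (real^'s1)" and K4 where h1: "unif_cont_compactified (tube xs \<gamma> ?U) (\<lambda>t x u. h1 t x)" "unif_cont_compactified (tube xs \<gamma> ?U) D4" "K4 > 0"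
    "\<And>t x u. \<lbrakk>0 \<le> t; norm (x - xs t) \<le> \<gamma>; u \<in> ?U\<rbrakk> \<Longrightarrow> ((\<lambda>y. h1 t y) has_derivative blinfun_apply (D4 t x u)) (at x)"
    "\<And>t x y u. \<lbrakk>0 \<le> t; norm (x - xs t) \<le> \<gamma>; norm (y - xs t) \<le> \<gamma>; u \<in> ?U\<rbrakk> \<Longrightarrow> norm (h1 t x - h1 t y) \<le> K4 * norm (x - y)"
    "\<And>e. e > 0 \<Longrightarrow> \<exists>\<rho>>0. \<rho> \<le> \<gamma> \<and> (\<forall>t\<ge>0. \<forall>u\<in>?U. \<forall>x. norm (x - xs t) \<le> \<rho> \<longrightarrow>
       norm (h1 t x - h1 t (xs t) - D4 t (xs t) u (x - xs t)) \<le> e * norm (x - xs t))"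
    by (rule unif_C1_in_x_estimates[OF C1(4) \<gamma>(1) xs_bounded bU]; blast)
  define K where "K = Max {K1, K2, K3, K4}"
  have K: "K1 \<le> K" "K2 \<le> K" "K3 \<le> K" "K4 \<le> K" by (auto simp: K_def)
  have KL: "c \<le> K * norm w" if "c \<le> k * norm w" "k \<le> K" for c k :: real and w :: "real^'n"
    using that mult_right_mono[OF that(2) norm_ge_zero[of w]] by linarith
  have K0: "K > 0" using K(1) phi(3) by linarith
  \<comment> \<open>Seen as a function of \<open>(t, x, u)\<close>, \<open>h0\<close> has a
    derivative that formally depends on \<open>t\<close> and \<open>u\<close>; evaluation along the
    process at time 0 turns it into a single map.\<close>
  show ?thesis
  proof (rule that[of \<gamma> K D1 D2 D4 "D3 0 (xs 0) (us 0)"])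
    show "0 < \<gamma>" "\<gamma> \<le> \<gamma>1" "K > 0" by (rule \<gamma> K0)+
    show "unif_cont_compactified (tube xs \<gamma> ?U) \<phi>" by (rule phi(1))
    show "unif_cont_compactified (tube xs \<gamma> ?U) f" by (rule f(1))
    show "unif_cont_compactified (tube xs \<gamma> ?U) (\<lambda>t x u. h1 t x)" by (rule h1(1))
    show "unif_cont_compactified (tube xs \<gamma> ?U) D1" by (rule phi(2))
    show "unif_cont_compactified (tube xs \<gamma> ?U) D2" by (rule f(2))
    show "unif_cont_compactified (tube xs \<gamma> ?U) D4" by (rule h1(2))
  next
    fix t x u assume t: "0 \<le> t" "norm (x - xs t) \<le> \<gamma>" "u \<in> ?U"
    show "norm (\<phi> t x u) \<le> K" "norm (f t x u) \<le> K" "norm (D1 t x u) \<le> K" "norm (D2 t x u) \<le> K"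
      using phi(5,6)[OF t] f(5,6)[OF t] K by linarith+
    fix y assume y: "norm (y - xs t) \<le> \<gamma>"
    show "norm (\<phi> t x u - \<phi> t y u) \<le> K * norm (x - y)" by (rule KL[OF phi(7)[OF t(1,2) y t(3)] K(1)])
    show "norm (f t x u - f t y u) \<le> K * norm (x - y)" by (rule KL[OF f(7)[OF t(1,2) y t(3)] K(2)])
  next
    fix x y assume "norm (x - xs 0) \<le> \<gamma>" "norm (y - xs 0) \<le> \<gamma>"
    then show "norm (h0 x - h0 y) \<le> K * norm (x - y)" by (rule KL[OF h0(3)[OF order_refl _ _ u0[OF order_refl]] K(3)])
  next
    fix t x y assume t: "0 \<le> t" "norm (x - xs t) \<le> \<gamma>" "norm (y - xs t) \<le> \<gamma>"
    show "norm (h1 t x - h1 t y) \<le> K * norm (x - y)" by (rule KL[OF h1(5)[OF t u0[OF t(1)]] K(4)])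
  next
    fix t :: real assume t: "0 \<le> t"
    show "((\<lambda>y. \<phi> t y (us t)) has_derivative D1 t (xs t) (us t)) (at (xs t))" by (rule phi(4)[OF t z u0[OF t]])
    show "((\<lambda>y. f t y (us t)) has_derivative D2 t (xs t) (us t)) (at (xs t))" by (rule f(4)[OF t z u0[OF t]])
    show "(h1 t has_derivative D4 t (xs t) u) (at (xs t))" if "u \<in> ?U" for u using h1(4)[OF t z that] by simp
  next
    show "(h0 has_derivative blinfun_apply (D3 0 (xs 0) (us 0))) (at (xs 0))"
      using h0(2)[OF order_refl z u0[OF order_refl]] by simp
  next
    fix e :: real assume e: "e > 0"
    show "\<exists>\<rho>>0. \<forall>t\<ge>0. \<forall>x. norm (x - xs t) \<le> \<rho> \<longrightarrow>
       norm (\<phi> t x (us t) - \<phi> t (xs t) (us t) - D1 t (xs t) (us t) (x - xs t)) \<le> e * norm (x - xs t)"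
      using phi(8)[OF e] u0 by meson
    show "\<exists>\<rho>>0. \<forall>t\<ge>0. \<forall>x. norm (x - xs t) \<le> \<rho> \<longrightarrow>
       norm (f t x (us t) - f t (xs t) (us t) - D2 t (xs t) (us t) (x - xs t)) \<le> e * norm (x - xs t)"
      using f(8)[OF e] u0 by meson
    show "\<exists>\<rho>>0. \<forall>t\<ge>0. \<forall>x. norm (x - xs t) \<le> \<rho> \<longrightarrow>
       norm (h1 t x - h1 t (xs t) - D4 t (xs t) (us t) (x - xs t)) \<le> e * norm (x - xs t)"
      using h1(6)[OF e] u0 by meson
  qed
qed

section \<open>Derivatives along the optimal process\<close>

lemma jacobian_phi:
  assumes "t \<ge> 0" shows "jacobian (\<lambda>y. \<phi> t y (us t)) (at (xs t)) *v v = A t v"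
proof -
  obtain \<gamma> K :: real and D1 :: "real \<Rightarrow> real^'n \<Rightarrow> real^'m \<Rightarrow> (real^'n) \<Rightarrow>\<^sub>L (real^'n)"
    and D2 :: "real \<Rightarrow> real^'n \<Rightarrow> real^'m \<Rightarrow> (real^'n) \<Rightarrow>\<^sub>L real"
    and D3 :: "(real^'n) \<Rightarrow>\<^sub>L (real^'s0)"
    and D4 :: "real \<Rightarrow> real^'n \<Rightarrow> real^'m \<Rightarrow> (real^'n) \<Rightarrow>\<^sub>L (real^'s1)"
    where "\<And>t. 0 \<le> t \<Longrightarrow> ((\<lambda>y. \<phi> t y (us t)) has_derivative blinfun_apply (D1 t (xs t) (us t))) (at (xs t))"
    by (rule tube_estimates[OF order_refl zero_less_one]; blast)
  from this[OF assms] show ?thesis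
    unfolding A_def by (simp add: Blinfun_frechet_derivative jacobian_mult_eq)
qed

lemma H0_derivative: "(h0 has_derivative H0) (at (xs 0))"
proof -
  obtain \<gamma> K :: real and D1 :: "real \<Rightarrow> real^'n \<Rightarrow> real^'m \<Rightarrow> (real^'n) \<Rightarrow>\<^sub>L (real^'n)"
    and D2 :: "real \<Rightarrow> real^'n \<Rightarrow> real^'m \<Rightarrow> (real^'n) \<Rightarrow>\<^sub>L real"
    and D3 :: "(real^'n) \<Rightarrow>\<^sub>L (real^'s0)"
    and D4 :: "real \<Rightarrow> real^'n \<Rightarrow> real^'m \<Rightarrow> (real^'n) \<Rightarrow>\<^sub>L (real^'s1)"
    where "(h0 has_derivative blinfun_apply D3) (at (xs 0))"
    by (rule tube_estimates[OF order_refl zero_less_one]; blast)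
  then show ?thesis unfolding H0_def by (simp add: Blinfun_frechet_derivative)
qed

lemma A_eq:
  assumes "((\<lambda>y. \<phi> t y (us t)) has_derivative blinfun_apply D) (at (xs t))" shows "D = A t"
  unfolding A_def using Blinfun_frechet_derivative[OF assms] by simp

lemma fx_eq:
  assumes "((\<lambda>y. f t y (us t)) has_derivative blinfun_apply D) (at (xs t))" shows "D v = fx t \<bullet> v"
  unfolding fx_def using gradient_inner_eq[OF assms] by simp

lemma H1_eq:
  assumes "(h1 t has_derivative blinfun_apply D) (at (xs t))" shows "D = H1 t"
  unfolding H1_def using Blinfun_frechet_derivative[OF assms] by simp

lemma H1_derivative:
  assumes "t \<ge> 0" shows "(h1 t has_derivative H1 t) (at (xs t))"
proof -
  obtain \<gamma> K :: real and D1 :: "real \<Rightarrow> real^'n \<Rightarrow> real^'m \<Rightarrow> (real^'n) \<Rightarrow>\<^sub>L (real^'n)"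
    and D2 :: "real \<Rightarrow> real^'n \<Rightarrow> real^'m \<Rightarrow> (real^'n) \<Rightarrow>\<^sub>L real"
    and D3 :: "(real^'n) \<Rightarrow>\<^sub>L (real^'s0)"
    and D4 :: "real \<Rightarrow> real^'n \<Rightarrow> real^'m \<Rightarrow> (real^'n) \<Rightarrow>\<^sub>L (real^'s1)"
    where "\<And>t u. 0 \<le> t \<Longrightarrow> u \<in> cball 0 C \<Longrightarrow> (h1 t has_derivative blinfun_apply (D4 t (xs t) u)) (at (xs t))"
    by (rule tube_estimates[OF order_refl zero_less_one]; blast)
  from this[OF assms us_cball[OF assms order_refl]] show ?thesis using H1_eq by metis
qed

lemma phi_absolutely_integrable: "(\<lambda>t. \<phi> t (xs t) (us t)) absolutely_integrable_on {0..}"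
proof -
  obtain \<gamma> K :: real and D1 :: "real \<Rightarrow> real^'n \<Rightarrow> real^'m \<Rightarrow> (real^'n) \<Rightarrow>\<^sub>L (real^'n)"
    and D2 :: "real \<Rightarrow> real^'n \<Rightarrow> real^'m \<Rightarrow> (real^'n) \<Rightarrow>\<^sub>L real"
    and D3 :: "(real^'n) \<Rightarrow>\<^sub>L (real^'s0)"
    and D4 :: "real \<Rightarrow> real^'n \<Rightarrow> real^'m \<Rightarrow> (real^'n) \<Rightarrow>\<^sub>L (real^'s1)"
    where \<gamma>: "0 < \<gamma>" and uc: "unif_cont_compactified (tube xs \<gamma> (cball 0 C)) \<phi>"
    by (rule tube_estimates[OF order_refl zero_less_one]; blast)
  have "(\<lambda>t. \<phi> t (xs t) (us t)) \<in> borel_measurable leb_half"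
    using \<gamma> us_cball[OF _ order_refl] by (intro measurable_compose_tube[OF uc xs_measurable us_meas]) auto
  then show ?thesis using phi_int by (rule nn_integral_finite_absolutely_integrable)
qed

lemma xs_converges: "(xs \<longlongrightarrow> xs 0 + integral {0..} (\<lambda>t. \<phi> t (xs t) (us t))) at_top"
proof -
  have "((\<lambda>t. xs 0 + integral {0..t} (\<lambda>t. \<phi> t (xs t) (us t))) \<longlongrightarrow> xs 0 + integral {0..} (\<lambda>t. \<phi> t (xs t) (us t))) at_top"
    by (intro tendsto_intros tendsto_integral_half_line phi_absolutely_integrable)
  then show ?thesis
    by (rule Lim_transform_eventually)
      (rule eventually_mono[OF eventually_ge_at_top[of 0]], rule xs_eq[symmetric])
qed

text \<open>The derivative of \<open>h1\<close> extends continuously to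
  \<open>t = \<infinity>\<close>. Its formal control argument is held at \<open>us 0\<close>,
  because \<open>us\<close> itself need not have a limit.\<close>

lemma H1_converges: "\<exists>L. (H1 \<longlongrightarrow> L) at_top"
proof -
  obtain \<gamma> K :: real and D1 :: "real \<Rightarrow> real^'n \<Rightarrow> real^'m \<Rightarrow> (real^'n) \<Rightarrow>\<^sub>L (real^'n)"
    and D2 :: "real \<Rightarrow> real^'n \<Rightarrow> real^'m \<Rightarrow> (real^'n) \<Rightarrow>\<^sub>L real"
    and D3 :: "(real^'n) \<Rightarrow>\<^sub>L (real^'s0)"
    and D4 :: "real \<Rightarrow> real^'n \<Rightarrow> real^'m \<Rightarrow> (real^'n) \<Rightarrow>\<^sub>L (real^'s1)"
    where \<gamma>: "0 < \<gamma>" and uc: "unif_cont_compactified (tube xs \<gamma> (cball 0 C)) D4"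
    and der: "\<And>t u. 0 \<le> t \<Longrightarrow> u \<in> cball 0 C \<Longrightarrow> (h1 t has_derivative blinfun_apply (D4 t (xs t) u)) (at (xs t))"
    by (rule tube_estimates[OF order_refl zero_less_one]; blast)
  have u0: "us 0 \<in> cball 0 C" by (rule us_cball) auto
  obtain L where L: "((\<lambda>t. D4 t (xs t) (us 0)) \<longlongrightarrow> L) at_top"
    using \<gamma> by (rule_tac compactified_limit_exists[OF uc u0 xs_converges]) auto
  then have "(H1 \<longlongrightarrow> L) at_top"
    by (rule Lim_transform_eventually)
      (rule eventually_mono[OF eventually_ge_at_top[of 0]], rule H1_eq[OF der[OF _ u0]])
  then show ?thesis by blast
qed

lemma A_norm_eq: "t \<ge> 0 \<Longrightarrow> onorm ((*v) (jacobian (\<lambda>y. \<phi> t y (us t)) (at (xs t)))) = norm (A t)"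
  unfolding norm_blinfun.rep_eq by (rule arg_cong[where f=onorm], rule ext, rule jacobian_phi)

lemma A_borel: "(\<lambda>t. if 0 \<le> t then A t else 0) \<in> borel_measurable leb_half"
proof -
  obtain \<gamma> K :: real and D1 :: "real \<Rightarrow> real^'n \<Rightarrow> real^'m \<Rightarrow> (real^'n) \<Rightarrow>\<^sub>L (real^'n)"
    and D2 :: "real \<Rightarrow> real^'n \<Rightarrow> real^'m \<Rightarrow> (real^'n) \<Rightarrow>\<^sub>L real"
    and D3 :: "(real^'n) \<Rightarrow>\<^sub>L (real^'s0)"
    and D4 :: "real \<Rightarrow> real^'n \<Rightarrow> real^'m \<Rightarrow> (real^'n) \<Rightarrow>\<^sub>L (real^'s1)"
    where \<gamma>: "0 < \<gamma>" and uc: "unif_cont_compactified (tube xs \<gamma> (cball 0 C)) D1"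
    and der: "\<And>t. 0 \<le> t \<Longrightarrow> ((\<lambda>y. \<phi> t y (us t)) has_derivative blinfun_apply (D1 t (xs t) (us t))) (at (xs t))"
    by (rule tube_estimates[OF order_refl zero_less_one]; blast)
  have "(\<lambda>t. D1 t (xs t) (us t)) \<in> borel_measurable leb_half"
    using \<gamma> us_cball[OF _ order_refl] by (intro measurable_compose_tube[OF uc xs_measurable us_meas]) auto
  moreover have "(if 0 \<le> t then A t else 0) = D1 t (xs t) (us t)" if "t \<in> space leb_half" for t
    using that A_eq[OF der] by simp
  ultimately show ?thesis by (subst measurable_cong[where g="\<lambda>t. D1 t (xs t) (us t)"]) auto
qed

lemma A_apply_measurable:
  assumes "z \<in> borel_measurable leb_half" shows "(\<lambda>t. A t (z t)) \<in> borel_measurable leb_half"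
proof -
  have "(\<lambda>t. (if 0 \<le> t then A t else 0) (z t)) \<in> borel_measurable leb_half"
    by (rule blinfun_apply_measurable[OF A_borel assms])
  then show ?thesis by (rule measurable_cong[THEN iffD1, rotated]) simp
qed

lemma A_integrable: "(\<lambda>t. norm (A t)) absolutely_integrable_on {0..}"
proof (rule nn_integral_finite_absolutely_integrable)
  have "(\<lambda>t. norm (if 0 \<le> t then A t else 0)) \<in> borel_measurable leb_half"
    using A_borel by (rule measurable_compose) simp
  then show "(\<lambda>t. norm (A t)) \<in> borel_measurable leb_half"
    by (rule measurable_cong[THEN iffD1, rotated]) simp
  have "(\<integral>\<^sup>+t. ennreal (norm (norm (A t))) \<partial>leb_half) =
    (\<integral>\<^sup>+t. ennreal (onorm ((*v) (jacobian (\<lambda>y. \<phi> t y (us t)) (at (xs t))))) \<partial>leb_half)"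
    by (rule nn_integral_cong) (simp add: A_norm_eq)
  then show "(\<integral>\<^sup>+t. ennreal (norm (norm (A t))) \<partial>leb_half) < \<infinity>" using phix_int by simp
qed

lemma tail_bounds:
  obtains \<gamma>t where "\<gamma>t > 0"
    "\<And>\<delta> R \<gamma>. \<delta> > 0 \<Longrightarrow> C \<le> R \<Longrightarrow> \<gamma> \<le> \<gamma>t \<Longrightarrow> unif_cont_compactified (tube xs \<gamma> (cball 0 R)) \<phi> \<Longrightarrow>
      \<exists>T>0. \<forall>T'\<ge>T. \<forall>x\<in>W1_inf. \<forall>x'\<in>W1_inf. \<forall>B. (\<forall>t\<ge>0. norm (x t - xs t) \<le> \<gamma>) \<longrightarrow> (\<forall>t\<ge>0. norm (x' t - xs t) \<le> \<gamma>) \<longrightarrow>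
        (\<forall>t\<ge>0. norm (x t - x' t) \<le> B) \<longrightarrow>
        (\<lambda>t. norm (\<phi> t (x t) (us t) - \<phi> t (x' t) (us t) - A t (x t - x' t))) integrable_on {T'..} \<and>
        integral {T'..} (\<lambda>t. norm (\<phi> t (x t) (us t) - \<phi> t (x' t) (us t) - A t (x t - x' t))) \<le> \<delta> * B"
proof -
  obtain \<gamma>0 where \<gamma>0: "\<gamma>0 > 0" and tl: "\<And>\<delta>. \<delta> > 0 \<Longrightarrow> \<exists>T>0. \<forall>x\<in>W1_inf. \<forall>x'\<in>W1_inf.
         sup_norm (\<lambda>t. x t - xs t) < \<gamma>0 \<and> sup_norm (\<lambda>t. x' t - xs t) < \<gamma>0 \<longrightarrow>
         (\<integral>\<^sup>+t. ennreal (norm (\<phi> t (x t) (us t) - \<phi> t (x' t) (us t)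
              - jacobian (\<lambda>y. \<phi> t y (us t)) (at (xs t)) *v (x t - x' t))) \<partial>lebesgue_on {T..})
           \<le> ennreal (\<delta> * sup_norm (\<lambda>t. x t - x' t))"
    using tail by blast
  show ?thesis
  proof (rule that[of "\<gamma>0 / 2"])
    fix \<delta> R \<gamma> :: real assume \<delta>: "\<delta> > 0" and R: "C \<le> R" and \<gamma>: "\<gamma> \<le> \<gamma>0 / 2"
      and uc: "unif_cont_compactified (tube xs \<gamma> (cball 0 R)) \<phi>"
    obtain T where T: "T > 0" and tT: "\<forall>x\<in>W1_inf. \<forall>x'\<in>W1_inf.
         sup_norm (\<lambda>t. x t - xs t) < \<gamma>0 \<and> sup_norm (\<lambda>t. x' t - xs t) < \<gamma>0 \<longrightarrow>
         (\<integral>\<^sup>+t. ennreal (norm (\<phi> t (x t) (us t) - \<phi> t (x' t) (us t)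
              - jacobian (\<lambda>y. \<phi> t y (us t)) (at (xs t)) *v (x t - x' t))) \<partial>lebesgue_on {T..})
           \<le> ennreal (\<delta> * sup_norm (\<lambda>t. x t - x' t))"
      using tl[OF \<delta>] by blast
    show "\<exists>T>0. \<forall>T'\<ge>T. \<forall>x\<in>W1_inf. \<forall>x'\<in>W1_inf. \<forall>B. (\<forall>t\<ge>0. norm (x t - xs t) \<le> \<gamma>) \<longrightarrow> (\<forall>t\<ge>0. norm (x' t - xs t) \<le> \<gamma>) \<longrightarrow>
        (\<forall>t\<ge>0. norm (x t - x' t) \<le> B) \<longrightarrow>
        (\<lambda>t. norm (\<phi> t (x t) (us t) - \<phi> t (x' t) (us t) - A t (x t - x' t))) integrable_on {T'..} \<and>
        integral {T'..} (\<lambda>t. norm (\<phi> t (x t) (us t) - \<phi> t (x' t) (us t) - A t (x t - x' t))) \<le> \<delta> * B"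
    proof (intro exI[of _ T] conjI T allI ballI impI)
      fix T' x x' B
      assume T': "T \<le> T'" and x: "x \<in> W1_inf" "x' \<in> W1_inf"
        and xc: "\<forall>t\<ge>0. norm (x t - xs t) \<le> \<gamma>" "\<forall>t\<ge>0. norm (x' t - xs t) \<le> \<gamma>"
        and B: "\<forall>t\<ge>0. norm (x t - x' t) \<le> B"
      let ?g = "\<lambda>t. norm (\<phi> t (x t) (us t) - \<phi> t (x' t) (us t) - A t (x t - x' t))"
      have B0: "B \<ge> 0" using B norm_ge_zero order_trans by blast
      have xm: "x \<in> borel_measurable leb_half" "x' \<in> borel_measurable leb_half"
        using x by (auto intro: continuous_on_measurable_half W1_inf_continuous_on)
      have "(\<lambda>t. \<phi> t (x t) (us t)) \<in> borel_measurable leb_half" "(\<lambda>t. \<phi> t (x' t) (us t)) \<in> borel_measurable leb_half"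
        using xc us_cball[OF _ R] by (auto intro!: measurable_compose_tube[OF uc] xm us_meas)
      moreover have "(\<lambda>t. A t (x t - x' t)) \<in> borel_measurable leb_half"
        by (intro A_apply_measurable borel_measurable_diff xm)
      ultimately have gm: "?g \<in> borel_measurable leb_half" by measurable
      have "sup_norm (\<lambda>t. x t - xs t) \<le> \<gamma>" "sup_norm (\<lambda>t. x' t - xs t) \<le> \<gamma>"
        using xc by (auto intro: sup_norm_le)
      then have "sup_norm (\<lambda>t. x t - xs t) < \<gamma>0 \<and> sup_norm (\<lambda>t. x' t - xs t) < \<gamma>0" using \<gamma> \<gamma>0 by auto
      then have "(\<integral>\<^sup>+t. ennreal (norm (\<phi> t (x t) (us t) - \<phi> t (x' t) (us t)
              - jacobian (\<lambda>y. \<phi> t y (us t)) (at (xs t)) *v (x t - x' t))) \<partial>lebesgue_on {T..})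
           \<le> ennreal (\<delta> * sup_norm (\<lambda>t. x t - x' t))"
        using tT x by blast
      also have "(\<integral>\<^sup>+t. ennreal (norm (\<phi> t (x t) (us t) - \<phi> t (x' t) (us t)
              - jacobian (\<lambda>y. \<phi> t y (us t)) (at (xs t)) *v (x t - x' t))) \<partial>lebesgue_on {T..})
        = (\<integral>\<^sup>+t. ennreal (?g t) \<partial>lebesgue_on {T..})"
        using T by (intro nn_integral_cong) (simp add: jacobian_phi)
      also have "ennreal (\<delta> * sup_norm (\<lambda>t. x t - x' t)) \<le> ennreal (\<delta> * B)"
        using \<delta> B by (intro ennreal_leI mult_left_mono sup_norm_le) auto
      finally have le: "(\<integral>\<^sup>+t. ennreal (?g t) \<partial>lebesgue_on {T..}) \<le> ennreal (\<delta> * B)" .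
      show "?g integrable_on {T'..}" "integral {T'..} ?g \<le> \<delta> * B"
        using nn_integral_tail_le[OF gm _ le _ T'] T \<delta> B0 by auto
    qed
  qed (use \<gamma>0 in simp)
qed

text \<open>Both \<open>R\<close>, as long as it is at least \<open>C\<close>, and the lower bound
  \<open>T1\<close> are free, so an instance can be adapted to needles that have already been
  chosen.\<close>

lemma control_problem_instance:
  assumes R: "C \<le> R" and H1inf: "(H1 \<longlongrightarrow> H1inf) at_top"
  shows "\<exists>\<gamma> K T. T \<ge> T1 \<and> control_problem \<phi> xs us (cball 0 R) \<gamma> K T A \<omega> f fx h0 h1 H0 H1 H1inf"
proof -
  let ?U = "cball (0::real^'m) R"
  obtain \<gamma>t where \<gamma>t: "\<gamma>t > 0" and tl: "\<And>\<delta> R \<gamma>. \<delta> > 0 \<Longrightarrow> C \<le> R \<Longrightarrow> \<gamma> \<le> \<gamma>t \<Longrightarrow> unif_cont_compactified (tube xs \<gamma> (cball 0 R)) \<phi> \<Longrightarrow>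
      \<exists>T>0. \<forall>T'\<ge>T. \<forall>x\<in>W1_inf. \<forall>x'\<in>W1_inf. \<forall>B. (\<forall>t\<ge>0. norm (x t - xs t) \<le> \<gamma>) \<longrightarrow> (\<forall>t\<ge>0. norm (x' t - xs t) \<le> \<gamma>) \<longrightarrow>
        (\<forall>t\<ge>0. norm (x t - x' t) \<le> B) \<longrightarrow>
        (\<lambda>t. norm (\<phi> t (x t) (us t) - \<phi> t (x' t) (us t) - A t (x t - x' t))) integrable_on {T'..} \<and>
        integral {T'..} (\<lambda>t. norm (\<phi> t (x t) (us t) - \<phi> t (x' t) (us t) - A t (x t - x' t))) \<le> \<delta> * B"
    by (rule tail_bounds) (rule that)
  obtain \<gamma> K :: real and D1 :: "real \<Rightarrow> real^'n \<Rightarrow> real^'m \<Rightarrow> (real^'n) \<Rightarrow>\<^sub>L (real^'n)"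
    and D2 :: "real \<Rightarrow> real^'n \<Rightarrow> real^'m \<Rightarrow> (real^'n) \<Rightarrow>\<^sub>L real"
    and D3 :: "(real^'n) \<Rightarrow>\<^sub>L (real^'s0)"
    and D4 :: "real \<Rightarrow> real^'n \<Rightarrow> real^'m \<Rightarrow> (real^'n) \<Rightarrow>\<^sub>L (real^'s1)"
    where \<gamma>: "0 < \<gamma>" "\<gamma> \<le> \<gamma>t" "K > 0"
    and uc: "unif_cont_compactified (tube xs \<gamma> ?U) \<phi>" "unif_cont_compactified (tube xs \<gamma> ?U) f"
    "unif_cont_compactified (tube xs \<gamma> ?U) (\<lambda>t x u. h1 t x)"
    and ucD: "unif_cont_compactified (tube xs \<gamma> ?U) D1" "unif_cont_compactified (tube xs \<gamma> ?U) D2"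
    "unif_cont_compactified (tube xs \<gamma> ?U) D4"
    and bd: "\<And>t x u. \<lbrakk>0 \<le> t; norm (x - xs t) \<le> \<gamma>; u \<in> ?U\<rbrakk> \<Longrightarrow> norm (\<phi> t x u) \<le> K"
    "\<And>t x u. \<lbrakk>0 \<le> t; norm (x - xs t) \<le> \<gamma>; u \<in> ?U\<rbrakk> \<Longrightarrow> norm (f t x u) \<le> K"
    and bdD: "\<And>t x u. \<lbrakk>0 \<le> t; norm (x - xs t) \<le> \<gamma>; u \<in> ?U\<rbrakk> \<Longrightarrow> norm (D1 t x u) \<le> K"
    "\<And>t x u. \<lbrakk>0 \<le> t; norm (x - xs t) \<le> \<gamma>; u \<in> ?U\<rbrakk> \<Longrightarrow> norm (D2 t x u) \<le> K"
    and lip: "\<And>t x y u. \<lbrakk>0 \<le> t; norm (x - xs t) \<le> \<gamma>; norm (y - xs t) \<le> \<gamma>; u \<in> ?U\<rbrakk> \<Longrightarrow> norm (\<phi> t x u - \<phi> t y u) \<le> K * norm (x - y)"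
    "\<And>t x y u. \<lbrakk>0 \<le> t; norm (x - xs t) \<le> \<gamma>; norm (y - xs t) \<le> \<gamma>; u \<in> ?U\<rbrakk> \<Longrightarrow> norm (f t x u - f t y u) \<le> K * norm (x - y)"
    "\<And>x y. \<lbrakk>norm (x - xs 0) \<le> \<gamma>; norm (y - xs 0) \<le> \<gamma>\<rbrakk> \<Longrightarrow> norm (h0 x - h0 y) \<le> K * norm (x - y)"
    "\<And>t x y. \<lbrakk>0 \<le> t; norm (x - xs t) \<le> \<gamma>; norm (y - xs t) \<le> \<gamma>\<rbrakk> \<Longrightarrow> norm (h1 t x - h1 t y) \<le> K * norm (x - y)"
    and der: "\<And>t. 0 \<le> t \<Longrightarrow> ((\<lambda>y. \<phi> t y (us t)) has_derivative D1 t (xs t) (us t)) (at (xs t))"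
    "\<And>t. 0 \<le> t \<Longrightarrow> ((\<lambda>y. f t y (us t)) has_derivative D2 t (xs t) (us t)) (at (xs t))"
    "\<And>t u. 0 \<le> t \<Longrightarrow> u \<in> ?U \<Longrightarrow> (h1 t has_derivative D4 t (xs t) u) (at (xs t))"
    and lin: "\<And>e. e > 0 \<Longrightarrow> \<exists>\<rho>>0. \<forall>t\<ge>0. \<forall>x. norm (x - xs t) \<le> \<rho> \<longrightarrow>
       norm (\<phi> t x (us t) - \<phi> t (xs t) (us t) - D1 t (xs t) (us t) (x - xs t)) \<le> e * norm (x - xs t)"
    "\<And>e. e > 0 \<Longrightarrow> \<exists>\<rho>>0. \<forall>t\<ge>0. \<forall>x. norm (x - xs t) \<le> \<rho> \<longrightarrow>
       norm (f t x (us t) - f t (xs t) (us t) - D2 t (xs t) (us t) (x - xs t)) \<le> e * norm (x - xs t)"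
    "\<And>e. e > 0 \<Longrightarrow> \<exists>\<rho>>0. \<forall>t\<ge>0. \<forall>x. norm (x - xs t) \<le> \<rho> \<longrightarrow>
       norm (h1 t x - h1 t (xs t) - D4 t (xs t) (us t) (x - xs t)) \<le> e * norm (x - xs t)"
    by (rule tube_estimates[OF R \<gamma>t]) (rule that; assumption)
  have u0: "us t \<in> ?U" if "t \<ge> 0" for t using us_cball[OF that R] .
  have z: "norm (xs t - xs t) \<le> \<gamma>" for t using \<gamma> by simp
  have DA: "D1 t (xs t) (us t) = A t" if "t \<ge> 0" for t by (rule A_eq[OF der(1)[OF that]])
  have Dfx: "D2 t (xs t) (us t) v = fx t \<bullet> v" if "t \<ge> 0" for t v by (rule fx_eq[OF der(2)[OF that]])
  have DH: "D4 t (xs t) (us t) = H1 t" if "t \<ge> 0" for t by (rule H1_eq[OF der(3)[OF that u0[OF that]]])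
  \<comment> \<open>The tolerance prescribed by \<open>tail0\<close> of
    \<open>controlled_system\<close>.\<close>
  define \<delta> where "\<delta> = exp (- 2 * integral {0..} (\<lambda>t. norm (A t))) / 4"
  have \<delta>: "\<delta> > 0" by (simp add: \<delta>_def)
  obtain T0 where T0: "T0 > 0" and tT0: "\<forall>T'\<ge>T0. \<forall>x\<in>W1_inf. \<forall>x'\<in>W1_inf. \<forall>B. (\<forall>t\<ge>0. norm (x t - xs t) \<le> \<gamma>) \<longrightarrow> (\<forall>t\<ge>0. norm (x' t - xs t) \<le> \<gamma>) \<longrightarrow>
        (\<forall>t\<ge>0. norm (x t - x' t) \<le> B) \<longrightarrow>
        (\<lambda>t. norm (\<phi> t (x t) (us t) - \<phi> t (x' t) (us t) - A t (x t - x' t))) integrable_on {T'..} \<and>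
        integral {T'..} (\<lambda>t. norm (\<phi> t (x t) (us t) - \<phi> t (x' t) (us t) - A t (x t - x' t))) \<le> \<delta> * B"
    using tl[OF \<delta> R \<gamma>(2) uc(1)] by blast
  define T where "T = max T0 T1"
  have T: "T0 \<le> T" "T1 \<le> T" "T \<ge> 0" using T0 by (auto simp: T_def)
  \<comment> \<open>Converts the curves of the locale into members of \<open>W1_inf\<close>, for
    which the tail condition is stated.\<close>
  have W1: "x \<in> W1_inf" if g: "g \<in> borel_measurable leb_half" "\<And>t. t \<ge> 0 \<Longrightarrow> norm (g t) \<le> K"
    and x: "\<And>t. t \<ge> 0 \<Longrightarrow> x t = c + integral {0..t} g" "\<And>t. t \<ge> 0 \<Longrightarrow> norm (x t - xs t) \<le> \<gamma>" for x c g
  proof (rule W1_inf_integralI[OF g x(1)])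
    obtain b where b: "\<And>t. t \<ge> 0 \<Longrightarrow> norm (xs t) \<le> b" using xs_bounded by (auto simp: bounded_iff)
    have "norm (x t) \<le> b + \<gamma>" if "t \<ge> 0" for t
      using b[OF that] x(2)[OF that] norm_triangle_sub[of "x t" "xs t"] by linarith
    then show "bounded (x ` {0..})" by (auto simp: bounded_iff)
  qed
  have cs: "controlled_system \<phi> xs us ?U \<gamma> K T A"
  proof
    show "\<gamma> > 0" "K > 0" "T \<ge> 0" by fact+
    show "unif_cont_compactified (tube xs \<gamma> ?U) \<phi>" by fact
    show "us \<in> borel_measurable leb_half" by (rule us_meas)
    show "xs \<in> borel_measurable leb_half" by (rule xs_measurable)
    show "(\<lambda>t. \<phi> t (xs t) (us t)) absolutely_integrable_on {0..}" by (rule phi_absolutely_integrable)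
    show "(\<lambda>t. norm (A t)) absolutely_integrable_on {0..}" by (rule A_integrable)
    show "(\<lambda>t. A t (z t)) \<in> borel_measurable leb_half" if "z \<in> borel_measurable leb_half" for z
      using that by (rule A_apply_measurable)
    show "us t \<in> ?U" if "t \<ge> 0" for t using u0[OF that] .
    show "xs t = xs 0 + integral {0..t} (\<lambda>t. \<phi> t (xs t) (us t))" if "t \<ge> 0" for t using that by (rule xs_eq)
    show "norm (\<phi> t x u) \<le> K" if "0 \<le> t" "norm (x - xs t) \<le> \<gamma>" "u \<in> ?U" for t x u using that by (rule bd(1))
    show "norm (\<phi> t x u - \<phi> t y u) \<le> K * norm (x - y)"
      if "0 \<le> t" "norm (x - xs t) \<le> \<gamma>" "norm (y - xs t) \<le> \<gamma>" "u \<in> ?U" for t x y u using that by (rule lip(1))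
    fix x x' g g' c c' B
    assume g: "g \<in> borel_measurable leb_half" "g' \<in> borel_measurable leb_half"
       "\<And>t. t \<ge> 0 \<Longrightarrow> norm (g t) \<le> K" "\<And>t. t \<ge> 0 \<Longrightarrow> norm (g' t) \<le> K"
       "\<And>t. t \<ge> 0 \<Longrightarrow> x t = c + integral {0..t} g" "\<And>t. t \<ge> 0 \<Longrightarrow> x' t = c' + integral {0..t} g'"
      and close: "\<And>t. t \<ge> 0 \<Longrightarrow> norm (x t - xs t) \<le> \<gamma>" "\<And>t. t \<ge> 0 \<Longrightarrow> norm (x' t - xs t) \<le> \<gamma>"
       "\<And>t. t \<ge> 0 \<Longrightarrow> norm (x t - x' t) \<le> B"
    have W: "x \<in> W1_inf" "x' \<in> W1_inf"
      using W1[OF g(1,3,5) close(1)] W1[OF g(2,4,6) close(2)] by auto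
    have close': "\<forall>t\<ge>0. norm (x t - xs t) \<le> \<gamma>" "\<forall>t\<ge>0. norm (x' t - xs t) \<le> \<gamma>" "\<forall>t\<ge>0. norm (x t - x' t) \<le> B"
      using close by auto
    show "(\<lambda>t. norm (\<phi> t (x t) (us t) - \<phi> t (x' t) (us t) - A t (x t - x' t))) integrable_on {T..} \<and>
       integral {T..} (\<lambda>t. norm (\<phi> t (x t) (us t) - \<phi> t (x' t) (us t) - A t (x t - x' t)))
         \<le> exp (- 2 * integral {0..} (\<lambda>t. norm (A t))) / 4 * B"
      unfolding \<delta>_def[symmetric]
      by (rule tT0[THEN spec, THEN mp, OF T(1), THEN bspec, OF W(1), THEN bspec, OF W(2), THEN spec,
          THEN mp, OF close'(1), THEN mp, OF close'(2), THEN mp, OF close'(3)])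
  qed
  interpret cs: controlled_system \<phi> xs us ?U \<gamma> K T A by (rule cs)
  have trajW: "x \<in> W1_inf" if x: "cs.traj x" for x
  proof -
    obtain c g where "g \<in> borel_measurable leb_half" "\<forall>t\<ge>0. norm (g t) \<le> K" "\<forall>t\<ge>0. x t = c + integral {0..t} g"
      "\<forall>t\<ge>0. norm (x t - xs t) \<le> \<gamma>"
      using x unfolding cs.traj_def by blast
    then show ?thesis by (intro W1[of g x c]) blast+
  qed
  have "control_problem \<phi> xs us ?U \<gamma> K T A \<omega> f fx h0 h1 H0 H1 H1inf"
  proof (intro control_problem.intro cs control_problem_axioms.intro)
    show "\<omega> absolutely_integrable_on {0..}" using omega_L1 by (simp add: absolutely_integrable_leb_half_iff)
    show "unif_cont_compactified (tube xs \<gamma> ?U) f" by (rule uc(2))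
    show "norm (f t x u) \<le> K" if "0 \<le> t" "norm (x - xs t) \<le> \<gamma>" "u \<in> ?U" for t x u using that by (rule bd(2))
    show "norm (f t x u - f t y u) \<le> K * norm (x - y)"
      if "0 \<le> t" "norm (x - xs t) \<le> \<gamma>" "norm (y - xs t) \<le> \<gamma>" "u \<in> ?U" for t x y u using that by (rule lip(2))
    show "norm (h0 x - h0 y) \<le> K * norm (x - y)" if "norm (x - xs 0) \<le> \<gamma>" "norm (y - xs 0) \<le> \<gamma>" for x y
      using that by (rule lip(3))
    show "norm (h1 t x - h1 t y) \<le> K * norm (x - y)"
      if "0 \<le> t" "norm (x - xs t) \<le> \<gamma>" "norm (y - xs t) \<le> \<gamma>" for t x y using that by (rule lip(4))
    show "(h0 has_derivative H0) (at (xs 0))" by (rule H0_derivative)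
    show "(H1 \<longlongrightarrow> H1inf) at_top" by (rule H1inf)
    show "norm (A t) \<le> K" if "t \<ge> 0" for t using bdD(1)[OF that z u0[OF that]] DA[OF that] by simp
    show "norm (fx t) \<le> K" if t: "t \<ge> 0" for t
    proof -
      \<comment> \<open>The bound on the derivative is tested on the vector \<open>fx t\<close>
        itself.\<close>
      have "norm (fx t) * norm (fx t) = D2 t (xs t) (us t) (fx t)"
        unfolding Dfx[OF t] by (simp add: dot_square_norm power2_eq_square)
      also have "\<dots> \<le> K * norm (fx t)"
        using norm_blinfun[of "D2 t (xs t) (us t)" "fx t"] mult_right_mono[OF bdD(2)[OF t z u0[OF t]] norm_ge_zero[of "fx t"]] by simp
      finally show ?thesis using \<gamma>(3) by (cases "norm (fx t) = 0") auto
    qed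
    show "fx \<in> borel_measurable leb_half"
    proof (subst borel_measurable_euclidean_space, intro ballI)
      fix b :: "real^'n"
      have "(\<lambda>t. D2 t (xs t) (us t)) \<in> borel_measurable leb_half"
        by (rule measurable_compose_tube[OF ucD(2) xs_measurable us_meas z u0])
      then have "(\<lambda>t. D2 t (xs t) (us t) b) \<in> borel_measurable leb_half"
        by (rule blinfun_apply_measurable) simp
      then show "(\<lambda>t. fx t \<bullet> b) \<in> borel_measurable leb_half"
        by (rule measurable_cong[THEN iffD1, rotated]) (simp add: Dfx)
    qed
    show "\<exists>\<rho>>0. \<forall>t\<ge>0. \<forall>x. norm (x - xs t) \<le> \<rho> \<longrightarrow>
       norm (\<phi> t x (us t) - \<phi> t (xs t) (us t) - A t (x - xs t)) \<le> e * norm (x - xs t)" if "e > 0" for e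
      using lin(1)[OF that] by (simp add: DA cong: conj_cong)
    show "\<exists>\<rho>>0. \<forall>t\<ge>0. \<forall>x. norm (x - xs t) \<le> \<rho> \<longrightarrow>
       norm (f t x (us t) - f t (xs t) (us t) - fx t \<bullet> (x - xs t)) \<le> e * norm (x - xs t)" if "e > 0" for e
      using lin(2)[OF that] by (simp only: Dfx cong: imp_cong)
    show "\<exists>\<rho>>0. \<forall>t\<ge>0. \<forall>x. norm (x - xs t) \<le> \<rho> \<longrightarrow>
       norm (h1 t x - h1 t (xs t) - H1 t (x - xs t)) \<le> e * norm (x - xs t)" if "e > 0" for e
      using lin(3)[OF that] by (simp only: DH cong: imp_cong)
    show "\<exists>z. ((\<lambda>t. h1 t (x t)) \<longlongrightarrow> z) at_top" if x: "cs.traj x" and l: "(x \<longlongrightarrow> l) at_top" for x l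
      using compactified_limit_exists[OF uc(3) u0[OF order_refl] l cs.traj_close[OF x]] by blast
    show "\<exists>T'\<ge>T. \<forall>x B. cs.traj x \<longrightarrow> (\<forall>t\<ge>0. norm (x t - xs t) \<le> B) \<longrightarrow> integral {T'..} (cs.rem x xs) \<le> e * B"
      if e: "e > 0" for e
    proof -
      obtain Te where Te: "\<forall>T'\<ge>Te. \<forall>x\<in>W1_inf. \<forall>x'\<in>W1_inf. \<forall>B. (\<forall>t\<ge>0. norm (x t - xs t) \<le> \<gamma>) \<longrightarrow> (\<forall>t\<ge>0. norm (x' t - xs t) \<le> \<gamma>) \<longrightarrow>
        (\<forall>t\<ge>0. norm (x t - x' t) \<le> B) \<longrightarrow>
        (\<lambda>t. norm (\<phi> t (x t) (us t) - \<phi> t (x' t) (us t) - A t (x t - x' t))) integrable_on {T'..} \<and>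
        integral {T'..} (\<lambda>t. norm (\<phi> t (x t) (us t) - \<phi> t (x' t) (us t) - A t (x t - x' t))) \<le> e * B"
        using tl[OF e R \<gamma>(2) uc(1)] by blast
      \<comment> \<open>The time belonging to the tolerance \<open>e\<close> may precede
        \<open>T\<close>, while \<open>tail_small\<close> asks for one not before it.\<close>
      show ?thesis
      proof (intro exI[of _ "max T Te"] conjI allI impI)
        fix x B assume x: "cs.traj x" and B: "\<forall>t\<ge>0. norm (x t - xs t) \<le> B"
        have "integral {max T Te..} (\<lambda>t. norm (\<phi> t (x t) (us t) - \<phi> t (xs t) (us t) - A t (x t - xs t))) \<le> e * B"
          using Te[rule_format, of "max T Te" x xs B] trajW[OF x] xs_W1 cs.traj_close[OF x] z B by auto
        then show "integral {max T Te..} (cs.rem x xs) \<le> e * B" unfolding cs.rem_def[abs_def] .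
      qed simp
    qed
  qed
  then show ?thesis using T(2) by blast
qed

end

section \<open>Multipliers\<close>

lemma adjoint_eq_transpose:
  fixes L :: "(real^'n) \<Rightarrow>\<^sub>L (real^'m)"
  assumes "\<And>v. M *v v = L v"
  shows "adjoint L p = transpose M *v p"
proof -
  have "adjoint L p \<bullet> v = (transpose M *v p) \<bullet> v" for v
    using adjoint_blinfun(1)[of L p v] inner_transpose_mult[of M p v] assms[of v] by (simp only:)
  then show ?thesis using vector_eq_rdot[of "adjoint L p" "transpose M *v p"] by blast
qed

lemma adjoint_blinfun_tendsto:
  fixes L :: "real \<Rightarrow> 'x::euclidean_space \<Rightarrow>\<^sub>L 'y::euclidean_space"
  assumes "(L \<longlongrightarrow> Linf) F"
  shows "((\<lambda>t. adjoint (L t) p) \<longlongrightarrow> adjoint Linf p) F"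
proof -
  have eq: "adjoint M p = (\<Sum>b\<in>Basis. (p \<bullet> M b) *\<^sub>R b)" for M :: "'x \<Rightarrow>\<^sub>L 'y"
    using euclidean_representation[of "adjoint M p"] by (simp add: adjoint_blinfun)
  show ?thesis unfolding eq by (intro tendsto_intros assms)
qed

lemma subspace_coord_space: "subspace (coord_space I)"
  by (auto simp: subspace_def coord_space_def)

lemma closed_coord_space: "closed (coord_space I)"
  by (rule closed_subspace[OF subspace_coord_space])

context control_problem
begin

lemma adjoint_rhs_sum:
  "adjoint_rhs (\<Sum>b\<in>B. c b * l b) (\<lambda>t. \<Sum>b\<in>B. c b *\<^sub>R p b t) t = (\<Sum>b\<in>B. c b *\<^sub>R adjoint_rhs (l b) (p b) t)"
  by (simp add: adjoint_rhs_def linear_sum[OF adjoint_blinfun_linear] linear_cmul[OF adjoint_blinfun_linear]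
      scaleR_sum_left sum_distrib_right sum.distrib scaleR_diff_right sum_subtractf sum_negf mult.assoc)

text \<open>The adjoint equation and its terminal condition are linear in \<open>lam0\<close>,
  \<open>l1\<close> and \<open>p\<close> jointly; this carries the costates of a basis over to any
  multiplier.\<close>

lemma costate_sum:
  assumes B: "finite B" and p: "\<And>b. b \<in> B \<Longrightarrow> costate (l b) (m b) (p b)"
  shows "costate (\<Sum>b\<in>B. c b * l b) (\<Sum>b\<in>B. c b *\<^sub>R m b) (\<lambda>t. \<Sum>b\<in>B. c b *\<^sub>R p b t)"
proof -
  let ?P = "\<lambda>t. \<Sum>b\<in>B. c b *\<^sub>R p b t" and ?r = "\<lambda>t. \<Sum>b\<in>B. c b *\<^sub>R adjoint_rhs (l b) (p b) t"
  have pb: "bounded (p b ` {0..})" "adjoint_rhs (l b) (p b) absolutely_integrable_on {0..}"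
    "\<And>t. t \<ge> 0 \<Longrightarrow> p b t = p b 0 + integral {0..t} (adjoint_rhs (l b) (p b))"
    "(p b \<longlongrightarrow> - adjoint H1inf (m b)) at_top" if "b \<in> B" for b
    using p[OF that] unfolding costate_def by blast+
  have "\<exists>M. \<forall>t\<ge>0. norm (p b t) \<le> M" if "b \<in> B" for b
    using pb(1)[OF that] by (auto simp: bounded_iff)
  then obtain M where M: "\<And>b t. b \<in> B \<Longrightarrow> t \<ge> 0 \<Longrightarrow> norm (p b t) \<le> M b" by metis
  have "norm (?P t) \<le> (\<Sum>b\<in>B. \<bar>c b\<bar> * M b)" if "t \<ge> 0" for t
    by (rule sum_norm_le) (auto intro!: mult_left_mono M that)
  then have 1: "bounded (?P ` {0..})" by (auto simp: bounded_iff)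
  have 2: "?r absolutely_integrable_on {0..}"
    using B pb(2) by (intro absolutely_integrable_sum absolutely_integrable_scaleR_left) auto
  have 3: "?P t = ?P 0 + integral {0..t} ?r" if t: "t \<ge> 0" for t
  proof -
    have I: "adjoint_rhs (l b) (p b) integrable_on {0..t}" if "b \<in> B" for b
      using absolutely_integrable_on_subinterval[OF pb(2)[OF that], of 0 t] by (auto simp: absolutely_integrable_on_def)
    have "integral {0..t} ?r = (\<Sum>b\<in>B. c b *\<^sub>R integral {0..t} (adjoint_rhs (l b) (p b)))"
      using B I by (subst integral_sum) (auto intro: integrable_cmul)
    moreover have "?P t = (\<Sum>b\<in>B. c b *\<^sub>R (p b 0 + integral {0..t} (adjoint_rhs (l b) (p b))))"
      by (intro sum.cong refl arg_cong2[where f="(*\<^sub>R)"] pb(3) t)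
    ultimately show ?thesis by (simp add: scaleR_add_right sum.distrib)
  qed
  have "(?P \<longlongrightarrow> (\<Sum>b\<in>B. c b *\<^sub>R (- adjoint H1inf (m b)))) at_top"
    by (intro tendsto_intros pb(4))
  also have "(\<Sum>b\<in>B. c b *\<^sub>R (- adjoint H1inf (m b))) = - adjoint H1inf (\<Sum>b\<in>B. c b *\<^sub>R m b)"
    by (simp add: linear_sum[OF adjoint_blinfun_linear] linear_cmul[OF adjoint_blinfun_linear] sum_negf)
  finally have 4: "(?P \<longlongrightarrow> - adjoint H1inf (\<Sum>b\<in>B. c b *\<^sub>R m b)) at_top" .
  have r: "adjoint_rhs (\<Sum>b\<in>B. c b * l b) ?P = ?r" by (rule ext) (rule adjoint_rhs_sum)
  show ?thesis
    unfolding costate_def r using 1 2 3 4 by blast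
qed

lemma needle_gain_sum:
  "needle_gain (\<Sum>b\<in>B. c b * l b) (\<lambda>t. \<Sum>b\<in>B. c b *\<^sub>R p b t) t v = (\<Sum>b\<in>B. c b * needle_gain (l b) (p b) t v)"
  by (simp add: needle_gain_def inner_sum_left sum_distrib_right sum_subtractf[symmetric] right_diff_distrib mult.assoc)

lemma sol_admissible:
  assumes s: "sol y u x" and U: "\<And>t. t \<ge> 0 \<Longrightarrow> u t \<in> U" "bounded U1" and b: "bounded (xs ` {0..})"
  shows "x \<in> W1_inf" "u \<in> L_inf U" "AE t in leb_half. (x has_vector_derivative \<phi> t (x t) (u t)) (at t within {0..})"
    "integrable leb_half (\<lambda>t. \<omega> t * f t (x t) (u t))" "(LINT t|leb_half. \<omega> t * f t (x t) (u t)) = J x u"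
proof -
  note tr = sol_traj[OF s] and u = sol_ctrl[OF s]
  have eq: "x t = (xs 0 + y) + integral {0..t} (\<lambda>t. \<phi> t (x t) (u t))" if "t \<ge> 0" for t
    using s that by (simp add: sol_def)
  obtain M where M: "\<And>t. t \<ge> 0 \<Longrightarrow> norm (xs t) \<le> M" using b by (auto simp: bounded_iff)
  have "norm (x t) \<le> M + \<gamma>" if "t \<ge> 0" for t
    using M[OF that] traj_close[OF tr that] norm_triangle_sub[of "x t" "xs t"] by linarith
  then have bdd: "bounded (x ` {0..})" by (auto simp: bounded_iff)
  show "x \<in> W1_inf"
  proof (rule W1_inf_integralI[OF phi_traj(1)[OF tr u] _ _ bdd])
    show "norm (\<phi> t (x t) (u t)) \<le> K" if "t \<ge> 0" for t by (rule phi_traj(2)[OF tr u that])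
    show "x t = (xs 0 + y) + integral {0..t} (\<lambda>t. \<phi> t (x t) (u t))" if "t \<ge> 0" for t by (rule eq[OF that])
  qed
  show "AE t in leb_half. (x has_vector_derivative \<phi> t (x t) (u t)) (at t within {0..})"
    by (rule integral_derivative_AE[OF phi_traj(3)[OF tr u] eq])
  show "integrable leb_half (\<lambda>t. \<omega> t * f t (x t) (u t))"
    using f_traj(3)[OF tr u] by (simp add: absolutely_integrable_leb_half_iff)
  show "(LINT t|leb_half. \<omega> t * f t (x t) (u t)) = J x u" unfolding J_def by (rule integral_leb_half[OF f_traj(3)[OF tr u]])
  obtain R where "\<And>v. v \<in> U1 \<Longrightarrow> norm v \<le> R" using U(2) by (auto simp: bounded_iff)
  then have "ess_bounded u"
    unfolding ess_bounded_def
    by (intro exI[of _ R] leb_half_AE_I[OF negligible_empty]) (use u in \<open>auto simp: ctrl_def\<close>)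
  then show "u \<in> L_inf U" using u U(1) by (auto simp: L_inf_def ctrl_def)
qed

end

text \<open>\<open>opt\<close> compares with the integral along \<open>us\<close> directly, because
  \<open>strong_local_min\<close> is available for the control before its change on a null
  set.\<close>

locale pontryagin_optimal = pontryagin_data \<omega> f \<phi> h0 h1 xs us C
  for \<omega> :: "real \<Rightarrow> real"
    and f :: "real \<Rightarrow> real^'n \<Rightarrow> real^'m \<Rightarrow> real"
    and \<phi> :: "real \<Rightarrow> real^'n \<Rightarrow> real^'m \<Rightarrow> real^'n"
    and h0 :: "real^'n \<Rightarrow> real^'s0"
    and h1 :: "real \<Rightarrow> real^'n \<Rightarrow> real^'s1"
    and xs :: "real \<Rightarrow> real^'n" and us :: "real \<Rightarrow> real^'m" and C :: real +
  fixes U :: "(real^'m) set" and I0 :: "'s0 set" and I1 :: "'s1 set"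
  assumes us_U: "\<And>t. t \<ge> 0 \<Longrightarrow> us t \<in> U"
    and h0_range: "\<And>x. h0 x \<in> coord_space I0"
    and h1_range: "\<And>t x. h1 t x \<in> coord_space I1"
    and h0_feas: "h0 (xs 0) = 0" and h1_feas: "((\<lambda>t. h1 t (xs t)) \<longlongrightarrow> 0) at_top"
    and opt: "\<exists>\<epsilon>>0. \<forall>x u. admissible \<omega> f \<phi> h0 h1 U x u \<and> sup_norm (\<lambda>t. x t - xs t) \<le> \<epsilon> \<longrightarrow>
        integral {0..} (\<lambda>t. \<omega> t * f t (xs t) (us t)) \<le> cost \<omega> f x u"
begin

text \<open>A ball of radius at least \<open>norm u + 1\<close> contains the sequence eventually, so
  uniform continuity on one compact set of controls suffices.\<close>

lemma control_continuous:
  assumes t: "t \<ge> 0" and v: "v \<longlonglongrightarrow> u"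
  shows "(\<lambda>k. \<phi> t (xs t) (v k)) \<longlonglongrightarrow> \<phi> t (xs t) u" "(\<lambda>k. f t (xs t) (v k)) \<longlonglongrightarrow> f t (xs t) u"
proof -
  define R where "R = max C (norm u + 1)"
  have R: "C \<le> R" by (simp add: R_def)
  obtain \<gamma> :: real where \<gamma>: "0 < \<gamma>" and uc: "unif_cont_compactified (tube xs \<gamma> (cball 0 R)) \<phi>"
    "unif_cont_compactified (tube xs \<gamma> (cball 0 R)) f"
    by (rule tube_estimates[OF R zero_less_one]; blast)
  have z: "norm (xs t - xs t) \<le> \<gamma>" using \<gamma> by simp
  have uR: "u \<in> cball 0 R" by (simp add: R_def)
  have ev: "\<forall>\<^sub>F k in sequentially. v k \<in> cball 0 R"
  proof -
    have "\<forall>\<^sub>F k in sequentially. dist (v k) u < 1" using v by (rule tendstoD) simp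
    then show ?thesis
    proof eventually_elim
      case (elim k)
      then have "norm (v k) \<le> norm u + 1"
        using norm_triangle_sub[of "v k" u] by (simp add: dist_norm)
      then show ?case by (simp add: R_def)
    qed
  qed
  have gen: "(\<lambda>k. g t (xs t) (v k)) \<longlonglongrightarrow> g t (xs t) u"
    if g: "unif_cont_compactified (tube xs \<gamma> (cball 0 R)) g" for g :: "real \<Rightarrow> real^'n \<Rightarrow> real^'m \<Rightarrow> 'z::metric_space"
  proof (rule tendstoI)
    fix e :: real assume "e > 0"
    then obtain d where d: "d > 0" "\<And>t x y u v. \<lbrakk>0 \<le> t; norm (x - xs t) \<le> \<gamma>; norm (y - xs t) \<le> \<gamma>; u \<in> cball 0 R;
      v \<in> cball 0 R; dist x y < d; dist u v < d\<rbrakk> \<Longrightarrow> dist (g t x u) (g t y v) < e"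
      by (rule unif_cont_compactified_D[OF g]) (rule that; assumption)
    have "\<forall>\<^sub>F k in sequentially. dist (v k) u < d" using v d(1) by (rule tendstoD)
    then show "\<forall>\<^sub>F k in sequentially. dist (g t (xs t) (v k)) (g t (xs t) u) < e"
      using ev by eventually_elim (rule d(2)[OF t z z _ uR], use d(1) in auto)
  qed
  show "(\<lambda>k. \<phi> t (xs t) (v k)) \<longlonglongrightarrow> \<phi> t (xs t) u" "(\<lambda>k. f t (xs t) (v k)) \<longlonglongrightarrow> f t (xs t) u"
    using gen uc by blast+
qed

theorem multipliers_exist:
  "\<exists>lam0 p l0 l1.
     lam0 \<ge> 0 \<and> p \<in> adjoint_class \<omega> \<and> l0 \<in> coord_space I0 \<and> l1 \<in> coord_space I1 \<and>
     \<not> (lam0 = 0 \<and> (\<forall>t\<ge>0. p t = 0) \<and> l0 = 0 \<and> l1 = 0) \<and>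
     (AE t in leb_half.
        (p has_vector_derivative
           (- (transpose (jacobian (\<lambda>y. \<phi> t y (us t)) (at (xs t))) *v p t)
            + (lam0 * \<omega> t) *\<^sub>R gradient (\<lambda>y. f t y (us t)) (xs t)))
          (at t within {0..})) \<and>
     p 0 = transpose (jacobian h0 (at (xs 0))) *v l0 \<and>
     (\<exists>L. ((\<lambda>t. transpose (jacobian (h1 t) (at (xs t))) *v l1) \<longlongrightarrow> L) at_top \<and>
          (p \<longlongrightarrow> - L) at_top) \<and>
     (AE t in leb_half. us t \<in> U \<and>
        (\<forall>u\<in>U. pontryagin \<omega> f \<phi> t (xs t) u (p t) lam0
                \<le> pontryagin \<omega> f \<phi> t (xs t) (us t) (p t) lam0))"
proof -
  obtain H1inf where H1inf: "(H1 \<longlongrightarrow> H1inf) at_top" using H1_converges by blast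
  \<comment> \<open>The smallest admissible ball is enough here: \<open>costate\<close> and
    \<open>needle_gain\<close> do not involve it and are shared by the larger instances
    below.\<close>
  obtain \<gamma> K T where base: "control_problem \<phi> xs us (cball 0 C) \<gamma> K T A \<omega> f fx h0 h1 H0 H1 H1inf"
    using control_problem_instance[OF order_refl H1inf] by blast
  interpret base: control_problem \<phi> xs us "cball 0 C" \<gamma> K T A \<omega> f fx h0 h1 H0 H1 H1inf by (rule base)
  \<comment> \<open>End values lie in \<open>W\<close> because \<open>h0\<close> and
    \<open>h1\<close> take values in coordinate subspaces; functionals are sought in
    \<open>W\<close> too, so that \<open>l0\<close> and \<open>l1\<close> belong to these
    subspaces.\<close>
  define W :: "(real \<times> (real^'s0) \<times> (real^'s1)) set" where "W = UNIV \<times> coord_space I0 \<times> coord_space I1"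
  have W: "subspace W" unfolding W_def by (intro subspace_Times subspace_UNIV subspace_coord_space)
  obtain B where B: "B \<subseteq> W" "pairwise orthogonal B" "\<And>b. b \<in> B \<Longrightarrow> norm b = 1" "independent B" "span B = W"
    using orthonormal_basis_subspace[OF W] by metis
  have finB: "finite B" using B(4) by (rule independent_imp_finite)
  have "\<forall>b :: real \<times> (real^'s0) \<times> (real^'s1). \<exists>q. base.costate (fst b) (snd (snd b)) q"
    using base.costate_exists by blast
  then obtain p where p: "\<And>b :: real \<times> (real^'s0) \<times> (real^'s1). base.costate (fst b) (snd (snd b)) (p b)"
    by metis
  obtain D where D: "countable D" "D \<subseteq> U" "U \<subseteq> closure D" using separable by blast
  have "D \<noteq> {}" using D(3) us_U[of 0] by auto
  then obtain v0 where v0: "v0 \<in> D" by blast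
  let ?gain = "\<lambda>b t v. base.needle_gain (fst b) (p b) t v"
  have "\<exists>N. negligible N \<and> (\<forall>t\<ge>0. t \<notin> N \<longrightarrow>
      ((\<lambda>t. integral {0..t} (\<lambda>t. ?gain b t v)) has_vector_derivative ?gain b t v) (at t within {0..}))"
    for b :: "real \<times> (real^'s0) \<times> (real^'s1)" and v
  proof -
    \<comment> \<open>\<open>v\<close> may lie outside the ball of \<open>base\<close>; an instance
      whose ball contains it gives the integrability of the gain.\<close>
    have "C \<le> max C (norm v)" by simp
    from control_problem_instance[OF this H1inf] obtain \<gamma>' K' T'
      where "control_problem \<phi> xs us (cball 0 (max C (norm v))) \<gamma>' K' T' A \<omega> f fx h0 h1 H0 H1 H1inf" by blast
    then interpret other: control_problem \<phi> xs us "cball 0 (max C (norm v))" \<gamma>' K' T' A \<omega> f fx h0 h1 H0 H1 H1inf .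
    have "AE t in leb_half. ((\<lambda>t. integral {0..t} (\<lambda>t. ?gain b t v)) has_vector_derivative ?gain b t v) (at t within {0..})"
      by (rule integral_has_vector_derivative_AE[OF other.needle_gain_integrable[OF p]]) simp
    then show ?thesis by (rule leb_half_AE_D)
  qed
  then obtain Nf where Nf: "\<And>(b :: real \<times> (real^'s0) \<times> (real^'s1)) v. negligible (Nf b v)"
    "\<And>b v t. t \<ge> 0 \<Longrightarrow> t \<notin> Nf b v \<Longrightarrow>
      ((\<lambda>t. integral {0..t} (\<lambda>t. ?gain b t v)) has_vector_derivative ?gain b t v) (at t within {0..})" by metis
  \<comment> \<open>Finitely many basis vectors and countably many values give countably many null
    sets. The point 0 is added since the derivative at a needle has to be two-sided.\<close>
  define N where "N = {0} \<union> \<Union>((\<lambda>(b, v). Nf b v) ` (B \<times> D))"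
  have N: "negligible N"
    unfolding N_def using Nf(1) D(1) finB
    by (intro negligible_Un negligible_sing negligible_countable_Union) (auto simp: countable_finite)
  have der: "((\<lambda>t. integral {0..t} (\<lambda>t. ?gain b t v)) has_vector_derivative ?gain b t v) (at t)"
    if "t > 0" "t \<notin> N" "b \<in> B" "v \<in> D" for b v t
  proof -
    have "t \<notin> Nf b v" using that unfolding N_def by blast
    then have "((\<lambda>t. integral {0..t} (\<lambda>t. ?gain b t v)) has_vector_derivative ?gain b t v) (at t within {0..})"
      using Nf(2) that(1) by simp
    moreover have "at t within {0..} = at t" using that(1) by (intro at_within_interior) (simp add: interior_real_atLeast)
    ultimately show ?thesis by simp
  qed
  \<comment> \<open>The pairing of a variation with \<open>b\<close>, as suggested by
    \<open>variation_formula\<close> for the costate \<open>p b\<close>; since \<open>B\<close> is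
    orthonormal, these are the coordinates of \<open>gv\<close>.\<close>
  define gc where "gc s y \<tau> v b = fst b * s + (adjoint H0 (fst (snd b)) - p b 0) \<bullet> y - ?gain b \<tau> v" for s y \<tau> v b
  define gv where "gv s y \<tau> v = (\<Sum>b\<in>B. gc s y \<tau> v b *\<^sub>R b)" for s y \<tau> v
  \<comment> \<open>\<open>gv s y \<tau> v\<close> is the first-order change of \<open>(J + s, h0, h1lim)\<close> caused by the initial shift \<open>y\<close> and
    the needle at \<open>\<tau>\<close> with value \<open>v\<close>; the slack \<open>s \<ge> 0\<close> is what forces \<open>lam0 \<ge> 0\<close>.\<close>
  define G where "G = {gv s y \<tau> v | s y \<tau> v. 0 \<le> s \<and> 0 < \<tau> \<and> \<tau> \<notin> N \<and> v \<in> D}"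
  have GW: "G \<subseteq> W"
    unfolding G_def gv_def using B(1) by (auto intro!: subspace_sum[OF W] subspace_scale[OF W])
  obtain \<tau>0 where \<tau>0: "\<tau>0 > 0" "\<tau>0 \<notin> N"
  proof -
    have "\<not> negligible {0<..<(1::real)}" using negligible_interval(2)[of 0 "1::real"] by (simp add: box_real)
    then have "\<not> {0<..<1} \<subseteq> N" using N negligible_subset by blast
    then obtain t where "t \<in> {0<..<1}" "t \<notin> N" by blast
    then show ?thesis by (intro that[of t]) auto
  qed
  have G0: "G \<noteq> {}" unfolding G_def using \<tau>0 v0 by (intro ex_in_conv[THEN iffD1]) (rule exI[of _ "gv 0 0 \<tau>0 v0"], blast)
  have bg: "b \<bullet> gv s y \<tau> v = gc s y \<tau> v b" if b: "b \<in> B" for b s y \<tau> v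
  proof -
    have "b \<bullet> gv s y \<tau> v = (\<Sum>b'\<in>B. gc s y \<tau> v b' * (b \<bullet> b'))" by (simp add: gv_def inner_sum_right)
    also have "\<dots> = (\<Sum>b'\<in>B. if b' = b then gc s y \<tau> v b' else 0)"
      using B(2,3) b by (intro sum.cong) (auto simp: pairwise_def orthogonal_def dot_square_norm)
    also have "\<dots> = gc s y \<tau> v b" using finB b by simp
    finally show ?thesis .
  qed
  show ?thesis
  proof (cases "\<exists>l. l \<in> W \<and> l \<noteq> 0 \<and> (\<forall>g\<in>G. 0 \<le> l \<bullet> g)")
    case True
    then obtain l where l: "l \<in> W" "l \<noteq> 0" "\<And>g. g \<in> G \<Longrightarrow> 0 \<le> l \<bullet> g" by blast
    define c where "c b = l \<bullet> b" for b
    have lsum: "l = (\<Sum>b\<in>B. c b *\<^sub>R b)"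
      unfolding c_def using orthonormal_basis_expand[OF B(2,3) _ finB, of l] l(1) B(5) by simp
    define lam0 l0 l1 where "lam0 = fst l" and "l0 = fst (snd l)" and "l1 = snd (snd l)"
    have lam0: "lam0 = (\<Sum>b\<in>B. c b * fst b)" and l0: "l0 = (\<Sum>b\<in>B. c b *\<^sub>R fst (snd b))"
      and l1: "l1 = (\<Sum>b\<in>B. c b *\<^sub>R snd (snd b))"
      unfolding lam0_def l0_def l1_def by (subst lsum, simp add: fst_sum snd_sum)+
    define P where "P t = (\<Sum>b\<in>B. c b *\<^sub>R p b t)" for t
    have P: "base.costate lam0 l1 P"
      unfolding lam0 l1 P_def[abs_def] by (rule base.costate_sum[OF finB p])
    have lg: "l \<bullet> gv s y \<tau> v = lam0 * s + (adjoint H0 l0 - P 0) \<bullet> y - base.needle_gain lam0 P \<tau> v" for s y \<tau> v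
    proof -
      have "l \<bullet> gv s y \<tau> v = (\<Sum>b\<in>B. c b * gc s y \<tau> v b)"
        by (simp add: gv_def c_def inner_sum_right mult.commute)
      also have "\<dots> = (\<Sum>b\<in>B. c b * fst b) * s + (\<Sum>b\<in>B. c b *\<^sub>R (adjoint H0 (fst (snd b)) - p b 0)) \<bullet> y - (\<Sum>b\<in>B. c b * ?gain b \<tau> v)"
        by (simp add: gc_def inner_sum_left sum_distrib_right sum.distrib sum_subtractf right_diff_distrib distrib_left mult.assoc)
      also have "(\<Sum>b\<in>B. c b *\<^sub>R (adjoint H0 (fst (snd b)) - p b 0)) = adjoint H0 l0 - P 0"
        by (simp add: l0 P_def linear_sum[OF adjoint_blinfun_linear] linear_cmul[OF adjoint_blinfun_linear] scaleR_diff_right sum_subtractf)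
      also have "(\<Sum>b\<in>B. c b * ?gain b \<tau> v) = base.needle_gain lam0 P \<tau> v"
        unfolding lam0 P_def[abs_def] by (rule base.needle_gain_sum[symmetric])
      finally show ?thesis by (simp add: lam0)
    qed
    have ineq: "0 \<le> lam0 * s + (adjoint H0 l0 - P 0) \<bullet> y - base.needle_gain lam0 P \<tau> v"
      if "0 \<le> s" "0 < \<tau>" "\<tau> \<notin> N" "v \<in> D" for s y \<tau> v
      unfolding lg[symmetric] by (rule l(3)) (use that in \<open>auto simp: G_def\<close>)
    \<comment> \<open>Every vector in \<open>G\<close> includes a needle. One fixed needle has a
      fixed gain, which a large slack or a large initial shift outweighs.\<close>
    let ?g0 = "base.needle_gain lam0 P \<tau>0 v0"
    have lam0_nonneg: "lam0 \<ge> 0"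
    proof (rule ccontr)
      assume "\<not> lam0 \<ge> 0"
      then have neg: "lam0 < 0" by simp
      have "0 \<le> (\<bar>?g0\<bar> + 1) / (- lam0)" using neg by (intro divide_nonneg_pos) auto
      then have "0 \<le> lam0 * ((\<bar>?g0\<bar> + 1) / (- lam0)) + (adjoint H0 l0 - P 0) \<bullet> 0 - ?g0"
        by (rule ineq[OF _ \<tau>0 v0])
      moreover have "lam0 * ((\<bar>?g0\<bar> + 1) / (- lam0)) = - (\<bar>?g0\<bar> + 1)" using neg by simp
      ultimately show False by simp
    qed
    have P0: "P 0 = adjoint H0 l0"
    proof (rule ccontr)
      assume "P 0 \<noteq> adjoint H0 l0"
      define w where "w = adjoint H0 l0 - P 0"
      have w: "w \<bullet> w > 0" using \<open>P 0 \<noteq> adjoint H0 l0\<close> by (simp add: w_def)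
      \<comment> \<open>The shift is scaled so that its pairing with \<open>w\<close> is
        \<open>- (\<bar>?g0\<bar> + 1)\<close>.\<close>
      have "0 \<le> lam0 * 0 + w \<bullet> (- ((\<bar>?g0\<bar> + 1) / (w \<bullet> w)) *\<^sub>R w) - ?g0"
        unfolding w_def by (intro ineq \<tau>0 v0) simp
      then have "0 \<le> - (\<bar>?g0\<bar> + 1) - ?g0" using w by simp
      then show False by simp
    qed
    have gain_le: "base.needle_gain lam0 P t v \<le> 0" if "0 < t" "t \<notin> N" "v \<in> D" for t v
      using ineq[of 0 t v 0] that by simp
    have ai: "base.adjoint_rhs lam0 P absolutely_integrable_on {0..}"
      and Peq: "\<And>t. t \<ge> 0 \<Longrightarrow> P t = P 0 + integral {0..t} (base.adjoint_rhs lam0 P)"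
      and Pb: "bounded (P ` {0..})" and Plim: "(P \<longlongrightarrow> - adjoint H1inf l1) at_top"
      using P unfolding base.costate_def by blast+
    have aiR: "base.adjoint_rhs lam0 P absolutely_integrable_on {0..R}" for R
      by (rule absolutely_integrable_on_subinterval[OF ai]) auto
    have lac: "locally_abs_cont P" by (rule locally_abs_cont_integral[OF aiR Peq])
    have Pder: "AE t in leb_half. (P has_vector_derivative base.adjoint_rhs lam0 P t) (at t within {0..})"
      by (rule integral_derivative_AE[OF aiR Peq])
    have rhs: "base.adjoint_rhs lam0 P t = - (transpose (jacobian (\<lambda>y. \<phi> t y (us t)) (at (xs t))) *v P t)
            + (lam0 * \<omega> t) *\<^sub>R gradient (\<lambda>y. f t y (us t)) (xs t)" if "t \<ge> 0" for t
      unfolding base.adjoint_rhs_def fx_def using adjoint_eq_transpose[OF jacobian_phi[OF that]] by simp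
    \<comment> \<open>\<open>A\<close> and \<open>fx\<close> are bounded by \<open>K\<close>, so an
      essentially bounded \<open>\<omega>\<close> makes the right-hand side essentially
      bounded.\<close>
    have PW: "P \<in> W1_inf" if "ess_bounded \<omega>"
    proof -
      obtain Co where "AE t in leb_half. norm (\<omega> t) \<le> Co" using \<open>ess_bounded \<omega>\<close> unfolding ess_bounded_def by blast
      then obtain N' where N': "negligible N'" "\<And>t. t \<ge> 0 \<Longrightarrow> t \<notin> N' \<Longrightarrow> norm (\<omega> t) \<le> Co" using leb_half_AE_D by blast
      obtain Pm where Pm: "Pm \<ge> 0" "\<And>t. t \<ge> 0 \<Longrightarrow> norm (P t) \<le> Pm" using base.costate_bounded[OF P] by blast
      have bnd: "norm (base.adjoint_rhs lam0 P t) \<le> K * Pm + \<bar>lam0\<bar> * Co * K" if t: "t \<ge> 0" "t \<notin> N'" for t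
      proof -
        have "norm (adjoint (A t) (P t)) \<le> K * Pm"
          using adjoint_blinfun(2)[of "A t" "P t"] mult_mono[OF base.A_bound[OF t(1)] Pm(2)[OF t(1)]] base.pos by auto
        moreover have "norm ((lam0 * \<omega> t) *\<^sub>R fx t) \<le> \<bar>lam0\<bar> * Co * K"
        proof -
          have "\<bar>lam0\<bar> * \<bar>\<omega> t\<bar> \<le> \<bar>lam0\<bar> * Co" using N'(2)[OF t] by (intro mult_left_mono) auto
          moreover have "0 \<le> Co" using N'(2)[OF t] norm_ge_zero order_trans by blast
          ultimately show ?thesis using base.fx(2)[OF t(1)] by (simp add: abs_mult mult_mono)
        qed
        ultimately show ?thesis
          unfolding base.adjoint_rhs_def by (intro norm_triangle_le) simp
      qed
      then have "ess_bounded (base.adjoint_rhs lam0 P)"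
        unfolding ess_bounded_def
        by (intro exI[of _ "K * Pm + \<bar>lam0\<bar> * Co * K"] leb_half_AE_I[OF N'(1)]) (rule bnd)
      then show ?thesis using Pb lac Pder unfolding W1_inf_def by blast
    qed
    have max: "pontryagin \<omega> f \<phi> t (xs t) u (P t) lam0 \<le> pontryagin \<omega> f \<phi> t (xs t) (us t) (P t) lam0"
      if t: "t \<ge> 0" "t \<notin> N" and u: "u \<in> U" for t u
    proof -
      have t0: "t > 0" using t by (cases "t = 0") (auto simp: N_def)
      \<comment> \<open>Density of \<open>D\<close> and continuity in the control extend the
        inequality from \<open>D\<close> to \<open>U\<close> without enlarging the null set.\<close>
      obtain v where v: "\<And>k. v k \<in> D" "v \<longlonglongrightarrow> u" 
        using subsetD[OF D(3) u] unfolding closure_sequential by blast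
      have lim: "(\<lambda>k. pontryagin \<omega> f \<phi> t (xs t) (v k) (P t) lam0) \<longlonglongrightarrow> pontryagin \<omega> f \<phi> t (xs t) u (P t) lam0"
        unfolding pontryagin_def by (intro tendsto_intros control_continuous v t)
      have le: "pontryagin \<omega> f \<phi> t (xs t) (v k) (P t) lam0 \<le> pontryagin \<omega> f \<phi> t (xs t) (us t) (P t) lam0" for k
        using gain_le[OF t0 t(2) v(1)[of k]]
        by (simp add: base.needle_gain_def pontryagin_def inner_diff_right right_diff_distrib)
      show ?thesis by (rule LIMSEQ_le_const2[OF lim]) (intro exI[of _ 0] allI impI le)
    qed
    show ?thesis
    proof (intro exI[of _ lam0] exI[of _ P] exI[of _ l0] exI[of _ l1] conjI)
      show "lam0 \<ge> 0" by (rule lam0_nonneg)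
      show "P \<in> adjoint_class \<omega>" using Pb lac PW by (simp add: adjoint_class_def)
      show "l0 \<in> coord_space I0" "l1 \<in> coord_space I1" using l(1) by (auto simp: W_def l0_def l1_def)
      show "\<not> (lam0 = 0 \<and> (\<forall>t\<ge>0. P t = 0) \<and> l0 = 0 \<and> l1 = 0)"
        using l(2) by (auto simp: lam0_def l0_def l1_def prod_eq_iff)
      show "P 0 = transpose (jacobian h0 (at (xs 0))) *v l0"
        using adjoint_eq_transpose[of "jacobian h0 (at (xs 0))" H0 l0] jacobian_mult_eq[OF H0_derivative] P0 by simp
      show "AE t in leb_half. (P has_vector_derivative
           (- (transpose (jacobian (\<lambda>y. \<phi> t y (us t)) (at (xs t))) *v P t)
            + (lam0 * \<omega> t) *\<^sub>R gradient (\<lambda>y. f t y (us t)) (xs t))) (at t within {0..})"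
      proof -
        obtain N' where N': "negligible N'" "\<And>t. t \<ge> 0 \<Longrightarrow> t \<notin> N' \<Longrightarrow> (P has_vector_derivative base.adjoint_rhs lam0 P t) (at t within {0..})"
          using leb_half_AE_D[OF Pder] by blast
        show ?thesis
        proof (rule leb_half_AE_I[OF N'(1)])
          fix t assume t: "t \<ge> 0" "t \<notin> N'"
          show "(P has_vector_derivative
           (- (transpose (jacobian (\<lambda>y. \<phi> t y (us t)) (at (xs t))) *v P t)
            + (lam0 * \<omega> t) *\<^sub>R gradient (\<lambda>y. f t y (us t)) (xs t))) (at t within {0..})"
            using N'(2)[OF t] unfolding rhs[OF t(1)] .
        qed
      qed
      show "AE t in leb_half. us t \<in> U \<and> (\<forall>u\<in>U. pontryagin \<omega> f \<phi> t (xs t) u (P t) lam0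
                \<le> pontryagin \<omega> f \<phi> t (xs t) (us t) (P t) lam0)"
        by (rule leb_half_AE_I[OF N]) (use max us_U in auto)
      show "\<exists>L. ((\<lambda>t. transpose (jacobian (h1 t) (at (xs t))) *v l1) \<longlongrightarrow> L) at_top \<and> (P \<longlongrightarrow> - L) at_top"
      proof (intro exI[of _ "adjoint H1inf l1"] conjI Plim)
        show "((\<lambda>t. transpose (jacobian (h1 t) (at (xs t))) *v l1) \<longlongrightarrow> adjoint H1inf l1) at_top"
        proof (rule Lim_transform_eventually[OF adjoint_blinfun_tendsto[OF H1inf]])
          show "\<forall>\<^sub>F t in at_top. adjoint (H1 t) l1 = transpose (jacobian (h1 t) (at (xs t))) *v l1"
            by (rule eventually_mono[OF eventually_ge_at_top[of 0]])
              (rule adjoint_eq_transpose, rule jacobian_mult_eq, rule H1_derivative)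
        qed
      qed
    qed
  next
    case False
    define e :: "real \<times> (real^'s0) \<times> (real^'s1)" where "e = (-1, 0, 0)"
    have eW: "e \<in> W" by (simp add: W_def e_def coord_space_def)
    obtain S \<alpha> where S: "finite S" "S \<subseteq> G" and \<alpha>: "\<And>g. continuous_on UNIV (\<alpha> g)" "\<And>g y. 0 \<le> \<alpha> g y"
      "\<And>y. y \<in> W \<Longrightarrow> (\<Sum>g\<in>S. \<alpha> g y *\<^sub>R g) = y + e"
      by (rule cone_param[OF W GW G0 False eW]) (rule that; assumption)
    \<comment> \<open>An enumeration is chosen because needles are laid out in the order of natural
      numbers.\<close>
    obtain h where h: "bij_betw h {..<card S} S"
      using ex_bij_betw_nat_finite[OF S(1)] by (auto simp: atLeast0LessThan)
    define n where "n = card S"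
    have hG: "h i \<in> G" if "i < n" for i using h that S(2) by (auto simp: n_def bij_betw_def)
    have "\<forall>i. \<exists>s y \<tau> v. i < n \<longrightarrow> h i = gv s y \<tau> v \<and> 0 \<le> s \<and> 0 < \<tau> \<and> \<tau> \<notin> N \<and> v \<in> D"
      using hG unfolding G_def by blast
    then obtain s y \<tau> v where nd: "\<And>i. i < n \<Longrightarrow> h i = gv (s i) (y i) (\<tau> i) (v i)" "\<And>i. i < n \<Longrightarrow> 0 \<le> s i"
      "\<And>i. i < n \<Longrightarrow> 0 < \<tau> i" "\<And>i. i < n \<Longrightarrow> \<tau> i \<notin> N" "\<And>i. i < n \<Longrightarrow> v i \<in> D" by metis
    \<comment> \<open>Large enough for the bound \<open>C\<close> on \<open>us\<close> and for all
      of the finitely many needle values.\<close>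
    define R where "R = max C (\<Sum>i<n. norm (v i))"
    have R: "C \<le> R" by (simp add: R_def)
    have vR: "v i \<in> cball 0 R" if "i < n" for i
      using member_le_sum[of i "{..<n}" "\<lambda>i. norm (v i)"] that by (simp add: R_def)
    \<comment> \<open>As all positions are positive, \<open>1 + (\<Sum>i<n. \<tau> i)\<close>
      exceeds each of them.\<close>
    obtain \<gamma>' K' T' where T': "T' \<ge> 1 + (\<Sum>i<n. \<tau> i)"
      and oth: "control_problem \<phi> xs us (cball 0 R) \<gamma>' K' T' A \<omega> f fx h0 h1 H0 H1 H1inf"
      using control_problem_instance[OF R H1inf] by blast
    interpret other: control_problem \<phi> xs us "cball 0 R" \<gamma>' K' T' A \<omega> f fx h0 h1 H0 H1 H1inf by (rule oth)
    have \<tau>T: "\<tau> i < T'" if "i < n" for i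
      using member_le_sum[of i "{..<n}" \<tau>] that nd(3) T' by (simp add: less_imp_le)
    have sumh: "(\<Sum>i<n. \<alpha> (h i) z *\<^sub>R h i) = z + e" if "z \<in> W" for z
      using sum.reindex_bij_betw[OF h, of "\<lambda>g. \<alpha> g z *\<^sub>R g"] \<alpha>(3)[OF that] by (simp add: n_def)
    obtain \<epsilon> where \<epsilon>: "\<epsilon> > 0" "\<And>x u. admissible \<omega> f \<phi> h0 h1 U x u \<Longrightarrow> sup_norm (\<lambda>t. x t - xs t) \<le> \<epsilon> \<Longrightarrow>
        integral {0..} (\<lambda>t. \<omega> t * f t (xs t) (us t)) \<le> cost \<omega> f x u"
      using opt by blast
    have range: "(r, h0 (x 0), other.h1lim x) \<in> W" if s: "other.sol y u x" for y u x r
    proof -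
      have "other.h1lim x \<in> coord_space I1"
        by (rule Lim_in_closed_set[OF closed_coord_space _ _ other.h1lim[OF s]]) (simp_all add: h1_range)
      then show ?thesis by (simp add: W_def h0_range)
    qed
    have h1lim_xs: "other.h1lim xs = 0"
      using tendsto_unique[OF _ other.h1lim[OF other.sol_us] h1_feas] by simp
    have "\<exists>y u x. other.sol y u x \<and> (\<forall>t\<ge>0. norm (x t - xs t) \<le> \<epsilon>) \<and> other.J x u < other.J xs us \<and> h0 (x 0) = 0 \<and>
      other.h1lim x = 0 \<and> (\<forall>t. u t = us t \<or> (\<exists>i<n. u t = v i))"
    proof (rule other.needle_descent[where W=W and B=B and p=p and N=n and g=h and \<alpha>="\<lambda>i. \<alpha> (h i)" and s=s and ?y0.0=y and \<tau>=\<tau> and v=v and e=e])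
      show "b \<bullet> h i = fst b * s i + (adjoint H0 (fst (snd b)) - p b 0) \<bullet> y i - other.needle_gain (fst b) (p b) (\<tau> i) (v i)"
        if "b \<in> B" "i < n" for b i
        using bg[OF that(1), of "s i" "y i" "\<tau> i" "v i"] nd(1)[OF that(2)] by (simp add: gc_def)
      show "((\<lambda>t. integral {0..t} (\<lambda>t. other.needle_gain (fst b) (p b) t (v i))) has_vector_derivative
        other.needle_gain (fst b) (p b) (\<tau> i) (v i)) (at (\<tau> i))" if "b \<in> B" "i < n" for b i
        by (rule der[OF nd(3)[OF that(2)] nd(4)[OF that(2)] that(1) nd(5)[OF that(2)]])
      show "subspace W" "finite B" "B \<subseteq> W" "pairwise orthogonal B" "span B = W"
        by (rule W finB B)+
      show "norm b = 1" if "b \<in> B" for b by (rule B(3)[OF that])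
      show "other.costate (fst b) (snd (snd b)) (p b)" for b by (rule p)
      show "0 < \<tau> i" "\<tau> i < T'" "v i \<in> cball 0 R" "0 \<le> s i" if "i < n" for i
        by (rule nd(3) \<tau>T vR nd(2), rule that)+
      show "continuous_on UNIV (\<alpha> (h i))" "0 \<le> \<alpha> (h i) z" for i z by (rule \<alpha>)+
      show "e = (-1, 0, 0)" "e \<in> W" by (rule e_def eW)+
      show "(\<Sum>i<n. \<alpha> (h i) z *\<^sub>R h i) = z + e" if "z \<in> W" for z by (rule sumh[OF that])
      show "(r, h0 (x 0), other.h1lim x) \<in> W" if "other.sol y u x" for y u x r by (rule range[OF that])
      show "h0 (xs 0) = 0" "other.h1lim xs = 0" "\<epsilon> > 0" by (rule h0_feas h1lim_xs \<epsilon>(1))+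
    qed
    then obtain y' u x where x: "other.sol y' u x" "\<forall>t\<ge>0. norm (x t - xs t) \<le> \<epsilon>" "other.J x u < other.J xs us"
      "h0 (x 0) = 0" "other.h1lim x = 0" "\<And>t. u t = us t \<or> (\<exists>i<n. u t = v i)" by blast
    have uU: "u t \<in> U" if "t \<ge> 0" for t using x(6)[of t] us_U[OF that] nd(5) D(2) by auto
    note sa = other.sol_admissible[OF x(1) uU bounded_cball xs_bounded]
    have "admissible \<omega> f \<phi> h0 h1 U x u"
      unfolding admissible_def using sa x(4) other.h1lim[OF x(1)] x(5) by simp
    moreover have "sup_norm (\<lambda>t. x t - xs t) \<le> \<epsilon>" using x(2) by (intro sup_norm_le) auto
    ultimately have "integral {0..} (\<lambda>t. \<omega> t * f t (xs t) (us t)) \<le> cost \<omega> f x u" by (rule \<epsilon>(2))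
    then show ?thesis using x(3) sa(5) by (simp add: cost_def other.J_def)
  qed
qed

end

text \<open>The control may be changed on a null set so as to be bounded everywhere.\<close>

theorem theorem3p1:
  fixes \<omega> :: "real \<Rightarrow> real"
    and f :: "real \<Rightarrow> real^'n \<Rightarrow> real^'m \<Rightarrow> real"
    and \<phi> :: "real \<Rightarrow> real^'n \<Rightarrow> real^'m \<Rightarrow> real^'n"
    and h0 :: "real^'n \<Rightarrow> real^'s0"
    and h1 :: "real \<Rightarrow> real^'n \<Rightarrow> real^'s1"
    and I0 :: "'s0 set" and I1 :: "'s1 set"
    and U :: "(real^'m) set"
    and xs :: "real \<Rightarrow> real^'n" and us :: "real \<Rightarrow> real^'m"
  assumes U_nonempty: "U \<noteq> {}"
    and omega_nonneg: "\<And>t. t \<ge> 0 \<Longrightarrow> \<omega> t \<ge> 0"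
    and omega_L1: "integrable leb_half \<omega>"
    and h0_range: "\<And>x. h0 x \<in> coord_space I0"
    and h1_range: "\<And>t x. h1 t x \<in> coord_space I1"
    and adm: "admissible \<omega> f \<phi> h0 h1 U xs us"
    and reg: "xs \<in> B_Lip f \<phi> h0 h1"
    and phi_int: "(\<integral>\<^sup>+t. ennreal (norm (\<phi> t (xs t) (us t))) \<partial>leb_half) < \<infinity>"
    and phix_int:
      "(\<integral>\<^sup>+t. ennreal (onorm ((*v) (jacobian (\<lambda>y. \<phi> t y (us t)) (at (xs t))))) \<partial>leb_half) < \<infinity>"
    and tail:
      "\<exists>\<gamma>>0. \<forall>\<delta>>0. \<exists>T>0. \<forall>x\<in>W1_inf. \<forall>x'\<in>W1_inf.
         sup_norm (\<lambda>t. x t - xs t) < \<gamma> \<and> sup_norm (\<lambda>t. x' t - xs t) < \<gamma> \<longrightarrow>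
         (\<integral>\<^sup>+t. ennreal (norm (\<phi> t (x t) (us t) - \<phi> t (x' t) (us t)
              - jacobian (\<lambda>y. \<phi> t y (us t)) (at (xs t)) *v (x t - x' t))) \<partial>lebesgue_on {T..})
           \<le> ennreal (\<delta> * sup_norm (\<lambda>t. x t - x' t))"
    and opt: "strong_local_min \<omega> f \<phi> h0 h1 U xs us"
  shows "\<exists>lam0 p l0 l1.
     lam0 \<ge> 0 \<and> p \<in> adjoint_class \<omega> \<and> l0 \<in> coord_space I0 \<and> l1 \<in> coord_space I1 \<and>
     \<not> (lam0 = 0 \<and> (\<forall>t\<ge>0. p t = 0) \<and> l0 = 0 \<and> l1 = 0) \<and>
     (AE t in leb_half.
        (p has_vector_derivative
           (- (transpose (jacobian (\<lambda>y. \<phi> t y (us t)) (at (xs t))) *v p t)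
            + (lam0 * \<omega> t) *\<^sub>R gradient (\<lambda>y. f t y (us t)) (xs t)))
          (at t within {0..})) \<and>
     p 0 = transpose (jacobian h0 (at (xs 0))) *v l0 \<and>
     (\<exists>L. ((\<lambda>t. transpose (jacobian (h1 t) (at (xs t))) *v l1) \<longlongrightarrow> L) at_top \<and>
          (p \<longlongrightarrow> - L) at_top) \<and>
     (AE t in leb_half. us t \<in> U \<and>
        (\<forall>u\<in>U. pontryagin \<omega> f \<phi> t (xs t) u (p t) lam0
                \<le> pontryagin \<omega> f \<phi> t (xs t) (us t) (p t) lam0))"
proof -
  obtain u0 where u0: "u0 \<in> U" using U_nonempty by blast
  have xs: "xs \<in> W1_inf" and us: "us \<in> borel_measurable leb_half" "\<And>t. t \<ge> 0 \<Longrightarrow> us t \<in> U" "ess_bounded us"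
    and der: "AE t in leb_half. (xs has_vector_derivative \<phi> t (xs t) (us t)) (at t within {0..})"
    and h: "h0 (xs 0) = 0" "((\<lambda>t. h1 t (xs t)) \<longlongrightarrow> 0) at_top"
    and int: "integrable leb_half (\<lambda>t. \<omega> t * f t (xs t) (us t))"
    using adm unfolding admissible_def L_inf_def by auto
  obtain C where "AE t in leb_half. norm (us t) \<le> C" using us(3) unfolding ess_bounded_def by blast
  then obtain N where N: "negligible N" "\<And>t. t \<ge> 0 \<Longrightarrow> t \<notin> N \<Longrightarrow> norm (us t) \<le> C" using leb_half_AE_D by blast
  \<comment> \<open>Large values are replaced by a fixed element of \<open>U\<close>, so that the
    everywhere valid bound becomes \<open>max C (norm u0)\<close>.\<close>
  define us' where "us' t = (if norm (us t) \<le> C then us t else u0)" for t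
  have eq: "us' t = us t" if "t \<ge> 0" "t \<notin> N" for t using N(2)[OF that] by (simp add: us'_def)
  \<comment> \<open>Stated for every starting time, since the tail condition integrates over
    \<open>{T..}\<close>.\<close>
  have AEN: "AE t in lebesgue_on {T..}. us' t = us t" if "T \<ge> 0" for T
  proof -
    have "AE t in lebesgue. t \<notin> N" using N(1) by (intro AE_not_in) (simp add: negligible_iff_null_sets)
    then have "AE t in lebesgue. t \<in> {T..} \<longrightarrow> us' t = us t"
      by (rule eventually_mono) (use that eq in auto)
    then show ?thesis by (subst AE_restrict_space_iff) auto
  qed
  have AE0: "AE t in leb_half. us' t = us t" by (rule AEN) simp
  have "us' \<in> borel_measurable leb_half" unfolding us'_def[abs_def] using us(1) by measurable
  moreover have "norm (us' t) \<le> max C (norm u0)" for t by (auto simp: us'_def)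
  moreover have "us' t \<in> U" if "t \<ge> 0" for t using us(2)[OF that] u0 by (simp add: us'_def)
  moreover have "AE t in leb_half. (xs has_vector_derivative \<phi> t (xs t) (us' t)) (at t within {0..})"
    using der AE0 by eventually_elim simp
  moreover have "(\<integral>\<^sup>+t. ennreal (norm (\<phi> t (xs t) (us' t))) \<partial>leb_half) < \<infinity>"
  proof -
    have "(\<integral>\<^sup>+t. ennreal (norm (\<phi> t (xs t) (us' t))) \<partial>leb_half) = (\<integral>\<^sup>+t. ennreal (norm (\<phi> t (xs t) (us t))) \<partial>leb_half)"
      by (rule nn_integral_cong_AE) (use AE0 in eventually_elim, simp)
    then show ?thesis using phi_int by simp
  qed
  moreover have "(\<integral>\<^sup>+t. ennreal (onorm ((*v) (jacobian (\<lambda>y. \<phi> t y (us' t)) (at (xs t))))) \<partial>leb_half) < \<infinity>"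
  proof -
    have "(\<integral>\<^sup>+t. ennreal (onorm ((*v) (jacobian (\<lambda>y. \<phi> t y (us' t)) (at (xs t))))) \<partial>leb_half) =
      (\<integral>\<^sup>+t. ennreal (onorm ((*v) (jacobian (\<lambda>y. \<phi> t y (us t)) (at (xs t))))) \<partial>leb_half)"
      by (rule nn_integral_cong_AE) (use AE0 in eventually_elim, simp)
    then show ?thesis using phix_int by simp
  qed
  moreover have "\<exists>\<gamma>>0. \<forall>\<delta>>0. \<exists>T>0. \<forall>x\<in>W1_inf. \<forall>x'\<in>W1_inf.
         sup_norm (\<lambda>t. x t - xs t) < \<gamma> \<and> sup_norm (\<lambda>t. x' t - xs t) < \<gamma> \<longrightarrow>
         (\<integral>\<^sup>+t. ennreal (norm (\<phi> t (x t) (us' t) - \<phi> t (x' t) (us' t)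
              - jacobian (\<lambda>y. \<phi> t y (us' t)) (at (xs t)) *v (x t - x' t))) \<partial>lebesgue_on {T..})
           \<le> ennreal (\<delta> * sup_norm (\<lambda>t. x t - x' t))"
  proof -
    have "(\<integral>\<^sup>+t. ennreal (norm (\<phi> t (x t) (us' t) - \<phi> t (x' t) (us' t)
              - jacobian (\<lambda>y. \<phi> t y (us' t)) (at (xs t)) *v (x t - x' t))) \<partial>lebesgue_on {T..}) =
      (\<integral>\<^sup>+t. ennreal (norm (\<phi> t (x t) (us t) - \<phi> t (x' t) (us t)
              - jacobian (\<lambda>y. \<phi> t y (us t)) (at (xs t)) *v (x t - x' t))) \<partial>lebesgue_on {T..})" if "T > 0" for T x x'
      by (rule nn_integral_cong_AE) (use AEN[OF less_imp_le[OF that]] in eventually_elim, simp)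
    then show ?thesis using tail by (simp cong: conj_cong)
  qed
  moreover have "\<exists>\<epsilon>>0. \<forall>x u. admissible \<omega> f \<phi> h0 h1 U x u \<and> sup_norm (\<lambda>t. x t - xs t) \<le> \<epsilon> \<longrightarrow>
        integral {0..} (\<lambda>t. \<omega> t * f t (xs t) (us' t)) \<le> cost \<omega> f x u"
  proof -
    have "integral {0..} (\<lambda>t. \<omega> t * f t (xs t) (us' t)) = integral {0..} (\<lambda>t. \<omega> t * f t (xs t) (us t))"
      by (rule integral_spike[OF N(1)]) (simp add: eq)
    also have "\<dots> = cost \<omega> f xs us"
      unfolding cost_def using int by (intro integral_leb_half[symmetric]) (simp add: absolutely_integrable_leb_half_iff)
    finally show ?thesis using opt unfolding strong_local_min_def by simp
  qed
  ultimately interpret pontryagin_optimal \<omega> f \<phi> h0 h1 xs us' "max C (norm u0)" U I0 I1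
    using omega_L1 reg h0_range h1_range h by unfold_locales
  obtain lam0 p l0 l1 where m: "lam0 \<ge> 0" "p \<in> adjoint_class \<omega>" "l0 \<in> coord_space I0" "l1 \<in> coord_space I1"
     "\<not> (lam0 = 0 \<and> (\<forall>t\<ge>0. p t = 0) \<and> l0 = 0 \<and> l1 = 0)"
     and a: "AE t in leb_half.
        (p has_vector_derivative
           (- (transpose (jacobian (\<lambda>y. \<phi> t y (us' t)) (at (xs t))) *v p t)
            + (lam0 * \<omega> t) *\<^sub>R gradient (\<lambda>y. f t y (us' t)) (xs t)))
          (at t within {0..})"
     and b: "p 0 = transpose (jacobian h0 (at (xs 0))) *v l0"
     "\<exists>L. ((\<lambda>t. transpose (jacobian (h1 t) (at (xs t))) *v l1) \<longlongrightarrow> L) at_top \<and> (p \<longlongrightarrow> - L) at_top"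
     and c: "AE t in leb_half. us' t \<in> U \<and>
        (\<forall>u\<in>U. pontryagin \<omega> f \<phi> t (xs t) u (p t) lam0
                \<le> pontryagin \<omega> f \<phi> t (xs t) (us' t) (p t) lam0)"
    using multipliers_exist by blast
  have "AE t in leb_half.
        (p has_vector_derivative
           (- (transpose (jacobian (\<lambda>y. \<phi> t y (us t)) (at (xs t))) *v p t)
            + (lam0 * \<omega> t) *\<^sub>R gradient (\<lambda>y. f t y (us t)) (xs t)))
          (at t within {0..})"
    using a AE0 by eventually_elim simp
  moreover have "AE t in leb_half. us t \<in> U \<and>
        (\<forall>u\<in>U. pontryagin \<omega> f \<phi> t (xs t) u (p t) lam0
                \<le> pontryagin \<omega> f \<phi> t (xs t) (us t) (p t) lam0)"
    using c AE0 by eventually_elim simp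
  ultimately show ?thesis using m b by (intro exI[of _ lam0] exI[of _ p] exI[of _ l0] exI[of _ l1] conjI)
qed

end
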